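(* Let $\Omega\subset\mathbb{H}^n$ be a $C^2$ bounded open set and let $u\in\Gamma^3(\overline\Omega)\cap C^2(\overline\Omega)$ with $u\le0$ in $\Omega$ and $u=0$ on $\partial\Omega$. Then $$\int_\Omega(\Delta_Hu)^2\,dg-\int_\Omega\|\nabla_H^2u\|^2\,dg+\frac32\,n\int_\Omega(Tu)^2\,dg=\int_{\partial\Omega}\mathcal H\,|\nabla_Hu|^2\,d\sigma_H .$$ As a consequence, if $\partial\Omega$ has $H$-mean curvature $\mathcal H\ge0$, then $$\int_\Omega\|\nabla_H^2u\|^2\,dg\le\int_\Omega(\Delta_Hu)^2\,dg+\frac32\,n\int_\Omega(Tu)^2\,dg .$$ If instead $u\in C_0^\infty(\Omega)$, then, regardless of the sign of $\mathcal H$, $$\int_\Omega\|\nabla_H^2u\|^2\,dg=\int_\Omega(\Delta_Hu)^2\,dg+\frac32\,n\int_\Omega(Tu)^2\,dg .$$ When $n=1$, the first identity becomes $$\int_\Omega\det(\nabla_H^2u)\,dg+\frac34\int_\Omega(Tu)^2\,dg=\frac12\int_{\partial\Omega}\mathcal H\,|\nabla_Hu|^2\,d\sigma_H .$$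
   Context: Heisenberg group. $\mathbb{H}^n=\mathbb R^n\times\mathbb R^n\times\mathbb R$ with group law $(x,y,t)\circ(x',y',t')=(x+x',y+y',t+t'+\frac12(x\cdot y'-x'\cdot y))$ and left-invariant vector fields $$X_j=\frac{\partial}{\partial x_j}-\frac{y_j}{2}\frac{\partial}{\partial t},\qquad X_{n+j}=\frac{\partial}{\partial y_j}+\frac{x_j}{2}\frac{\partial}{\partial t}\quad(j=1,\dots,n),\qquad T=\frac{\partial}{\partial t}.$$ Set $m=2n$. $\mathbb{H}^n$ carries the left-invariant Riemannian metric $\langle\cdot,\cdot\rangle$ for which $X_1,\dots,X_{2n},T$ are orthonormal; $dg$ is Lebesgue (Haar) measure. Function classes. $\Gamma^k(\Omega)$ is the Folland-Stein class of continuous $u$ such that $X_{j_1}\cdots X_{j_s}u$ is continuous for all $1\le s\le k$ and $j_\ell\in\{1,\dots,m\}$; $\Gamma^k(\overline\Omega)$ is the same with continuity up to $\overline\Omega$. Operators. $\nabla^Hu=\nabla_Hu=\sum_{i=1}^mX_iu\,X_i$; $\Delta_Hu=\sum_{i=1}^mX_i^2u$; $u_{,ij}=\frac12(X_iX_ju+X_jX_iu)$; $\nabla_H^2u=[u_{,ij}]_{i,j=1}^m$; $\|\nabla_H^2u\|^2=\sum_{i,j=1}^mu_{,ij}^2$; $\Delta_{H,\infty}u=\sum_{i,j=1}^mu_{,ij}X_iu\,X_ju$. Boundary. Let $\boldsymbol\nu$ be the Riemannian outer unit normal on $\partial\Omega$, $\sigma$ the Riemannian surface measure, $W=\big(\sum_{j=1}^m\langle\boldsymbol\nu,X_j\rangle^2\big)^{1/2}$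 the angle function, $\Sigma=\{g\in\partial\Omega: W(g)=0\}$ the characteristic set, and $d\sigma_H=W\,d\sigma$ the $H$-perimeter measure. The $H$-mean curvature $\mathcal H$ of $\partial\Omega$ at a point of $\partial\Omega\setminus\Sigma$ is $$\mathcal H=\frac{|\nabla^H\phi|^2\Delta_H\phi-\Delta_{H,\infty}\phi}{|\nabla^H\phi|^3},$$ where $\phi$ is any local $C^2$ defining function of $\Omega$ near that point ($\Omega=\{\phi<0\}$, with nonvanishing Riemannian gradient); the value does not depend on $\phi$. At $g_0\in\Sigma$, $\mathcal H(g_0)=\lim_{g\to g_0}\mathcal H(g)$ if this limit exists and is finite. Since $\sigma_H(\Sigma)=0$, the values on $\Sigma$ do not affect integrals with respect to $\sigma_H$. *)

theory Defs
  imports "HOL-Analysis.Analysis"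
begin

section \<open>The Heisenberg group\<close>

text \<open>
  Points are triples \<open>(x, y, t)\<close> with \<open>x, y \<in> \<real>\<^sup>n\<close> and \<open>n = CARD('n)\<close>. The Haar measure
  \<open>dg\<close> is Lebesgue measure, i.e. \<open>lborel\<close> on this Euclidean space. Horizontal indices
  \<open>1, \<dots>, m = 2n\<close> are the elements of \<open>'n + 'n\<close>: \<open>Inl j\<close> stands for \<open>j\<close> and \<open>Inr j\<close>
  for \<open>n + j\<close>.
\<close>

type_synonym 'n heis = "(real ^ 'n) \<times> (real ^ 'n) \<times> real"

fun hmult :: "'n::finite heis \<Rightarrow> 'n heis \<Rightarrow> 'n heis" where
  "hmult (x, y, t) (x', y', t') = (x + x', y + y', t + t' + (x \<bullet> y' - x' \<bullet> y) / 2)"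

fun hfield :: "'n::finite + 'n \<Rightarrow> 'n heis \<Rightarrow> 'n heis" where
  "hfield (Inl j) (x, y, t) = (axis j 1, 0, - (y $ j) / 2)"
| "hfield (Inr j) (x, y, t) = (0, axis j 1, x $ j / 2)"

definition tfield :: "'n::finite heis \<Rightarrow> 'n heis" where
  "tfield g = (0, 0, 1)"

text \<open>The integral curves of the left-invariant fields are straight lines.\<close>

lemma hmult_hfield: "hmult g (s *\<^sub>R hfield i 0) = g + s *\<^sub>R hfield i g"
proof (cases g)
  case (fields x y t)
  have *: "hmult g (s *\<^sub>R hfield i (0, 0, 0)) = g + s *\<^sub>R hfield i g"
    by (cases i) (simp_all add: fields inner_axis inner_axis')
  then show ?thesis
    by (simp only: zero_prod_def)
qed

text \<open>
  The action of a vector field \<open>V\<close> on a function. Only differentiability along \<open>V\<close> is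
  needed for this to be meaningful; it is the derivative along the one-parameter subgroup when
  \<open>V\<close> is one of the fields above.
\<close>

definition along :: "('n::finite heis \<Rightarrow> 'n heis) \<Rightarrow> ('n heis \<Rightarrow> real) \<Rightarrow> 'n heis \<Rightarrow> real" where
  "along V u g = deriv (\<lambda>s. u (g + s *\<^sub>R V g)) 0"

definition X :: "'n::finite + 'n \<Rightarrow> ('n heis \<Rightarrow> real) \<Rightarrow> 'n heis \<Rightarrow> real" where
  "X i = along (hfield i)"

definition T :: "('n::finite heis \<Rightarrow> real) \<Rightarrow> 'n heis \<Rightarrow> real" where
  "T = along tfield"

text \<open>
  The third frame coordinate of a tangent vector \<open>(a, b, c)\<close> at \<open>(x, y, t)\<close> is
  \<open>c + (y \<bullet> a - x \<bullet> b) / 2\<close>, the first two are \<open>a\<close> and \<open>b\<close>.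
\<close>

fun hcontact :: "'n::finite heis \<Rightarrow> 'n heis \<Rightarrow> real" where
  "hcontact (x, y, t) (a, b, c) = c + (y \<bullet> a - x \<bullet> b) / 2"

definition riem :: "'n::finite heis \<Rightarrow> 'n heis \<Rightarrow> 'n heis \<Rightarrow> real" where
  "riem g v w = fst v \<bullet> fst w + fst (snd v) \<bullet> fst (snd w) + hcontact g v * hcontact g w"

lemma riem_hfield_hfield: "riem g (hfield i g) (hfield j g) = (if i = j then 1 else 0)"
  by (cases g; cases i; cases j) (simp_all add: riem_def inner_axis, simp_all add: axis_def)

lemma riem_hfield_tfield: "riem g (hfield i g) (tfield g) = 0"
  by (cases g; cases i) (simp_all add: riem_def tfield_def inner_axis)

lemma riem_tfield_tfield: "riem g (tfield g) (tfield g) = 1"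
  by (cases g) (simp add: riem_def tfield_def)


section \<open>Function classes\<close>

definition extends_continuously :: "'a::topological_space set \<Rightarrow> ('a \<Rightarrow> real) \<Rightarrow> bool" where
  "extends_continuously \<Omega> f \<longleftrightarrow> (\<exists>F. continuous_on (closure \<Omega>) F \<and> (\<forall>g\<in>\<Omega>. F g = f g))"

fun Xs :: "('n::finite + 'n) list \<Rightarrow> ('n heis \<Rightarrow> real) \<Rightarrow> 'n heis \<Rightarrow> real" where
  "Xs [] u = u"
| "Xs (i # is) u = X i (Xs is u)"

text \<open>The Folland-Stein classes on an open set and up to its closure.\<close>

definition Gamma_class :: "nat \<Rightarrow> 'n::finite heis set \<Rightarrow> ('n heis \<Rightarrow> real) \<Rightarrow> bool" where
  "Gamma_class k \<Omega> u \<longleftrightarrow>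
     (\<forall>is. length is < k \<longrightarrow>
        (\<forall>g\<in>\<Omega>. \<forall>i. (\<lambda>s. Xs is u (g + s *\<^sub>R hfield i g)) field_differentiable (at 0))) \<and>
     (\<forall>is. length is \<le> k \<longrightarrow> continuous_on \<Omega> (Xs is u))"

definition Gamma_class_closure :: "nat \<Rightarrow> 'n::finite heis set \<Rightarrow> ('n heis \<Rightarrow> real) \<Rightarrow> bool" where
  "Gamma_class_closure k \<Omega> u \<longleftrightarrow> Gamma_class k \<Omega> u \<and> continuous_on (closure \<Omega>) u \<and>
     (\<forall>is. length is \<le> k \<longrightarrow> extends_continuously \<Omega> (Xs is u))"

fun Ds :: "'a::real_normed_vector list \<Rightarrow> ('a \<Rightarrow> 'b::real_normed_vector) \<Rightarrow> 'a \<Rightarrow> 'b" where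
  "Ds [] f = f"
| "Ds (v # vs) f = (\<lambda>x. frechet_derivative (Ds vs f) (at x) v)"

text \<open>The usual (Euclidean) classes \<open>C\<^sup>k\<close> on an open set and up to its closure.\<close>

definition C_class ::
  "nat \<Rightarrow> 'a::real_normed_vector set \<Rightarrow> ('a \<Rightarrow> 'b::real_normed_vector) \<Rightarrow> bool" where
  "C_class k U f \<longleftrightarrow>
     (\<forall>vs. length vs < k \<longrightarrow> (\<forall>x\<in>U. Ds vs f differentiable (at x))) \<and>
     (\<forall>vs. length vs \<le> k \<longrightarrow> continuous_on U (Ds vs f))"

definition C_class_closure ::
  "nat \<Rightarrow> 'a::real_normed_vector set \<Rightarrow> ('a \<Rightarrow> real) \<Rightarrow> bool" where
  "C_class_closure k \<Omega> u \<longleftrightarrow> C_class k \<Omega> u \<and> continuous_on (closure \<Omega>) u \<and>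
     (\<forall>vs. length vs \<le> k \<longrightarrow> extends_continuously \<Omega> (Ds vs u))"

definition test_function :: "'a::real_normed_vector set \<Rightarrow> ('a \<Rightarrow> real) \<Rightarrow> bool" where
  "test_function \<Omega> u \<longleftrightarrow> (\<forall>k. C_class k \<Omega> u) \<and>
     (\<exists>K. compact K \<and> K \<subseteq> \<Omega> \<and> (\<forall>g\<in>\<Omega> - K. u g = 0))"


section \<open>Differential operators\<close>

definition hgrad_norm :: "('n::finite heis \<Rightarrow> real) \<Rightarrow> 'n heis \<Rightarrow> real" where
  "hgrad_norm u g = sqrt (\<Sum>i\<in>UNIV. (X i u g)\<^sup>2)"

definition hlaplace :: "('n::finite heis \<Rightarrow> real) \<Rightarrow> 'n heis \<Rightarrow> real" where
  "hlaplace u g = (\<Sum>i\<in>UNIV. X i (X i u) g)"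

definition hhess :: "('n::finite heis \<Rightarrow> real) \<Rightarrow> 'n heis \<Rightarrow> real ^ ('n + 'n) ^ ('n + 'n)" where
  "hhess u g = (\<chi> i j. (X i (X j u) g + X j (X i u) g) / 2)"

definition hhess_normsq :: "('n::finite heis \<Rightarrow> real) \<Rightarrow> 'n heis \<Rightarrow> real" where
  "hhess_normsq u g = (\<Sum>i\<in>UNIV. \<Sum>j\<in>UNIV. (hhess u g $ i $ j)\<^sup>2)"

definition hinflaplace :: "('n::finite heis \<Rightarrow> real) \<Rightarrow> 'n heis \<Rightarrow> real" where
  "hinflaplace u g = (\<Sum>i\<in>UNIV. \<Sum>j\<in>UNIV. hhess u g $ i $ j * X i u g * X j u g)"

definition riem_grad :: "('n::finite heis \<Rightarrow> real) \<Rightarrow> 'n heis \<Rightarrow> 'n heis" where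
  "riem_grad u g = (\<Sum>i\<in>UNIV. X i u g *\<^sub>R hfield i g) + T u g *\<^sub>R tfield g"

text \<open>
  The squared norm of the horizontal gradient at a boundary point, where the derivatives are
  understood as continuous extensions from \<open>\<Omega>\<close>.
\<close>

definition hgrad_normsq_bdry :: "'n::finite heis set \<Rightarrow> ('n heis \<Rightarrow> real) \<Rightarrow> 'n heis \<Rightarrow> real" where
  "hgrad_normsq_bdry \<Omega> u g = (\<Sum>i\<in>UNIV. (Lim (at g within \<Omega>) (X i u))\<^sup>2)"


section \<open>The boundary\<close>

definition defining_function ::
  "'n::finite heis set \<Rightarrow> 'n heis \<Rightarrow> ('n heis \<Rightarrow> real) \<Rightarrow> bool" where
  "defining_function \<Omega> g \<phi> \<longleftrightarrow> (\<exists>U. open U \<and> g \<in> U \<and> C_class 2 U \<phi> \<and>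
     \<Omega> \<inter> U = {p \<in> U. \<phi> p < 0} \<and> (\<forall>p\<in>U. riem_grad \<phi> p \<noteq> 0))"

definition C2_boundary :: "'n::finite heis set \<Rightarrow> bool" where
  "C2_boundary \<Omega> \<longleftrightarrow> (\<forall>g\<in>frontier \<Omega>. \<exists>\<phi>. defining_function \<Omega> g \<phi>)"

text \<open>
  The normal and the \<open>H\<close>-mean curvature below do not depend on the defining function chosen.
\<close>

definition local_defining :: "'n::finite heis set \<Rightarrow> 'n heis \<Rightarrow> 'n heis \<Rightarrow> real" where
  "local_defining \<Omega> g = (SOME \<phi>. defining_function \<Omega> g \<phi>)"

definition outer_normal :: "'n::finite heis set \<Rightarrow> 'n heis \<Rightarrow> 'n heis" where
  "outer_normal \<Omega> g =
     (let v = riem_grad (local_defining \<Omega> g) g in v /\<^sub>R sqrt (riem g v v))"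

definition angle_fun :: "'n::finite heis set \<Rightarrow> 'n heis \<Rightarrow> real" where
  "angle_fun \<Omega> g = sqrt (\<Sum>i\<in>UNIV. (riem g (outer_normal \<Omega> g) (hfield i g))\<^sup>2)"

definition char_set :: "'n::finite heis set \<Rightarrow> 'n heis set" where
  "char_set \<Omega> = {g \<in> frontier \<Omega>. angle_fun \<Omega> g = 0}"

definition hcurv_expr :: "('n::finite heis \<Rightarrow> real) \<Rightarrow> 'n heis \<Rightarrow> real" where
  "hcurv_expr \<phi> g =
     ((hgrad_norm \<phi> g)\<^sup>2 * hlaplace \<phi> g - hinflaplace \<phi> g) / (hgrad_norm \<phi> g) ^ 3"

text \<open>
  At characteristic points where the limit fails to exist the curvature is undefined; it gets the
  default value \<open>0\<close> there, which affects neither integrals against the \<open>H\<close>-perimeter nor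
  the validity of \<open>\<forall>g\<in>frontier \<Omega>. hmean_curv \<Omega> g \<ge> 0\<close>.
\<close>

definition hmean_curv :: "'n::finite heis set \<Rightarrow> 'n heis \<Rightarrow> real" where
  "hmean_curv \<Omega> g0 =
     (let h = (\<lambda>g. hcurv_expr (local_defining \<Omega> g) g);
          F = at g0 within (frontier \<Omega> - char_set \<Omega>)
      in if g0 \<notin> char_set \<Omega> then h g0
         else if \<exists>!L. (h \<longlongrightarrow> L) F then Lim F h
         else 0)"

text \<open>
  A local parametrization of the hypersurface \<open>S\<close>: a \<open>C\<^sup>1\<close> immersion of an open subset of
  \<open>\<real>\<^sup>2\<^sup>n\<close> that is a homeomorphism onto a relatively open subset of \<open>S\<close>.
\<close>

definition parametrization ::
  "'n::finite heis set \<Rightarrow> (real ^ ('n + 'n)) set \<Rightarrow> (real ^ ('n + 'n) \<Rightarrow> 'n heis) \<Rightarrow> bool" where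
  "parametrization S V \<psi> \<longleftrightarrow> open V \<and> C_class 1 V \<psi> \<and>
     (\<forall>x\<in>V. inj (frechet_derivative \<psi> (at x))) \<and>
     openin (top_of_set S) (\<psi> ` V) \<and> (\<exists>\<theta>. homeomorphism V (\<psi> ` V) \<psi> \<theta>)"

definition riem_gram ::
  "(real ^ ('n + 'n) \<Rightarrow> 'n::finite heis) \<Rightarrow> real ^ ('n + 'n) \<Rightarrow> real ^ ('n + 'n) ^ ('n + 'n)" where
  "riem_gram \<psi> x = (\<chi> i j. riem (\<psi> x) (frechet_derivative \<psi> (at x) (axis i 1))
                                       (frechet_derivative \<psi> (at x) (axis j 1)))"

text \<open>
  The Riemannian surface measure is the Borel measure on \<open>S\<close> given in every local
  parametrization by the area element of the induced metric. As countably many parametrizations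
  cover \<open>S\<close>, this determines it uniquely.
\<close>

definition is_surface_measure :: "'n::finite heis set \<Rightarrow> 'n heis measure \<Rightarrow> bool" where
  "is_surface_measure S \<sigma> \<longleftrightarrow> sets \<sigma> = sets (restrict_space borel S) \<and>
     (\<forall>V \<psi>. parametrization S V \<psi> \<longrightarrow>
        (\<forall>A\<in>sets borel. A \<subseteq> \<psi> ` V \<longrightarrow>
           emeasure \<sigma> A =
             (\<integral>\<^sup>+x. ennreal (sqrt (det (riem_gram \<psi> x))) * indicator (V \<inter> \<psi> -` A) x \<partial>lborel)))"

definition surface_measure :: "'n::finite heis set \<Rightarrow> 'n heis measure" where
  "surface_measure S = (THE \<sigma>. is_surface_measure S \<sigma>)"

definition hperimeter :: "'n::finite heis set \<Rightarrow> 'n heis measure" where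
  "hperimeter \<Omega> = density (surface_measure (frontier \<Omega>)) (\<lambda>g. ennreal (angle_fun \<Omega> g))"

end

theory Submission
  imports Defs
begin

text \<open>
  The horizontal field with components
  \<open>X\<^sub>ju \<Delta>\<^sub>Hu - \<Sum>\<^sub>i X\<^sub>iu X\<^sub>iX\<^sub>ju - Tu \<Sum>\<^sub>i b\<^sub>i\<^sub>j X\<^sub>iu\<close>, where \<open>[X\<^sub>i, X\<^sub>j] = b\<^sub>i\<^sub>j T\<close>, has divergence
  \<open>(\<Delta>\<^sub>Hu)\<^sup>2 - \<parallel>\<nabla>\<^sub>H\<^sup>2u\<parallel>\<^sup>2 + (3/2) n (Tu)\<^sup>2\<close>: all third derivatives cancel. As \<open>u\<close> is only \<open>C\<^sup>2\<close> with
  continuous third horizontal derivatives, the commutation rules behind this are obtained weakly.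
  On the boundary \<open>u\<close> vanishes, so its first derivatives are those of a defining function \<open>\<phi>\<close>
  times a factor \<open>a\<close>, and its second derivatives along a tangent vector twice are also \<open>a\<close> times
  those of \<open>\<phi>\<close>. The numerator of the mean curvature only involves such tangential second
  derivatives, hence the flux of the field is \<open>\<H> |\<nabla>\<^sub>Hu|\<^sup>2 W\<close>, also at characteristic points, where it
  is zero. The divergence theorem is applied to one component at a time: each \<open>X\<^sub>i\<close> generates a
  measure-preserving flow of shears, and near the boundary the domain lies under a graph, along
  which a cutoff in the depth produces the surface integral.
\<close>

section \<open>Shears and derivatives along straight fields\<close>

text \<open>The factor 3/2 is 1/2 + 1. The antisymmetric part of \<open>X i (X j u)\<close> is half
  a structure constant times \<open>T u\<close> and yields n/2 through the trace of the squared
  matrix; differentiating the last term of the field yields n. That last term is needed because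
  exchanging horizontal derivatives in third order leaves derivatives of \<open>T u\<close> in the
  divergence. Two lacks of regularity shape the proof. Each component of the field is known to be
  differentiable only along its own \<open>X j\<close>, so the field need not be C^1 and the
  Euclidean divergence theorem does not apply; hence the flows and the treatment of one component at
  a time. And \<open>u\<close> comes without a C^1 extension across the boundary, only with
  continuous limits of its derivatives, so nothing can be differentiated along curves in the
  boundary; tangential statements rest on mean value estimates along segments inside the domain. The
  surface measure is specified by its values in all parametrizations at once, so its existence needs
  a change of variables between them. The curvature has to be Borel also on the characteristic set,
  where it is a limit or a default value.\<close>

lemma nn_integral_lborel_translation:
  fixes f :: "'a::euclidean_space \<Rightarrow> ennreal"
  assumes [measurable]: "f \<in> borel_measurable borel"
  shows "(\<integral>\<^sup>+x. f (x + c) \<partial>lborel) = (\<integral>\<^sup>+x. f x \<partial>lborel)"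
proof -
  have "(\<integral>\<^sup>+x. f x \<partial>lborel) = (\<integral>\<^sup>+x. f x \<partial>distr lborel borel ((+) c))"
    by (simp add: lborel_distr_plus)
  also have "\<dots> = (\<integral>\<^sup>+x. f (x + c) \<partial>lborel)"
    by (subst nn_integral_distr) (auto simp: add.commute)
  finally show ?thesis by simp
qed

lemma nn_integral_lborel_Pair:
  fixes f :: "'a::euclidean_space \<times> 'b::euclidean_space \<Rightarrow> ennreal"
  assumes [measurable]: "f \<in> borel_measurable borel"
  shows "(\<integral>\<^sup>+p. f p \<partial>lborel) = (\<integral>\<^sup>+x. \<integral>\<^sup>+y. f (x, y) \<partial>lborel \<partial>lborel)"
proof -
  have "f \<in> borel_measurable (lborel \<Otimes>\<^sub>M lborel)"
    using assms by (simp add: lborel_prod)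
  from lborel.nn_integral_fst[OF this] show ?thesis
    by (simp add: lborel_prod)
qed

lemma distr_lborel_eq_lborelI:
  fixes \<Phi> :: "'a::euclidean_space \<Rightarrow> 'a"
  assumes [measurable]: "\<Phi> \<in> borel_measurable borel"
    and "\<And>f :: 'a \<Rightarrow> ennreal. f \<in> borel_measurable borel \<Longrightarrow>
      (\<integral>\<^sup>+x. f (\<Phi> x) \<partial>lborel) = (\<integral>\<^sup>+x. f x \<partial>lborel)"
  shows "distr lborel borel \<Phi> = lborel"
proof (rule measure_eqI)
  fix A assume "A \<in> sets (distr lborel borel \<Phi>)"
  then have A [measurable]: "A \<in> sets borel" by simp
  have "emeasure (distr lborel borel \<Phi>) A = (\<integral>\<^sup>+x. indicator A x \<partial>distr lborel borel \<Phi>)"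
    by simp
  also have "\<dots> = (\<integral>\<^sup>+x. indicator A (\<Phi> x) \<partial>lborel)"
    by (subst nn_integral_distr) auto
  also have "\<dots> = (\<integral>\<^sup>+x. indicator A x \<partial>lborel)"
    by (rule assms) auto
  finally show "emeasure (distr lborel borel \<Phi>) A = emeasure lborel A" by simp
qed simp

text \<open>By Tonelli it suffices to change variables in each fibre and then to translate the base.
  Used twice, with base x and fibre (y, t) and with base y and fibre t, this covers the flow maps of
  shear fields.\<close>

lemma distr_lborel_fibrewise:
  fixes \<Psi> :: "'a::euclidean_space \<Rightarrow> 'b::euclidean_space \<Rightarrow> 'b"
  assumes [measurable]: "(\<lambda>p. \<Psi> (fst p) (snd p)) \<in> borel_measurable borel"
    and \<Psi>: "\<And>x. distr lborel borel (\<Psi> x) = lborel"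
  shows "distr lborel borel (\<lambda>p. (fst p + c, \<Psi> (fst p) (snd p))) = lborel"
proof (rule distr_lborel_eq_lborelI)
  show m: "(\<lambda>p. (fst p + c, \<Psi> (fst p) (snd p))) \<in> borel_measurable borel"
    by (rule borel_measurable_Pair) (auto intro!: borel_measurable_continuous_onI continuous_intros assms(1))
  fix f :: "'a \<times> 'b \<Rightarrow> ennreal" assume f [measurable]: "f \<in> borel_measurable borel"
  have f2 [measurable]: "f \<in> borel_measurable (borel \<Otimes>\<^sub>M borel)"
    using f by (simp add: borel_prod)
  have Px: "\<Psi> x \<in> borel_measurable borel" for x
  proof -
    have "(\<lambda>y. (\<lambda>p. \<Psi> (fst p) (snd p)) (x, y)) \<in> borel_measurable borel"
      by measurable
    then show ?thesis by simp
  qed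
  have "(\<integral>\<^sup>+p. f (fst p + c, \<Psi> (fst p) (snd p)) \<partial>lborel)
      = (\<integral>\<^sup>+x. \<integral>\<^sup>+y. f (x + c, \<Psi> x y) \<partial>lborel \<partial>lborel)"
    by (subst nn_integral_lborel_Pair) (auto intro!: measurable_compose[OF m f])
  also have "\<dots> = (\<integral>\<^sup>+x. \<integral>\<^sup>+y. f (x + c, y) \<partial>lborel \<partial>lborel)"
  proof (rule nn_integral_cong)
    fix x
    have "(\<integral>\<^sup>+y. f (x + c, \<Psi> x y) \<partial>lborel)
        = (\<integral>\<^sup>+y. f (x + c, y) \<partial>distr lborel borel (\<Psi> x))"
      by (rule nn_integral_distr[symmetric]) (use Px in auto)
    then show "(\<integral>\<^sup>+y. f (x + c, \<Psi> x y) \<partial>lborel) = (\<integral>\<^sup>+y. f (x + c, y) \<partial>lborel)"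
      by (simp add: \<Psi>)
  qed
  also have "\<dots> = (\<integral>\<^sup>+x. \<integral>\<^sup>+y. f (x, y) \<partial>lborel \<partial>lborel)"
    by (rule nn_integral_lborel_translation[where f="\<lambda>x. \<integral>\<^sup>+y. f (x, y) \<partial>lborel"]) measurable
  also have "\<dots> = (\<integral>\<^sup>+p. f p \<partial>lborel)"
    by (rule nn_integral_lborel_Pair[symmetric]) simp
  finally show "(\<integral>\<^sup>+p. f (fst p + c, \<Psi> (fst p) (snd p)) \<partial>lborel) = (\<integral>\<^sup>+p. f p \<partial>lborel)" .
qed

text \<open>
  The left-invariant fields and the constant fields are both of this form, and their flows are
  shears along straight lines.
\<close>

definition shear_field :: "('n::finite heis \<Rightarrow> 'n heis) \<Rightarrow> 'n heis \<Rightarrow> ('n heis \<Rightarrow> real) \<Rightarrow> bool" where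
  "shear_field V v l \<longleftrightarrow> linear l \<and> l v = 0 \<and> l (0, 0, 1) = 0 \<and> V = (\<lambda>g. v + l g *\<^sub>R (0, 0, 1))"

lemma shear_fieldD:
  assumes "shear_field V v l"
  shows "linear l" "l v = 0" "l (0, 0, 1) = 0" "V g = v + l g *\<^sub>R (0, 0, 1)"
  using assms by (auto simp: shear_field_def)

lemma shear_field_const_along:
  assumes "shear_field V v l"
  shows "V (g + s *\<^sub>R V g) = V g"
proof -
  have "l (g + s *\<^sub>R V g) = l g"
    unfolding shear_fieldD(4)[OF assms]
    by (simp only: linear_add[OF shear_fieldD(1)[OF assms]] linear_scale[OF shear_fieldD(1)[OF assms]]
        shear_fieldD(2,3)[OF assms]) simp
  then show ?thesis using shear_fieldD[OF assms] by simp
qed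

lemma shear_field_continuous:
  assumes "shear_field V v l"
  shows "continuous_on A V"
proof -
  have "continuous_on A l"
    by (rule linear_continuous_on) (use shear_fieldD(1)[OF assms] linear_conv_bounded_linear in blast)
  then show ?thesis
    using assms by (auto simp: shear_field_def intro!: continuous_intros)
qed

text \<open>The form \<open>l\<close> does not see t, so the flow map is triangular: x and y are
  translated by constants, and t by an amount depending on x and y only.\<close>

lemma shear_field_flow_preserves_lborel:
  fixes V :: "'n::finite heis \<Rightarrow> 'n heis"
  assumes V: "shear_field V v l"
  shows "distr lborel borel (\<lambda>g. g + s *\<^sub>R V g) = lborel"
proof -
  note D = shear_fieldD[OF V]
  have lc: "continuous_on UNIV l"
    by (rule linear_continuous_on) (use D(1) linear_conv_bounded_linear in blast)
  obtain v1 v2 v3 where v: "v = (v1, v2, v3)" by (cases v)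
  have l0: "l (x, y, t) = l (x, y, 0)" for x y t
  proof -
    have "(x, y, t) = (x, y, 0) + t *\<^sub>R (0, 0, 1)" by simp
    then have "l (x, y, t) = l (x, y, 0) + t *\<^sub>R l (0, 0, 1)"
      by (simp only: linear_add[OF D(1)] linear_scale[OF D(1)])
    then show ?thesis by (simp only: D(3)) simp
  qed
  define k where "k x p = (fst p + s *\<^sub>R v2, snd p + (s * v3 + s * l (x, fst p, 0)))"
    for x :: "real^'n" and p :: "(real^'n) \<times> real"
  have eq: "(\<lambda>g. g + s *\<^sub>R V g) = (\<lambda>p. (fst p + s *\<^sub>R v1, k (fst p) (snd p)))"
  proof
    fix g :: "'n heis"
    obtain x y t where g: "g = (x, y, t)" by (cases g)
    show "g + s *\<^sub>R V g = (fst g + s *\<^sub>R v1, k (fst g) (snd g))"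
      unfolding D(4) g v k_def l0[of x y t] by (simp add: algebra_simps)
  qed
  have dk: "distr lborel borel (k x) = lborel" for x
  proof -
    have "distr lborel borel (\<lambda>p. (fst p + s *\<^sub>R v2, (\<lambda>y t. t + (s * v3 + s * l (x, y, 0))) (fst p) (snd p))) = lborel"
    proof (rule distr_lborel_fibrewise)
      show "(\<lambda>p. snd p + (s * v3 + s * l (x, fst p, 0))) \<in> borel_measurable borel"
        by (intro borel_measurable_continuous_onI continuous_intros continuous_on_compose2[OF lc]) auto
      show "distr lborel borel (\<lambda>t. t + (s * v3 + s * l (x, y, 0))) = lborel" for y
      proof -
        have "(\<lambda>t. t + (s * v3 + s * l (x, y, 0))) = (+) (s * v3 + s * l (x, y, 0))"
          by (intro ext add.commute)
        then show ?thesis by (simp only: lborel_distr_plus)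
      qed
    qed
    then show ?thesis by (simp add: k_def[abs_def])
  qed
  show ?thesis unfolding eq
  proof (rule distr_lborel_fibrewise)
    show "(\<lambda>p. k (fst p) (snd p)) \<in> borel_measurable borel"
      unfolding k_def
      by (intro borel_measurable_continuous_onI continuous_intros continuous_on_compose2[OF lc]) auto
  qed (rule dk)
qed

section \<open>Calculus of derivatives along a field\<close>

lemma along_cong_open:
  assumes "open O'" "g \<in> O'" "\<And>p. p \<in> O' \<Longrightarrow> f p = f' p"
  shows "along V f g = along V f' g"
    and "(\<lambda>s. f (g + s *\<^sub>R V g)) field_differentiable (at 0) \<longleftrightarrow>
         (\<lambda>s. f' (g + s *\<^sub>R V g)) field_differentiable (at 0)"
proof -
  have "((\<lambda>s::real. g + s *\<^sub>R V g) \<longlongrightarrow> g + 0 *\<^sub>R V g) (nhds 0)"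
    by (intro tendsto_intros filterlim_ident)
  then have "\<forall>\<^sub>F s in nhds 0. g + s *\<^sub>R V g \<in> O'"
    using assms(1,2) by (auto dest: topological_tendstoD)
  then have ev: "\<forall>\<^sub>F s in nhds 0. f (g + s *\<^sub>R V g) = f' (g + s *\<^sub>R V g)"
    by eventually_elim (use assms(3) in auto)
  show "along V f g = along V f' g"
    unfolding along_def by (rule deriv_cong_ev[OF ev refl])
  show "(\<lambda>s. f (g + s *\<^sub>R V g)) field_differentiable (at 0) \<longleftrightarrow>
         (\<lambda>s. f' (g + s *\<^sub>R V g)) field_differentiable (at 0)"
    unfolding field_differentiable_def by (intro ex_cong1 DERIV_cong_ev refl ev)
qed

text \<open>\<open>along\<close> is a \<open>deriv\<close> and has a value even where no derivative
  exists; this relation records existence together with the value, so that the usual rules can be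
  chained.\<close>

definition dalong :: "('n::finite heis \<Rightarrow> 'n heis) \<Rightarrow> ('n heis \<Rightarrow> real) \<Rightarrow> real \<Rightarrow> 'n heis \<Rightarrow> bool" where
  "dalong V f D g \<longleftrightarrow> ((\<lambda>s. f (g + s *\<^sub>R V g)) has_real_derivative D) (at 0)"

lemma dalong_along: "dalong V f D g \<Longrightarrow> along V f g = D"
  by (simp add: dalong_def along_def DERIV_imp_deriv)

lemma dalongI: "(\<lambda>s. f (g + s *\<^sub>R V g)) field_differentiable (at 0) \<Longrightarrow> dalong V f (along V f g) g"
  unfolding dalong_def along_def by (rule field_differentiable_derivI)

lemma dalong_mult:
  "dalong V f a g \<Longrightarrow> dalong V h b g \<Longrightarrow> dalong V (\<lambda>p. f p * h p) (a * h g + f g * b) g"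
  unfolding dalong_def by (auto intro!: derivative_eq_intros)

lemma dalong_add:
  "dalong V f a g \<Longrightarrow> dalong V h b g \<Longrightarrow> dalong V (\<lambda>p. f p + h p) (a + b) g"
  unfolding dalong_def by (auto intro!: derivative_eq_intros)

lemma dalong_diff:
  "dalong V f a g \<Longrightarrow> dalong V h b g \<Longrightarrow> dalong V (\<lambda>p. f p - h p) (a - b) g"
  unfolding dalong_def by (auto intro!: derivative_eq_intros)

lemma dalong_cmult:
  "dalong V f a g \<Longrightarrow> dalong V (\<lambda>p. c * f p) (c * a) g"
  unfolding dalong_def by (auto intro!: derivative_eq_intros)

lemma dalong_sum:
  "(\<And>i. i \<in> I \<Longrightarrow> dalong V (f i) (a i) g) \<Longrightarrow> dalong V (\<lambda>p. \<Sum>i\<in>I. f i p) (\<Sum>i\<in>I. a i) g"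
  unfolding dalong_def by (auto intro!: derivative_eq_intros)

lemma dalong_cong_open:
  assumes "open O'" "g \<in> O'" "\<And>p. p \<in> O' \<Longrightarrow> f p = f' p" "dalong V f D g"
  shows "dalong V f' D g"
proof -
  have "(\<lambda>s. f (g + s *\<^sub>R V g)) field_differentiable (at 0)"
    using assms(4) unfolding dalong_def field_differentiable_def by blast
  then have "(\<lambda>s. f' (g + s *\<^sub>R V g)) field_differentiable (at 0)"
    using along_cong_open(2)[of O' g f f' V] assms(1-3) by blast
  from dalongI[of f' g V, OF this] show ?thesis
    using along_cong_open(1)[of O' g f f' V] assms(1-3) dalong_along[OF assms(4)] by simp
qed

lemma dalong_compose:
  assumes "dalong V f a g" "(h has_real_derivative b) (at (f g))"
  shows "dalong V (\<lambda>p. h (f p)) (b * a) g"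
  using DERIV_chain2[of h b "\<lambda>s. f (g + s *\<^sub>R V g)" 0 a UNIV] assms
  unfolding dalong_def by simp

lemma has_derivative_dalong:
  assumes "(f has_derivative f') (at g)"
  shows "dalong V f (f' (V g)) g"
proof -
  have "((\<lambda>s. g + s *\<^sub>R V g) has_derivative (\<lambda>s. s *\<^sub>R V g)) (at 0)"
    by (auto intro!: derivative_eq_intros)
  then have "((\<lambda>s. f (g + s *\<^sub>R V g)) has_derivative (\<lambda>s. f' (s *\<^sub>R V g))) (at 0)"
    using has_derivative_compose[of "\<lambda>s. g + s *\<^sub>R V g" _ 0 UNIV f f'] assms by simp
  moreover have "(\<lambda>s. f' (s *\<^sub>R V g)) = (*) (f' (V g))"
    using assms by (intro ext) (simp add: has_derivative_linear linear_scale)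
  ultimately show ?thesis
    unfolding dalong_def has_field_derivative_def by simp
qed

text \<open>A shear field is constant along its own integral lines, so restarting the line at a
  later point only shifts its parameter.\<close>

lemma dalong_DERIV_line:
  assumes V: "shear_field V v l" and d: "dalong V f D (g + s *\<^sub>R V g)"
  shows "((\<lambda>r. f (g + r *\<^sub>R V g)) has_real_derivative D) (at s)"
proof -
  have "((\<lambda>r. f ((g + s *\<^sub>R V g) + r *\<^sub>R V g)) has_real_derivative D) (at 0)"
    using d unfolding dalong_def shear_field_const_along[OF V] .
  then have "((\<lambda>r. f (g + (r + s) *\<^sub>R V g)) has_real_derivative D) (at 0)"
    by (simp add: algebra_simps)
  then show ?thesis
    using DERIV_shift[of "\<lambda>r. f (g + r *\<^sub>R V g)" D 0 s] by simp
qed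

section \<open>Integration by parts along shear flows\<close>

text \<open>
  The flow of a shear field preserves Lebesgue measure, so the difference quotients of a compactly
  supported function along the flow integrate to zero.
\<close>

lemma integral_along_compact_support_UNIV:
  fixes F D :: "'n::finite heis \<Rightarrow> real"
  assumes V: "shear_field V v l" and K: "compact K"
    and d: "\<And>g. dalong V F (D g) g"
    and cF: "continuous_on UNIV F" and cD: "continuous_on UNIV D"
    and F0: "\<And>g. g \<notin> K \<Longrightarrow> F g = 0" and D0: "\<And>g. g \<notin> K \<Longrightarrow> D g = 0"
  shows "integrable lborel F" "integrable lborel D" "(LINT g|lborel. D g) = 0"
proof -
  have cV: "continuous_on A V" for A by (rule shear_field_continuous[OF V])
  have int: "integrable lborel H" if cH: "continuous_on UNIV H" and H0: "\<And>g. g \<notin> K \<Longrightarrow> H g = 0" 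
    for H :: "'n heis \<Rightarrow> real"
  proof -
    have "integrable lborel (\<lambda>x. indicator K x *\<^sub>R H x)"
      by (rule borel_integrable_compact[OF K]) (use cH continuous_on_subset in blast)
    moreover have "(\<lambda>x. indicator K x *\<^sub>R H x) = H"
      using H0 by (auto simp: indicator_def fun_eq_iff)
    ultimately show ?thesis by simp
  qed
  show iF: "integrable lborel F" and "integrable lborel D"
    using int cF cD F0 D0 by blast+
  have "bounded (D ` K)"
    by (intro compact_imp_bounded compact_continuous_image K) (use cD continuous_on_subset in blast)
  then obtain B where B: "\<And>g. g \<in> K \<Longrightarrow> \<bar>D g\<bar> \<le> B" "B > 0"
    unfolding bounded_pos by auto
  have B': "\<bar>D g\<bar> \<le> B" for g using B D0[of g] by (cases "g \<in> K") auto
  \<comment> \<open>Everything that flows into \<open>K\<close> within time one: a common compact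
    support for all difference quotients.\<close>
  define K' where "K' = (\<lambda>(s, g). g + s *\<^sub>R V g) ` ({-1..1} \<times> K)"
  have K': "compact K'" unfolding K'_def
    by (intro compact_continuous_image compact_Times K)
      (auto intro!: continuous_intros continuous_on_compose2[OF cV] simp: case_prod_unfold)
  define q where "q n g = (F (g + (1 / real (Suc n)) *\<^sub>R V g) - F g) * real (Suc n)" for n g
  have flow_m [measurable]: "(\<lambda>g. g + s *\<^sub>R V g) \<in> borel_measurable borel" for s
    by (intro borel_measurable_continuous_onI continuous_intros cV)
  have [measurable]: "F \<in> borel_measurable borel" "D \<in> borel_measurable borel"
    by (auto intro!: borel_measurable_continuous_onI cF cD)
  have iflow: "integrable lborel (\<lambda>g. F (g + s *\<^sub>R V g))"
    and Iflow: "(LINT g|lborel. F (g + s *\<^sub>R V g)) = (LINT g|lborel. F g)" for s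
  proof -
    have "integrable (distr lborel borel (\<lambda>g. g + s *\<^sub>R V g)) F"
      using iF by (simp add: shear_field_flow_preserves_lborel[OF V])
    then show "integrable lborel (\<lambda>g. F (g + s *\<^sub>R V g))"
      by (subst (asm) integrable_distr_eq) auto
    have "(LINT g|lborel. F g) = (LINT g|distr lborel borel (\<lambda>g. g + s *\<^sub>R V g). F g)"
      by (simp add: shear_field_flow_preserves_lborel[OF V])
    also have "\<dots> = (LINT g|lborel. F (g + s *\<^sub>R V g))"
      by (subst integral_distr) auto
    finally show "(LINT g|lborel. F (g + s *\<^sub>R V g)) = (LINT g|lborel. F g)" ..
  qed
  have q0: "(LINT g|lborel. q n g) = 0" for n
    unfolding q_def by (simp only: integral_mult_left_zero Bochner_Integration.integral_diff[OF iflow iF] Iflow) simp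
  have "(\<lambda>n. LINT g|lborel. q n g) \<longlonglongrightarrow> (LINT g|lborel. D g)"
  proof (rule integral_dominated_convergence)
    show "integrable lborel (\<lambda>g. indicator K' g *\<^sub>R B)"
      by (rule borel_integrable_compact[OF K']) auto
    show "AE g in lborel. (\<lambda>n. q n g) \<longlonglongrightarrow> D g"
    proof (rule AE_I2)
      fix g
      have "((\<lambda>h. (F (g + h *\<^sub>R V g) - F g) / h) \<longlongrightarrow> D g) (at 0)"
        using d[of g] unfolding dalong_def DERIV_def by simp
      moreover have "filterlim (\<lambda>n. 1 / real (Suc n)) (at 0) sequentially"
        unfolding filterlim_at using LIMSEQ_Suc[OF lim_1_over_n] by (auto simp: divide_simps)
      ultimately have "((\<lambda>n. (F (g + (1 / real (Suc n)) *\<^sub>R V g) - F g) / (1 / real (Suc n))) \<longlongrightarrow> D g) sequentially"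
        by (rule filterlim_compose)
      then show "(\<lambda>n. q n g) \<longlonglongrightarrow> D g"
        by (simp add: q_def)
    qed
    show "AE g in lborel. norm (q n g) \<le> indicator K' g *\<^sub>R B" for n
    proof (rule AE_I2)
      fix g
      define h where "h = 1 / real (Suc n)"
      have h: "0 < h" "h \<le> 1" by (auto simp: h_def)
      \<comment> \<open>By the mean value theorem the difference quotient is a value of
        \<open>D\<close> on the same flow line. So it is bounded by \<open>B\<close>, and it
        vanishes unless that line meets \<open>K\<close> in time at most one.\<close>
      have "\<exists>z>0. z < h \<and> F (g + h *\<^sub>R V g) - F (g + 0 *\<^sub>R V g) = (h - 0) * D (g + z *\<^sub>R V g)"
        by (rule MVT2) (use h dalong_DERIV_line[OF V d] in auto)
      then obtain z where z: "0 < z" "z < h" "F (g + h *\<^sub>R V g) - F g = h * D (g + z *\<^sub>R V g)"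
        by auto
      have q: "q n g = D (g + z *\<^sub>R V g)"
        using z(3) by (simp add: q_def h_def field_simps)
      show "norm (q n g) \<le> indicator K' g *\<^sub>R B"
      proof (cases "g + z *\<^sub>R V g \<in> K")
        case True
        have "g = (g + z *\<^sub>R V g) + (- z) *\<^sub>R V (g + z *\<^sub>R V g)"
          by (simp add: shear_field_const_along[OF V])
        moreover have "(- z, g + z *\<^sub>R V g) \<in> {-1..1} \<times> K" using True z h by auto
        ultimately have "g \<in> K'" unfolding K'_def by (metis (mono_tags, lifting) case_prod_conv image_eqI)
        then show ?thesis using q B' by simp
      next
        case False
        then show ?thesis using q D0 B(2) by (simp add: indicator_def)
      qed
    qed
    show "q n \<in> borel_measurable lborel" for n
      unfolding q_def by measurable
  qed auto
  then show "(LINT g|lborel. D g) = 0"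
    unfolding q0 using LIMSEQ_unique tendsto_const by blast
qed

lemma continuous_on_zero_extension:
  fixes f :: "'a::t2_space \<Rightarrow> real"
  assumes "open O'" "compact K" "K \<subseteq> O'" "continuous_on O' f" "\<And>g. g \<in> O' - K \<Longrightarrow> f g = 0"
  shows "continuous_on UNIV (\<lambda>g. if g \<in> O' then f g else 0)"
proof -
  have "continuous_on (O' \<union> - K) (\<lambda>g. if g \<in> O' then f g else 0)"
  proof (rule continuous_on_open_Un)
    show "continuous_on O' (\<lambda>g. if g \<in> O' then f g else 0)"
      using assms(4) by (rule continuous_on_eq) auto
    show "continuous_on (- K) (\<lambda>g. if g \<in> O' then f g else 0)"
      by (rule continuous_on_eq[where f="\<lambda>_. 0"]) (use assms(5) in auto)
  qed (use assms compact_imp_closed in auto)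
  moreover have "O' \<union> - K = UNIV" using assms(3) by auto
  ultimately show ?thesis by simp
qed

text \<open>Both functions are extended by zero. \<open>D\<close> also vanishes off
  \<open>K\<close>, being there the derivative of a function that is zero on an open set, so the
  extensions stay continuous.\<close>

lemma integral_along_compact_support:
  fixes f D :: "'n::finite heis \<Rightarrow> real"
  assumes V: "shear_field V v l" and O': "open O'" and K: "compact K" "K \<subseteq> O'"
    and d: "\<And>g. g \<in> O' \<Longrightarrow> dalong V f (D g) g"
    and cf: "continuous_on O' f" and cD: "continuous_on O' D"
    and f0: "\<And>g. g \<in> O' - K \<Longrightarrow> f g = 0"
  shows "set_integrable lborel O' D" "(LINT g:O'|lborel. D g) = 0"
proof -
  define F where "F g = (if g \<in> O' then f g else 0)" for g
  define E where "E g = (if g \<in> O' then D g else 0)" for g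
  have D0: "D g = 0" if "g \<in> O' - K" for g
  proof -
    have "dalong V f 0 g"
      by (rule dalong_cong_open[of "O' - K" g "\<lambda>_. 0"])
        (use that f0 O' K in \<open>auto simp: dalong_def compact_imp_closed open_Diff\<close>)
    moreover have "dalong V f (D g) g" using d that by auto
    ultimately show ?thesis using dalong_along by metis
  qed
  have dF: "dalong V F (E g) g" for g
  proof (cases "g \<in> O'")
    case True
    then show ?thesis
      using dalong_cong_open[of O' g f F V "D g"] d[OF True] O' by (simp add: F_def E_def)
  next
    case False
    have "dalong V F 0 g"
      by (rule dalong_cong_open[of "- K" g "\<lambda>_. 0"])
        (use False f0 K in \<open>auto simp: dalong_def F_def compact_imp_closed open_Compl\<close>)
    then show ?thesis using False by (simp add: E_def)
  qed
  have cF: "continuous_on UNIV F" and cE: "continuous_on UNIV E"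
    unfolding F_def[abs_def] E_def[abs_def]
    by (rule continuous_on_zero_extension[OF O' K]; use cf cD f0 D0 in blast)+
  have "F g = 0" "E g = 0" if "g \<notin> K" for g
    using that f0 D0 by (auto simp: F_def E_def)
  note * = integral_along_compact_support_UNIV[OF V K(1) dF cF cE this]
  have E: "(\<lambda>g. indicator O' g *\<^sub>R D g) = E" by (auto simp: E_def indicator_def fun_eq_iff)
  show "set_integrable lborel O' D"
    unfolding set_integrable_def E using * by simp
  show "(LINT g:O'|lborel. D g) = 0"
    unfolding set_lebesgue_integral_def E using * by simp
qed

lemma set_integrable_mult_compact_support:
  fixes f h :: "'n::finite heis \<Rightarrow> real"
  assumes "open O'" "compact K" "K \<subseteq> O'" "continuous_on O' f" "\<And>g. g \<in> O' - K \<Longrightarrow> f g = 0"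
  shows "set_integrable lborel O' f"
proof -
  have "integrable lborel (\<lambda>x. indicator K x *\<^sub>R f x)"
    by (rule borel_integrable_compact[OF assms(2)]) (use assms continuous_on_subset in blast)
  moreover have "(\<lambda>x. indicator K x *\<^sub>R f x) = (\<lambda>x. indicator O' x *\<^sub>R f x)"
    using assms(3,5) by (auto simp: indicator_def fun_eq_iff)
  ultimately show ?thesis by (simp add: set_integrable_def)
qed

lemma integral_by_parts_along:
  fixes f h Df Dh :: "'n::finite heis \<Rightarrow> real"
  assumes V: "shear_field V v l" and O': "open O'" and K: "compact K" "K \<subseteq> O'"
    and df: "\<And>g. g \<in> O' \<Longrightarrow> dalong V f (Df g) g"
    and dh: "\<And>g. g \<in> O' \<Longrightarrow> dalong V h (Dh g) g"
    and c: "continuous_on O' f" "continuous_on O' Df" "continuous_on O' h" "continuous_on O' Dh"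
    and h0: "\<And>g. g \<in> O' - K \<Longrightarrow> h g = 0" and Dh0: "\<And>g. g \<in> O' - K \<Longrightarrow> Dh g = 0"
  shows "(LINT g:O'|lborel. Df g * h g) = - (LINT g:O'|lborel. f g * Dh g)"
proof -
  have "(LINT g:O'|lborel. Df g * h g + f g * Dh g) = 0"
    by (rule integral_along_compact_support(2)[OF V O' K dalong_mult[OF df dh]])
      (use c h0 in \<open>auto intro!: continuous_intros\<close>)
  moreover have "set_integrable lborel O' (\<lambda>g. Df g * h g)" "set_integrable lborel O' (\<lambda>g. f g * Dh g)"
    by (rule set_integrable_mult_compact_support[OF O' K]; use c h0 Dh0 in \<open>auto intro!: continuous_intros\<close>)+
  ultimately show ?thesis by (simp add: set_integral_add)
qed

section \<open>The commutator identity in low regularity\<close>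

lemma max_power_has_derivative:
  "((\<lambda>x. max 0 x ^ Suc (Suc k)) has_real_derivative real (Suc (Suc k)) * max 0 x ^ Suc k) (at x)"
proof (cases x "0::real" rule: linorder_cases)
  case less
  have "((\<lambda>x. 0) has_real_derivative 0) (at x)" by simp
  then have "((\<lambda>x. max 0 x ^ Suc (Suc k)) has_real_derivative 0) (at x)"
    by (rule has_field_derivative_transform_within_open[where S="{..<0}"]) (use less in auto)
  then show ?thesis using less by simp
next
  case greater
  have "((\<lambda>x. x ^ Suc (Suc k)) has_real_derivative real (Suc (Suc k)) * x ^ Suc k) (at x)"
    using DERIV_pow[of "Suc (Suc k)" x UNIV] by simp
  then have "((\<lambda>x. max 0 x ^ Suc (Suc k)) has_real_derivative real (Suc (Suc k)) * x ^ Suc k) (at x)"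
    by (rule has_field_derivative_transform_within_open[where S="{0<..}"]) (use greater in auto)
  then show ?thesis using greater by simp
next
  case equal
  have "((\<lambda>h::real. max 0 h ^ Suc (Suc k) / h) \<longlongrightarrow> 0) (at 0)"
  proof (rule Lim_null_comparison)
    show "\<forall>\<^sub>F h::real in at 0. norm (max 0 h ^ Suc (Suc k) / h) \<le> \<bar>h\<bar> ^ Suc k"
    proof (rule always_eventually, rule allI)
      fix h :: real
      show "norm (max 0 h ^ Suc (Suc k) / h) \<le> \<bar>h\<bar> ^ Suc k"
      proof (cases "h > 0")
        case False
        then have "max 0 h = 0" by simp
        then have "norm (max 0 h ^ Suc (Suc k) / h) = 0" by simp
        also have "0 \<le> \<bar>h\<bar> ^ Suc k" by (intro zero_le_power abs_ge_zero)
        finally show ?thesis .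
      qed simp
    qed
    show "((\<lambda>h::real. \<bar>h\<bar> ^ Suc k) \<longlongrightarrow> 0) (at 0)"
      by (auto intro!: tendsto_eq_intros)
  qed
  then show ?thesis using equal by (simp add: DERIV_def)
qed

text \<open>
  The commutator of two shear fields is a constant multiple of \<open>T\<close>. For a function of low
  regularity the commutator identity is tested against bump functions, to which both fields are
  moved by integration by parts.
\<close>

lemma along_commutator:
  fixes f :: "'n::finite heis \<Rightarrow> real"
  assumes V: "shear_field V v l" and W: "shear_field W w m" and O': "open O'" and p: "p \<in> O'"
    and Vf: "\<And>g. g \<in> O' \<Longrightarrow> dalong V f (Vf g) g"
    and Wf: "\<And>g. g \<in> O' \<Longrightarrow> dalong W f (Wf g) g"
    and Tf: "\<And>g. g \<in> O' \<Longrightarrow> dalong tfield f (Tf g) g"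
    and VWf: "\<And>g. g \<in> O' \<Longrightarrow> dalong V Wf (VWf g) g"
    and WVf: "\<And>g. g \<in> O' \<Longrightarrow> dalong W Vf (WVf g) g"
    and c: "continuous_on O' f" "continuous_on O' Vf" "continuous_on O' Wf" "continuous_on O' Tf"
       "continuous_on O' VWf" "continuous_on O' WVf"
  shows "VWf p - WVf p = (m v - l w) * Tf p"
proof (rule ccontr)
  assume neq: "VWf p - WVf p \<noteq> (m v - l w) * Tf p"
  define \<kappa> where "\<kappa> = m v - l w"
  define \<delta> where "\<delta> g = VWf g - WVf g - \<kappa> * Tf g" for g
  have c\<delta>: "continuous_on O' \<delta>" unfolding \<delta>_def by (intro continuous_intros c)
  have \<delta>p: "\<delta> p \<noteq> 0" using neq by (simp add: \<delta>_def \<kappa>_def)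
  have "isCont \<delta> p" using c\<delta> O' p continuous_on_eq_continuous_at by blast
  then obtain r1 where r1: "r1 > 0" "\<And>g. dist g p < r1 \<Longrightarrow> dist (\<delta> g) (\<delta> p) < \<bar>\<delta> p\<bar>"
    using \<delta>p unfolding continuous_at_eps_delta by (meson zero_less_abs_iff)
  obtain r2 where r2: "r2 > 0" "ball p r2 \<subseteq> O'" using O' p open_contains_ball by blast
  \<comment> \<open>On the closed ball of this radius \<open>\<delta>\<close> differs from
    \<open>\<delta> p\<close> by less than \<open>\<bar>\<delta> p\<bar>\<close> and hence keeps its
    sign.\<close>
  define r where "r = min r1 r2 / 2"
  have r: "r > 0" "r < r1" "r < r2" using r1 r2 by (auto simp: r_def)
  define K where "K = cball p r"
  have K: "compact K" "K \<subseteq> O'" using r r2 by (auto simp: K_def)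
  have sgn\<delta>: "\<delta> g * \<delta> p > 0" if "g \<in> K" for g
  proof -
    have "dist (\<delta> g) (\<delta> p) < \<bar>\<delta> p\<bar>" using that r r1(2)[of g] by (auto simp: K_def dist_commute)
    then show ?thesis
      by (auto simp: dist_real_def zero_less_mult_iff abs_if split: if_splits)
  qed
  define q where "q g = r\<^sup>2 - (g - p) \<bullet> (g - p)" for g
  define e where "e k g = max 0 (q g) ^ k" for k :: nat and g
  have cq: "continuous_on A q" for A unfolding q_def by (intro continuous_intros)
  have ce: "continuous_on A (e k)" for A k unfolding e_def by (intro continuous_intros cq)
  have dq: "dalong U q (- 2 * ((g - p) \<bullet> U g)) g" for U g
  proof -
    have "(q has_derivative (\<lambda>y. - 2 * ((g - p) \<bullet> y))) (at g)"
      unfolding q_def by (auto intro!: derivative_eq_intros simp: inner_commute)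
    from has_derivative_dalong[OF this] show ?thesis .
  qed
  have de: "dalong U (e (Suc (Suc k))) (real (Suc (Suc k)) * e (Suc k) g * (- 2 * ((g - p) \<bullet> U g))) g" for U g k
    unfolding e_def using dalong_compose[OF dq max_power_has_derivative] .
  have q_le: "q g \<le> 0" if "g \<notin> K" for g
  proof -
    have "r < norm (g - p)" using that by (simp add: K_def dist_norm norm_minus_commute)
    then have "r\<^sup>2 \<le> (norm (g - p))\<^sup>2" using r by (intro power_mono) auto
    then show ?thesis by (simp add: q_def power2_norm_eq_inner)
  qed
  have e0: "e (Suc k) g = 0" if "g \<in> O' - K" for g k
    using q_le[of g] that by (simp add: e_def max_def)
  \<comment> \<open>Two integrations by parts cost two derivatives; the cube of a positive part is
    the lowest power whose second derivatives are still continuous.\<close>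
  define F where "F = e 3"
  define D where "D U g = 3 * e 2 g * (- 2 * ((g - p) \<bullet> U g))" for U :: "'n heis \<Rightarrow> 'n heis" and g
  have dF: "dalong U F (D U g) g" for U g
    using de[of U 1 g] by (simp add: F_def D_def eval_nat_numeral)
  \<comment> \<open>The derivative along \<open>U'\<close> of \<open>D U\<close>. The argument
    \<open>dU\<close> is the derivative of the \<open>T\<close>-coefficient of \<open>U\<close>
    along \<open>U'\<close>, a constant because that coefficient is linear and ignores
    \<open>T\<close>.\<close>
  define DD where "DD U U' dU g = 3 * (2 * e 1 g * (- 2 * ((g - p) \<bullet> U' g))) * (- 2 * ((g - p) \<bullet> U g))
     + 3 * e 2 g * (- 2 * (U' g \<bullet> U g + (g - p) \<bullet> (dU *\<^sub>R (0, 0, 1))))" for U U' :: "'n heis \<Rightarrow> 'n heis" and dU g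
  have dD: "dalong U' (D U) (DD U U' (k (u' )) g) g"
    if U: "shear_field U u k" and U': "shear_field U' u' k'" for U U' u u' k k' g
  proof -
    note S = shear_fieldD[OF U] shear_fieldD[OF U']
    have kU': "k (U' g) = k u'" for g
      by (simp only: S linear_add[OF S(1)] linear_scale[OF S(1)]) simp
    have "(k has_derivative k) (at g)"
      by (rule bounded_linear_imp_has_derivative) (use S(1) linear_conv_bounded_linear in blast)
    then have "(U has_derivative (\<lambda>y. k y *\<^sub>R (0, 0, 1))) (at g)"
      using U unfolding shear_field_def by (auto intro!: derivative_eq_intros)
    then have "((\<lambda>g. - 2 * ((g - p) \<bullet> U g)) has_derivative
        (\<lambda>y. - 2 * (y \<bullet> U g + (g - p) \<bullet> (k y *\<^sub>R (0, 0, 1))))) (at g)"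
      by (auto intro!: derivative_eq_intros)
    from has_derivative_dalong[OF this, of U']
    have "dalong U' (\<lambda>g. - 2 * ((g - p) \<bullet> U g)) (- 2 * (U' g \<bullet> U g + (g - p) \<bullet> (k u' *\<^sub>R (0, 0, 1)))) g"
      unfolding kU' .
    moreover have "dalong U' (\<lambda>g. 3 * e 2 g) (3 * (2 * e 1 g * (- 2 * ((g - p) \<bullet> U' g)))) g"
      using dalong_cmult[OF de[of U' 0 g], of 3] by (simp add: eval_nat_numeral)
    ultimately show ?thesis
      unfolding D_def DD_def using dalong_mult by blast
  qed
  have cU: "continuous_on A U" if "shear_field U u k" for U u k A by (rule shear_field_continuous[OF that])
  have tf: "shear_field tfield (0, 0, 1) (\<lambda>_. 0)"
    unfolding shear_field_def tfield_def[abs_def] by (auto simp: linear_iff fun_eq_iff)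
  have F0: "F g = 0" and D0: "D U g = 0" and DD0: "DD U U' dU g = 0"
    if "g \<in> O' - K" for g U U' dU
    using e0[OF that, of 2] e0[OF that, of 1] e0[OF that, of 0]
    by (simp_all add: F_def D_def DD_def eval_nat_numeral)
  have cF: "continuous_on O' F" unfolding F_def by (rule ce)
  have cD: "continuous_on O' (D U)" if "shear_field U u k" for U u k
    unfolding D_def by (intro continuous_intros ce cU[OF that])
  have cDD: "continuous_on O' (DD U U' dU)" if "shear_field U u k" "shear_field U' u' k'" for U U' dU u k u' k'
    unfolding DD_def by (intro continuous_intros ce cU[OF that(1)] cU[OF that(2)])
  note si = set_integrable_mult_compact_support[OF O' K]
  have "(LINT g:O'|lborel. VWf g * F g) = - (LINT g:O'|lborel. Wf g * D V g)"
    by (rule integral_by_parts_along[OF V O' K VWf dF c(3) c(5) cF cD[OF V] F0 D0])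
  also have "\<dots> = (LINT g:O'|lborel. f g * DD V W (l w) g)"
    by (subst integral_by_parts_along[OF W O' K Wf dD[OF V W] c(1,3) cD[OF V] cDD[OF V W] D0 DD0]) auto
  finally have 1: "(LINT g:O'|lborel. VWf g * F g) = (LINT g:O'|lborel. f g * DD V W (l w) g)" .
  have "(LINT g:O'|lborel. WVf g * F g) = - (LINT g:O'|lborel. Vf g * D W g)"
    by (rule integral_by_parts_along[OF W O' K WVf dF c(2) c(6) cF cD[OF W] F0 D0])
  also have "\<dots> = (LINT g:O'|lborel. f g * DD W V (m v) g)"
    by (subst integral_by_parts_along[OF V O' K Vf dD[OF W V] c(1,2) cD[OF W] cDD[OF W V] D0 DD0]) auto
  finally have 2: "(LINT g:O'|lborel. WVf g * F g) = (LINT g:O'|lborel. f g * DD W V (m v) g)" .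
  have 3: "(LINT g:O'|lborel. Tf g * F g) = - (LINT g:O'|lborel. f g * D tfield g)"
    by (rule integral_by_parts_along[OF tf O' K Tf dF c(1,4) cF cD[OF tf] F0 D0])
  \<comment> \<open>The commutator identity holds for the bump function by direct computation: the
    symmetric terms cancel, and the derivatives of the two field coefficients leave
    \<open>\<kappa>\<close> times the \<open>T\<close>-derivative.\<close>
  have zero: "DD V W (l w) g - DD W V (m v) g + \<kappa> * D tfield g = 0" for g
    by (simp add: DD_def D_def \<kappa>_def tfield_def inner_commute algebra_simps del: scaleR_Pair)
  have "(LINT g:O'|lborel. \<delta> g * F g) =
      (LINT g:O'|lborel. VWf g * F g) - (LINT g:O'|lborel. WVf g * F g) - \<kappa> * (LINT g:O'|lborel. Tf g * F g)"
  proof -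
    have "set_integrable lborel O' (\<lambda>g. VWf g * F g)" "set_integrable lborel O' (\<lambda>g. WVf g * F g)"
      "set_integrable lborel O' (\<lambda>g. Tf g * F g)"
      by (rule si; use c cF F0 in \<open>auto intro!: continuous_intros\<close>)+
    then have "(LINT g:O'|lborel. VWf g * F g - WVf g * F g - \<kappa> * (Tf g * F g)) =
      (LINT g:O'|lborel. VWf g * F g) - (LINT g:O'|lborel. WVf g * F g) - \<kappa> * (LINT g:O'|lborel. Tf g * F g)"
      by (subst set_integral_diff; simp)+
    then show ?thesis by (simp add: \<delta>_def algebra_simps)
  qed
  also have "\<dots> = (LINT g:O'|lborel. f g * DD V W (l w) g - f g * DD W V (m v) g + \<kappa> * (f g * D tfield g))"
  proof -
    have "set_integrable lborel O' (\<lambda>g. f g * DD V W (l w) g)" "set_integrable lborel O' (\<lambda>g. f g * DD W V (m v) g)"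
      "set_integrable lborel O' (\<lambda>g. f g * D tfield g)"
      by (rule si; use c cDD[OF V W] cDD[OF W V] cD[OF tf] D0 DD0 in \<open>auto intro!: continuous_intros\<close>)+
    then show ?thesis
      unfolding 1 2 3 by (subst set_integral_add; simp)
  qed
  also have "\<dots> = (LINT g:O'|lborel. f g * (DD V W (l w) g - DD W V (m v) g + \<kappa> * D tfield g))"
    by (simp add: algebra_simps)
  also have "\<dots> = 0" by (simp add: zero)
  finally have I0: "(LINT g:O'|lborel. \<delta> g * F g) = 0" .
  \<comment> \<open>The constant factor \<open>\<delta> p\<close> makes the integrand nonnegative
    everywhere and positive on the open ball, so its vanishing integral forces the ball to be
    null.\<close>
  define G where "G g = indicator O' g *\<^sub>R (\<delta> g * F g * \<delta> p)" for g
  have "set_integrable lborel O' (\<lambda>g. \<delta> g * F g * \<delta> p)"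
    by (rule si) (use c\<delta> cF F0 in \<open>auto intro!: continuous_intros\<close>)
  then have iG: "integrable lborel G" unfolding set_integrable_def G_def[abs_def] .
  have nn: "G g \<ge> 0" for g
  proof (cases "g \<in> K")
    case True
    have "0 \<le> (\<delta> g * \<delta> p) * F g"
      using sgn\<delta>[OF True] by (intro mult_nonneg_nonneg[OF less_imp_le]) (auto simp: F_def e_def)
    then show ?thesis using True K by (auto simp: G_def mult.commute mult.left_commute)
  next
    case False
    then show ?thesis using F0[of g] by (cases "g \<in> O'") (auto simp: G_def)
  qed
  have "(LINT g|lborel. G g) = 0"
    using I0 by (simp add: G_def set_lebesgue_integral_def mult.assoc[symmetric])
  then have "AE g in lborel. G g = 0"
    using integral_nonneg_eq_0_iff_AE[OF iG] nn by simp
  moreover have "G g > 0" if "g \<in> ball p r" for g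
  proof -
    have gK: "g \<in> K" using that by (auto simp: K_def)
    have "norm (g - p) < r" using that by (simp add: dist_norm norm_minus_commute)
    then have "(norm (g - p))\<^sup>2 < r\<^sup>2" using r by (intro power_strict_mono) auto
    then have "F g > 0" by (simp add: F_def e_def q_def power2_norm_eq_inner)
    then have "0 < (\<delta> g * \<delta> p) * F g" using sgn\<delta>[OF gK] by simp
    then show ?thesis using gK K by (auto simp: G_def mult.commute mult.left_commute)
  qed
  ultimately have "AE g in lborel. g \<notin> ball p r"
    by (elim AE_mp) (intro AE_I2, force)
  then have "ball p r \<in> null_sets lborel"
    using AE_iff_null_sets[of "ball p r" lborel] by simp
  moreover have "ball p r \<notin> null_sets lborel"
    using open_not_negligible[of "ball p r"] r
    by (auto simp: negligible_iff_null_sets null_sets_completion_iff)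
  ultimately show False by contradiction
qed

section \<open>Change of variables\<close>

text \<open>Conjugation by a bijection turns a transposition into a transposition; induction over
  products of transpositions does the rest. The two index types may differ, so this is not
  conjugation inside one group.\<close>

lemma sign_conjugate:
  fixes r :: "'a::finite \<Rightarrow> 'b::finite"
  assumes r: "bij r" and p: "p permutes UNIV"
  shows "(r \<circ> p \<circ> inv r) permutes UNIV \<and> sign (r \<circ> p \<circ> inv r) = sign p"
  using p finite_class.finite_UNIV
proof (induction p rule: permutes_induct)
  case id
  have "r \<circ> id \<circ> inv r = id"
    using surj_iff[THEN iffD1, OF bij_is_surj[OF r]] by simp
  then show ?case by (simp only: permutes_id sign_id simp_thms)
next
  case (swap a b p)
  have eq: "r \<circ> (Transposition.transpose a b \<circ> p) \<circ> inv r = Transposition.transpose (r a) (r b) \<circ> (r \<circ> p \<circ> inv r)"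
  proof
    fix x
    have "r (Transposition.transpose a b y) = Transposition.transpose (r a) (r b) (r y)" for y
      using bij_is_inj[OF r] by (auto simp: Transposition.transpose_def inj_def)
    then show "(r \<circ> (Transposition.transpose a b \<circ> p) \<circ> inv r) x = (Transposition.transpose (r a) (r b) \<circ> (r \<circ> p \<circ> inv r)) x"
      by simp
  qed
  have "permutation p" using swap.hyps finite_class.finite_UNIV unfolding permutation_permutes by blast
  moreover have "permutation (r \<circ> p \<circ> inv r)"
    using swap.IH finite_class.finite_UNIV unfolding permutation_permutes by blast
  moreover have "(r a = r b) = (a = b)" using bij_is_inj[OF r] by (auto simp: inj_def)
  ultimately have "sign (r \<circ> (Transposition.transpose a b \<circ> p) \<circ> inv r) = sign (Transposition.transpose a b \<circ> p)"
    unfolding eq using swap.IH by (simp only: sign_compose permutation_swap_id sign_swap_id)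
  moreover have "(r \<circ> (Transposition.transpose a b \<circ> p) \<circ> inv r) permutes UNIV"
    unfolding eq by (rule permutes_compose[OF conjunct1[OF swap.IH] permutes_swap_id]) auto
  ultimately show ?case by (simp only: simp_thms)
qed

text \<open>Conjugation by \<open>r\<close> is a sign-preserving bijection between the permutations
  of the two index types, and it matches the Leibniz sums term by term.\<close>

lemma det_reindex:
  fixes A :: "real ^ 'a::finite ^ 'a" and r :: "'b::finite \<Rightarrow> 'a"
  assumes r: "bij r"
  shows "det (\<chi> i j. A $ r i $ r j) = det A"
proof -
  have ir: "bij (inv r)" "inv (inv r) = r" and rr: "\<And>x. r (inv r x) = x" "\<And>x. inv r (r x) = x"
    using bij_imp_bij_inv[OF r] inv_inv_eq[OF r] surj_f_inv_f[OF bij_is_surj[OF r]] inv_f_f[OF bij_is_inj[OF r]]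
    by blast+
  show ?thesis unfolding det_def
  proof (rule sum.reindex_bij_witness[where i="\<lambda>p. inv r \<circ> p \<circ> r" and j="\<lambda>p. r \<circ> p \<circ> inv r"])
    fix p assume "p \<in> {p. p permutes (UNIV :: 'b set)}"
    then have p: "p permutes UNIV" by simp
    show "r \<circ> p \<circ> inv r \<in> {p. p permutes UNIV}" using sign_conjugate[OF r p] by blast
    show "inv r \<circ> (r \<circ> p \<circ> inv r) \<circ> r = p" by (simp add: fun_eq_iff rr)
    have "(\<Prod>i\<in>UNIV. A $ i $ (r \<circ> p \<circ> inv r) i) = (\<Prod>i\<in>UNIV. A $ r i $ r (p i))"
      by (rule prod.reindex_bij_witness[where i=r and j="inv r"]) (simp_all add: rr)
    then show "of_int (sign (r \<circ> p \<circ> inv r)) * (\<Prod>i\<in>UNIV. A $ i $ (r \<circ> p \<circ> inv r) i) =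
        of_int (sign p) * (\<Prod>i\<in>UNIV. (\<chi> i j. A $ r i $ r j) $ i $ p i)"
      by (simp only: conjunct2[OF sign_conjugate[OF r p]] vec_lambda_beta)
  next
    fix p assume "p \<in> {p. p permutes (UNIV :: 'a set)}"
    then have p: "p permutes UNIV" by simp
    show "inv r \<circ> p \<circ> r \<in> {p. p permutes UNIV}" using sign_conjugate[OF ir(1) p] unfolding ir(2) by blast
    show "r \<circ> (inv r \<circ> p \<circ> r) \<circ> inv r = p" by (simp add: fun_eq_iff rr)
  qed
qed

text \<open>
  The library proves the change of variables formula for well-ordered index types only; a
  copy of an arbitrary finite index type can be well-ordered.
\<close>

typedef 'a ordered_copy = "UNIV :: 'a set" by auto

lemma bij_Rep_ordered_copy: "bij Rep_ordered_copy"
  by (rule bij_betwI[where g=Abs_ordered_copy]) (simp_all add: Abs_ordered_copy_inverse Rep_ordered_copy_inverse)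

instance ordered_copy :: (finite) finite
proof
  have "finite (range (Abs_ordered_copy :: 'a \<Rightarrow> 'a ordered_copy))" by simp
  moreover have "range (Abs_ordered_copy :: 'a \<Rightarrow> 'a ordered_copy) = UNIV"
    by (rule type_definition.Abs_image[OF type_definition_ordered_copy])
  ultimately show "finite (UNIV :: 'a ordered_copy set)" by simp
qed

definition ordered_copy_index :: "'a::finite ordered_copy \<Rightarrow> nat" where
  "ordered_copy_index = (SOME f. inj f)"

lemma inj_ordered_copy_index: "inj (ordered_copy_index :: 'a::finite ordered_copy \<Rightarrow> nat)"
proof -
  obtain f :: "'a ordered_copy \<Rightarrow> nat" where "inj f"
    using finite_imp_inj_to_nat_seg[OF finite_class.finite_UNIV] by blast
  then show ?thesis unfolding ordered_copy_index_def by (rule someI[where P=inj])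
qed

instantiation ordered_copy :: (finite) wellorder
begin

definition less_eq_ordered_copy :: "'a ordered_copy \<Rightarrow> 'a ordered_copy \<Rightarrow> bool" where
  "less_eq_ordered_copy x y \<longleftrightarrow> ordered_copy_index x \<le> ordered_copy_index y"

definition less_ordered_copy :: "'a ordered_copy \<Rightarrow> 'a ordered_copy \<Rightarrow> bool" where
  "less_ordered_copy x y \<longleftrightarrow> ordered_copy_index x < ordered_copy_index y"

instance
proof
  fix x y :: "'a ordered_copy"
  show "x \<le> y \<Longrightarrow> y \<le> x \<Longrightarrow> x = y"
    unfolding less_eq_ordered_copy_def by (rule injD[OF inj_ordered_copy_index]) (rule antisym)
next
  fix P :: "'a ordered_copy \<Rightarrow> bool" and a
  assume step: "\<And>x. (\<And>y. y < x \<Longrightarrow> P y) \<Longrightarrow> P x"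
  show "P a"
  proof (induction a rule: measure_induct_rule[of ordered_copy_index])
    case (less x)
    show ?case by (rule step) (rule less.IH, simp only: less_ordered_copy_def)
  qed
qed (auto simp: less_eq_ordered_copy_def less_ordered_copy_def)

end

text \<open>The formula applied here concerns absolute integrability and gauge integrals of
  vector-valued functions, hence the passage through \<open>real^1\<close>. For a nonnegative
  function the Lebesgue integral is the gauge integral if that converges absolutely and infinite
  otherwise, so the equivalence also settles the infinite case.\<close>

lemma nn_integral_change_of_variables_ordered:
  fixes g :: "real^'m::{finite,wellorder} \<Rightarrow> real^'m::_" and f :: "real^'m::_ \<Rightarrow> real"
  assumes S: "S \<in> sets borel" and gS: "g ` S \<in> sets borel" and inj: "inj_on g S"
    and der: "\<And>x. x \<in> S \<Longrightarrow> (g has_derivative g' x) (at x within S)"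
    and f0: "\<And>y. y \<in> g ` S \<Longrightarrow> 0 \<le> f y"
    and m1: "(\<lambda>y. indicator (g ` S) y * f y) \<in> borel_measurable borel"
    and m2: "(\<lambda>x. indicator S x * (\<bar>det (matrix (g' x))\<bar> * f (g x))) \<in> borel_measurable borel"
  shows "(\<integral>\<^sup>+y. ennreal (f y) * indicator (g ` S) y \<partial>lborel) =
         (\<integral>\<^sup>+x. ennreal (\<bar>det (matrix (g' x))\<bar> * f (g x)) * indicator S x \<partial>lborel)"
proof -
  let ?h = "\<lambda>x. \<bar>det (matrix (g' x))\<bar> * f (g x)"
  have cv: "?h absolutely_integrable_on S \<and> integral S ?h = b \<longleftrightarrow>
      f absolutely_integrable_on (g ` S) \<and> integral (g ` S) f = b" for b
  proof -
    have "(\<lambda>x. \<bar>det (matrix (g' x))\<bar> *\<^sub>R (vec (f (g x)) :: real^1)) absolutely_integrable_on S \<and>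
           integral S (\<lambda>x. \<bar>det (matrix (g' x))\<bar> *\<^sub>R (vec (f (g x)) :: real^1)) = vec b
     \<longleftrightarrow> (\<lambda>y. vec (f y) :: real^1) absolutely_integrable_on (g ` S) \<and> integral (g ` S) (\<lambda>y. vec (f y) :: real^1) = vec b"
      by (rule has_absolute_integral_change_of_variables)
        (use S der inj in auto)
    then show ?thesis
      by (simp add: absolutely_integrable_on_1_iff integral_on_1_eq vec_eq_iff)
  qed
  have nn: "(\<integral>\<^sup>+y. ennreal (k y) * indicator A y \<partial>lborel) =
      (if k absolutely_integrable_on A then ennreal (integral A k) else \<infinity>)"
    if k0: "\<And>y. y \<in> A \<Longrightarrow> 0 \<le> k y" and m: "(\<lambda>y. indicator A y * k y) \<in> borel_measurable borel"
    for k :: "real^'m::_ \<Rightarrow> real" and A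
  proof -
    define F where "F y = indicator A y * k y" for y
    have Fm: "F \<in> borel_measurable lborel" using m by (simp add: F_def[abs_def])
    have F0: "0 \<le> F y" for y using k0 by (auto simp: F_def indicator_def)
    have eq: "ennreal (k y) * indicator A y = ennreal (F y)" for y
      by (auto simp: F_def indicator_def)
    have ai: "k absolutely_integrable_on A \<longleftrightarrow> integrable lborel F"
      unfolding set_integrable_def F_def[abs_def] real_scaleR_def
      by (rule integrable_completion) (use m in simp)
    show ?thesis
    proof (cases "integrable lborel F")
      case True
      have "(\<integral>\<^sup>+y. ennreal (F y) \<partial>lborel) = ennreal (LINT y|lborel. F y)"
        by (rule nn_integral_eq_integral[OF True]) (use F0 in auto)
      also have "(LINT y|lborel. F y) = (LINT y|lebesgue. F y)"
        by (rule integral_completion[symmetric]) (rule Fm)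
      also have "\<dots> = integral A k"
        using set_lebesgue_integral_eq_integral(2)[of A k] True ai
        by (simp add: set_lebesgue_integral_def F_def)
      finally show ?thesis using True ai eq by simp
    next
      case False
      then have "\<not> (\<integral>\<^sup>+y. ennreal (F y) \<partial>lborel) < \<infinity>"
        using integrableI_nonneg[OF Fm AE_I2[OF F0]] by blast
      then have "(\<integral>\<^sup>+y. ennreal (F y) \<partial>lborel) = \<infinity>"
        by (simp add: less_top[symmetric])
      then show ?thesis using False ai eq by simp
    qed
  qed
  have "(\<integral>\<^sup>+y. ennreal (f y) * indicator (g ` S) y \<partial>lborel) =
      (if f absolutely_integrable_on g ` S then ennreal (integral (g ` S) f) else \<infinity>)"
    by (rule nn[OF f0 m1])
  moreover have "(\<integral>\<^sup>+x. ennreal (?h x) * indicator S x \<partial>lborel) =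
      (if ?h absolutely_integrable_on S then ennreal (integral S ?h) else \<infinity>)"
    by (rule nn[OF _ m2]) (use f0 in auto)
  ultimately show ?thesis using cv[of "integral S ?h"] cv[of "integral (g ` S) f"] by (smt (verit))
qed

text \<open>Such a map is a relabelling of orthonormal coordinates. It pulls boxes back to boxes
  with the same side lengths, and boxes determine Lebesgue measure.\<close>

lemma distr_lborel_basis_bij:
  fixes L :: "'a::euclidean_space \<Rightarrow> 'b::euclidean_space"
  assumes lin: "linear L" and bb: "bij_betw L Basis Basis"
  shows "distr lborel borel L = lborel"
proof -
  have inn: "L x \<bullet> L b = x \<bullet> b" if b: "b \<in> Basis" for x b
  proof -
    have "L x = L (\<Sum>c\<in>Basis. (x \<bullet> c) *\<^sub>R c)" by (simp add: euclidean_representation)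
    also have "\<dots> = (\<Sum>c\<in>Basis. (x \<bullet> c) *\<^sub>R L c)"
      using lin by (simp add: linear_sum linear_scale)
    finally have "L x \<bullet> L b = (\<Sum>c\<in>Basis. (x \<bullet> c) * (L c \<bullet> L b))"
      by (simp add: inner_sum_left)
    also have "\<dots> = (\<Sum>c\<in>Basis. (x \<bullet> c) * (if c = b then 1 else 0))"
    proof (rule sum.cong[OF refl])
      fix c :: 'a assume c: "c \<in> Basis"
      have "L c \<in> Basis" "L b \<in> Basis" "(L c = L b) = (c = b)"
        using c that bij_betwE[OF bb] inj_on_eq_iff[OF bij_betw_imp_inj_on[OF bb]] by blast+
      then show "(x \<bullet> c) * (L c \<bullet> L b) = (x \<bullet> c) * (if c = b then 1 else 0)"
        by (auto simp: inner_Basis)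
    qed
    also have "\<dots> = x \<bullet> b" using that by (simp add: if_distrib cong: if_cong)
    finally show ?thesis .
  qed
  have Lm [measurable]: "L \<in> borel_measurable borel"
    using lin linear_continuous_on linear_conv_bounded_linear borel_measurable_continuous_onI by blast
  have "lborel = distr lborel borel L"
  proof (rule lborel_eqI)
    fix l u :: 'b assume le: "\<And>b. b \<in> Basis \<Longrightarrow> l \<bullet> b \<le> u \<bullet> b"
    define l' where "l' = (\<Sum>b\<in>Basis. (l \<bullet> L b) *\<^sub>R b)"
    define u' where "u' = (\<Sum>b\<in>Basis. (u \<bullet> L b) *\<^sub>R b)"
    have l': "l' \<bullet> b = l \<bullet> L b" "u' \<bullet> b = u \<bullet> L b" if "b \<in> Basis" for b
      using that by (auto simp: l'_def u'_def)
    have im: "L ` Basis = Basis" by (rule bij_betw_imp_surj_on[OF bb])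
    have "L -` box l u = box l' u'"
    proof -
      have "x \<in> L -` box l u \<longleftrightarrow> (\<forall>b\<in>L ` Basis. l \<bullet> b < L x \<bullet> b \<and> L x \<bullet> b < u \<bullet> b)" for x
        unfolding im by (auto simp: box_def)
      then show ?thesis by (auto simp: box_def l' inn)
    qed
    then have "emeasure (distr lborel borel L) (box l u) = emeasure lborel (box l' u')"
      by (simp add: emeasure_distr)
    also have "\<dots> = ennreal (\<Prod>b\<in>Basis. (u' - l') \<bullet> b)"
      using le im by (intro emeasure_lborel_box) (force simp: l')
    also have "(\<Prod>b\<in>Basis. (u' - l') \<bullet> b) = (\<Prod>b\<in>Basis. (u - l) \<bullet> L b)"
      by (rule prod.cong) (auto simp: l' inner_diff_left)
    also have "\<dots> = (\<Prod>b\<in>Basis. (u - l) \<bullet> b)"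
      by (rule prod.reindex_bij_betw[OF bb, of "\<lambda>b. (u - l) \<bullet> b"])
    finally show "emeasure (distr lborel borel L) (box l u) = (\<Prod>b\<in>Basis. (u - l) \<bullet> b)" .
  qed simp
  then show ?thesis by simp
qed

text \<open>The relabellings \<open>P\<close> and \<open>Q\<close> to and from the ordered copy
  preserve Lebesgue measure, and the Jacobian determinant is unchanged by relabelling rows and
  columns alike.\<close>

lemma nn_integral_change_of_variables:
  fixes g :: "real^'m::finite \<Rightarrow> real^'m" and f :: "real^'m \<Rightarrow> real"
  assumes S: "S \<in> sets borel" and gS: "g ` S \<in> sets borel" and inj: "inj_on g S"
    and der: "\<And>x. x \<in> S \<Longrightarrow> (g has_derivative g' x) (at x within S)"
    and f0: "\<And>y. y \<in> g ` S \<Longrightarrow> 0 \<le> f y"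
    and m1: "(\<lambda>y. indicator (g ` S) y * f y) \<in> borel_measurable borel"
    and m2: "(\<lambda>x. indicator S x * (\<bar>det (matrix (g' x))\<bar> * f (g x))) \<in> borel_measurable borel"
  shows "(\<integral>\<^sup>+y. ennreal (f y) * indicator (g ` S) y \<partial>lborel) =
         (\<integral>\<^sup>+x. ennreal (\<bar>det (matrix (g' x))\<bar> * f (g x)) * indicator S x \<partial>lborel)"
proof -
  define P :: "real^'m \<Rightarrow> real^'m ordered_copy" where "P v = (\<chi> i. v $ Rep_ordered_copy i)" for v
  define Q :: "real^'m ordered_copy \<Rightarrow> real^'m" where "Q w = (\<chi> i. w $ Abs_ordered_copy i)" for w
  have PQ [simp]: "P (Q w) = w" "Q (P v) = v" for v w
    by (simp_all add: P_def Q_def vec_eq_iff Abs_ordered_copy_inverse Rep_ordered_copy_inverse)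
  have lP: "linear P" and lQ: "linear Q" by (auto simp: P_def Q_def linear_iff vec_eq_iff)
  have Qax: "Q (axis j 1) = axis (Rep_ordered_copy j) 1" for j
    by (auto simp: Q_def axis_def vec_eq_iff Abs_ordered_copy_inject Abs_ordered_copy_inverse Rep_ordered_copy_inverse)
  have Pax: "P (axis j 1) = axis (Abs_ordered_copy j) 1" for j
    using Qax[of "Abs_ordered_copy j"] by (metis PQ(1) Abs_ordered_copy_inverse UNIV_I)
  have "bij_betw P Basis Basis"
    by (rule bij_betwI[where g=Q]) (auto simp: Basis_vec_def Pax Qax)
  then have dP: "distr lborel borel P = lborel" by (rule distr_lborel_basis_bij[OF lP])
  have cP: "continuous_on A P" and cQ: "continuous_on B Q" for A B
    by (rule linear_continuous_on[OF lP[unfolded linear_conv_bounded_linear]]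
        linear_continuous_on[OF lQ[unfolded linear_conv_bounded_linear]])+
  have [measurable]: "P \<in> borel_measurable borel" "Q \<in> borel_measurable borel"
    by (rule borel_measurable_continuous_onI[OF cP] borel_measurable_continuous_onI[OF cQ])+
  have pull: "(\<integral>\<^sup>+y. F (Q y) \<partial>lborel) = (\<integral>\<^sup>+x. F x \<partial>lborel)" if [measurable]: "F \<in> borel_measurable borel" for F
  proof -
    have "(\<integral>\<^sup>+y. F (Q y) \<partial>lborel) = (\<integral>\<^sup>+y. F (Q y) \<partial>distr lborel borel P)" by (simp only: dP)
    also have "\<dots> = (\<integral>\<^sup>+x. F x \<partial>lborel)" by (subst nn_integral_distr) auto
    finally show ?thesis .
  qed
  define S' where "S' = P ` S"
  define G where "G = P \<circ> g \<circ> Q"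
  define G' where "G' x = P \<circ> g' (Q x) \<circ> Q" for x
  have S'_iff: "y \<in> S' \<longleftrightarrow> Q y \<in> S" for y unfolding S'_def by (metis PQ image_iff)
  have GS'_iff: "y \<in> G ` S' \<longleftrightarrow> Q y \<in> g ` S" for y
    unfolding S'_def G_def image_comp by (auto simp: image_iff) (metis PQ)
  have det: "det (matrix (G' x)) = det (matrix (g' (Q x)))" if "Q x \<in> S" for x
  proof -
    have "matrix (G' x) = (\<chi> i j. matrix (g' (Q x)) $ Rep_ordered_copy i $ Rep_ordered_copy j)"
      by (simp add: matrix_def G'_def vec_eq_iff Qax P_def)
    then show ?thesis using det_reindex[OF bij_Rep_ordered_copy] by simp
  qed
  have "(\<integral>\<^sup>+y. ennreal (f (Q y)) * indicator (G ` S') y \<partial>lborel) =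
         (\<integral>\<^sup>+x. ennreal (\<bar>det (matrix (G' x))\<bar> * f (Q (G x))) * indicator S' x \<partial>lborel)"
  proof (rule nn_integral_change_of_variables_ordered)
    have "S' = Q -` S" "G ` S' = Q -` (g ` S)"
      by (rule set_eqI, simp only: vimage_eq S'_iff GS'_iff)+
    moreover have "Q -` S \<in> sets borel" "Q -` (g ` S) \<in> sets borel"
      using measurable_sets_borel[of Q borel S] measurable_sets_borel[of Q borel "g ` S"] S gS by simp_all
    ultimately show "S' \<in> sets borel" "G ` S' \<in> sets borel" by (simp_all only:)
    show "inj_on G S'"
    proof (rule inj_onI)
      fix x y assume xy: "x \<in> S'" "y \<in> S'" "G x = G y"
      then have "g (Q x) = g (Q y)" unfolding G_def o_def by (metis PQ(2))
      then have "Q x = Q y" using inj_onD[OF inj] xy S'_iff by blast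
      then show "x = y" by (metis PQ(1))
    qed
    show "(G has_derivative G' x) (at x within S')" if "x \<in> S'" for x
    proof -
      have dQ: "(Q has_derivative Q) (at x within S')" and dP: "(P has_derivative P) (at y)" for y
        by (rule bounded_linear_imp_has_derivative[OF lQ[unfolded linear_conv_bounded_linear]]
          bounded_linear_imp_has_derivative[OF lP[unfolded linear_conv_bounded_linear]])+
      have QS: "Q ` S' = S" unfolding S'_def by (force simp: image_iff)
      have "(g has_derivative g' (Q x)) (at (Q x) within Q ` S')"
        unfolding QS using der that S'_iff by blast
      from diff_chain_within[OF dQ this]
      have "(g \<circ> Q has_derivative g' (Q x) \<circ> Q) (at x within S')" .
      from diff_chain_within[OF this has_derivative_at_withinI[OF dP]]
      show ?thesis by (simp add: G_def G'_def comp_assoc)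
    qed
    show "0 \<le> f (Q y)" if "y \<in> G ` S'" for y using that f0 GS'_iff by blast
    have "(\<lambda>y. indicator (G ` S') y * f (Q y)) = (\<lambda>x. (\<lambda>y. indicator (g ` S) y * f y) (Q x))"
      using GS'_iff by (auto simp: indicator_def fun_eq_iff)
    also have "\<dots> \<in> borel_measurable borel" by (rule measurable_compose[OF _ m1]) simp
    finally show "(\<lambda>y. indicator (G ` S') y * f (Q y)) \<in> borel_measurable borel" .
    have "(\<lambda>x. indicator S' x * (\<bar>det (matrix (G' x))\<bar> * f (Q (G x)))) =
       (\<lambda>x. (\<lambda>x. indicator S x * (\<bar>det (matrix (g' x))\<bar> * f (g x))) (Q x))"
      using S'_iff det by (auto simp: indicator_def fun_eq_iff G_def)
    also have "\<dots> \<in> borel_measurable borel" by (rule measurable_compose[OF _ m2]) simp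
    finally show "(\<lambda>x. indicator S' x * (\<bar>det (matrix (G' x))\<bar> * f (Q (G x)))) \<in> borel_measurable borel" .
  qed
  also have "(\<integral>\<^sup>+y. ennreal (f (Q y)) * indicator (G ` S') y \<partial>lborel)
      = (\<integral>\<^sup>+y. (\<lambda>y. ennreal (indicator (g ` S) y * f y)) (Q y) \<partial>lborel)"
    using GS'_iff by (intro nn_integral_cong) (auto simp: indicator_def)
  also have "\<dots> = (\<integral>\<^sup>+y. ennreal (indicator (g ` S) y * f y) \<partial>lborel)"
    by (rule pull) (use m1 in simp)
  also have "\<dots> = (\<integral>\<^sup>+y. ennreal (f y) * indicator (g ` S) y \<partial>lborel)"
    by (intro nn_integral_cong) (auto simp: indicator_def)
  also have "(\<integral>\<^sup>+x. ennreal (\<bar>det (matrix (G' x))\<bar> * f (Q (G x))) * indicator S' x \<partial>lborel)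
     = (\<integral>\<^sup>+y. (\<lambda>x. ennreal (indicator S x * (\<bar>det (matrix (g' x))\<bar> * f (g x)))) (Q y) \<partial>lborel)"
    using S'_iff det by (intro nn_integral_cong) (auto simp: indicator_def G_def)
  also have "\<dots> = (\<integral>\<^sup>+x. ennreal (indicator S x * (\<bar>det (matrix (g' x))\<bar> * f (g x))) \<partial>lborel)"
    by (rule pull) (use m2 in simp)
  also have "\<dots> = (\<integral>\<^sup>+x. ennreal (\<bar>det (matrix (g' x))\<bar> * f (g x)) * indicator S x \<partial>lborel)"
    by (intro nn_integral_cong) (auto simp: indicator_def)
  finally show ?thesis .
qed

section \<open>The surface measure\<close>

lemma hcontact_eq: "hcontact g v = snd (snd v) + (fst (snd g) \<bullet> fst v - fst g \<bullet> fst (snd v)) / 2"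
  by (cases g; cases v) simp

lemma hcontact_add: "hcontact g (v + w) = hcontact g v + hcontact g w"
  and hcontact_scaleR: "hcontact g (c *\<^sub>R v) = c * hcontact g v"
  by (simp_all add: hcontact_eq inner_add_right algebra_simps add_divide_distrib diff_divide_distrib)

lemma riem_add_left: "riem g (v + v') w = riem g v w + riem g v' w"
  and riem_scaleR_left: "riem g (c *\<^sub>R v) w = c * riem g v w"
  and riem_add_right: "riem g v (w + w') = riem g v w + riem g v w'"
  and riem_scaleR_right: "riem g v (c *\<^sub>R w) = c * riem g v w"
  by (simp_all add: riem_def hcontact_add hcontact_scaleR inner_add_left inner_add_right algebra_simps)

lemma riem_zero [simp]: "riem g 0 w = 0" "riem g v 0 = 0"
  using riem_scaleR_left[of g 0 0 w] riem_scaleR_right[of g v 0 0] by auto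

lemma riem_sum_left: "riem g (\<Sum>i\<in>I. f i) w = (\<Sum>i\<in>I. riem g (f i) w)"
  and riem_sum_right: "riem g v (\<Sum>i\<in>I. f i) = (\<Sum>i\<in>I. riem g v (f i))"
  by (induction I rule: infinite_finite_induct) (auto simp: riem_add_left riem_add_right)

lemma continuous_on_riem:
  assumes "continuous_on A g" "continuous_on A v" "continuous_on A w"
  shows "continuous_on A (\<lambda>x. riem (g x) (v x) (w x))"
  unfolding riem_def hcontact_eq by (intro continuous_intros assms) auto

lemma continuous_on_det:
  fixes A :: "'b::topological_space \<Rightarrow> real^'a::finite^'a"
  assumes "\<And>i j. continuous_on S (\<lambda>x. A x $ i $ j)"
  shows "continuous_on S (\<lambda>x. det (A x))"
  unfolding det_def by (intro continuous_intros assms)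

lemma parametrizationD:
  assumes "parametrization S V \<psi>"
  shows "open V" "continuous_on V \<psi>"
    "\<And>x. x \<in> V \<Longrightarrow> (\<psi> has_derivative frechet_derivative \<psi> (at x)) (at x)"
    "\<And>x. x \<in> V \<Longrightarrow> inj (frechet_derivative \<psi> (at x))"
    "\<And>v. continuous_on V (\<lambda>x. frechet_derivative \<psi> (at x) v)"
    "openin (top_of_set S) (\<psi> ` V)" "\<exists>\<theta>. homeomorphism V (\<psi> ` V) \<psi> \<theta>"
proof -
  have C: "C_class 1 V \<psi>" using assms by (simp add: parametrization_def)
  show d: "(\<psi> has_derivative frechet_derivative \<psi> (at x)) (at x)" if "x \<in> V" for x
  proof -
    have "Ds [] \<psi> differentiable (at x)"
      using C that unfolding C_class_def by (metis length_0_conv less_one)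
    then show ?thesis by (simp add: frechet_derivative_works)
  qed
  show "continuous_on V \<psi>"
    using d has_derivative_continuous continuous_at_imp_continuous_on by blast
  show "continuous_on V (\<lambda>x. frechet_derivative \<psi> (at x) v)" for v
  proof -
    have "continuous_on V (Ds [v] \<psi>)"
      using C unfolding C_class_def by (metis One_nat_def length_Cons list.size(3) order_refl)
    then show ?thesis by simp
  qed
qed (use assms in \<open>auto simp: parametrization_def\<close>)

lemma continuous_on_riem_gram:
  assumes "parametrization S V \<psi>"
  shows "continuous_on V (\<lambda>x. sqrt (det (riem_gram \<psi> x)))"
proof -
  have "continuous_on V (\<lambda>x. riem_gram \<psi> x $ i $ j)" for i j
    unfolding riem_gram_def
    by (simp, intro continuous_on_riem parametrizationD[OF assms])
  then show ?thesis by (intro continuous_on_real_sqrt continuous_on_det)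
qed

lemma sets_borel_Int_vimage:
  fixes f :: "'a::topological_space \<Rightarrow> 'b::topological_space"
  assumes "open V" "continuous_on V f" "A \<in> sets borel"
  shows "V \<inter> f -` A \<in> sets borel"
proof -
  have "f \<in> measurable (restrict_space borel V) borel"
    using assms(2) by (rule borel_measurable_continuous_on_restrict)
  from measurable_sets[OF this assms(3)] have "f -` A \<inter> V \<in> sets (restrict_space borel V)"
    by (simp add: space_restrict_space)
  then have "f -` A \<inter> V \<in> sets borel"
    using assms(1) by (subst (asm) sets_restrict_space_iff) auto
  then show ?thesis by (simp add: Int_commute)
qed

lemma ennreal_max_zero: "ennreal (max 0 x) = ennreal x"
  by (cases "0 \<le> x") (auto simp: max_def ennreal_neg)

section \<open>Independence of the parametrization; existence and uniqueness of the measure\<close>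

text \<open>
  The transition map between two parametrizations is differentiable because the derivative of the
  second one has a left inverse; the area elements then differ by its Jacobian.
\<close>

lemma area_element_independent:
  fixes S :: "'n::finite heis set"
  assumes 1: "parametrization S V \<psi>" and 2: "parametrization S V' \<psi>'"
    and A: "A \<in> sets borel" "A \<subseteq> \<psi> ` V" "A \<subseteq> \<psi>' ` V'"
  shows "(\<integral>\<^sup>+x. ennreal (sqrt (det (riem_gram \<psi> x))) * indicator (V \<inter> \<psi> -` A) x \<partial>lborel) =
    (\<integral>\<^sup>+x. ennreal (sqrt (det (riem_gram \<psi>' x))) * indicator (V' \<inter> \<psi>' -` A) x \<partial>lborel)"
proof -
  obtain \<theta> where \<theta>: "homeomorphism V (\<psi> ` V) \<psi> \<theta>" using parametrizationD(7)[OF 1] by auto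
  obtain \<theta>' where \<theta>': "homeomorphism V' (\<psi>' ` V') \<psi>' \<theta>'" using parametrizationD(7)[OF 2] by auto
  define J where "J x = sqrt (det (riem_gram \<psi> x))" for x
  define J' where "J' x = sqrt (det (riem_gram \<psi>' x))" for x
  define E where "E = V \<inter> \<psi> -` A"
  define E' where "E' = V' \<inter> \<psi>' -` A"
  define \<tau> where "\<tau> x = \<theta>' (\<psi> x)" for x
  define U where "U = V \<inter> \<psi> -` (\<psi>' ` V')"
  obtain T where T: "open T" "\<psi>' ` V' = S \<inter> T"
    using parametrizationD(6)[OF 2] by (auto simp: openin_open)
  have "\<psi> ` V \<subseteq> S" using parametrizationD(6)[OF 1] openin_imp_subset by blast
  then have "U = V \<inter> \<psi> -` T" unfolding U_def T(2) by auto
  then have oU: "open U"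
    using continuous_open_preimage[OF parametrizationD(2)[OF 1] parametrizationD(1)[OF 1] T(1)] by simp
  have EU: "E \<subseteq> U" using A by (auto simp: E_def U_def)
  have \<tau>: "\<psi>' (\<tau> x) = \<psi> x" "\<tau> x \<in> V'" if "x \<in> U" for x
  proof -
    obtain y where y: "y \<in> V'" "\<psi> x = \<psi>' y" using \<open>x \<in> U\<close> by (auto simp: U_def)
    then show "\<psi>' (\<tau> x) = \<psi> x" "\<tau> x \<in> V'"
      using homeomorphism_apply1[OF \<theta>' y(1)] by (auto simp: \<tau>_def)
  qed
  define D where "D x = frechet_derivative \<psi> (at x)" for x
  define D' where "D' x = frechet_derivative \<psi>' (at x)" for x
  have "\<exists>\<tau>'. (\<tau> has_derivative \<tau>') (at x) \<and> D x = D' (\<tau> x) \<circ> \<tau>'" if x: "x \<in> U" for x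
  proof -
    have xV: "x \<in> V" using x by (simp add: U_def)
    have dD: "(\<psi> has_derivative D x) (at x)"
      unfolding D_def using parametrizationD(3)[OF 1 xV] .
    have dD': "(\<psi>' has_derivative D' (\<tau> x)) (at (\<tau> x))"
      unfolding D'_def using parametrizationD(3)[OF 2] \<tau>(2)[OF x] by blast
    have "linear (D' (\<tau> x))" "inj (D' (\<tau> x))"
      using has_derivative_linear[OF dD'] parametrizationD(4)[OF 2] \<tau>(2)[OF x] by (auto simp: D'_def)
    then obtain h where h: "linear h" "h \<circ> D' (\<tau> x) = id"
      using linear_injective_left_inverse by blast
    \<comment> \<open>The inverse of a parametrization can only be differentiated relative to the
      surface. Composing with \<open>\<psi>\<close>, which maps an open set into the surface, turns
      this into a full derivative of the transition map.\<close>
    have "(\<theta>' has_derivative h) (at (\<psi>' (\<tau> x)) within \<psi>' ` V')"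
    proof (rule has_derivative_inverse_within[OF has_derivative_at_withinI[OF dD'] _ _ h])
      show "continuous (at (\<psi>' (\<tau> x)) within \<psi>' ` V') \<theta>'"
        using homeomorphism_cont2[OF \<theta>'] \<tau>(2)[OF x] unfolding continuous_on_eq_continuous_within by blast
      show "\<tau> x \<in> V'" by (rule \<tau>(2)[OF x])
      show "\<theta>' (\<psi>' y) = y" if "y \<in> V'" for y using homeomorphism_apply1[OF \<theta>' that] .
    qed
    then have "(\<theta>' has_derivative h) (at (\<psi> x) within \<psi> ` U)"
      unfolding \<tau>(1)[OF x] by (rule has_derivative_subset) (auto simp: U_def)
    from diff_chain_within[OF has_derivative_at_withinI[OF dD] this]
    have "(\<tau> has_derivative h \<circ> D x) (at x within U)" by (simp add: \<tau>_def[abs_def] o_def)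
    then have d\<tau>: "(\<tau> has_derivative h \<circ> D x) (at x)" using oU x at_within_open by metis
    have "(\<psi>' \<circ> \<tau> has_derivative D' (\<tau> x) \<circ> (h \<circ> D x)) (at x)"
      by (rule diff_chain_at[OF d\<tau> dD'])
    then have "(\<psi> has_derivative D' (\<tau> x) \<circ> (h \<circ> D x)) (at x)"
      by (rule has_derivative_transform_within_open[OF _ oU x]) (simp add: \<tau>)
    then have "D x = D' (\<tau> x) \<circ> (h \<circ> D x)" using has_derivative_unique dD by blast
    then show ?thesis using d\<tau> by blast
  qed
  then obtain \<tau>' where \<tau>': "\<And>x. x \<in> U \<Longrightarrow> (\<tau> has_derivative \<tau>' x) (at x)"
    "\<And>x. x \<in> U \<Longrightarrow> D x = D' (\<tau> x) \<circ> \<tau>' x" by metis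
  have JJ': "J x = \<bar>det (matrix (\<tau>' x))\<bar> * J' (\<tau> x)" if x: "x \<in> U" for x
  proof -
    define M where "M = matrix (\<tau>' x)"
    have lin: "linear (\<tau>' x)" using \<tau>'(1)[OF x] has_derivative_linear by blast
    have lD': "linear (D' (\<tau> x))"
      using parametrizationD(3)[OF 2 \<tau>(2)[OF x]] has_derivative_linear unfolding D'_def by blast
    have col: "D x (axis i 1) = (\<Sum>k\<in>UNIV. M $ k $ i *\<^sub>R D' (\<tau> x) (axis k 1))" for i
    proof -
      have "\<tau>' x (axis i 1) = (\<Sum>k\<in>UNIV. M $ k $ i *\<^sub>R axis k 1)"
        by (simp add: M_def matrix_def vec_eq_iff axis_def if_distrib cong: if_cong)
      then show ?thesis
        unfolding \<tau>'(2)[OF x] o_def by (simp add: linear_sum[OF lD'] linear_scale[OF lD'])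
    qed
    have "riem_gram \<psi> x = transpose M ** riem_gram \<psi>' (\<tau> x) ** M"
    proof -
      have "riem_gram \<psi> x $ i $ j = (transpose M ** riem_gram \<psi>' (\<tau> x) ** M) $ i $ j" for i j
      proof -
        define R where "R k l = riem (\<psi> x) (D' (\<tau> x) (axis k 1)) (D' (\<tau> x) (axis l 1))" for k l
        have "riem_gram \<psi> x $ i $ j = (\<Sum>l\<in>UNIV. \<Sum>k\<in>UNIV. M $ k $ i * (M $ l $ j * R k l))"
          unfolding riem_gram_def R_def
          by (simp add: D_def[symmetric] col riem_sum_left riem_sum_right riem_scaleR_left
              riem_scaleR_right sum_distrib_left mult.left_commute)
        also have "\<dots> = (\<Sum>l\<in>UNIV. (\<Sum>k\<in>UNIV. M $ k $ i * R k l) * M $ l $ j)"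
          unfolding sum_distrib_right by (intro sum.cong refl) (simp add: mult_ac)
        also have "\<dots> = (transpose M ** riem_gram \<psi>' (\<tau> x) ** M) $ i $ j"
          unfolding riem_gram_def matrix_matrix_mult_def transpose_def R_def D'_def[symmetric] \<tau>(1)[OF x]
          by simp
        finally show ?thesis .
      qed
      then show ?thesis unfolding vec_eq_iff by blast
    qed
    then have "det (riem_gram \<psi> x) = (det M)\<^sup>2 * det (riem_gram \<psi>' (\<tau> x))"
      by (simp add: det_mul det_transpose power2_eq_square)
    then show ?thesis unfolding J_def J'_def M_def[symmetric] by (simp only: real_sqrt_mult real_sqrt_abs)
  qed
  have EE': "\<tau> ` E = E'"
  proof
    show "\<tau> ` E \<subseteq> E'" using \<tau> EU by (auto simp: E_def E'_def)
    show "E' \<subseteq> \<tau> ` E"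
    proof
      fix y assume y: "y \<in> E'"
      then obtain x where x: "x \<in> V" "\<psi> x = \<psi>' y" using A by (force simp: E'_def)
      have "\<tau> x = y" using homeomorphism_apply1[OF \<theta>', of y] y x by (simp add: \<tau>_def E'_def)
      moreover have "x \<in> E" using x y by (auto simp: E_def E'_def)
      ultimately show "y \<in> \<tau> ` E" by blast
    qed
  qed
  have mE: "E \<in> sets borel" "E' \<in> sets borel"
    unfolding E_def E'_def
    using sets_borel_Int_vimage[OF parametrizationD(1)[OF 1] parametrizationD(2)[OF 1] A(1)]
      sets_borel_Int_vimage[OF parametrizationD(1)[OF 2] parametrizationD(2)[OF 2] A(1)] by auto
  have cJ: "continuous_on V J" "continuous_on V' J'"
    unfolding J_def J'_def by (rule continuous_on_riem_gram[OF 1] continuous_on_riem_gram[OF 2])+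
  \<comment> \<open>\<open>sqrt\<close> of a negative number is negative, and the sign of the Gram
    determinant is not established at this point. Since \<open>ennreal\<close> truncates at zero,
    the positive part may replace the area element and satisfies the sign condition of the change of
    variables.\<close>
  have mJ: "(\<lambda>x. indicator E x * max 0 (J x)) \<in> borel_measurable borel"
    "(\<lambda>x. indicator E' x * max 0 (J' x)) \<in> borel_measurable borel"
  proof -
    have c: "continuous_on E (\<lambda>x. max 0 (J x))" "continuous_on E' (\<lambda>x. max 0 (J' x))"
      by (auto intro!: continuous_intros continuous_on_subset[OF cJ(1)] continuous_on_subset[OF cJ(2)]
          simp: E_def E'_def)
    show "(\<lambda>x. indicator E x * max 0 (J x)) \<in> borel_measurable borel"
      using borel_measurable_continuous_on_indicator[OF mE(1) c(1)] by simp
    show "(\<lambda>x. indicator E' x * max 0 (J' x)) \<in> borel_measurable borel"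
      using borel_measurable_continuous_on_indicator[OF mE(2) c(2)] by simp
  qed
  have maxJ: "max 0 (J x) = \<bar>det (matrix (\<tau>' x))\<bar> * max 0 (J' (\<tau> x))" if "x \<in> U" for x
    unfolding JJ'[OF that] by (simp add: max_mult_distrib_left)
  have "(\<integral>\<^sup>+y. ennreal (max 0 (J' y)) * indicator (\<tau> ` E) y \<partial>lborel) =
      (\<integral>\<^sup>+x. ennreal (\<bar>det (matrix (\<tau>' x))\<bar> * max 0 (J' (\<tau> x))) * indicator E x \<partial>lborel)"
  proof (rule nn_integral_change_of_variables)
    show "inj_on \<tau> E"
    proof (rule inj_onI)
      fix x y assume xy: "x \<in> E" "y \<in> E" "\<tau> x = \<tau> y"
      have V: "x \<in> V" "y \<in> V" using xy by (auto simp: E_def)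
      have "\<psi> x = \<psi>' (\<tau> x)" using \<tau>(1)[OF subsetD[OF EU xy(1)]] ..
      also have "\<dots> = \<psi> y" unfolding xy(3) by (rule \<tau>(1)[OF subsetD[OF EU xy(2)]])
      finally have "\<psi> x = \<psi> y" .
      then show "x = y"
        by (metis homeomorphism_apply1[OF \<theta> V(1)] homeomorphism_apply1[OF \<theta> V(2)])
    qed
    show "(\<tau> has_derivative \<tau>' x) (at x within E)" if "x \<in> E" for x
      using \<tau>'(1) EU that has_derivative_at_withinI by blast
    show "(\<lambda>y. indicat_real (\<tau> ` E) y * max 0 (J' y)) \<in> borel_measurable borel"
      using mJ(2) unfolding EE' .
    have "(\<lambda>x. indicat_real E x * (\<bar>det (matrix (\<tau>' x))\<bar> * max 0 (J' (\<tau> x)))) = (\<lambda>x. indicator E x * max 0 (J x))"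
    proof
      fix x
      show "indicat_real E x * (\<bar>det (matrix (\<tau>' x))\<bar> * max 0 (J' (\<tau> x))) = indicator E x * max 0 (J x)"
        using maxJ[of x] EU by (cases "x \<in> E") auto
    qed
    then show "(\<lambda>x. indicat_real E x * (\<bar>det (matrix (\<tau>' x))\<bar> * max 0 (J' (\<tau> x)))) \<in> borel_measurable borel"
      using mJ(1) by simp
  qed (use mE EE' in auto)
  also have "\<dots> = (\<integral>\<^sup>+x. ennreal (max 0 (J x)) * indicator E x \<partial>lborel)"
  proof (rule nn_integral_cong)
    fix x
    show "ennreal (\<bar>det (matrix (\<tau>' x))\<bar> * max 0 (J' (\<tau> x))) * indicator E x = ennreal (max 0 (J x)) * indicator E x"
      using maxJ[of x] EU by (cases "x \<in> E") auto
  qed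
  finally show ?thesis
    unfolding EE' ennreal_max_zero by (simp only: J_def J'_def E_def E'_def)
qed

lemma area_element_measurable:
  assumes p: "parametrization S V \<psi>" and E: "E \<in> sets borel" "E \<subseteq> V"
  shows "(\<lambda>x. ennreal (sqrt (det (riem_gram \<psi> x))) * indicator E x) \<in> borel_measurable borel"
proof -
  have "(\<lambda>x. indicator E x *\<^sub>R sqrt (det (riem_gram \<psi> x))) \<in> borel_measurable borel"
    by (rule borel_measurable_continuous_on_indicator[OF E(1) continuous_on_subset[OF continuous_on_riem_gram[OF p] E(2)]])
  then have "(\<lambda>x. ennreal (indicator E x *\<^sub>R sqrt (det (riem_gram \<psi> x)))) \<in> borel_measurable borel"
    by simp
  moreover have "(\<lambda>x. ennreal (indicator E x *\<^sub>R sqrt (det (riem_gram \<psi> x)))) =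
      (\<lambda>x. ennreal (sqrt (det (riem_gram \<psi> x))) * indicator E x)"
    by (auto simp: indicator_def)
  ultimately show ?thesis by simp
qed

text \<open>The finitely many chart images are made disjoint, and the measure is the sum of the area
  integrals over the pieces, each in its own chart. Independence of the parametrization yields the
  required values in every other chart. A measure with these values is determined on each piece,
  hence unique.\<close>

lemma ex1_surface_measure:
  fixes S :: "'n::finite heis set"
  assumes S: "closed S" and p: "\<And>i::nat. i < N \<Longrightarrow> parametrization S (V i) (\<psi> i)"
    and cov: "S = (\<Union>i<N. \<psi> i ` V i)"
  shows "\<exists>!\<sigma>. is_surface_measure S \<sigma>"
proof -
  have SB: "S \<in> sets borel" using S by simp
  define M where "M = sets (restrict_space borel S)"
  have M_iff: "A \<in> M \<longleftrightarrow> A \<in> sets borel \<and> A \<subseteq> S" for A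
    unfolding M_def using SB by (subst sets_restrict_space_iff) auto
  have M_alg: "sigma_algebra S M"
    using sets.sigma_algebra_axioms[of "restrict_space borel S"] by (simp add: M_def space_restrict_space)
  define C where "C i = \<psi> i ` V i" for i
  have C: "C i \<in> sets borel" "C i \<subseteq> S" if i: "i < N" for i
  proof -
    obtain T where "open T" "C i = S \<inter> T"
      using parametrizationD(6)[OF p[OF i]] unfolding openin_open C_def by blast
    then show "C i \<in> sets borel" "C i \<subseteq> S" using SB by auto
  qed
  define B where "B i = C i - (\<Union>j<i. C j)" for i
  have B: "B i \<in> sets borel" "B i \<subseteq> C i" if "i < N" for i
    using that C by (auto simp: B_def)
  have Bdisj: "disjoint_family_on B {..<N}"
  proof -
    have "B i \<inter> B j = {}" if "i < j" for i j using that by (auto simp: B_def)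
    then have "B i \<inter> B j = {}" if "i \<noteq> j" for i j
      using that linorder_neqE_nat[of i j] by (metis Int_commute)
    then show ?thesis unfolding disjoint_family_on_def by blast
  qed
  have BS: "x \<in> S \<Longrightarrow> \<exists>i<N. x \<in> B i" for x
  proof -
    assume "x \<in> S"
    then have "\<exists>i. i < N \<and> x \<in> C i" by (auto simp: cov C_def)
    define i where "i = (LEAST i. i < N \<and> x \<in> C i)"
    have i: "i < N \<and> x \<in> C i" unfolding i_def by (rule LeastI_ex) fact
    have "x \<notin> C j" if "j < i" for j
      using not_less_Least[OF that[unfolded i_def]] that i by simp
    then have "x \<in> B i" using i by (simp add: B_def)
    then show "\<exists>i<N. x \<in> B i" using i by blast
  qed
  define J where "J i x = ennreal (sqrt (det (riem_gram (\<psi> i) x)))" for i x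
  define F where "F i A = (\<integral>\<^sup>+x. J i x * indicator (V i \<inter> \<psi> i -` (A \<inter> B i)) x \<partial>lborel)" for i A
  have vimage: "V i \<inter> \<psi> i -` A \<in> sets borel" if "i < N" "A \<in> sets borel" for i A
    by (rule sets_borel_Int_vimage[OF parametrizationD(1,2)[OF p[OF that(1)]] that(2)])
  define \<mu> where "\<mu> A = (\<Sum>i<N. F i A)" for A
  define \<sigma> where "\<sigma> = measure_of S M \<mu>"
  have sets\<sigma>: "sets \<sigma> = M" and space\<sigma>: "space \<sigma> = S"
    unfolding \<sigma>_def using sigma_algebra.sets_measure_of_eq[OF M_alg] sigma_algebra.space_measure_of_eq[OF M_alg]
    by auto
  have em: "emeasure \<sigma> A = \<mu> A" if "A \<in> M" for A
  proof (rule emeasure_measure_of_sigma[OF _ _ _ that, of S \<mu>, folded \<sigma>_def])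
    show "sigma_algebra S M" by (rule M_alg)
    show "positive M \<mu>" by (simp add: positive_def \<mu>_def F_def)
    show "countably_additive M \<mu>"
    proof (rule countably_additiveI)
      fix A :: "nat \<Rightarrow> 'n heis set"
      assume A: "range A \<subseteq> M" "disjoint_family A" "(\<Union>n. A n) \<in> M"
      have "F i (\<Union>n. A n) = (\<Sum>n. F i (A n))" if i: "i < N" for i
      proof -
        have "F i (\<Union>n. A n) = (\<integral>\<^sup>+x. (\<Sum>n. J i x * indicator (V i \<inter> \<psi> i -` (A n \<inter> B i)) x) \<partial>lborel)"
          unfolding F_def
        proof (rule nn_integral_cong)
          fix x
          have "disjoint_family (\<lambda>n. V i \<inter> \<psi> i -` (A n \<inter> B i))"
            using A(2) unfolding disjoint_family_on_def by blast
          then have "(\<Sum>n. indicator (V i \<inter> \<psi> i -` (A n \<inter> B i)) x :: ennreal) = indicator (\<Union>n. V i \<inter> \<psi> i -` (A n \<inter> B i)) x"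
            by (rule suminf_indicator)
          moreover have "(\<Union>n. V i \<inter> \<psi> i -` (A n \<inter> B i)) = V i \<inter> \<psi> i -` ((\<Union>n. A n) \<inter> B i)" by auto
          ultimately show "J i x * indicator (V i \<inter> \<psi> i -` ((\<Union>n. A n) \<inter> B i)) x =
            (\<Sum>n. J i x * indicator (V i \<inter> \<psi> i -` (A n \<inter> B i)) x)" by simp
        qed
        also have "\<dots> = (\<Sum>n. F i (A n))"
          unfolding F_def
        proof (rule nn_integral_suminf)
          fix n
          have "A n \<in> sets borel" using A(1) M_iff by blast
          then have "V i \<inter> \<psi> i -` (A n \<inter> B i) \<in> sets borel" using B(1)[OF i] by (intro vimage[OF i]) simp
          from area_element_measurable[OF p[OF i] this]
          show "(\<lambda>x. J i x * indicator (V i \<inter> \<psi> i -` (A n \<inter> B i)) x) \<in> borel_measurable lborel"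
            unfolding J_def by simp
        qed
        finally show ?thesis .
      qed
      then have "\<mu> (\<Union>n. A n) = (\<Sum>i<N. \<Sum>n. F i (A n))" by (simp add: \<mu>_def)
      also have "\<dots> = (\<Sum>n. \<Sum>i<N. F i (A n))" by (rule suminf_sum[symmetric]) simp
      finally show "(\<Sum>n. \<mu> (A n)) = \<mu> (\<Union>n. A n)" by (simp add: \<mu>_def)
    qed
  qed
  have "is_surface_measure S \<sigma>"
    unfolding is_surface_measure_def
  proof (intro conjI allI impI ballI)
    show "sets \<sigma> = sets (restrict_space borel S)" by (simp add: sets\<sigma> M_def)
    fix W \<phi> A assume p': "parametrization S W \<phi>" and A: "A \<in> sets borel" "A \<subseteq> \<phi> ` W"
    have "\<phi> ` W \<subseteq> S" using parametrizationD(6)[OF p'] openin_imp_subset by blast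
    then have AS: "A \<subseteq> S" using A by blast
    then have "emeasure \<sigma> A = (\<Sum>i<N. F i A)" using em A M_iff by (simp add: \<mu>_def)
    also have "\<dots> = (\<Sum>i<N. \<integral>\<^sup>+x. ennreal (sqrt (det (riem_gram \<phi> x))) * indicator (W \<inter> \<phi> -` (A \<inter> B i)) x \<partial>lborel)"
    proof (rule sum.cong[OF refl])
      fix i assume i: "i \<in> {..<N}"
      then show "F i A = (\<integral>\<^sup>+x. ennreal (sqrt (det (riem_gram \<phi> x))) * indicator (W \<inter> \<phi> -` (A \<inter> B i)) x \<partial>lborel)"
        unfolding F_def J_def
        by (intro area_element_independent[OF p p']) (use A B[of i] in \<open>auto simp: C_def\<close>)
    qed
    also have "\<dots> = (\<integral>\<^sup>+x. (\<Sum>i<N. ennreal (sqrt (det (riem_gram \<phi> x))) * indicator (W \<inter> \<phi> -` (A \<inter> B i)) x) \<partial>lborel)"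
    proof (rule nn_integral_sum[symmetric])
      fix i assume i: "i \<in> {..<N}"
      have "W \<inter> \<phi> -` (A \<inter> B i) \<in> sets borel"
        by (rule sets_borel_Int_vimage[OF parametrizationD(1,2)[OF p']]) (use A B[of i] i in auto)
      from area_element_measurable[OF p' this]
      show "(\<lambda>x. ennreal (sqrt (det (riem_gram \<phi> x))) * indicator (W \<inter> \<phi> -` (A \<inter> B i)) x) \<in> borel_measurable lborel"
        by simp
    qed
    also have "\<dots> = (\<integral>\<^sup>+x. ennreal (sqrt (det (riem_gram \<phi> x))) * indicator (W \<inter> \<phi> -` A) x \<partial>lborel)"
    proof (rule nn_integral_cong)
      fix x
      have "(\<Sum>i<N. indicator (W \<inter> \<phi> -` (A \<inter> B i)) x :: ennreal) = indicator (W \<inter> \<phi> -` A) x"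
      proof (cases "x \<in> W \<inter> \<phi> -` A")
        case True
        then obtain i where i: "i < N" "\<phi> x \<in> B i" using BS AS by blast
        have "indicator (W \<inter> \<phi> -` (A \<inter> B j)) x = (if j = i then 1 else 0 :: ennreal)" if "j < N" for j
        proof (cases "j = i")
          case False
          then have "\<phi> x \<notin> B j" using disjoint_family_onD[OF Bdisj, of j i] i that by auto
          then show ?thesis using False by simp
        qed (use i True in simp)
        then have "(\<Sum>j<N. indicator (W \<inter> \<phi> -` (A \<inter> B j)) x :: ennreal) = (\<Sum>j<N. if j = i then 1 else 0)"
          by (intro sum.cong) auto
        also have "\<dots> = 1" using i by simp
        finally show ?thesis using True by simp
      next
        case False
        then show ?thesis by (auto simp: indicator_def intro!: sum.neutral)
      qed
      then show "(\<Sum>i<N. ennreal (sqrt (det (riem_gram \<phi> x))) * indicator (W \<inter> \<phi> -` (A \<inter> B i)) x) =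
         ennreal (sqrt (det (riem_gram \<phi> x))) * indicator (W \<inter> \<phi> -` A) x"
        by (simp only: sum_distrib_left[symmetric])
    qed
    finally show "emeasure \<sigma> A = (\<integral>\<^sup>+x. ennreal (sqrt (det (riem_gram \<phi> x))) * indicator (W \<inter> \<phi> -` A) x \<partial>lborel)" .
  qed
  moreover have "\<sigma>1 = \<sigma>2" if 1: "is_surface_measure S \<sigma>1" and 2: "is_surface_measure S \<sigma>2" for \<sigma>1 \<sigma>2
  proof (rule measure_eqI)
    show "sets \<sigma>1 = sets \<sigma>2" using 1 2 by (simp add: is_surface_measure_def)
    fix A assume "A \<in> sets \<sigma>1"
    then have A: "A \<in> M" using 1 by (simp add: is_surface_measure_def M_def)
    have AB: "(\<Union>i<N. A \<inter> B i) = A" using A BS M_iff by blast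
    have dec: "emeasure \<tau> A = (\<Sum>i<N. emeasure \<tau> (A \<inter> B i))" if \<tau>: "is_surface_measure S \<tau>" for \<tau>
    proof -
      have "(\<lambda>i. A \<inter> B i) ` {..<N} \<subseteq> sets \<tau>"
      proof -
        have "A \<inter> B i \<in> M" if "i < N" for i using A B[OF that] M_iff by auto
        then show ?thesis using \<tau> by (auto simp: is_surface_measure_def M_def)
      qed
      moreover have "disjoint_family_on (\<lambda>i. A \<inter> B i) {..<N}"
        using Bdisj by (auto simp: disjoint_family_on_def)
      ultimately have "(\<Sum>i<N. emeasure \<tau> (A \<inter> B i)) = emeasure \<tau> (\<Union>i<N. A \<inter> B i)"
        by (rule sum_emeasure) simp
      then show ?thesis using AB by simp
    qed
    have "emeasure \<sigma>1 (A \<inter> B i) = emeasure \<sigma>2 (A \<inter> B i)" if i: "i < N" for i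
    proof -
      have AB: "A \<inter> B i \<in> sets borel" "A \<inter> B i \<subseteq> \<psi> i ` V i"
        using A B[OF i] M_iff by (auto simp: C_def)
      have "emeasure \<tau> (A \<inter> B i) = (\<integral>\<^sup>+x. ennreal (sqrt (det (riem_gram (\<psi> i) x))) *
          indicator (V i \<inter> \<psi> i -` (A \<inter> B i)) x \<partial>lborel)" if "is_surface_measure S \<tau>" for \<tau>
        using that p[OF i] AB unfolding is_surface_measure_def by blast
      then show ?thesis using 1 2 by simp
    qed
    then show "emeasure \<sigma>1 A = emeasure \<sigma>2 A" unfolding dec[OF 1] dec[OF 2] by simp
  qed
  ultimately show ?thesis by blast
qed

text \<open>Restricted to the image of a chart, the surface measure is the image under the
  parametrization of the measure with the area element as density; the integral of a function
  supported there can thus be computed in the chart.\<close>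

lemma integral_surface_chart:
  fixes S :: "'n::finite heis set" and f :: "'n heis \<Rightarrow> real"
  assumes S: "closed S" and \<sigma>: "is_surface_measure S \<sigma>" and p: "parametrization S V \<psi>"
    and J0: "\<And>x. x \<in> V \<Longrightarrow> 0 \<le> sqrt (det (riem_gram \<psi> x))"
    and f: "f \<in> borel_measurable (restrict_space borel S)" and f0: "\<And>g. g \<in> S - \<psi> ` V \<Longrightarrow> f g = 0"
    and int: "set_integrable lborel V (\<lambda>x. sqrt (det (riem_gram \<psi> x)) * f (\<psi> x))"
  shows "integrable \<sigma> f" "(LINT g|\<sigma>. f g) = (LINT x:V|lborel. sqrt (det (riem_gram \<psi> x)) * f (\<psi> x))"
proof -
  define J where "J x = sqrt (det (riem_gram \<psi> x))" for x
  define C where "C = \<psi> ` V"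
  have SB: "S \<in> sets borel" using S by simp
  have V: "open V" "V \<in> sets borel" using parametrizationD(1)[OF p] by auto
  have CS: "C \<subseteq> S" and CB: "C \<in> sets borel"
  proof -
    obtain T where "open T" "C = S \<inter> T"
      using parametrizationD(6)[OF p] unfolding openin_open C_def by blast
    then show "C \<subseteq> S" "C \<in> sets borel" using SB by auto
  qed
  have sets\<sigma>: "sets \<sigma> = sets (restrict_space borel S)" using \<sigma> by (simp add: is_surface_measure_def)
  have sets_iff: "A \<in> sets \<sigma> \<longleftrightarrow> A \<in> sets borel \<and> A \<subseteq> S" for A
    unfolding sets\<sigma> using SB by (subst sets_restrict_space_iff) auto
  have space\<sigma>: "space \<sigma> = S" using sets_eq_imp_space_eq[OF sets\<sigma>] by (simp add: space_restrict_space)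
  have fm [measurable]: "f \<in> borel_measurable \<sigma>" using f measurable_cong_sets[OF sets\<sigma> refl] by blast
  have Cm [measurable]: "C \<in> sets \<sigma>" using sets_iff CS CB by blast
  define R where "R = restrict_space lborel V"
  have Jm [measurable]: "J \<in> borel_measurable R"
  proof -
    have "J \<in> borel_measurable (restrict_space borel V)"
      unfolding J_def by (rule borel_measurable_continuous_on_restrict[OF continuous_on_riem_gram[OF p]])
    then show ?thesis unfolding R_def
      by (subst measurable_cong_sets[OF sets_restrict_space_cong[OF sets_lborel] refl])
  qed
  have \<psi>m [measurable]: "\<psi> \<in> measurable R (restrict_space borel S)"
  proof (rule measurable_restrict_space2)
    show "\<psi> \<in> space R \<rightarrow> S" using CS by (auto simp: R_def space_restrict_space C_def)
    have "\<psi> \<in> borel_measurable (restrict_space borel V)"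
      by (rule borel_measurable_continuous_on_restrict[OF parametrizationD(2)[OF p]])
    then show "\<psi> \<in> borel_measurable R" unfolding R_def
      by (subst measurable_cong_sets[OF sets_restrict_space_cong[OF sets_lborel] refl])
  qed
  \<comment> \<open>Two descriptions of the surface measure cut down to \<open>C\<close>: through an
    indicator density, and as an image measure from the parameter domain.\<close>
  define \<nu> where "\<nu> = density \<sigma> (\<lambda>g. ennreal (indicator C g))"
  define \<mu> where "\<mu> = distr (density R (\<lambda>x. ennreal (J x))) (restrict_space borel S) \<psi>"
  have eq: "\<nu> = \<mu>"
  proof (rule measure_eqI)
    show "sets \<nu> = sets \<mu>" by (simp add: \<nu>_def \<mu>_def sets\<sigma>)
    fix A assume "A \<in> sets \<nu>"
    then have A [measurable]: "A \<in> sets \<sigma>" by (simp add: \<nu>_def)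
    then have A': "A \<in> sets (restrict_space borel S)" using sets\<sigma> by simp
    have AC: "A \<inter> C \<in> sets borel" "A \<inter> C \<subseteq> \<psi> ` V" using sets_iff A CB by (auto simp: C_def)
    have "emeasure \<nu> A = (\<integral>\<^sup>+g. indicator (A \<inter> C) g \<partial>\<sigma>)"
    proof -
      have "emeasure \<nu> A = (\<integral>\<^sup>+g. ennreal (indicator C g) * indicator A g \<partial>\<sigma>)"
        unfolding \<nu>_def by (rule emeasure_density) auto
      also have "\<dots> = (\<integral>\<^sup>+g. indicator (A \<inter> C) g \<partial>\<sigma>)"
        by (rule nn_integral_cong) (auto simp: indicator_def)
      finally show ?thesis .
    qed
    also have "\<dots> = emeasure \<sigma> (A \<inter> C)" by simp
    also have "\<dots> = (\<integral>\<^sup>+x. ennreal (J x) * indicator (V \<inter> \<psi> -` (A \<inter> C)) x \<partial>lborel)"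
      using \<sigma> p AC unfolding is_surface_measure_def J_def by blast
    also have "\<dots> = (\<integral>\<^sup>+x. ennreal (J x) * indicator (\<psi> -` A) x * indicator V x \<partial>lborel)"
      by (intro nn_integral_cong) (auto simp: indicator_def C_def)
    also have "\<dots> = (\<integral>\<^sup>+x. ennreal (J x) * indicator (\<psi> -` A) x \<partial>R)"
      unfolding R_def by (rule nn_integral_restrict_space[symmetric]) (use V in simp)
    also have "\<dots> = (\<integral>\<^sup>+x. ennreal (J x) * indicator (\<psi> -` A \<inter> space R) x \<partial>R)"
      by (intro nn_integral_cong) (auto simp: indicator_def)
    also have "\<dots> = emeasure (density R (\<lambda>x. ennreal (J x))) (\<psi> -` A \<inter> space R)"
      using measurable_sets[OF \<psi>m A'] by (subst emeasure_density) auto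
    also have "\<dots> = emeasure \<mu> A"
      unfolding \<mu>_def by (subst emeasure_distr) (use A' in auto)
    finally show "emeasure \<nu> A = emeasure \<mu> A" .
  qed
  have fC: "indicator C g *\<^sub>R f g = f g" if "g \<in> space \<sigma>" for g
    using f0[of g] that by (auto simp: indicator_def C_def space\<sigma>)
  have J0': "AE x in R. 0 \<le> J x" using J0 by (auto simp: J_def R_def space_restrict_space intro!: AE_I2)
  have fdm [measurable]: "(\<lambda>x. f (\<psi> x)) \<in> borel_measurable R" using measurable_compose[OF \<psi>m f] .
  have "integrable \<sigma> f \<longleftrightarrow> integrable \<sigma> (\<lambda>g. indicator C g *\<^sub>R f g)"
    by (rule Bochner_Integration.integrable_cong[OF refl]) (simp only: fC)
  also have "\<dots> \<longleftrightarrow> integrable \<nu> f"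
    unfolding \<nu>_def by (rule integrable_density[symmetric]) auto
  also have "\<dots> \<longleftrightarrow> integrable (density R (\<lambda>x. ennreal (J x))) (\<lambda>x. f (\<psi> x))"
    unfolding eq \<mu>_def by (rule integrable_distr_eq) (use f in auto)
  also have "\<dots> \<longleftrightarrow> integrable R (\<lambda>x. J x *\<^sub>R f (\<psi> x))"
    by (rule integrable_density) (use J0' in auto)
  also have "\<dots> \<longleftrightarrow> set_integrable lborel V (\<lambda>x. J x * f (\<psi> x))"
    unfolding R_def by (subst integrable_restrict_space) (use V in \<open>auto simp: set_integrable_def\<close>)
  finally show "integrable \<sigma> f" using int by (simp add: J_def)
  have "(LINT g|\<sigma>. f g) = (LINT g|\<sigma>. indicator C g *\<^sub>R f g)"
    by (rule Bochner_Integration.integral_cong[OF refl]) (simp only: fC)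
  also have "\<dots> = (LINT g|\<nu>. f g)"
    unfolding \<nu>_def by (rule integral_density[symmetric]) auto
  also have "\<dots> = (LINT x|density R (\<lambda>x. ennreal (J x)). f (\<psi> x))"
    unfolding eq \<mu>_def by (rule integral_distr) (use f in auto)
  also have "\<dots> = (LINT x|R. J x *\<^sub>R f (\<psi> x))"
    by (rule integral_density) (use J0' in auto)
  also have "\<dots> = (LINT x:V|lborel. J x * f (\<psi> x))"
    unfolding R_def by (subst integral_restrict_space) (use V in \<open>auto simp: set_lebesgue_integral_def\<close>)
  finally show "(LINT g|\<sigma>. f g) = (LINT x:V|lborel. sqrt (det (riem_gram \<psi> x)) * f (\<psi> x))"
    by (simp add: J_def)
qed

section \<open>The horizontal Bochner identity\<close>

definition tvec :: "'n::finite heis" where "tvec = (0, 0, 1)"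

text \<open>The linear form that makes \<open>hfield i\<close> a shear field: the field is a
  constant vector plus this multiple of \<open>T\<close>.\<close>

fun hcoef :: "'n::finite + 'n \<Rightarrow> 'n heis \<Rightarrow> real" where
  "hcoef (Inl j) (x, y, t) = - (y $ j) / 2"
| "hcoef (Inr j) (x, y, t) = x $ j / 2"

text \<open>The structure constants: \<open>[X\<^sub>i, X\<^sub>j] = structure_const i j T\<close>.\<close>

definition structure_const :: "'n::finite + 'n \<Rightarrow> 'n + 'n \<Rightarrow> real" where
  "structure_const i j = 2 * hcoef j (hfield i 0)"

lemma hfield_0: "hfield (Inl j) 0 = (axis j 1, 0, 0)" "hfield (Inr j) 0 = (0, axis j 1, 0)"
  by (simp_all add: zero_prod_def)

lemma hfield_eq: "hfield i g = hfield i 0 + hcoef i g *\<^sub>R tvec"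
  by (cases i; cases g) (simp_all add: hfield_0 tvec_def)

lemma linear_hcoef: "linear (hcoef i)"
  by (cases i) (auto simp: linear_iff add_divide_distrib diff_divide_distrib)

lemma bounded_linear_hcoef: "bounded_linear (hcoef i)"
  using linear_hcoef linear_conv_bounded_linear by blast

lemma hcoef_tvec [simp]: "hcoef i tvec = 0"
  by (cases i) (simp_all add: tvec_def)

lemma shear_field_hfield: "shear_field (hfield i) (hfield i 0) (hcoef i)"
proof -
  have "hcoef i (hfield i 0) = 0" by (cases i) (simp_all add: hfield_0)
  moreover have "hfield i = (\<lambda>g. hfield i 0 + hcoef i g *\<^sub>R (0, 0, 1))"
    by (rule ext) (metis hfield_eq tvec_def)
  moreover have "hcoef i (0, 0, 1) = 0" by (cases i) simp_all
  ultimately show ?thesis unfolding shear_field_def using linear_hcoef by blast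
qed

lemma tfield_eq: "tfield = (\<lambda>_. tvec)"
  by (simp add: tfield_def[abs_def] tvec_def)

lemma shear_field_const: "shear_field (\<lambda>_. v) v (\<lambda>_. 0)"
  by (simp add: shear_field_def linear_iff zero_prod_def[symmetric])

lemma structure_const_simps:
  "structure_const (Inl a) (Inl b) = 0" "structure_const (Inr a) (Inr b) = 0"
  "structure_const (Inl a) (Inr b) = (if a = b then 1 else 0)" "structure_const (Inr a) (Inl b) = (if a = b then - 1 else 0)"
  by (simp_all add: structure_const_def hfield_0 axis_def)

lemma structure_const_commute: "structure_const j i = - structure_const i j"
  by (cases i; cases j) (auto simp: structure_const_simps)

lemma sum_UNIV_Plus:
  fixes f :: "'a::finite + 'b::finite \<Rightarrow> 'c::comm_monoid_add"
  shows "(\<Sum>i\<in>UNIV. f i) = (\<Sum>a\<in>UNIV. f (Inl a)) + (\<Sum>b\<in>UNIV. f (Inr b))"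
  unfolding UNIV_Plus_UNIV[symmetric] by (subst sum.Plus) auto

text \<open>Each of the n conjugate pairs of indices contributes the two entries 1 and -1. This
  count is the only source of the factor n in the integral identity.\<close>

lemma sum_structure_const_squared:
  "(\<Sum>i\<in>UNIV. \<Sum>j\<in>UNIV. (structure_const i (j :: 'n::finite + 'n))\<^sup>2) = 2 * real CARD('n)"
  by (simp add: sum_UNIV_Plus structure_const_simps if_distrib[where f="\<lambda>x. x\<^sup>2"] cong: if_cong)

lemma hcoef_hfield: "hcoef j (hfield i g) = structure_const i j / 2"
  unfolding hfield_eq[of i g] by (simp add: linear_add[OF linear_hcoef] linear_scale[OF linear_hcoef] structure_const_def)

section \<open>Horizontal derivatives of C^2 functions\<close>

lemma X_eq: "(f has_derivative f') (at g) \<Longrightarrow> X i f g = f' (hfield i g)"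
  unfolding X_def by (rule dalong_along[OF has_derivative_dalong])

lemma T_eq: "(f has_derivative f') (at g) \<Longrightarrow> T f g = f' tvec"
  unfolding T_def tfield_eq by (rule dalong_along) (use has_derivative_dalong[where V="\<lambda>_. tvec"] in fast)

lemma C_classD:
  assumes "C_class k U f" "length vs < k" "x \<in> U"
  shows "(Ds vs f has_derivative (\<lambda>v. Ds (v # vs) f x)) (at x)"
  using assms by (simp add: C_class_def frechet_derivative_works)

lemma C_class_cont:
  assumes "C_class k U f" "length vs \<le> k"
  shows "continuous_on U (Ds vs f)"
  using assms by (auto simp: C_class_def)

lemma Ds_linear:
  assumes "C_class k U f" "length vs < k" "x \<in> U"
  shows "linear (\<lambda>v. Ds (v # vs) f x)"
  using C_classD[OF assms] by (rule has_derivative_linear)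

lemma C_class_1D:
  assumes "C_class k U f" "0 < k" "x \<in> U"
  shows "(f has_derivative (\<lambda>v. Ds [v] f x)) (at x)"
  using C_classD[OF assms(1), of "[]"] assms by simp

text \<open>The inner direction is frozen before the outer differentiation. First derivatives are
  linear in it on the whole open set, and uniqueness of derivatives carries this over.\<close>

lemma Ds_2_linear_right:
  assumes C: "C_class 2 U f" and U: "open U" "x \<in> U"
  shows "linear (\<lambda>w. Ds [v, w] f x)"
proof (rule linearI)
  have d: "(Ds [w] f has_derivative (\<lambda>v. Ds [v, w] f x)) (at x)" for w
    by (rule C_classD[OF C _ U(2)]) simp
  have l: "linear (\<lambda>v. Ds [v] f p)" if "p \<in> U" for p
    by (rule Ds_linear[OF C _ that]) simp
  fix w1 w2 c
  have "(Ds [w1 + w2] f has_derivative (\<lambda>v. Ds [v, w1] f x + Ds [v, w2] f x)) (at x)"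
    by (rule has_derivative_transform_within_open[OF has_derivative_add[OF d[of w1] d[of w2]] U])
      (use linear_add[OF l] in simp)
  then show "Ds [v, w1 + w2] f x = Ds [v, w1] f x + Ds [v, w2] f x"
    using fun_cong[OF has_derivative_unique[OF d[of "w1 + w2"]], of _ v] by blast
  have "(Ds [c *\<^sub>R w1] f has_derivative (\<lambda>v. c *\<^sub>R Ds [v, w1] f x)) (at x)"
    by (rule has_derivative_transform_within_open[OF has_derivative_scaleR_right[OF d[of w1], of c] U])
      (use linear_scale[OF l] in simp)
  then show "Ds [v, c *\<^sub>R w1] f x = c *\<^sub>R Ds [v, w1] f x"
    using fun_cong[OF has_derivative_unique[OF d[of "c *\<^sub>R w1"]], of _ v] by blast
qed

text \<open>Constant fields are shear fields with vanishing commutator, so the symmetry of second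
  derivatives is a special case of \<open>along_commutator\<close>.\<close>

lemma Ds_2_commute:
  fixes f :: "'n::finite heis \<Rightarrow> real"
  assumes C: "C_class 2 U f" and U: "open U" "x \<in> U"
  shows "Ds [v, w] f x = Ds [w, v] f x"
proof -
  have d1: "dalong (\<lambda>_. v) f (Ds [v] f g) g" if "g \<in> U" for v g
    using has_derivative_dalong[OF C_class_1D[OF C _ that], of "\<lambda>_. v"] by simp
  have d2: "dalong (\<lambda>_. v) (Ds [w] f) (Ds [v, w] f g) g" if "g \<in> U" for v w g
    using has_derivative_dalong[OF C_classD[OF C _ that, of "[w]"], of "\<lambda>_. v"] by simp
  have "continuous_on U f" using C_class_cont[OF C, of "[]"] by simp
  then have "Ds [v, w] f x - Ds [w, v] f x = (0 - 0) * Ds [tvec] f x"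
    by (intro along_commutator[OF shear_field_const[of v] shear_field_const[of w] U,
       where f=f and Vf="Ds [v] f" and Wf="Ds [w] f" and VWf="Ds [v, w] f"
       and WVf="Ds [w, v] f" and Tf="Ds [tvec] f"] d1 d2 C_class_cont[OF C])
     (use d1[of _ tvec] in \<open>simp_all add: tfield_eq\<close>)
  then show ?thesis by simp
qed

lemma X_C_class:
  assumes "C_class k U f" "0 < k" "x \<in> U"
  shows "X i f x = Ds [hfield i x] f x" "T f x = Ds [tvec] f x"
  using X_eq[OF C_class_1D[OF assms]] T_eq[OF C_class_1D[OF assms]] by auto

lemma X_C_class_coords:
  assumes "C_class k U f" "0 < k" "x \<in> U"
  shows "X i f x = Ds [hfield i 0] f x + hcoef i x * Ds [tvec] f x"
proof -
  have l: "linear (\<lambda>v. Ds [v] f x)" by (rule Ds_linear[OF assms(1)]) (use assms in auto)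
  show ?thesis
    unfolding X_C_class[OF assms] hfield_eq[of i x] by (simp only: linear_add[OF l] linear_scale[OF l]) simp
qed

text \<open>The additional term comes from differentiating the \<open>T\<close>-coefficient of
  \<open>X j\<close>. Along \<open>hfield i\<close> it is half a structure constant times
  \<open>T f\<close>, so \<open>X i (X j f)\<close> splits into a symmetric second derivative and an
  antisymmetric multiple of \<open>T f\<close>.\<close>

lemma dalong_X:
  fixes f :: "'n::finite heis \<Rightarrow> real"
  assumes C: "C_class 2 U f" and U: "open U" "x \<in> U"
  shows "dalong V (X j f) (Ds [V x, hfield j x] f x + hcoef j (V x) * T f x) x"
proof -
  have "dalong V (\<lambda>p. Ds [hfield j 0] f p + hcoef j p * Ds [tvec] f p)
     (Ds [V x, hfield j 0] f x + (hcoef j (V x) * Ds [tvec] f x + hcoef j x * Ds [V x, tvec] f x)) x"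
    by (intro dalong_add dalong_mult has_derivative_dalong[OF C_classD[OF C _ U(2)]]
        has_derivative_dalong[OF bounded_linear_imp_has_derivative[OF bounded_linear_hcoef]]) simp_all
  then have "dalong V (X j f) (Ds [V x, hfield j 0] f x +
      (hcoef j (V x) * Ds [tvec] f x + hcoef j x * Ds [V x, tvec] f x)) x"
    by (rule dalong_cong_open[OF U, rotated]) (simp add: X_C_class_coords[OF C])
  moreover have "Ds [V x, hfield j x] f x = Ds [V x, hfield j 0] f x + hcoef j x * Ds [V x, tvec] f x"
    unfolding hfield_eq[of j x]
    by (simp only: linear_add[OF Ds_2_linear_right[OF C U]] linear_scale[OF Ds_2_linear_right[OF C U]]) simp
  moreover have "T f x = Ds [tvec] f x" by (rule X_C_class(2)[OF C _ U(2)]) simp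
  ultimately show ?thesis by (simp add: algebra_simps)
qed

lemma X_X_C_class:
  assumes "C_class 2 U f" "open U" "x \<in> U"
  shows "X i (X j f) x = Ds [hfield i x, hfield j x] f x + structure_const i j / 2 * T f x"
  using dalong_along[OF dalong_X[OF assms, of "hfield i" j]] by (simp add: X_def hcoef_hfield)

lemma T_X_C_class:
  assumes "C_class 2 U f" "open U" "x \<in> U"
  shows "dalong tfield (X j f) (Ds [tvec, hfield j x] f x) x"
  using dalong_X[OF assms, of tfield j] by (simp add: tfield_eq)

lemma dalong_T:
  fixes f :: "'n::finite heis \<Rightarrow> real"
  assumes C: "C_class 2 U f" and U: "open U" "x \<in> U"
  shows "dalong V (T f) (Ds [V x, tvec] f x) x"
  by (rule dalong_cong_open[OF U _ has_derivative_dalong[OF C_classD[OF C _ U(2), of "[tvec]"]]])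
    (simp_all add: X_C_class(2)[OF C])

lemma X_T_C_class:
  assumes "C_class 2 U f" "open U" "x \<in> U"
  shows "X i (T f) x = Ds [hfield i x, tvec] f x"
  using dalong_along[OF dalong_T[OF assms, of "hfield i"]] by (simp add: X_def)

lemma X_commutator:
  assumes "C_class 2 U f" "open U" "x \<in> U"
  shows "X i (X j f) x - X j (X i f) x = structure_const i j * T f x"
  unfolding X_X_C_class[OF assms] using structure_const_commute[of i j] Ds_2_commute[OF assms, of "hfield i x" "hfield j x"]
  by (simp add: algebra_simps)

section \<open>Third derivatives and the divergence of the Bochner field\<close>

lemma dalong_Gamma_class:
  assumes "Gamma_class k U u" "length is < k" "x \<in> U"
  shows "dalong (hfield i) (Xs is u) (X i (Xs is u) x) x"
  unfolding X_def by (rule dalongI) (use assms in \<open>auto simp: Gamma_class_def\<close>)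

lemma Gamma_class_cont: "Gamma_class k U u \<Longrightarrow> length is \<le> k \<Longrightarrow> continuous_on U (Xs is u)"
  by (simp add: Gamma_class_def)

lemma continuous_on_Ds_coef:
  fixes f :: "'n::finite heis \<Rightarrow> real"
  assumes C: "C_class 2 U f" and U: "open U"
  shows "continuous_on U (\<lambda>x. Ds [hfield i x, tvec] f x)"
proof -
  have "Ds [hfield i x, tvec] f x = Ds [hfield i 0, tvec] f x + hcoef i x * Ds [tvec, tvec] f x" if "x \<in> U" for x
  proof -
    have l: "linear (\<lambda>v. Ds [v, tvec] f x)" by (rule Ds_linear[OF C _ that]) simp
    show ?thesis unfolding hfield_eq[of i x] by (simp only: linear_add[OF l] linear_scale[OF l]) simp
  qed
  moreover have "continuous_on U (\<lambda>x. Ds [hfield i 0, tvec] f x + hcoef i x * Ds [tvec, tvec] f x)"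
    by (intro continuous_on_add continuous_on_mult C_class_cont[OF C] linear_continuous_on[OF bounded_linear_hcoef]) simp_all
  ultimately show ?thesis by (subst continuous_on_cong[OF refl])
qed

text \<open>\<open>X k u\<close> is known to have two continuous horizontal derivatives and a
  continuous \<open>T\<close>-derivative, but not to be C^2, so the weak commutator identity is
  applied to it. Its \<open>T\<close>-derivative equals \<open>X k (T u)\<close> by the symmetry of
  the second derivatives of \<open>u\<close>.\<close>

lemma X_commutator_third:
  fixes u :: "'n::finite heis \<Rightarrow> real"
  assumes G: "Gamma_class 3 U u" and C: "C_class 2 U u" and U: "open U" "x \<in> U"
  shows "X i (X j (X k u)) x - X j (X i (X k u)) x = structure_const i j * X k (T u) x"
proof -
  have XX: "Xs [a, b] u = X a (X b u)" "Xs [b] u = X b u" "Xs [a, b, c] u = X a (X b (X c u))" for a b c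
    by simp_all
  have d1: "dalong (hfield a) (X k u) (X a (X k u) g) g" if "g \<in> U" for a g
    using dalong_Gamma_class[OF G _ that, of "[k]" a] by simp
  have d2: "dalong (hfield a) (X b (X k u)) (X a (X b (X k u)) g) g" if "g \<in> U" for a b g
    using dalong_Gamma_class[OF G _ that, of "[b, k]" a] by simp
  have dT: "dalong tfield (X k u) (X k (T u) g) g" if "g \<in> U" for g
    using T_X_C_class[OF C U(1) that, of k]
    unfolding X_T_C_class[OF C U(1) that] Ds_2_commute[OF C U(1) that, of tvec] .
  have "X i (X j (X k u)) x - X j (X i (X k u)) x = (hcoef j (hfield i 0) - hcoef i (hfield j 0)) * X k (T u) x"
  proof (rule along_commutator[OF shear_field_hfield shear_field_hfield U d1 d1 dT d2 d2])
    show "continuous_on U (X k u)" "continuous_on U (X i (X k u))" "continuous_on U (X j (X k u))"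
      "continuous_on U (X i (X j (X k u)))" "continuous_on U (X j (X i (X k u)))"
      using Gamma_class_cont[OF G, of "[k]"] Gamma_class_cont[OF G, of "[i, k]"] Gamma_class_cont[OF G, of "[j, k]"]
        Gamma_class_cont[OF G, of "[i, j, k]"] Gamma_class_cont[OF G, of "[j, i, k]"] by simp_all
    show "continuous_on U (X k (T u))"
      using continuous_on_Ds_coef[OF C U(1), of k] by (subst continuous_on_cong[OF refl X_T_C_class[OF C U(1)]])
  qed
  moreover have "hcoef j (hfield i 0) - hcoef i (hfield j 0) = structure_const i j"
    using structure_const_commute[of i j] by (simp add: structure_const_def)
  ultimately show ?thesis by simp
qed

text \<open>
  The last term is tangential to the level sets of \<open>u\<close>, so it does not change the boundary flux
  of the field \<open>\<Sum>\<^sub>j bochner u j X\<^sub>j\<close>; it removes the derivatives of \<open>T u\<close> from the divergence.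
\<close>

definition bochner :: "('n::finite heis \<Rightarrow> real) \<Rightarrow> 'n + 'n \<Rightarrow> 'n heis \<Rightarrow> real" where
  "bochner u j g = X j u g * (\<Sum>i\<in>UNIV. X i (X i u) g) - (\<Sum>i\<in>UNIV. X i u g * X i (X j u) g)
     - T u g * (\<Sum>i\<in>UNIV. structure_const i j * X i u g)"

definition bochner_deriv :: "('n::finite heis \<Rightarrow> real) \<Rightarrow> 'n + 'n \<Rightarrow> 'n heis \<Rightarrow> real" where
  "bochner_deriv u j g =
     (X j (X j u) g * (\<Sum>i\<in>UNIV. X i (X i u) g) + X j u g * (\<Sum>i\<in>UNIV. X j (X i (X i u)) g))
     - (\<Sum>i\<in>UNIV. X j (X i u) g * X i (X j u) g + X i u g * X j (X i (X j u)) g)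
     - (X j (T u) g * (\<Sum>i\<in>UNIV. structure_const i j * X i u g) + T u g * (\<Sum>i\<in>UNIV. structure_const i j * X j (X i u) g))"

lemma dalong_bochner:
  assumes G: "Gamma_class 3 U u" and C: "C_class 2 U u" and U: "open U" "x \<in> U"
  shows "dalong (hfield j) (bochner u j) (bochner_deriv u j x) x"
proof -
  have d: "dalong (hfield j) u (X j u x) x" "dalong (hfield j) (X b u) (X j (X b u) x) x"
    "dalong (hfield j) (X b (X c u)) (X j (X b (X c u)) x) x" for b c
    using dalong_Gamma_class[OF G _ U(2), of "[]" j] dalong_Gamma_class[OF G _ U(2), of "[b]" j]
      dalong_Gamma_class[OF G _ U(2), of "[b, c]" j] by simp_all
  have dT: "dalong (hfield j) (T u) (X j (T u) x) x"
    using dalong_T[OF C U, of "hfield j"] unfolding X_T_C_class[OF C U] .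
  show ?thesis
    unfolding bochner_def[abs_def] bochner_deriv_def
    by (intro dalong_diff dalong_mult dalong_sum dalong_cmult d dT)
qed

text \<open>Write \<open>a = s + (structure_const / 2) t\<close> with \<open>s\<close> symmetric.
  The third derivatives cancel up to a commutator that the last term of the field absorbs, and the
  two sums over structure constants contribute n/2 and n times the square of
  \<open>T u\<close>.\<close>

lemma bochner_divergence:
  fixes u :: "'n::finite heis \<Rightarrow> real"
  assumes G: "Gamma_class 3 U u" and C: "C_class 2 U u" and U: "open U" "x \<in> U"
  shows "(\<Sum>j\<in>UNIV. bochner_deriv u j x) =
    (hlaplace u x)\<^sup>2 - hhess_normsq u x + 3 / 2 * real CARD('n) * (T u x)\<^sup>2"
proof -
  define n where "n = real CARD('n)"
  define a where "a i j = X i (X j u) x" for i j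
  define b where "b i j k = X i (X j (X k u)) x" for i j k
  define p where "p i = X i u x" for i
  define t where "t = T u x"
  define q where "q i = X i (T u) x" for i
  define s where "s i j = (a i j + a j i) / 2" for i j
  have aij: "a i j = s i j + structure_const i j / 2 * t" for i j
    using X_commutator[OF C U, of i j] by (simp add: s_def a_def t_def field_simps)
  have s_sym: "s j i = s i j" for i j by (simp add: s_def add.commute)
  have bij: "b i j k = b j i k + structure_const i j * q k" for i j k
    using X_commutator_third[OF G C U, of i j k] by (simp add: b_def q_def)
  have som: "(\<Sum>i\<in>UNIV. \<Sum>j\<in>UNIV. s i j * structure_const i j) = 0"
  proof -
    have "(\<Sum>i\<in>UNIV. \<Sum>j\<in>UNIV. s i j * structure_const i j) = (\<Sum>i\<in>UNIV. \<Sum>j\<in>UNIV. s j i * structure_const j i)"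
      by (rule sum.swap)
    also have "\<dots> = - (\<Sum>i\<in>UNIV. \<Sum>j\<in>UNIV. s i j * structure_const i j)"
    proof -
      have "s j i * structure_const j i = - (s i j * structure_const i j)" for i j
        unfolding s_sym[of i j] structure_const_commute[of i j] by simp
      then show ?thesis unfolding sum_negf[symmetric] by (intro sum.cong refl)
    qed
    finally show ?thesis by simp
  qed
  \<comment> \<open>The trace of the square of a matrix is the squared norm of its symmetric part
    minus that of its antisymmetric part; the latter is \<open>2 n t\<^sup>2 / 4\<close>.\<close>
  have S1: "(\<Sum>j\<in>UNIV. \<Sum>i\<in>UNIV. a j i * a i j) = (\<Sum>i\<in>UNIV. \<Sum>j\<in>UNIV. (s i j)\<^sup>2) - n / 2 * t\<^sup>2"
  proof -
    have "a j i * a i j = (s j i)\<^sup>2 - (structure_const j i)\<^sup>2 * (t\<^sup>2 / 4)" for i j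
      unfolding aij s_sym[of i j] structure_const_commute[of i j] by (simp add: power2_eq_square algebra_simps)
    then have "(\<Sum>j\<in>UNIV. \<Sum>i\<in>UNIV. a j i * a i j) =
        (\<Sum>i\<in>UNIV. \<Sum>j\<in>UNIV. (s i j)\<^sup>2) - (\<Sum>i\<in>UNIV. \<Sum>j\<in>UNIV. (structure_const i (j :: 'n + 'n))\<^sup>2) * (t\<^sup>2 / 4)"
      by (simp add: sum_subtractf sum_distrib_right)
    then show ?thesis unfolding sum_structure_const_squared by (simp add: n_def)
  qed
  \<comment> \<open>Against the antisymmetric structure constants only the antisymmetric part of
    \<open>a\<close> survives.\<close>
  have S2: "(\<Sum>j\<in>UNIV. \<Sum>i\<in>UNIV. structure_const i j * a j i) = - n * t"
  proof -
    have "structure_const i j * a j i = - (s j i * structure_const j i) - (structure_const j i)\<^sup>2 * (t / 2)" for i j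
      unfolding aij structure_const_commute[of i j] by (simp add: power2_eq_square algebra_simps)
    then have "(\<Sum>j\<in>UNIV. \<Sum>i\<in>UNIV. structure_const i j * a j i) =
        - (\<Sum>i\<in>UNIV. \<Sum>j\<in>UNIV. s i j * structure_const i j) - (\<Sum>i\<in>UNIV. \<Sum>j\<in>UNIV. (structure_const i (j :: 'n + 'n))\<^sup>2) * (t / 2)"
      by (simp add: sum_subtractf sum_distrib_right sum_negf)
    then show ?thesis unfolding sum_structure_const_squared som by (simp add: n_def)
  qed
  \<comment> \<open>After renaming indices the first two sums differ by an exchange of the two outer
    fields in \<open>b\<close>, which costs exactly the third sum.\<close>
  have S3: "(\<Sum>j\<in>UNIV. p j * (\<Sum>i\<in>UNIV. b j i i)) - (\<Sum>j\<in>UNIV. \<Sum>i\<in>UNIV. p i * b j i j)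
      - (\<Sum>j\<in>UNIV. q j * (\<Sum>i\<in>UNIV. structure_const i j * p i)) = 0"
  proof -
    have "(\<Sum>j\<in>UNIV. p j * (\<Sum>i\<in>UNIV. b j i i)) = (\<Sum>j\<in>UNIV. \<Sum>i\<in>UNIV. p i * b i j j)"
      by (simp add: sum_distrib_left) (rule sum.swap)
    also have "\<dots> = (\<Sum>j\<in>UNIV. \<Sum>i\<in>UNIV. p i * b j i j + q j * (structure_const i j * p i))"
    proof -
      have "p i * b i j j = p i * b j i j + q j * (structure_const i j * p i)" for i j
        using bij[of i j j] by (simp add: algebra_simps)
      then show ?thesis by simp
    qed
    finally show ?thesis by (simp add: sum.distrib sum_distrib_left)
  qed
  have "(\<Sum>j\<in>UNIV. bochner_deriv u j x) =
    (\<Sum>j\<in>UNIV. a j j * (\<Sum>i\<in>UNIV. a i i)) + (\<Sum>j\<in>UNIV. p j * (\<Sum>i\<in>UNIV. b j i i))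
     - ((\<Sum>j\<in>UNIV. \<Sum>i\<in>UNIV. a j i * a i j) + (\<Sum>j\<in>UNIV. \<Sum>i\<in>UNIV. p i * b j i j))
     - ((\<Sum>j\<in>UNIV. q j * (\<Sum>i\<in>UNIV. structure_const i j * p i)) + (\<Sum>j\<in>UNIV. t * (\<Sum>i\<in>UNIV. structure_const i j * a j i)))"
    unfolding bochner_deriv_def a_def[symmetric] b_def[symmetric] p_def[symmetric] t_def[symmetric] q_def[symmetric]
    by (simp only: sum.distrib sum_subtractf)
  also have "\<dots> = (\<Sum>i\<in>UNIV. a i i)\<^sup>2 - (\<Sum>j\<in>UNIV. \<Sum>i\<in>UNIV. a j i * a i j)
      - t * (\<Sum>j\<in>UNIV. \<Sum>i\<in>UNIV. structure_const i j * a j i)"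
  proof -
    have "(\<Sum>j\<in>UNIV. a j j * (\<Sum>i\<in>UNIV. a i i)) = (\<Sum>i\<in>UNIV. a i i)\<^sup>2"
      by (simp only: sum_distrib_right[symmetric] power2_eq_square)
    moreover have "(\<Sum>j\<in>UNIV. t * (\<Sum>i\<in>UNIV. structure_const i j * a j i)) = t * (\<Sum>j\<in>UNIV. \<Sum>i\<in>UNIV. structure_const i j * a j i)"
      by (simp only: sum_distrib_left[symmetric])
    ultimately show ?thesis using S3 by linarith
  qed
  also have "\<dots> = (\<Sum>i\<in>UNIV. a i i)\<^sup>2 - (\<Sum>i\<in>UNIV. \<Sum>j\<in>UNIV. (s i j)\<^sup>2) + 3 / 2 * n * t\<^sup>2"
  proof -
    have "A - (B - n / 2 * t\<^sup>2) - t * (- n * t) = A - B + 3 / 2 * n * t\<^sup>2" for A B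
      by (simp add: power2_eq_square)
    then show ?thesis unfolding S1 S2 .
  qed
  finally show ?thesis
    unfolding hlaplace_def hhess_normsq_def hhess_def a_def s_def n_def t_def by (simp only: vec_lambda_beta)
qed

section \<open>Functions vanishing on the boundary\<close>

text \<open>\<open>defining_function\<close> hides its neighbourhood under a quantifier; here the
  neighbourhood is a parameter, so that it can be shrunk and shared.\<close>

definition defining_on :: "'n::finite heis set \<Rightarrow> 'n heis set \<Rightarrow> ('n heis \<Rightarrow> real) \<Rightarrow> bool" where
  "defining_on \<Omega> U \<phi> \<longleftrightarrow> open U \<and> C_class 2 U \<phi> \<and>
     \<Omega> \<inter> U = {p \<in> U. \<phi> p < 0} \<and> (\<forall>p\<in>U. riem_grad \<phi> p \<noteq> 0)"

lemma defining_function_iff: "defining_function \<Omega> g \<phi> \<longleftrightarrow> (\<exists>U. defining_on \<Omega> U \<phi> \<and> g \<in> U)"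
  by (auto simp: defining_function_def defining_on_def)

lemma defining_onD:
  assumes "defining_on \<Omega> U \<phi>"
  shows "open U" "C_class 2 U \<phi>" "\<And>p. p \<in> U \<Longrightarrow> p \<in> \<Omega> \<longleftrightarrow> \<phi> p < 0"
    "continuous_on U \<phi>"
    "\<And>p. p \<in> U \<Longrightarrow> (\<phi> has_derivative (\<lambda>v. Ds [v] \<phi> p)) (at p)"
    "\<And>p. p \<in> U \<Longrightarrow> linear (\<lambda>v. Ds [v] \<phi> p)"
proof -
  show C: "C_class 2 U \<phi>" and "open U" using assms by (auto simp: defining_on_def)
  show "p \<in> U \<Longrightarrow> p \<in> \<Omega> \<longleftrightarrow> \<phi> p < 0" for p using assms unfolding defining_on_def by blast
  show "continuous_on U \<phi>" using C_class_cont[OF C, of "[]"] by simp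
  show "p \<in> U \<Longrightarrow> (\<phi> has_derivative (\<lambda>v. Ds [v] \<phi> p)) (at p)" for p
    by (rule C_class_1D[OF C]) auto
  show "p \<in> U \<Longrightarrow> linear (\<lambda>v. Ds [v] \<phi> p)" for p
    by (rule Ds_linear[OF C]) auto
qed

lemma defining_on_gradient:
  assumes d: "defining_on \<Omega> U \<phi>" and p: "p \<in> U"
  obtains e where "0 < Ds [e] \<phi> p"
proof -
  have l: "linear (\<lambda>v. Ds [v] \<phi> p)" by (rule defining_onD(6)[OF d p])
  have "\<exists>e. Ds [e] \<phi> p \<noteq> 0"
  proof (rule ccontr)
    assume "\<not> ?thesis"
    then have z: "Ds [e] \<phi> p = 0" for e by blast
    have "X i \<phi> p = 0" "T \<phi> p = 0" for i
      using X_C_class(1)[OF defining_onD(2)[OF d] _ p, of i] X_C_class(2)[OF defining_onD(2)[OF d] _ p]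
        z[of "hfield i p"] z[of tvec] by simp_all
    then have "riem_grad \<phi> p = 0" by (simp add: riem_grad_def)
    then show False using d p by (simp add: defining_on_def)
  qed
  then obtain e where e: "Ds [e] \<phi> p \<noteq> 0" ..
  have "Ds [- e] \<phi> p = - Ds [e] \<phi> p" using linear_neg[OF l] .
  then show ?thesis using that[of e] that[of "- e"] e by linarith
qed

text \<open>Outside the domain \<open>\<phi>\<close> is nonnegative, and a positive value would
  persist on a neighbourhood that misses the domain.\<close>

lemma defining_on_frontier:
  assumes d: "defining_on \<Omega> U \<phi>" and O: "open \<Omega>" and p: "p \<in> frontier \<Omega>" "p \<in> U"
  shows "\<phi> p = 0"
proof -
  have "p \<notin> \<Omega>" using p(1) O by (auto simp: frontier_def interior_open)
  then have "0 \<le> \<phi> p" using defining_onD(3)[OF d p(2)] by auto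
  moreover have "\<phi> p \<le> 0"
  proof (rule ccontr)
    assume "\<not> \<phi> p \<le> 0"
    then have "p \<in> U \<inter> \<phi> -` {0<..}" using p by simp
    moreover have "open (U \<inter> \<phi> -` {0<..})"
      by (rule continuous_open_preimage[OF defining_onD(4,1)[OF d]]) simp
    moreover have "p \<in> closure \<Omega>" using p(1) by (simp add: frontier_def)
    ultimately obtain q where "q \<in> \<Omega>" "q \<in> U" "0 < \<phi> q"
      unfolding closure_iff_nhds_not_empty by (smt (verit) IntD1 IntD2 IntE disjoint_iff greaterThan_iff vimage_eq subset_refl)
    then show False using defining_onD(3)[OF d, of q] by simp
  qed
  ultimately show ?thesis by simp
qed

section \<open>First and second derivatives of functions vanishing on the boundary\<close>

text \<open>
  A step from a boundary point in a strictly inward direction stays in the domain, and a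
  correspondingly small step outwards leaves it again; between the two, \<open>f\<close> can only vary by as
  much as the (arbitrarily small) inward tilt allows.
\<close>

lemma tangential_derivative_zero:
  fixes f :: "'n::finite heis \<Rightarrow> real"
  assumes d: "defining_on \<Omega> U \<phi>" and O: "open \<Omega>" and p: "p \<in> frontier \<Omega>" "p \<in> U"
    and cf: "continuous_on (closure \<Omega> \<inter> U) f" and f0: "\<And>q. q \<in> frontier \<Omega> \<inter> U \<Longrightarrow> f q = 0"
    and df: "\<And>g. g \<in> \<Omega> \<inter> U \<Longrightarrow> (f has_derivative f' g) (at g)"
    and lim: "\<And>v. ((\<lambda>g. f' g v) \<longlongrightarrow> lm v) (at p within \<Omega>)"
    and lin: "linear lm" and v: "Ds [v] \<phi> p = 0"
  shows "lm v = 0"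
proof (rule ccontr)
  assume "lm v \<noteq> 0"
  define c where "c = \<bar>lm v\<bar>"
  have c: "c > 0" using \<open>lm v \<noteq> 0\<close> by (simp add: c_def)
  obtain e where e: "0 < Ds [e] \<phi> p" by (rule defining_on_gradient[OF d p(2)])
  define B where "B = \<bar>lm e\<bar> + 1"
  have B: "B > 0" by (simp add: B_def)
  \<comment> \<open>This tilt moves \<open>lm w\<close> by at most \<open>c / 8\<close> from
    \<open>lm v\<close>, so \<open>f\<close> changes by at least \<open>s c / 2\<close> along the
    inward step; the way back out has length parameter at most \<open>2 \<delta> s\<close> and
    changes \<open>f\<close> by at most \<open>2 \<delta> s B = s c / 4\<close>.\<close>
  define \<delta> where "\<delta> = c / (8 * B)"
  have \<delta>: "\<delta> > 0" "\<delta> * B = c / 8" using B c by (auto simp: \<delta>_def)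
  \<comment> \<open>Along a tangential \<open>v\<close> the sign of \<open>\<phi>\<close> is
    undecided. The tilted directions \<open>w\<close> and \<open>w'\<close> give it a strict sign,
    negative and positive respectively, for all small steps.\<close>
  define w where "w = v - \<delta> *\<^sub>R e"
  define w' where "w' = v + \<delta> *\<^sub>R e"
  have D\<phi>: "(\<phi> has_derivative (\<lambda>v. Ds [v] \<phi> p)) (at p)" and l\<phi>: "linear (\<lambda>v. Ds [v] \<phi> p)"
    using defining_onD(5,6)[OF d p(2)] .
  have Dw: "Ds [w] \<phi> p < 0" "0 < Ds [w'] \<phi> p"
    unfolding w_def w'_def using linear_diff[OF l\<phi>] linear_add[OF l\<phi>] linear_scale[OF l\<phi>] v e \<delta>(1) by simp_all
  have "\<bar>\<delta> * lm e\<bar> \<le> \<delta> * B" using \<delta>(1) by (simp add: abs_mult B_def)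
  moreover have "lm w = lm v - \<delta> * lm e" by (simp add: w_def linear_diff[OF lin] linear_scale[OF lin])
  ultimately have lmw: "\<bar>lm w\<bar> \<ge> 7 * c / 8" using \<delta>(2) abs_triangle_ineq2[of "lm v" "\<delta> * lm e"] unfolding c_def by linarith
  have \<phi>p: "\<phi> p = 0" by (rule defining_on_frontier[OF d O p])
  have "\<forall>\<^sub>F g in at p within \<Omega>. \<bar>f' g e - lm e\<bar> < 1 \<and> \<bar>f' g w - lm w\<bar> < c / 8"
    using tendstoD[OF lim[of e], of 1] tendstoD[OF lim[of w], of "c/8"] c
    by (auto simp: dist_real_def eventually_conj_iff)
  then obtain r1 where r1: "r1 > 0" "\<And>g. g \<in> \<Omega> \<Longrightarrow> g \<noteq> p \<Longrightarrow> dist g p < r1 \<Longrightarrow> \<bar>f' g e - lm e\<bar> < 1 \<and> \<bar>f' g w - lm w\<bar> < c / 8"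
    unfolding eventually_at by blast
  have pnO: "p \<notin> \<Omega>" using p(1) O by (auto simp: frontier_def interior_open)
  obtain r2 where r2: "r2 > 0" "ball p r2 \<subseteq> U" using defining_onD(1)[OF d] p(2) open_contains_ball by blast
  have near: "\<bar>f' g e\<bar> \<le> B" "\<bar>f' g w\<bar> > c / 2" if "g \<in> \<Omega>" "dist g p < r1" for g
  proof -
    have "\<bar>f' g e - lm e\<bar> < 1 \<and> \<bar>f' g w - lm w\<bar> < c / 8" using r1(2)[OF that(1) _ that(2)] that pnO by blast
    then show "\<bar>f' g e\<bar> \<le> B" "\<bar>f' g w\<bar> > c / 2" using lmw c unfolding B_def by linarith+
  qed
  have lim_dir: "((\<lambda>s. \<phi> (p + s *\<^sub>R z) / s) \<longlongrightarrow> Ds [z] \<phi> p) (at 0)" for z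
  proof -
    have "dalong (\<lambda>_. z) \<phi> (Ds [z] \<phi> p) p" using has_derivative_dalong[OF D\<phi>, of "\<lambda>_. z"] by simp
    then show ?thesis using \<phi>p by (simp add: dalong_def DERIV_def)
  qed
  have "\<forall>\<^sub>F s in at 0. \<phi> (p + s *\<^sub>R w) / s < 0" "\<forall>\<^sub>F s in at 0. \<phi> (p + s *\<^sub>R w') / s > 0"
    using order_tendstoD(2)[OF lim_dir Dw(1)] order_tendstoD(1)[OF lim_dir Dw(2)] by auto
  then have "\<forall>\<^sub>F s in at (0::real). \<phi> (p + s *\<^sub>R w) / s < 0 \<and> \<phi> (p + s *\<^sub>R w') / s > 0"
    by eventually_elim simp
  then obtain s1 where s1: "s1 > 0"
    "\<And>s. s \<noteq> 0 \<Longrightarrow> dist s 0 < s1 \<Longrightarrow> \<phi> (p + s *\<^sub>R w) / s < 0 \<and> \<phi> (p + s *\<^sub>R w') / s > 0"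
    unfolding eventually_at by blast
  define K where "K = norm w + 2 * \<delta> * norm e + 1"
  have K: "K > 0" using \<delta>(1) by (simp add: K_def add_nonneg_pos)
  \<comment> \<open>Below \<open>s1\<close> the signs of \<open>\<phi>\<close> are decided, and
    \<open>s K\<close> below both radii keeps the whole path inside \<open>U\<close> and inside the
    ball where the derivative estimates hold.\<close>
  define s where "s = min (s1 / 2) (min r1 r2 / (2 * K))"
  have s: "s > 0" "s < s1" using s1 r1 r2 K by (auto simp: s_def)
  have sK: "s * K < min r1 r2"
  proof -
    have "s * K \<le> min r1 r2 / (2 * K) * K" using K by (intro mult_right_mono) (auto simp: s_def)
    also have "\<dots> = min r1 r2 / 2" using K by simp
    also have "\<dots> < min r1 r2"
    proof -
      have "0 < min r1 r2" using r1(1) r2(1) by simp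
      then show ?thesis by linarith
    qed
    finally show ?thesis .
  qed
  have inball: "dist (p + \<tau> *\<^sub>R w + r *\<^sub>R e) p < min r1 r2" if "0 \<le> \<tau>" "\<tau> \<le> s" "0 \<le> r" "r \<le> 2 * \<delta> * s" for \<tau> r
  proof -
    have "dist (p + \<tau> *\<^sub>R w + r *\<^sub>R e) p = norm (\<tau> *\<^sub>R w + r *\<^sub>R e)" by (simp add: dist_norm algebra_simps)
    also have "\<dots> \<le> \<tau> * norm w + r * norm e" using norm_triangle_ineq[of "\<tau> *\<^sub>R w" "r *\<^sub>R e"] that by simp
    also have "\<dots> \<le> s * norm w + (2 * \<delta> * s) * norm e" using that by (intro add_mono mult_right_mono) auto
    also have "\<dots> \<le> s * K" using s by (simp add: K_def algebra_simps)
    finally show ?thesis using sK by linarith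
  qed
  have inU: "p + \<tau> *\<^sub>R w + r *\<^sub>R e \<in> U" if "0 \<le> \<tau>" "\<tau> \<le> s" "0 \<le> r" "r \<le> 2 * \<delta> * s" for \<tau> r
    using inball[OF that] r2(2) by (metis mem_ball dist_commute min_less_iff_conj subsetD)
  have seg: "p + \<tau> *\<^sub>R w \<in> \<Omega> \<inter> U" if "0 < \<tau>" "\<tau> \<le> s" for \<tau>
  proof -
    have "\<phi> (p + \<tau> *\<^sub>R w) / \<tau> < 0" using s1(2)[of \<tau>] that s by auto
    then have "\<phi> (p + \<tau> *\<^sub>R w) < 0" using that by (simp add: divide_less_0_iff)
    then show ?thesis using defining_onD(3)[OF d, of "p + \<tau> *\<^sub>R w"] inU[of \<tau> 0] that \<delta>(1) by simp
  qed
  have chain: "((\<lambda>\<tau>. f (a + \<tau> *\<^sub>R z)) has_real_derivative f' (a + \<tau> *\<^sub>R z) z) (at \<tau>)" if "a + \<tau> *\<^sub>R z \<in> \<Omega> \<inter> U" for a z \<tau>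
  proof -
    have "((\<lambda>\<tau>. a + \<tau> *\<^sub>R z) has_derivative (\<lambda>h. h *\<^sub>R z)) (at \<tau>)" by (auto intro!: derivative_eq_intros)
    from has_derivative_compose[OF this df[OF that]]
    have "((\<lambda>\<tau>. f (a + \<tau> *\<^sub>R z)) has_derivative (\<lambda>h. f' (a + \<tau> *\<^sub>R z) (h *\<^sub>R z))) (at \<tau>)" .
    moreover have "(\<lambda>h. f' (a + \<tau> *\<^sub>R z) (h *\<^sub>R z)) = (*) (f' (a + \<tau> *\<^sub>R z) z)"
      using linear_scale[OF has_derivative_linear[OF df[OF that]]] by (auto simp: fun_eq_iff)
    ultimately show ?thesis by (simp add: has_field_derivative_def)
  qed
  have clO: "\<Omega> \<inter> U \<subseteq> closure \<Omega> \<inter> U" using closure_subset by blast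
  define y where "y = p + s *\<^sub>R w"
  have low: "s * (c / 2) \<le> \<bar>f y\<bar>"
  proof -
    have "continuous_on {0..s} (\<lambda>\<tau>. f (p + \<tau> *\<^sub>R w))"
    proof (rule continuous_on_compose2[OF cf])
      show "(\<lambda>\<tau>. p + \<tau> *\<^sub>R w) ` {0..s} \<subseteq> closure \<Omega> \<inter> U"
      proof
        fix z assume "z \<in> (\<lambda>\<tau>. p + \<tau> *\<^sub>R w) ` {0..s}"
        then obtain \<tau> where \<tau>: "0 \<le> \<tau>" "\<tau> \<le> s" "z = p + \<tau> *\<^sub>R w" by auto
        show "z \<in> closure \<Omega> \<inter> U"
        proof (cases "\<tau> = 0")
          case True
          then show ?thesis using \<tau> p by (simp add: frontier_def)
        next
          case False
          then show ?thesis using seg[of \<tau>] \<tau> clO by auto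
        qed
      qed
    qed (intro continuous_intros)
    then obtain l z where z: "0 < z" "z < s" "DERIV (\<lambda>\<tau>. f (p + \<tau> *\<^sub>R w)) z :> l"
        "f (p + s *\<^sub>R w) - f (p + 0 *\<^sub>R w) = (s - 0) * l"
      using MVT[of 0 s "\<lambda>\<tau>. f (p + \<tau> *\<^sub>R w)"] chain[of p _ w] seg s(1) unfolding real_differentiable_def
      by (metis less_imp_le)
    have zO: "p + z *\<^sub>R w \<in> \<Omega> \<inter> U" using seg[of z] z by simp
    have "l = f' (p + z *\<^sub>R w) w" using DERIV_unique[OF z(3) chain[OF zO]] .
    moreover have "dist (p + z *\<^sub>R w) p < r1" using inball[of z 0] z s \<delta>(1) by simp
    ultimately have "\<bar>l\<bar> > c / 2" using near(2) zO by blast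
    moreover have "f y = s * l" using z(4) f0[of p] p by (simp add: y_def)
    ultimately show ?thesis using s(1) by (simp add: abs_mult)
  qed
  \<comment> \<open>Moving from \<open>y\<close> by \<open>2 \<delta> s\<close> in direction
    \<open>e\<close> ends at \<open>p + s w'\<close>, outside the domain. The smallest element of
    \<open>S\<close> is therefore a first exit point, which lies on the boundary, where
    \<open>f\<close> is zero.\<close>
  define S where "S = {r \<in> {0..2 * \<delta> * s}. y + r *\<^sub>R e \<notin> \<Omega>}"
  have "compact S"
  proof -
    have "S = {0..2 * \<delta> * s} \<inter> (\<lambda>r. y + r *\<^sub>R e) -` (- \<Omega>)" by (auto simp: S_def)
    moreover have "closed ((\<lambda>r. y + r *\<^sub>R e) -` (- \<Omega>))"
      by (intro closed_vimage continuous_intros) (use O in auto)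
    ultimately show ?thesis using compact_Int_closed[of "{0..2 * \<delta> * s}"] by simp
  qed
  moreover have "2 * \<delta> * s \<in> S"
  proof -
    have "(2 * \<delta> * s) *\<^sub>R e = (s * \<delta>) *\<^sub>R e + (s * \<delta>) *\<^sub>R e" by (simp add: scaleR_add_left[symmetric])
    then have eq: "y + (2 * \<delta> * s) *\<^sub>R e = p + s *\<^sub>R w'" by (simp add: y_def w_def w'_def scaleR_diff_right scaleR_add_right)
    have inU': "p + s *\<^sub>R w' \<in> U" using inU[of s "2 * \<delta> * s"] s(1) \<delta>(1) unfolding eq[unfolded y_def] by simp
    have "\<phi> (p + s *\<^sub>R w') / s > 0" using s1(2)[of s] s by auto
    then have "\<not> \<phi> (p + s *\<^sub>R w') < 0" using s(1) by (simp add: zero_less_divide_iff)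
    then have "p + s *\<^sub>R w' \<notin> \<Omega>" using defining_onD(3)[OF d inU'] by simp
    then show ?thesis using s(1) \<delta>(1) by (simp add: S_def eq)
  qed
  ultimately obtain r where r: "r \<in> S" "\<And>t. t \<in> S \<Longrightarrow> r \<le> t"
    using compact_attains_inf[of S] by blast
  have yO: "y \<in> \<Omega>" using seg[of s] s(1) by (simp add: y_def)
  have r0: "0 < r" "r \<le> 2 * \<delta> * s" using r(1) yO by (auto simp: S_def less_le)
  have seg2: "y + t *\<^sub>R e \<in> \<Omega> \<inter> U" if "0 \<le> t" "t < r" for t
  proof -
    have "t \<notin> S" using r(2)[of t] that by auto
    then show ?thesis using that r0 inU[of s t] s(1) by (auto simp: S_def y_def)
  qed
  have qU: "y + r *\<^sub>R e \<in> U" using inU[of s r] r0 s(1) by (simp add: y_def)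
  have qcl: "y + r *\<^sub>R e \<in> closure \<Omega>"
  proof -
    have "((\<lambda>t. y + t *\<^sub>R e) \<longlongrightarrow> y + r *\<^sub>R e) (at_left r)" by (intro tendsto_intros)
    moreover have "\<forall>\<^sub>F t in at_left r. y + t *\<^sub>R e \<in> closure \<Omega>"
    proof -
      have "y + t *\<^sub>R e \<in> closure \<Omega>" if "0 < t" "t < r" for t using seg2[of t] that closure_subset[of \<Omega>] by auto
      then show ?thesis unfolding eventually_at_left[OF r0(1)] using r0(1) by blast
    qed
    ultimately show ?thesis using Lim_in_closed_set[OF closed_closure] by (metis trivial_limit_at_left_real)
  qed
  have qF: "y + r *\<^sub>R e \<in> frontier \<Omega> \<inter> U"
    using qcl qU r(1) O by (auto simp: frontier_def interior_open S_def)
  have up: "\<bar>f y\<bar> \<le> 2 * \<delta> * s * B"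
  proof -
    have "continuous_on {0..r} (\<lambda>t. f (y + t *\<^sub>R e))"
    proof (rule continuous_on_compose2[OF cf])
      show "(\<lambda>t. y + t *\<^sub>R e) ` {0..r} \<subseteq> closure \<Omega> \<inter> U"
      proof
        fix z assume "z \<in> (\<lambda>t. y + t *\<^sub>R e) ` {0..r}"
        then obtain t where "0 \<le> t" "t \<le> r" "z = y + t *\<^sub>R e" by auto
        then show "z \<in> closure \<Omega> \<inter> U" using seg2[of t] clO qcl qU by (cases "t = r") auto
      qed
    qed (intro continuous_intros)
    then obtain l z where z: "0 < z" "z < r" "DERIV (\<lambda>t. f (y + t *\<^sub>R e)) z :> l"
        "f (y + r *\<^sub>R e) - f (y + 0 *\<^sub>R e) = (r - 0) * l"
      using MVT[of 0 r "\<lambda>t. f (y + t *\<^sub>R e)"] chain[of y _ e] seg2 r0(1) unfolding real_differentiable_def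
      by (metis less_imp_le)
    have zO: "y + z *\<^sub>R e \<in> \<Omega> \<inter> U" using seg2[of z] z by simp
    have "l = f' (y + z *\<^sub>R e) e" using DERIV_unique[OF z(3) chain[OF zO]] .
    moreover have "dist (y + z *\<^sub>R e) p < r1" using inball[of s z] z s r0 by (simp add: y_def)
    ultimately have "\<bar>l\<bar> \<le> B" using near(1) zO by blast
    moreover have "f y = - (r * l)" using z(4) f0[OF qF] by simp
    ultimately have "\<bar>f y\<bar> \<le> r * B" using r0(1) by (simp add: abs_mult)
    also have "\<dots> \<le> 2 * \<delta> * s * B" using r0(2) B by (intro mult_right_mono) auto
    finally show ?thesis .
  qed
  have "2 * \<delta> * s * B = s * (c / 4)" using \<delta>(2) by simp
  then have "s * (c / 2) \<le> s * (c / 4)" using low up by linarith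
  then show False using s(1) c by simp
qed

text \<open>\<open>F\<close> supplies the continuous extensions of all derivatives up to order two;
  it is separate data because \<open>f\<close> itself may behave arbitrarily outside the domain.
  Both the boundary values of \<open>u\<close> and a second defining function are instances.\<close>

definition C2_vanishing ::
  "'n::finite heis set \<Rightarrow> 'n heis set \<Rightarrow> ('n heis \<Rightarrow> real) \<Rightarrow> ('n heis list \<Rightarrow> 'n heis \<Rightarrow> real) \<Rightarrow> bool" where
  "C2_vanishing \<Omega> U f F \<longleftrightarrow> C_class 2 (\<Omega> \<inter> U) f \<and>
     (\<forall>vs. length vs \<le> 2 \<longrightarrow> continuous_on (closure \<Omega> \<inter> U) (F vs) \<and> (\<forall>g\<in>\<Omega> \<inter> U. F vs g = Ds vs f g)) \<and>
     (\<forall>q\<in>frontier \<Omega> \<inter> U. F [] q = 0)"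

lemma C2_vanishing_tendsto:
  assumes F: "C2_vanishing \<Omega> U f F" and O: "open \<Omega>" "open U" and p: "p \<in> frontier \<Omega>" "p \<in> U" and l: "length vs \<le> 2"
  shows "(F vs \<longlongrightarrow> F vs p) (at p within \<Omega>)" "((\<lambda>g. Ds vs f g) \<longlongrightarrow> F vs p) (at p within \<Omega>)"
proof -
  have "continuous_on (closure \<Omega> \<inter> U) (F vs)" using F l by (simp add: C2_vanishing_def)
  moreover have "p \<in> closure \<Omega> \<inter> U" using p by (simp add: frontier_def)
  ultimately have "(F vs \<longlongrightarrow> F vs p) (at p within (closure \<Omega> \<inter> U))" by (simp add: continuous_on_def)
  then have "(F vs \<longlongrightarrow> F vs p) (at p within (\<Omega> \<inter> U))"
    by (rule tendsto_within_subset) (use closure_subset in blast)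
  moreover have eq: "at p within (\<Omega> \<inter> U) = at p within \<Omega>"
    by (rule at_within_nhd[OF p(2) O(2)]) auto
  ultimately show 1: "(F vs \<longlongrightarrow> F vs p) (at p within \<Omega>)" by simp
  have "\<forall>\<^sub>F g in at p within (\<Omega> \<inter> U). F vs g = Ds vs f g"
    using F l by (auto simp: C2_vanishing_def eventually_at_filter)
  then show "((\<lambda>g. Ds vs f g) \<longlongrightarrow> F vs p) (at p within \<Omega>)"
    using 1 unfolding eq by (rule Lim_transform_eventually[rotated])
qed

lemma at_frontier_nontrivial:
  assumes "open \<Omega>" "p \<in> frontier \<Omega>"
  shows "at p within \<Omega> \<noteq> bot"
proof -
  have "p \<notin> \<Omega>" "p \<in> closure \<Omega>" using assms by (auto simp: frontier_def interior_open)
  then have "p islimpt \<Omega>" by (auto simp: closure_def)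
  then show ?thesis by (simp add: trivial_limit_within)
qed

lemma linear_limit:
  assumes "F \<noteq> bot" "\<forall>\<^sub>F g in F. linear (h g)" "\<And>v. ((\<lambda>g. h g v) \<longlongrightarrow> k v) F"
  shows "linear (k :: 'a::real_normed_vector \<Rightarrow> real)"
proof (rule linearI)
  fix v w c
  have "((\<lambda>g. h g (v + w)) \<longlongrightarrow> k v + k w) F"
    by (rule Lim_transform_eventually[OF tendsto_add[OF assms(3)[of v] assms(3)[of w]]])
      (use assms(2) in eventually_elim, simp add: linear_add)
  then show "k (v + w) = k v + k w" using tendsto_unique assms(1,3) by blast
  have "((\<lambda>g. h g (c *\<^sub>R v)) \<longlongrightarrow> c * k v) F"
    by (rule Lim_transform_eventually[OF tendsto_mult[OF tendsto_const[of c] assms(3)[of v]]])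
      (use assms(2) in eventually_elim, simp add: linear_scale)
  then show "k (c *\<^sub>R v) = c *\<^sub>R k v" using tendsto_unique assms(1,3) by (metis real_scaleR_def)
qed

lemma eventually_within_Int:
  assumes "open U" "p \<in> U" "\<And>g. g \<in> \<Omega> \<inter> U \<Longrightarrow> P g"
  shows "\<forall>\<^sub>F g in at p within \<Omega>. P g"
  unfolding eventually_at_topological using assms by blast

lemma C2_vanishing_linear:
  assumes F: "C2_vanishing \<Omega> U f F" and O: "open \<Omega>" "open U" and p: "p \<in> frontier \<Omega>" "p \<in> U"
  shows "linear (\<lambda>v. F [v] p)" "linear (\<lambda>v. F [v, w] p)" "linear (\<lambda>w. F [v, w] p)"
proof -
  note nt = at_frontier_nontrivial[OF O(1) p(1)]
  have C: "C_class 2 (\<Omega> \<inter> U) f" and oOU: "open (\<Omega> \<inter> U)" using F O by (auto simp: C2_vanishing_def)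
  show "linear (\<lambda>v. F [v] p)"
    by (rule linear_limit[OF nt _ C2_vanishing_tendsto(2)[OF F O p]], rule eventually_within_Int[OF O(2) p(2)])
      (rule Ds_linear[OF C], auto)
  show "linear (\<lambda>v. F [v, w] p)"
    by (rule linear_limit[OF nt _ C2_vanishing_tendsto(2)[OF F O p]], rule eventually_within_Int[OF O(2) p(2)])
      (rule Ds_linear[OF C], auto)
  show "linear (\<lambda>w. F [v, w] p)"
    by (rule linear_limit[OF nt _ C2_vanishing_tendsto(2)[OF F O p]], rule eventually_within_Int[OF O(2) p(2)])
      (rule Ds_2_linear_right[OF C oOU], auto)
qed

text \<open>The limit gradient kills every vector tangential for \<open>\<phi>\<close>. Two linear
  forms related in this way are proportional, and any non-tangential \<open>e\<close> yields the
  factor.\<close>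

lemma C2_vanishing_gradient:
  assumes d: "defining_on \<Omega> U \<phi>" and F: "C2_vanishing \<Omega> U f F" and O: "open \<Omega>"
    and p: "p \<in> frontier \<Omega>" "p \<in> U" and e: "Ds [e] \<phi> p \<noteq> 0"
  shows "F [v] p = F [e] p / Ds [e] \<phi> p * Ds [v] \<phi> p"
proof -
  note U = defining_onD(1)[OF d]
  have C: "C_class 2 (\<Omega> \<inter> U) f" using F by (simp add: C2_vanishing_def)
  have lF: "linear (\<lambda>v. F [v] p)" by (rule C2_vanishing_linear(1)[OF F O U p])
  have l\<phi>: "linear (\<lambda>v. Ds [v] \<phi> p)" by (rule defining_onD(6)[OF d p(2)])
  have tan: "F [w] p = 0" if w: "Ds [w] \<phi> p = 0" for w
  proof (rule tangential_derivative_zero[OF d O p, where f="F []" and f'="\<lambda>g v. Ds [v] f g" and lm="\<lambda>v. F [v] p"])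
    show "continuous_on (closure \<Omega> \<inter> U) (F [])" "\<And>q. q \<in> frontier \<Omega> \<inter> U \<Longrightarrow> F [] q = 0"
      using F by (auto simp: C2_vanishing_def)
    show "(F [] has_derivative (\<lambda>v. Ds [v] f g)) (at g)" if g: "g \<in> \<Omega> \<inter> U" for g
    proof -
      have "(f has_derivative (\<lambda>v. Ds [v] f g)) (at g)" by (rule C_class_1D[OF C _ g]) simp
      then show ?thesis
        by (rule has_derivative_transform_within_open[OF _ open_Int[OF O U] g])
          (use F in \<open>simp add: C2_vanishing_def\<close>)
    qed
    show "((\<lambda>g. Ds [v] f g) \<longlongrightarrow> F [v] p) (at p within \<Omega>)" for v
      by (rule C2_vanishing_tendsto(2)[OF F O U p]) simp
  qed (rule lF, rule w)
  define c where "c = Ds [v] \<phi> p / Ds [e] \<phi> p"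
  have "Ds [v - c *\<^sub>R e] \<phi> p = 0"
    using e by (simp only: linear_diff[OF l\<phi>] linear_scale[OF l\<phi>]) (simp add: c_def)
  from tan[OF this] have "F [v] p - c * F [e] p = 0"
    by (simp only: linear_diff[OF lF] linear_scale[OF lF]) simp
  then show ?thesis by (simp add: c_def)
qed

text \<open>By proportionality of the gradients at all nearby boundary points, the 2x2 minor of
  first derivatives in the directions v and e vanishes on the boundary. Its own derivative along the
  tangential v is therefore zero as well, and this is the claimed relation of second
  derivatives.\<close>

lemma C2_vanishing_second_order:
  assumes d: "defining_on \<Omega> U \<phi>" and F: "C2_vanishing \<Omega> U f F" and O: "open \<Omega>"
    and p: "p \<in> frontier \<Omega>" "p \<in> U"
  obtains a where "\<And>v. F [v] p = a * Ds [v] \<phi> p"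
    and "\<And>v. Ds [v] \<phi> p = 0 \<Longrightarrow> F [v, v] p = a * Ds [v, v] \<phi> p"
proof -
  note U = defining_onD(1)[OF d] and C\<phi> = defining_onD(2)[OF d]
  have oOU: "open (\<Omega> \<inter> U)" using O U by blast
  have C: "C_class 2 (\<Omega> \<inter> U) f" using F by (simp add: C2_vanishing_def)
  obtain e where e: "0 < Ds [e] \<phi> p" by (rule defining_on_gradient[OF d p(2)])
  define a where "a = F [e] p / Ds [e] \<phi> p"
  have grad: "F [v] p = a * Ds [v] \<phi> p" for v
    unfolding a_def by (rule C2_vanishing_gradient[OF d F O p]) (use e in simp)
  have "F [v, v] p = a * Ds [v, v] \<phi> p" if v: "Ds [v] \<phi> p = 0" for v
  proof -
    \<comment> \<open>The minor of the two gradients, with derivative \<open>W'\<close> inside and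
      limit derivative \<open>L\<close> at \<open>p\<close>. Two of the four terms of
      \<open>L v\<close> drop out because \<open>v\<close> is tangential.\<close>
    define W where "W g = F [v] g * Ds [e] \<phi> g - F [e] g * Ds [v] \<phi> g" for g
    define W' where "W' g w = (Ds [v] f g * Ds [w, e] \<phi> g + Ds [w, v] f g * Ds [e] \<phi> g)
        - (Ds [e] f g * Ds [w, v] \<phi> g + Ds [w, e] f g * Ds [v] \<phi> g)" for g w
    define L where "L w = (F [v] p * Ds [w, e] \<phi> p + F [w, v] p * Ds [e] \<phi> p)
        - (F [e] p * Ds [w, v] \<phi> p + F [w, e] p * Ds [v] \<phi> p)" for w
    have Fc: "continuous_on (closure \<Omega> \<inter> U) (F [w])" for w using F by (simp add: C2_vanishing_def)
    have \<phi>c: "continuous_on U (Ds vs \<phi>)" if "length vs \<le> 2" for vs by (rule C_class_cont[OF C\<phi> that])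
    have \<phi>t: "((\<lambda>g. Ds vs \<phi> g) \<longlongrightarrow> Ds vs \<phi> p) (at p within \<Omega>)" if "length vs \<le> 2" for vs
    proof -
      have "isCont (Ds vs \<phi>) p" using \<phi>c[OF that] U p(2) continuous_on_eq_continuous_at by blast
      then show ?thesis unfolding isCont_def by (rule tendsto_within_subset) simp
    qed
    have ft: "((\<lambda>g. Ds vs f g) \<longlongrightarrow> F vs p) (at p within \<Omega>)" if "length vs \<le> 2" for vs
      by (rule C2_vanishing_tendsto(2)[OF F O U p that])
    have lin: "linear L"
    proof -
      have "linear (\<lambda>w. Ds [w, z] \<phi> p)" for z by (rule Ds_linear[OF C\<phi> _ p(2)]) simp
      moreover have "linear (\<lambda>w. F [w, z] p)" for z by (rule C2_vanishing_linear(2)[OF F O U p])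
      ultimately show ?thesis
        unfolding L_def[abs_def] linear_iff by (simp only: real_scaleR_def) (simp add: algebra_simps)
    qed
    have "L v = 0"
    proof (rule tangential_derivative_zero[OF d O p, where f=W and f'=W' and lm=L])
      show "continuous_on (closure \<Omega> \<inter> U) W"
        unfolding W_def by (intro continuous_intros Fc continuous_on_subset[OF \<phi>c]) auto
      show "W q = 0" if "q \<in> frontier \<Omega> \<inter> U" for q
      proof -
        have q: "q \<in> frontier \<Omega>" "q \<in> U" using that by auto
        obtain z where "0 < Ds [z] \<phi> q" by (rule defining_on_gradient[OF d q(2)])
        then have z: "Ds [z] \<phi> q \<noteq> 0" by simp
        show ?thesis
          unfolding W_def C2_vanishing_gradient[OF d F O q z, of v] C2_vanishing_gradient[OF d F O q z, of e]
          by (simp only: mult_ac)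
      qed
      show "(W has_derivative W' g) (at g)" if g: "g \<in> \<Omega> \<inter> U" for g
      proof -
        have "((\<lambda>g. Ds [v] f g * Ds [e] \<phi> g - Ds [e] f g * Ds [v] \<phi> g) has_derivative W' g) (at g)"
          unfolding W'_def
          by (intro has_derivative_diff has_derivative_mult C_classD[OF C _ g] C_classD[OF C\<phi>]) (use g in simp_all)
        then show ?thesis
          by (rule has_derivative_transform_within_open[OF _ oOU g])
            (use F in \<open>simp add: W_def C2_vanishing_def\<close>)
      qed
      show "((\<lambda>g. W' g w) \<longlongrightarrow> L w) (at p within \<Omega>)" for w
        unfolding W'_def L_def by (intro tendsto_intros ft \<phi>t) simp_all
    qed (rule lin, rule v)
    then have "F [v, v] p * Ds [e] \<phi> p = F [e] p * Ds [v, v] \<phi> p"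
      unfolding L_def grad[of v] v by simp
    then show ?thesis using e by (simp add: a_def field_simps)
  qed
  then show ?thesis using grad that by blast
qed

section \<open>The curvature numerator as a tangential quadratic form\<close>

text \<open>
  The quadratic form of the numerator of the curvature is a sum of values on the tangential
  vectors \<open>N\<^sub>i X\<^sub>j - N\<^sub>j X\<^sub>i\<close>.
\<close>

lemma curvature_form_tangential:
  fixes Q :: "'a::real_vector \<Rightarrow> 'a \<Rightarrow> real" and N :: "'i::finite \<Rightarrow> real"
  assumes l: "\<And>w. linear (\<lambda>v. Q v w)" "\<And>v. linear (\<lambda>w. Q v w)"
  shows "(\<Sum>i\<in>UNIV. (N i)\<^sup>2) * (\<Sum>i\<in>UNIV. Q (h i) (h i)) - (\<Sum>i\<in>UNIV. \<Sum>j\<in>UNIV. N i * N j * Q (h i) (h j))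
    = (\<Sum>i\<in>UNIV. \<Sum>j\<in>UNIV. Q (N i *\<^sub>R h j - N j *\<^sub>R h i) (N i *\<^sub>R h j - N j *\<^sub>R h i)) / 2"
proof -
  have "Q (N i *\<^sub>R h j - N j *\<^sub>R h i) (N i *\<^sub>R h j - N j *\<^sub>R h i) =
     (N i)\<^sup>2 * Q (h j) (h j) + (N j)\<^sup>2 * Q (h i) (h i) - N j * N i * Q (h j) (h i) - N i * N j * Q (h i) (h j)" for i j
    by (simp add: linear_diff[OF l(1)] linear_diff[OF l(2)] linear_scale[OF l(1)] linear_scale[OF l(2)]
        power2_eq_square algebra_simps)
  then have "(\<Sum>i\<in>UNIV. \<Sum>j\<in>UNIV. Q (N i *\<^sub>R h j - N j *\<^sub>R h i) (N i *\<^sub>R h j - N j *\<^sub>R h i)) =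
     (\<Sum>i\<in>UNIV. \<Sum>j\<in>UNIV. (N i)\<^sup>2 * Q (h j) (h j)) + (\<Sum>i\<in>UNIV. \<Sum>j\<in>UNIV. (N j)\<^sup>2 * Q (h i) (h i))
     - (\<Sum>i\<in>UNIV. \<Sum>j\<in>UNIV. N j * N i * Q (h j) (h i)) - (\<Sum>i\<in>UNIV. \<Sum>j\<in>UNIV. N i * N j * Q (h i) (h j))"
    by (simp only: sum.distrib sum_subtractf)
  moreover have "(\<Sum>i\<in>UNIV. \<Sum>j\<in>UNIV. (N j)\<^sup>2 * Q (h i) (h i)) = (\<Sum>i\<in>UNIV. \<Sum>j\<in>UNIV. (N i)\<^sup>2 * Q (h j) (h j))"
    by (rule sum.swap)
  moreover have "(\<Sum>i\<in>UNIV. \<Sum>j\<in>UNIV. N j * N i * Q (h j) (h i)) = (\<Sum>i\<in>UNIV. \<Sum>j\<in>UNIV. N i * N j * Q (h i) (h j))"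
    by (rule sum.swap)
  moreover have "(\<Sum>i\<in>UNIV. (N i)\<^sup>2) * (\<Sum>i\<in>UNIV. Q (h i) (h i)) = (\<Sum>i\<in>UNIV. \<Sum>j\<in>UNIV. (N i)\<^sup>2 * Q (h j) (h j))"
    by (rule sum_product)
  ultimately show ?thesis by simp
qed

lemma C_class_subset: "C_class k U f \<Longrightarrow> V \<subseteq> U \<Longrightarrow> C_class k V f"
  unfolding C_class_def using continuous_on_subset by blast

lemma defining_on_subset: "defining_on \<Omega> U \<phi> \<Longrightarrow> open V \<Longrightarrow> V \<subseteq> U \<Longrightarrow> defining_on \<Omega> V \<phi>"
  unfolding defining_on_def using C_class_subset by blast

lemma defining_on_C2_vanishing:
  assumes d: "defining_on \<Omega> U \<phi>" and O: "open \<Omega>"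
  shows "C2_vanishing \<Omega> U \<phi> (\<lambda>vs. Ds vs \<phi>)"
  unfolding C2_vanishing_def
proof (intro conjI allI impI ballI)
  show "C_class 2 (\<Omega> \<inter> U) \<phi>" using C_class_subset[OF defining_onD(2)[OF d]] by blast
  show "continuous_on (closure \<Omega> \<inter> U) (Ds vs \<phi>)" if "length vs \<le> 2" for vs
    by (rule continuous_on_subset[OF C_class_cont[OF defining_onD(2)[OF d] that]]) blast
  show "Ds [] \<phi> q = 0" if "q \<in> frontier \<Omega> \<inter> U" for q
    using defining_on_frontier[OF d O, of q] that by simp
qed simp

lemma hgrad_norm_squared: "(hgrad_norm \<phi> p)\<^sup>2 = (\<Sum>i\<in>UNIV. (X i \<phi> p)\<^sup>2)"
  unfolding hgrad_norm_def by (simp add: sum_nonneg)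

text \<open>Symmetrizing removes the structure constants from \<open>X i (X j \<phi>)\<close>, and
  on the diagonal they are zero; only second derivatives in frozen frame directions remain.\<close>

lemma defining_on_hessian:
  fixes \<Omega> :: "'n::finite heis set"
  assumes d: "defining_on \<Omega> U \<phi>" and p: "p \<in> U"
  shows "hlaplace \<phi> p = (\<Sum>i\<in>UNIV. Ds [hfield i p, hfield i p] \<phi> p)"
    and "hinflaplace \<phi> p = (\<Sum>i\<in>UNIV. \<Sum>j\<in>UNIV. X i \<phi> p * X j \<phi> p * Ds [hfield i p, hfield j p] \<phi> p)"
proof -
  note XX = X_X_C_class[OF defining_onD(2,1)[OF d] p]
  have "structure_const i i = 0" for i :: "'n + 'n" using structure_const_commute[of i i] by simp
  then show "hlaplace \<phi> p = (\<Sum>i\<in>UNIV. Ds [hfield i p, hfield i p] \<phi> p)"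
    unfolding hlaplace_def XX by simp
  have "hhess \<phi> p $ i $ j = Ds [hfield i p, hfield j p] \<phi> p" for i j
    unfolding hhess_def vec_lambda_beta XX structure_const_commute[of i j]
      Ds_2_commute[OF defining_onD(2,1)[OF d] p, of "hfield j p" "hfield i p"] by simp
  then show "hinflaplace \<phi> p = (\<Sum>i\<in>UNIV. \<Sum>j\<in>UNIV. X i \<phi> p * X j \<phi> p * Ds [hfield i p, hfield j p] \<phi> p)"
    unfolding hinflaplace_def by (intro sum.cong refl) (simp only: mult_ac)
qed

text \<open>Along \<open>N i X\<^sub>j - N j X\<^sub>i\<close> the derivative of
  \<open>\<phi>\<close> is \<open>N i N j - N j N i = 0\<close>. So every summand of the form is a
  tangential second derivative, to which the common factor \<open>a\<close> applies.\<close>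

lemma C2_vanishing_curvature:
  fixes \<Omega> :: "'n::finite heis set"
  assumes d: "defining_on \<Omega> U \<phi>" and F: "C2_vanishing \<Omega> U f F" and O: "open \<Omega>"
    and p: "p \<in> frontier \<Omega>" "p \<in> U"
  obtains a where "\<And>v. F [v] p = a * Ds [v] \<phi> p"
    and "(hgrad_norm \<phi> p)\<^sup>2 * (\<Sum>i\<in>UNIV. F [hfield i p, hfield i p] p)
       - (\<Sum>i\<in>UNIV. \<Sum>j\<in>UNIV. X i \<phi> p * X j \<phi> p * F [hfield i p, hfield j p] p)
       = a * ((hgrad_norm \<phi> p)\<^sup>2 * hlaplace \<phi> p - hinflaplace \<phi> p)"
proof -
  note U = defining_onD(1)[OF d] and C\<phi> = defining_onD(2)[OF d]
  obtain a where a: "\<And>v. F [v] p = a * Ds [v] \<phi> p"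
    "\<And>v. Ds [v] \<phi> p = 0 \<Longrightarrow> F [v, v] p = a * Ds [v, v] \<phi> p"
    using C2_vanishing_second_order[OF d F O p] by blast
  define N where "N i = X i \<phi> p" for i
  define h where "h i = hfield i p" for i
  have N: "N i = Ds [h i] \<phi> p" for i
    using X_C_class(1)[OF C\<phi> _ p(2), of i] by (simp add: N_def h_def)
  have l\<phi>: "linear (\<lambda>v. Ds [v] \<phi> p)" by (rule defining_onD(6)[OF d p(2)])
  have l1: "linear (\<lambda>v. Ds [v, w] \<phi> p)" for w by (rule Ds_linear[OF C\<phi> _ p(2)]) simp
  have l2: "linear (\<lambda>w. Ds [v, w] \<phi> p)" for v by (rule Ds_2_linear_right[OF C\<phi> U p(2)])
  have tan: "Ds [N i *\<^sub>R h j - N j *\<^sub>R h i] \<phi> p = 0" for i j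
    by (simp only: linear_diff[OF l\<phi>] linear_scale[OF l\<phi>] N[symmetric]) simp
  define v where "v i j = N i *\<^sub>R h j - N j *\<^sub>R h i" for i j
  have "(\<Sum>i\<in>UNIV. (N i)\<^sup>2) * (\<Sum>i\<in>UNIV. F [h i, h i] p) - (\<Sum>i\<in>UNIV. \<Sum>j\<in>UNIV. N i * N j * F [h i, h j] p)
    = (\<Sum>i\<in>UNIV. \<Sum>j\<in>UNIV. F [v i j, v i j] p) / 2"
    unfolding v_def by (rule curvature_form_tangential[where Q="\<lambda>v w. F [v, w] p" and N=N and h=h, OF C2_vanishing_linear(2,3)[OF F O U p]])
  also have "\<dots> = a * ((\<Sum>i\<in>UNIV. \<Sum>j\<in>UNIV. Ds [v i j, v i j] \<phi> p) / 2)"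
    using a(2)[OF tan] by (simp only: v_def[symmetric] sum_distrib_left[symmetric] times_divide_eq_right)
  also have "(\<Sum>i\<in>UNIV. \<Sum>j\<in>UNIV. Ds [v i j, v i j] \<phi> p) / 2 =
     (\<Sum>i\<in>UNIV. (N i)\<^sup>2) * (\<Sum>i\<in>UNIV. Ds [h i, h i] \<phi> p) - (\<Sum>i\<in>UNIV. \<Sum>j\<in>UNIV. N i * N j * Ds [h i, h j] \<phi> p)"
    unfolding v_def by (rule curvature_form_tangential[where Q="\<lambda>v w. Ds [v, w] \<phi> p" and N=N and h=h, OF l1 l2, symmetric])
  finally show ?thesis
    using that[OF a(1)] unfolding hgrad_norm_squared defining_on_hessian[OF d p(2)] N_def h_def by blast
qed

text \<open>A second defining function vanishes on the boundary and so inherits the factor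
  \<open>a\<close> in gradient and tangential Hessian. The curvature numerator then scales with
  \<open>a ^ 3\<close>, as does the cube of the gradient norm; a positive sign of \<open>a\<close>
  makes the quotient invariant.\<close>

lemma defining_on_proportional:
  fixes \<Omega> :: "'n::finite heis set"
  assumes d: "defining_on \<Omega> U \<phi>" and d': "defining_on \<Omega> U' \<phi>'" and O: "open \<Omega>"
    and p: "p \<in> frontier \<Omega>" "p \<in> U" "p \<in> U'"
  obtains a where "0 < a" "\<And>v. Ds [v] \<phi>' p = a * Ds [v] \<phi> p" "hcurv_expr \<phi>' p = hcurv_expr \<phi> p"
proof -
  define V where "V = U \<inter> U'"
  have oV: "open V" and pV: "p \<in> V" using defining_onD(1)[OF d] defining_onD(1)[OF d'] p by (auto simp: V_def)
  have dV: "defining_on \<Omega> V \<phi>" "defining_on \<Omega> V \<phi>'"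
    using defining_on_subset[OF d oV] defining_on_subset[OF d' oV] by (auto simp: V_def)
  obtain a where a: "\<And>v. Ds [v] \<phi>' p = a * Ds [v] \<phi> p"
    and curv: "(hgrad_norm \<phi> p)\<^sup>2 * (\<Sum>i\<in>UNIV. Ds [hfield i p, hfield i p] \<phi>' p)
       - (\<Sum>i\<in>UNIV. \<Sum>j\<in>UNIV. X i \<phi> p * X j \<phi> p * Ds [hfield i p, hfield j p] \<phi>' p)
       = a * ((hgrad_norm \<phi> p)\<^sup>2 * hlaplace \<phi> p - hinflaplace \<phi> p)"
    by (rule C2_vanishing_curvature[OF dV(1) defining_on_C2_vanishing[OF dV(2) O] O p(1) pV]) blast
  obtain e where e: "0 < Ds [e] \<phi> p" by (rule defining_on_gradient[OF d p(2)])
  \<comment> \<open>If \<open>a\<close> were negative, then along \<open>-e\<close> one function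
    would decrease and the other increase from zero, so nearby points would lie both inside and
    outside the domain.\<close>
  have a0: "a > 0"
  proof (rule ccontr)
    assume "\<not> 0 < a"
    obtain e' where "0 < Ds [e'] \<phi>' p" by (rule defining_on_gradient[OF d' p(3)])
    then have "a \<noteq> 0" unfolding a by auto
    then have neg: "a < 0" using \<open>\<not> 0 < a\<close> by simp
    have m: "Ds [- e] \<phi> p = - Ds [e] \<phi> p" by (rule linear_neg[OF defining_onD(6)[OF d p(2)]])
    have der: "((\<lambda>s. f (p + s *\<^sub>R (- e))) has_real_derivative Ds [- e] f p) (at 0)"
      if "defining_on \<Omega> V f" for f
      using has_derivative_dalong[OF defining_onD(5)[OF that pV], of "\<lambda>_. - e"] by (simp add: dalong_def)
    have z: "\<phi> p = 0" "\<phi>' p = 0" using defining_on_frontier[OF dV(1) O p(1) pV] defining_on_frontier[OF dV(2) O p(1) pV] .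
    have "Ds [- e] \<phi> p < 0" unfolding m using e by simp
    then obtain s1 where s1: "s1 > 0" "\<And>s. 0 < s \<Longrightarrow> s < s1 \<Longrightarrow> \<phi> (p + s *\<^sub>R (- e)) < 0"
      using DERIV_neg_dec_right[OF der[OF dV(1)]] z by auto
    have "Ds [- e] \<phi>' p > 0" unfolding a m using e neg by (simp add: mult_neg_pos)
    then obtain s2 where s2: "s2 > 0" "\<And>s. 0 < s \<Longrightarrow> s < s2 \<Longrightarrow> \<phi>' (p + s *\<^sub>R (- e)) > 0"
      using DERIV_pos_inc_right[OF der[OF dV(2)]] z by auto
    have "((\<lambda>s. p + s *\<^sub>R (- e)) \<longlongrightarrow> p + 0 *\<^sub>R (- e)) (at_right 0)" by (intro tendsto_intros)
    then have "\<forall>\<^sub>F s in at_right 0. p + s *\<^sub>R (- e) \<in> V"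
      using topological_tendstoD[of _ "p + 0 *\<^sub>R (- e)" "at_right 0" V] oV pV by simp
    moreover have "\<forall>\<^sub>F s in at_right (0::real). 0 < s \<and> s < s1 \<and> s < s2"
      using s1(1) s2(1) by (auto simp: eventually_at_right[of 0 "min s1 s2"] intro!: exI[of _ "min s1 s2"])
    ultimately have "\<forall>\<^sub>F s in at_right (0::real). False"
    proof eventually_elim
      case (elim s)
      then have "\<phi> (p + s *\<^sub>R (- e)) < 0" "\<phi>' (p + s *\<^sub>R (- e)) > 0" using s1(2)[of s] s2(2)[of s] by auto
      then show False
        using defining_onD(3)[OF dV(1), of "p + s *\<^sub>R (- e)"] defining_onD(3)[OF dV(2), of "p + s *\<^sub>R (- e)"] elim by auto
    qed
    then show False by simp
  qed
  have Xa: "X i \<phi>' p = a * X i \<phi> p" for i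
    using a[of "hfield i p"] X_C_class(1)[OF defining_onD(2)[OF d] _ p(2), of i]
      X_C_class(1)[OF defining_onD(2)[OF d'] _ p(3), of i] by simp
  have hn: "hgrad_norm \<phi>' p = a * hgrad_norm \<phi> p"
    unfolding hgrad_norm_def Xa power_mult_distrib sum_distrib_left[symmetric] real_sqrt_mult using a0 by simp
  \<comment> \<open>Here the gradient factors contribute \<open>a\<^sup>2\<close>; the third power
    comes from the Hessian through \<open>curv\<close>.\<close>
  have "(hgrad_norm \<phi>' p)\<^sup>2 * hlaplace \<phi>' p - hinflaplace \<phi>' p =
     a\<^sup>2 * ((hgrad_norm \<phi> p)\<^sup>2 * (\<Sum>i\<in>UNIV. Ds [hfield i p, hfield i p] \<phi>' p)
       - (\<Sum>i\<in>UNIV. \<Sum>j\<in>UNIV. X i \<phi> p * X j \<phi> p * Ds [hfield i p, hfield j p] \<phi>' p))"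
  proof -
    have "(\<Sum>i\<in>UNIV. \<Sum>j\<in>UNIV. (a * X i \<phi> p) * (a * X j \<phi> p) * Ds [hfield i p, hfield j p] \<phi>' p) =
       a\<^sup>2 * (\<Sum>i\<in>UNIV. \<Sum>j\<in>UNIV. X i \<phi> p * X j \<phi> p * Ds [hfield i p, hfield j p] \<phi>' p)"
      unfolding sum_distrib_left by (intro sum.cong refl) (simp only: power2_eq_square mult_ac)
    then show ?thesis
      unfolding hn defining_on_hessian[OF d' p(3)] Xa power_mult_distrib by (simp only: right_diff_distrib mult.assoc)
  qed
  also have "\<dots> = a ^ 3 * ((hgrad_norm \<phi> p)\<^sup>2 * hlaplace \<phi> p - hinflaplace \<phi> p)"
    unfolding curv by (simp only: power2_eq_square power3_eq_cube mult.assoc)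
  finally have "hcurv_expr \<phi>' p = hcurv_expr \<phi> p"
    unfolding hcurv_expr_def hn power_mult_distrib using a0 by simp
  then show ?thesis using that a0 a by blast
qed

section \<open>Normal, angle function and curvature from an arbitrary defining function\<close>

definition riem_grad_norm :: "('n::finite heis \<Rightarrow> real) \<Rightarrow> 'n heis \<Rightarrow> real" where
  "riem_grad_norm \<phi> g = sqrt ((\<Sum>i\<in>UNIV. (X i \<phi> g)\<^sup>2) + (T \<phi> g)\<^sup>2)"

lemma riem_commute: "riem g v w = riem g w v"
  by (simp add: riem_def inner_commute mult.commute)

lemma riem_grad_hfield: "riem g (riem_grad \<phi> g) (hfield i g) = X i \<phi> g"
  unfolding riem_grad_def
  by (simp add: riem_add_left riem_sum_left riem_scaleR_left riem_hfield_hfield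
      riem_commute[of g "tfield g"] riem_hfield_tfield if_distrib cong: if_cong)

lemma riem_grad_tfield: "riem g (riem_grad \<phi> g) (tfield g) = T \<phi> g"
  unfolding riem_grad_def
  by (simp add: riem_add_left riem_sum_left riem_scaleR_left riem_hfield_tfield riem_tfield_tfield)

lemma riem_grad_self: "riem g (riem_grad \<phi> g) (riem_grad \<phi> g) = (\<Sum>i\<in>UNIV. (X i \<phi> g)\<^sup>2) + (T \<phi> g)\<^sup>2"
proof -
  have "riem g (riem_grad \<phi> g) (riem_grad \<phi> g) =
     riem g (riem_grad \<phi> g) ((\<Sum>i\<in>UNIV. X i \<phi> g *\<^sub>R hfield i g) + T \<phi> g *\<^sub>R tfield g)"
    by (simp only: riem_grad_def)
  also have "\<dots> = (\<Sum>i\<in>UNIV. (X i \<phi> g)\<^sup>2) + (T \<phi> g)\<^sup>2"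
    by (simp add: riem_add_right riem_sum_right riem_scaleR_right riem_grad_hfield riem_grad_tfield power2_eq_square)
  finally show ?thesis .
qed

lemma riem_grad_norm_pos:
  assumes "riem_grad \<phi> g \<noteq> 0"
  shows "0 < riem_grad_norm \<phi> g"
proof -
  have "(\<Sum>i\<in>UNIV. (X i \<phi> g)\<^sup>2) + (T \<phi> g)\<^sup>2 \<noteq> 0"
  proof
    assume z: "(\<Sum>i\<in>UNIV. (X i \<phi> g)\<^sup>2) + (T \<phi> g)\<^sup>2 = 0"
    have nn: "0 \<le> (\<Sum>i\<in>UNIV. (X i \<phi> g)\<^sup>2)" by (intro sum_nonneg) simp
    then have "(\<Sum>i\<in>UNIV. (X i \<phi> g)\<^sup>2) = 0" "T \<phi> g = 0"
      using z by (simp_all add: add_nonneg_eq_0_iff)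
    then have "X i \<phi> g = 0" for i by (simp add: sum_nonneg_eq_0_iff)
    then show False using assms \<open>T \<phi> g = 0\<close> by (simp add: riem_grad_def)
  qed
  moreover have "0 \<le> (\<Sum>i\<in>UNIV. (X i \<phi> g)\<^sup>2) + (T \<phi> g)\<^sup>2" by (simp add: sum_nonneg)
  ultimately show ?thesis unfolding riem_grad_norm_def by simp
qed

text \<open>\<open>local_defining\<close> is chosen anew at every point, without any continuity. Its
  gradient at \<open>p\<close> is a positive multiple of that of \<open>\<phi>\<close>, and the
  factor cancels in all three quantities, so one fixed \<open>\<phi>\<close> describes them on a
  whole neighbourhood.\<close>

lemma boundary_geometry:
  fixes \<Omega> :: "'n::finite heis set"
  assumes d: "defining_on \<Omega> U \<phi>" and O: "open \<Omega>" and p: "p \<in> frontier \<Omega>" "p \<in> U"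
  shows "riem p (outer_normal \<Omega> p) (hfield i p) = X i \<phi> p / riem_grad_norm \<phi> p"
    and "angle_fun \<Omega> p = hgrad_norm \<phi> p / riem_grad_norm \<phi> p"
    and "hcurv_expr (local_defining \<Omega> p) p = hcurv_expr \<phi> p"
proof -
  define \<phi>' where "\<phi>' = local_defining \<Omega> p"
  have "defining_function \<Omega> p \<phi>'"
    unfolding \<phi>'_def local_defining_def by (rule someI[of _ \<phi>]) (use d p in \<open>auto simp: defining_function_iff\<close>)
  then obtain U' where d': "defining_on \<Omega> U' \<phi>'" "p \<in> U'" by (auto simp: defining_function_iff)
  obtain a where a: "0 < a" "\<And>v. Ds [v] \<phi>' p = a * Ds [v] \<phi> p" "hcurv_expr \<phi>' p = hcurv_expr \<phi> p"
    using defining_on_proportional[OF d d'(1) O p d'(2)] by blast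
  show "hcurv_expr (local_defining \<Omega> p) p = hcurv_expr \<phi> p" using a(3) by (simp add: \<phi>'_def)
  have Xa: "X i \<phi>' p = a * X i \<phi> p" for i
    using a(2)[of "hfield i p"] X_C_class(1)[OF defining_onD(2)[OF d] _ p(2), of i]
      X_C_class(1)[OF defining_onD(2)[OF d'(1)] _ d'(2), of i] by simp
  have Ta: "T \<phi>' p = a * T \<phi> p"
    using a(2)[of tvec] X_C_class(2)[OF defining_onD(2)[OF d] _ p(2)]
      X_C_class(2)[OF defining_onD(2)[OF d'(1)] _ d'(2)] by simp
  have R: "riem_grad_norm \<phi>' p = a * riem_grad_norm \<phi> p"
    unfolding riem_grad_norm_def Xa Ta power_mult_distrib sum_distrib_left[symmetric]
      distrib_left[symmetric] real_sqrt_mult using a(1) by simp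
  have Rpos: "riem_grad_norm \<phi> p > 0"
    by (rule riem_grad_norm_pos) (use d p in \<open>simp add: defining_on_def\<close>)
  have sq: "sqrt (riem p (riem_grad \<phi>' p) (riem_grad \<phi>' p)) = a * riem_grad_norm \<phi> p"
    unfolding R[symmetric] by (simp only: riem_grad_self riem_grad_norm_def)
  show nu: "riem p (outer_normal \<Omega> p) (hfield i p) = X i \<phi> p / riem_grad_norm \<phi> p" for i
    unfolding outer_normal_def Let_def \<phi>'_def[symmetric] riem_scaleR_left riem_grad_hfield sq Xa using a(1) Rpos by (simp add: field_simps)
  show "angle_fun \<Omega> p = hgrad_norm \<phi> p / riem_grad_norm \<phi> p"
    unfolding angle_fun_def nu power_divide sum_divide_distrib[symmetric] real_sqrt_divide hgrad_norm_def
    using Rpos by simp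
qed

lemma hmean_curv_noncharacteristic:
  assumes d: "defining_on \<Omega> U \<phi>" and O: "open \<Omega>" and p: "p \<in> frontier \<Omega>" "p \<in> U" and n: "p \<notin> char_set \<Omega>"
  shows "hmean_curv \<Omega> p = hcurv_expr \<phi> p"
  using n boundary_geometry(3)[OF d O p] by (simp add: hmean_curv_def Let_def)

lemma char_set_iff:
  assumes d: "defining_on \<Omega> U \<phi>" and O: "open \<Omega>" and p: "p \<in> frontier \<Omega>" "p \<in> U"
  shows "p \<in> char_set \<Omega> \<longleftrightarrow> hgrad_norm \<phi> p = 0"
proof -
  have Rpos: "riem_grad_norm \<phi> p > 0"
    by (rule riem_grad_norm_pos) (use d p in \<open>simp add: defining_on_def\<close>)
  then show ?thesis using p by (simp add: char_set_def boundary_geometry(2)[OF d O p])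
qed

section \<open>Boundary graphs\<close>

lemma rank_one_update_mult:
  fixes u v y :: "real ^ 'a::finite"
  shows "(\<chi> i j. (if i = j then 1 else 0) + u $ i * v $ j) *v y = y + (v \<bullet> y) *\<^sub>R u"
proof -
  have "(\<Sum>j\<in>UNIV. ((if i = j then 1 else 0) + u $ i * v $ j) * y $ j) = y $ i + (v \<bullet> y) * u $ i" for i
  proof -
    have "(\<Sum>j\<in>UNIV. ((if i = j then 1 else 0) + u $ i * v $ j) * y $ j)
        = (\<Sum>j\<in>UNIV. (if i = j then y $ j else 0) + u $ i * (v $ j * y $ j))"
      by (intro sum.cong refl) (simp add: algebra_simps)
    also have "\<dots> = y $ i + u $ i * (v \<bullet> y)"
      by (simp add: sum.distrib inner_vec_def sum_distrib_left)
    finally show ?thesis by (simp add: mult.commute)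
  qed
  then show ?thesis by (simp add: vec_eq_iff matrix_vector_mult_def)
qed

text \<open>The matrix determinant lemma. An orthogonal \<open>Q\<close> that carries a coordinate
  axis to the direction of \<open>u\<close> conjugates the matrix into one that differs from the
  identity in a single row, whose determinant is given by Cramer's rule.\<close>

lemma det_rank_one_update:
  fixes u v :: "real ^ 'a::finite"
  shows "det (\<chi> i j. (if i = j then 1 else 0) + u $ i * v $ j) = 1 + u \<bullet> v"
proof (cases "u = 0")
  case True
  have "(\<chi> i j. (if i = j then 1 else 0) + u $ i * v $ j) = (mat 1 :: real^'a^'a)"
    using True by (simp add: mat_def vec_eq_iff)
  then show ?thesis using True by simp
next
  case False
  define n where "n = norm u"
  have n: "n > 0" using False by (simp add: n_def)
  obtain k :: 'a where True by blast
  have "norm (u /\<^sub>R n) = 1" using n by (simp add: n_def)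
  then obtain Q :: "real^'a^'a" where Q: "orthogonal_matrix Q" "Q *v (axis k 1) = u /\<^sub>R n"
    using orthogonal_matrix_exists_basis by metis
  have u: "u = n *\<^sub>R (Q *v axis k 1)" using Q(2) n by simp
  define w where "w = transpose Q *v v"
  define x where "x = axis k 1 + n *\<^sub>R w"
  \<comment> \<open>Row \<open>k\<close> is spelled out as a combination of rows of the identity to
    match \<open>cramer_lemma_transpose\<close>; the combination is just \<open>x\<close>.\<close>
  define R :: "real^'a^'a" where "R = (\<chi> i. if i = k then (\<Sum>j\<in>UNIV. x $ j *s row j (mat 1)) else row i (mat 1))"
  have row: "row i (mat 1 :: real^'a^'a) = axis i 1" for i
    by (simp add: row_def mat_def axis_def vec_eq_iff)
  have sx: "(\<Sum>j\<in>UNIV. x $ j *s row j (mat 1 :: real^'a^'a)) = x"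
    unfolding row by (rule basis_expansion)
  have R1: "R = (\<chi> i. if i = k then x else row i (mat 1))" unfolding R_def sx ..
  have R2: "R = (\<chi> i j. (if i = j then 1 else 0) + (axis k 1 :: real^'a) $ i * (n *\<^sub>R w) $ j)"
    unfolding R1 row by (auto simp: vec_eq_iff x_def axis_def)
  have Rv: "R *v y = y + (n * (w \<bullet> y)) *\<^sub>R axis k 1" for y
    unfolding R2 rank_one_update_mult by simp
  have QQ: "Q ** transpose Q = mat 1" "transpose Q ** Q = mat 1"
    using Q(1) by (simp_all add: orthogonal_matrix_def)
  have "(\<chi> i j. (if i = j then 1 else 0) + u $ i * v $ j) = Q ** R ** transpose Q"
  proof -
    have "(\<chi> i j. (if i = j then 1 else 0) + u $ i * v $ j) *v y = (Q ** R ** transpose Q) *v y" for y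
    proof -
      have "(\<chi> i j. (if i = j then 1 else 0) + u $ i * v $ j) *v y = y + (v \<bullet> y) *\<^sub>R u"
        by (rule rank_one_update_mult)
      moreover have "(Q ** R ** transpose Q) *v y = Q *v (R *v (transpose Q *v y))"
        by (simp only: matrix_vector_mul_assoc matrix_mul_assoc)
      moreover have "w \<bullet> (transpose Q *v y) = v \<bullet> y"
      proof -
        have "w \<bullet> (transpose Q *v y) = v \<bullet> (Q *v (transpose Q *v y))"
          unfolding w_def by (simp add: dot_lmul_matrix[symmetric] vector_transpose_matrix inner_commute)
        also have "Q *v (transpose Q *v y) = y"
          by (simp only: matrix_vector_mul_assoc QQ matrix_vector_mul_lid)
        finally show ?thesis .
      qed
      moreover have "Q *v (transpose Q *v y) = y"
        by (simp only: matrix_vector_mul_assoc QQ matrix_vector_mul_lid)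
      ultimately show ?thesis
        unfolding Rv u by (simp add: matrix_vector_right_distrib matrix_vector_mult_scaleR)
    qed
    then show ?thesis by (simp add: matrix_eq)
  qed
  then have "det (\<chi> i j. (if i = j then 1 else 0) + u $ i * v $ j) = det Q * det R * det (transpose Q)"
    by (simp only: det_mul)
  also have "\<dots> = det R * (det Q * det (transpose Q))" by simp
  also have "det Q * det (transpose Q) = 1"
    unfolding det_mul[symmetric] QQ by simp
  also have "det R = x $ k * det (mat 1 :: real^'a^'a)"
    unfolding R_def by (rule cramer_lemma_transpose)
  also have "x $ k * det (mat 1 :: real^'a^'a) * 1 = 1 + u \<bullet> v"
  proof -
    have "u \<bullet> v = n * ((Q *v axis k 1) \<bullet> v)" unfolding u by simp
    also have "(Q *v axis k 1) \<bullet> v = axis k 1 \<bullet> (transpose Q *v v)"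
      by (simp add: dot_lmul_matrix[symmetric] vector_transpose_matrix inner_commute)
    also have "\<dots> = w $ k" by (simp add: w_def inner_axis' )
    finally show ?thesis by (simp add: x_def axis_def)
  qed
  finally show ?thesis .
qed

text \<open>
  The Gram determinant of the tangent vectors \<open>m i + (\<dots>) T\<close> of a graph, in frame coordinates. It is
  computed directly when the tangent space projects isomorphically to the horizontal space, i.e.
  for \<open>b \<noteq> 0\<close>; the case \<open>b = 0\<close> follows by continuity.
\<close>

lemma det_gram_graph:
  fixes p \<alpha> \<kappa> :: "real ^ 'a::finite" and b \<delta> :: real
  assumes \<delta>: "\<delta> * \<delta> = 1" and D: "p \<bullet> \<alpha> + \<delta> * b \<noteq> 0"
  defines "q \<equiv> (- 1 / (p \<bullet> \<alpha> + \<delta> * b)) *\<^sub>R p"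
  defines "m \<equiv> \<lambda>i. axis i 1 + (q $ i) *\<^sub>R \<alpha>"
  defines "c \<equiv> \<lambda>i. \<delta> * q $ i - \<kappa> \<bullet> m i"
  shows "det (\<chi> i j. m i \<bullet> m j + c i * c j) =
    ((norm (p + b *\<^sub>R \<kappa>))\<^sup>2 + b\<^sup>2) / (p \<bullet> \<alpha> + \<delta> * b)\<^sup>2"
proof -
  define DD where "DD \<beta> = p \<bullet> \<alpha> + \<delta> * \<beta>" for \<beta>
  define qq where "qq \<beta> = (- 1 / DD \<beta>) *\<^sub>R p" for \<beta>
  define mm where "mm \<beta> i = axis i 1 + (qq \<beta> $ i) *\<^sub>R \<alpha>" for \<beta> i
  define cc where "cc \<beta> i = \<delta> * qq \<beta> $ i - \<kappa> \<bullet> mm \<beta> i" for \<beta> i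
  define G where "G \<beta> = (\<chi> i j. mm \<beta> i \<bullet> mm \<beta> j + cc \<beta> i * cc \<beta> j)" for \<beta>
  define R where "R \<beta> = ((norm (p + \<beta> *\<^sub>R \<kappa>))\<^sup>2 + \<beta>\<^sup>2) / (DD \<beta>)\<^sup>2" for \<beta>
  have main: "det (G \<beta>) = R \<beta>" if \<beta>: "\<beta> \<noteq> 0" and D\<beta>: "DD \<beta> \<noteq> 0" for \<beta>
  proof -
    \<comment> \<open>In the application \<open>p\<close> and \<open>b\<close> hold the derivatives
      of \<open>\<phi>\<close> along the constant horizontal vectors and \<open>T\<close>, and
      \<open>\<kappa>\<close> holds the coefficients \<open>hcoef\<close>. At
      \<open>\<beta> = b\<close>, \<open>a\<close> is then the horizontal gradient.\<close>
    define a where "a = p + \<beta> *\<^sub>R \<kappa>"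
    define M :: "real^'a^'a" where "M = (\<chi> k i. (if k = i then 1 else 0) + \<alpha> $ k * qq \<beta> $ i)"
    define N :: "real^'a^'a" where "N = (\<chi> k l. (if k = l then 1 else 0) + (a /\<^sub>R \<beta>) $ k * (a /\<^sub>R \<beta>) $ l)"
    have mM: "mm \<beta> i $ k = M $ k $ i" for i k
      by (simp add: mm_def M_def axis_def mult.commute)
    \<comment> \<open>The tangent vectors \<open>(mm, cc)\<close> are orthogonal to the frame
      gradient \<open>(a, \<beta>)\<close>. For \<open>\<beta> \<noteq> 0\<close> their vertical
      coordinate is therefore a linear function of the horizontal one, and the Gram matrix factors
      through two rank one updates of the identity.\<close>
    have ann: "a \<bullet> mm \<beta> i + \<beta> * cc \<beta> i = 0" for i
    proof -
      have "p \<bullet> mm \<beta> i = p $ i + qq \<beta> $ i * (p \<bullet> \<alpha>)"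
        by (simp add: mm_def inner_add_right inner_axis)
      moreover have "qq \<beta> $ i * DD \<beta> = - p $ i" using D\<beta> by (simp add: qq_def)
      ultimately show ?thesis
        by (simp add: a_def cc_def inner_add_left algebra_simps DD_def)
    qed
    have "G \<beta> = transpose M ** N ** M"
    proof -
      have "G \<beta> $ i $ j = (transpose M ** N ** M) $ i $ j" for i j
      proof -
        have cci: "cc \<beta> i = - ((a /\<^sub>R \<beta>) \<bullet> mm \<beta> i)" for i
          using ann[of i] \<beta> by (simp add: field_simps)
        have "(N *v y) = y + ((a /\<^sub>R \<beta>) \<bullet> y) *\<^sub>R (a /\<^sub>R \<beta>)" for y
          unfolding N_def by (rule rank_one_update_mult)
        then have Nm: "mm \<beta> i \<bullet> (N *v mm \<beta> j) = mm \<beta> i \<bullet> mm \<beta> j + ((a /\<^sub>R \<beta>) \<bullet> mm \<beta> j) * ((a /\<^sub>R \<beta>) \<bullet> mm \<beta> i)"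
          by (simp add: inner_add_right inner_commute)
        have "(transpose M ** N ** M) $ i $ j = mm \<beta> i \<bullet> (N *v mm \<beta> j)"
        proof -
          have "(transpose M ** (N ** M)) $ i $ j = (\<Sum>k\<in>UNIV. mm \<beta> i $ k * (N ** M) $ k $ j)"
            by (simp add: matrix_matrix_mult_def transpose_def mM)
          also have "\<dots> = mm \<beta> i \<bullet> (N *v mm \<beta> j)"
            by (simp add: inner_vec_def matrix_matrix_mult_def matrix_vector_mult_def mM)
          finally show ?thesis by (simp add: matrix_mul_assoc)
        qed
        then show ?thesis unfolding G_def Nm by (simp add: cci)
      qed
      then show ?thesis unfolding vec_eq_iff by blast
    qed
    then have "det (G \<beta>) = (det M)\<^sup>2 * det N"
      by (simp add: det_mul power2_eq_square)
    also have "det N = 1 + (a /\<^sub>R \<beta>) \<bullet> (a /\<^sub>R \<beta>)" unfolding N_def by (rule det_rank_one_update)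
    also have "det M = 1 + \<alpha> \<bullet> qq \<beta>" unfolding M_def by (rule det_rank_one_update)
    also have "\<alpha> \<bullet> qq \<beta> = - (p \<bullet> \<alpha>) / DD \<beta>" by (simp add: qq_def inner_commute)
    also have "1 + - (p \<bullet> \<alpha>) / DD \<beta> = \<delta> * \<beta> / DD \<beta>" 
    proof -
      have "1 + - (p \<bullet> \<alpha>) / DD \<beta> = (DD \<beta> - p \<bullet> \<alpha>) / DD \<beta>" using D\<beta> by (simp add: diff_divide_distrib)
      also have "DD \<beta> - p \<bullet> \<alpha> = \<delta> * \<beta>" by (simp add: DD_def)
      finally show ?thesis .
    qed
    also have "(\<delta> * \<beta> / DD \<beta>)\<^sup>2 * (1 + (a /\<^sub>R \<beta>) \<bullet> (a /\<^sub>R \<beta>)) = R \<beta>"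
    proof -
      have \<delta>2: "\<delta>\<^sup>2 = 1" using \<delta> by (simp add: power2_eq_square)
      have "(a /\<^sub>R \<beta>) \<bullet> (a /\<^sub>R \<beta>) = (norm a)\<^sup>2 / \<beta>\<^sup>2"
        unfolding power2_norm_eq_inner by (simp add: power2_eq_square divide_inverse)
      then have "(\<delta> * \<beta> / DD \<beta>)\<^sup>2 * (1 + (a /\<^sub>R \<beta>) \<bullet> (a /\<^sub>R \<beta>)) = \<beta>\<^sup>2 / (DD \<beta>)\<^sup>2 * (1 + (norm a)\<^sup>2 / \<beta>\<^sup>2)"
        by (simp only: power_divide power_mult_distrib \<delta>2 mult_1_left)
      also have "\<dots> = (\<beta>\<^sup>2 * (1 + (norm a)\<^sup>2 / \<beta>\<^sup>2)) / (DD \<beta>)\<^sup>2" by simp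
      also have "\<beta>\<^sup>2 * (1 + (norm a)\<^sup>2 / \<beta>\<^sup>2) = (norm a)\<^sup>2 + \<beta>\<^sup>2"
        using \<beta> by (simp add: distrib_left)
      finally show ?thesis by (simp only: R_def a_def)
    qed
    finally show ?thesis .
  qed
  have "det (G b) = R b"
  proof (cases "b = 0")
    case False
    then show ?thesis using main D by (simp add: DD_def)
  next
    case True
    have D0: "DD 0 \<noteq> 0" using D True by (simp add: DD_def)
    define S where "S = {\<beta>. DD \<beta> \<noteq> 0}"
    have cD: "continuous_on A DD" for A unfolding DD_def by (intro continuous_intros)
    have oS: "open S"
      unfolding S_def by (rule open_Collect_neq[OF cD continuous_on_const])
    have cq: "continuous_on S (\<lambda>\<beta>. qq \<beta> $ i)" for i
      unfolding qq_def by (simp, intro continuous_intros cD) (auto simp: S_def)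
    have cm: "continuous_on S (\<lambda>\<beta>. mm \<beta> i)" for i
      unfolding mm_def by (intro continuous_intros cq)
    have cc: "continuous_on S (\<lambda>\<beta>. cc \<beta> i)" for i
      unfolding cc_def by (intro continuous_intros cq cm)
    have cG: "continuous_on S (\<lambda>\<beta>. det (G \<beta>))"
      unfolding G_def by (rule continuous_on_det, simp) (intro continuous_intros cc cm)
    have cR: "continuous_on S R"
      unfolding R_def by (intro continuous_intros cD) (auto simp: S_def)
    have 0: "0 \<in> S" using D0 by (simp add: S_def)
    have tG: "((\<lambda>\<beta>. det (G \<beta>)) \<longlongrightarrow> det (G 0)) (at 0)"
      using cG 0 unfolding continuous_on_eq_continuous_at[OF oS] isCont_def by (rule bspec)
    have tR: "(R \<longlongrightarrow> R 0) (at 0)"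
      using cR 0 unfolding continuous_on_eq_continuous_at[OF oS] isCont_def by (rule bspec)
    have "\<forall>\<^sub>F \<beta> in at 0. R \<beta> = det (G \<beta>)"
      unfolding eventually_at_topological using oS 0 main by (intro exI[of _ S]) (auto simp: S_def)
    then have "((\<lambda>\<beta>. det (G \<beta>)) \<longlongrightarrow> R 0) (at 0)" by (rule Lim_transform_eventually[OF tR])
    then have "det (G 0) = R 0"
      using tendsto_unique[OF trivial_limit_at tG] by simp
    then show ?thesis using True by simp
  qed
  then show ?thesis
    unfolding G_def R_def cc_def mm_def qq_def DD_def c_def m_def q_def .
qed

section \<open>Transversal linear charts and local graphs\<close>

definition horizontal_part :: "'n::finite heis \<Rightarrow> real ^ ('n + 'n)" where
  "horizontal_part g = (\<chi> i. case i of Inl j \<Rightarrow> fst g $ j | Inr j \<Rightarrow> fst (snd g) $ j)"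

definition heis_point :: "real ^ ('n::finite + 'n) \<Rightarrow> real \<Rightarrow> 'n heis" where
  "heis_point z t = ((\<chi> j. z $ Inl j), (\<chi> j. z $ Inr j), t)"

text \<open>
  Linear coordinates of determinant \<open>\<plusminus>1\<close> whose last coordinate direction is
  \<open>heis_point \<alpha> \<delta>\<close>; near any boundary point such a direction can be chosen transversal to the boundary.
\<close>

definition chart :: "real ^ ('n::finite + 'n) \<Rightarrow> real \<Rightarrow> (real ^ ('n + 'n)) \<times> real \<Rightarrow> 'n heis" where
  "chart \<alpha> \<delta> q = heis_point (fst q + snd q *\<^sub>R \<alpha>) (\<delta> * snd q)"

definition chart_inv :: "real ^ ('n::finite + 'n) \<Rightarrow> real \<Rightarrow> 'n heis \<Rightarrow> (real ^ ('n + 'n)) \<times> real" where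
  "chart_inv \<alpha> \<delta> g = (horizontal_part g - (\<delta> * snd (snd g)) *\<^sub>R \<alpha>, \<delta> * snd (snd g))"

lemma horizontal_part_heis_point [simp]: "horizontal_part (heis_point z t) = z"
  by (simp add: horizontal_part_def heis_point_def vec_eq_iff split: sum.split)

lemma snd_heis_point [simp]: "snd (snd (heis_point z t)) = t"
  by (simp add: heis_point_def)

lemma heis_point_horizontal_part: "heis_point (horizontal_part g) (snd (snd g)) = g"
  by (cases g) (simp add: horizontal_part_def heis_point_def)

lemma chart_inverse:
  assumes "\<delta> * \<delta> = 1"
  shows "chart_inv \<alpha> \<delta> (chart \<alpha> \<delta> q) = q" "chart \<alpha> \<delta> (chart_inv \<alpha> \<delta> g) = g"
proof -
  have dd: "\<delta> * (\<delta> * r) = r" for r using assms by (metis mult.assoc mult_1_left)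
  show "chart_inv \<alpha> \<delta> (chart \<alpha> \<delta> q) = q"
    unfolding chart_def chart_inv_def horizontal_part_heis_point snd_heis_point dd by simp
  show "chart \<alpha> \<delta> (chart_inv \<alpha> \<delta> g) = g"
    unfolding chart_def chart_inv_def fst_conv snd_conv dd by (simp add: heis_point_horizontal_part)
qed

lemma linear_horizontal_part: "linear horizontal_part"
  by (rule linearI) (auto simp: horizontal_part_def vec_eq_iff split: sum.split)

lemma linear_chart: "linear (chart \<alpha> \<delta>)"
  by (rule linearI) (auto simp: chart_def heis_point_def vec_eq_iff algebra_simps)

lemma linear_chart_inv: "linear (chart_inv \<alpha> \<delta>)"
  by (rule linearI) (auto simp: chart_inv_def linear_add[OF linear_horizontal_part] linear_scale[OF linear_horizontal_part] algebra_simps)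

lemma bounded_linear_chart: "bounded_linear (chart \<alpha> \<delta>)" and bounded_linear_chart_inv: "bounded_linear (chart_inv \<alpha> \<delta>)"
  using linear_chart linear_chart_inv linear_conv_bounded_linear by blast+

lemma continuous_on_chart: "continuous_on A (chart \<alpha> \<delta>)" and continuous_on_chart_inv: "continuous_on B (chart_inv \<alpha> \<delta>)"
  by (rule linear_continuous_on[OF bounded_linear_chart] linear_continuous_on[OF bounded_linear_chart_inv])+

lemma open_chart_image:
  assumes "\<delta> * \<delta> = 1" "open A"
  shows "open (chart \<alpha> \<delta> ` A)"
proof -
  have "chart \<alpha> \<delta> ` A = chart_inv \<alpha> \<delta> -` A"
    using chart_inverse[OF assms(1), of \<alpha>] by (auto simp: image_iff) metis
  then show ?thesis using open_vimage[OF assms(2) continuous_on_chart_inv] by simp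
qed

lemma distr_heis_point: "distr lborel borel (\<lambda>q. heis_point (fst q) (snd q) :: 'a::finite heis) = lborel"
proof (rule distr_lborel_basis_bij)
  show "linear (\<lambda>q. heis_point (fst q) (snd q) :: 'a heis)"
    by (rule linearI) (auto simp: heis_point_def vec_eq_iff)
  have 1: "heis_point (axis (Inl j) 1) 0 = (axis j 1, 0, 0)" "heis_point (axis (Inr j) 1) 0 = (0, axis j 1, 0)"
    "heis_point 0 1 = (0, 0, 1)" for j :: 'a
    by (auto simp: heis_point_def vec_eq_iff axis_def)
  have 2: "horizontal_part (axis j 1, 0, 0) = axis (Inl j) 1" "horizontal_part (0, axis j 1, 0) = axis (Inr j) 1" "horizontal_part (0, 0, 1) = 0" for j :: 'a
    by (auto simp: horizontal_part_def vec_eq_iff axis_def split: sum.split)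
  have B1: "(Basis :: ((real^('a+'a)) \<times> real) set) =
      (\<lambda>j. (axis (Inl j) 1, 0)) ` UNIV \<union> (\<lambda>j. (axis (Inr j) 1, 0)) ` UNIV \<union> {(0, 1)}"
    unfolding Basis_prod_def Basis_vec_def UNIV_sum by (auto simp: image_iff)
  have B2: "(Basis :: 'a heis set) =
      (\<lambda>j. (axis j 1, 0, 0)) ` UNIV \<union> (\<lambda>j. (0, axis j 1, 0)) ` UNIV \<union> {(0, 0, 1)}"
    unfolding Basis_prod_def Basis_vec_def by (auto simp: image_iff zero_prod_def)
  show "bij_betw (\<lambda>q. heis_point (fst q) (snd q)) (Basis :: ((real^('a+'a)) \<times> real) set) (Basis :: 'a heis set)"
  proof (rule bij_betwI[where g="\<lambda>g. (horizontal_part g, snd (snd g))"])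
    show "(\<lambda>q. heis_point (fst q) (snd q)) \<in> (Basis :: ((real^('a+'a)) \<times> real) set) \<rightarrow> (Basis :: 'a heis set)"
      unfolding B1 B2 by (auto simp: 1)
    show "(\<lambda>g. (horizontal_part g, snd (snd g))) \<in> (Basis :: 'a heis set) \<rightarrow> (Basis :: ((real^('a+'a)) \<times> real) set)"
      unfolding B1 B2 by (auto simp: 2)
  qed (simp_all add: heis_point_horizontal_part)
qed

lemma nn_integral_lborel_Pair_swap:
  fixes f :: "'a::euclidean_space \<times> 'b::euclidean_space \<Rightarrow> ennreal"
  assumes [measurable]: "f \<in> borel_measurable borel"
  shows "(\<integral>\<^sup>+x. \<integral>\<^sup>+y. f (x, y) \<partial>lborel \<partial>lborel) = (\<integral>\<^sup>+y. \<integral>\<^sup>+x. f (x, y) \<partial>lborel \<partial>lborel)"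
proof -
  have "(\<lambda>(x, y). f (x, y)) \<in> borel_measurable (lborel \<Otimes>\<^sub>M lborel)"
    using assms by (simp add: lborel_prod case_prod_unfold)
  from lborel_pair.Fubini'[OF this] show ?thesis by simp
qed

text \<open>The chart is a shear along \<open>\<alpha>\<close> combined with multiplication of the
  last coordinate by \<open>\<delta>\<close>, which is 1 or -1, followed by a regrouping of
  coordinates.\<close>

lemma distr_chart:
  assumes "\<delta> * \<delta> = 1"
  shows "distr lborel borel (chart \<alpha> \<delta> :: _ \<Rightarrow> 'n::finite heis) = lborel"
proof -
  define s where "s q = (fst q + snd q *\<^sub>R \<alpha>, \<delta> * snd q)" for q :: "(real^('n+'n)) \<times> real"
  have sm [measurable]: "s \<in> borel_measurable borel"
    unfolding s_def[abs_def] by (intro borel_measurable_continuous_onI continuous_intros)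
  have hm [measurable]: "(\<lambda>q. heis_point (fst q) (snd q) :: 'n heis) \<in> borel_measurable borel"
    unfolding heis_point_def by (intro borel_measurable_continuous_onI continuous_intros)
  have "\<delta> = 1 \<or> \<delta> = - 1" using assms by (metis square_eq_1_iff)
  then have refl: "(\<integral>\<^sup>+x. F (\<delta> * x) \<partial>lborel) = (\<integral>\<^sup>+x. F x \<partial>lborel)" if [measurable]: "F \<in> borel_measurable borel"
    for F :: "real \<Rightarrow> ennreal"
  proof
    assume "\<delta> = - 1"
    then have "(\<integral>\<^sup>+x. F (\<delta> * x) \<partial>lborel) = (\<integral>\<^sup>+x. F x \<partial>distr lborel borel uminus)"
      by (subst nn_integral_distr) auto
    then show ?thesis by (simp add: lborel_distr_uminus)
  qed simp
  have "distr lborel borel s = lborel"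
  proof (rule distr_lborel_eq_lborelI[OF sm])
    fix f :: "(real^('n+'n)) \<times> real \<Rightarrow> ennreal" assume f [measurable]: "f \<in> borel_measurable borel"
    have fc: "(\<lambda>q. f (k q)) \<in> borel_measurable borel" if "continuous_on UNIV k" for k :: "'x::topological_space \<Rightarrow> _"
      using measurable_compose[OF borel_measurable_continuous_onI[OF that] f] .
    have sf: "(\<lambda>q. f (s q)) \<in> borel_measurable borel" using measurable_compose[OF sm f] .
    have "(\<integral>\<^sup>+q. f (s q) \<partial>lborel) = (\<integral>\<^sup>+z. \<integral>\<^sup>+x. f (z + x *\<^sub>R \<alpha>, \<delta> * x) \<partial>lborel \<partial>lborel)"
      by (subst nn_integral_lborel_Pair[OF sf]) (simp add: s_def)
    also have "\<dots> = (\<integral>\<^sup>+x. \<integral>\<^sup>+z. f (z + x *\<^sub>R \<alpha>, \<delta> * x) \<partial>lborel \<partial>lborel)"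
      using nn_integral_lborel_Pair_swap[OF sf] by (simp add: s_def)
    also have "\<dots> = (\<integral>\<^sup>+x. \<integral>\<^sup>+z. f (z, \<delta> * x) \<partial>lborel \<partial>lborel)"
    proof (rule nn_integral_cong)
      fix x
      show "(\<integral>\<^sup>+z. f (z + x *\<^sub>R \<alpha>, \<delta> * x) \<partial>lborel) = (\<integral>\<^sup>+z. f (z, \<delta> * x) \<partial>lborel)"
        by (rule nn_integral_lborel_translation[where f="\<lambda>z. f (z, \<delta> * x)"]) (intro fc continuous_intros)
    qed
    also have "\<dots> = (\<integral>\<^sup>+z. \<integral>\<^sup>+x. f (z, \<delta> * x) \<partial>lborel \<partial>lborel)"
    proof -
      have "(\<lambda>q. f (fst q, \<delta> * snd q)) \<in> borel_measurable borel" by (intro fc continuous_intros)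
      from nn_integral_lborel_Pair_swap[OF this] show ?thesis by simp
    qed
    also have "\<dots> = (\<integral>\<^sup>+z. \<integral>\<^sup>+x. f (z, x) \<partial>lborel \<partial>lborel)"
    proof (rule nn_integral_cong)
      fix z
      show "(\<integral>\<^sup>+x. f (z, \<delta> * x) \<partial>lborel) = (\<integral>\<^sup>+x. f (z, x) \<partial>lborel)"
        by (rule refl[where F="\<lambda>x. f (z, x)"]) (intro fc continuous_intros)
    qed
    also have "\<dots> = (\<integral>\<^sup>+q. f q \<partial>lborel)"
      by (rule nn_integral_lborel_Pair[symmetric]) (rule f)
    finally show "(\<integral>\<^sup>+q. f (s q) \<partial>lborel) = (\<integral>\<^sup>+q. f q \<partial>lborel)" .
  qed
  then have "distr lborel borel (\<lambda>q. heis_point (fst q) (snd q) :: 'n heis) =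
     distr (distr lborel borel s) borel (\<lambda>q. heis_point (fst q) (snd q))" by simp
  also have "\<dots> = distr lborel borel ((\<lambda>q. heis_point (fst q) (snd q)) \<circ> s)"
    by (rule distr_distr) simp_all
  also have "(\<lambda>q. heis_point (fst q) (snd q) :: 'n heis) \<circ> s = chart \<alpha> \<delta>"
    by (auto simp: s_def chart_def fun_eq_iff)
  finally show ?thesis by (simp add: distr_heis_point)
qed

lemma heis_point_expansion: "heis_point z t = (\<Sum>i\<in>UNIV. z $ i *\<^sub>R hfield i 0) + t *\<^sub>R tvec"
proof -
  have "(\<Sum>i\<in>UNIV. z $ i *\<^sub>R hfield i 0) =
      (\<Sum>j\<in>UNIV. z $ Inl j *\<^sub>R (axis j 1, 0, 0)) + (\<Sum>j\<in>UNIV. z $ Inr j *\<^sub>R (0, axis j 1, 0))"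
    by (simp only: sum_UNIV_Plus hfield_0)
  also have "\<dots> = ((\<chi> j. z $ Inl j), (\<chi> j. z $ Inr j), 0)"
    by (simp add: prod_eq_iff fst_sum snd_sum vec_eq_iff axis_def if_distrib cong: if_cong)
  finally show ?thesis by (simp add: heis_point_def tvec_def)
qed

lemma linear_heis_point_eq:
  fixes f :: "'n::finite heis \<Rightarrow> real"
  assumes "linear f"
  shows "f (heis_point z t) = (\<chi> i. f (hfield i 0)) \<bullet> z + t * f tvec"
  unfolding heis_point_expansion
  by (simp add: linear_add[OF assms] linear_scale[OF assms] linear_sum[OF assms] inner_vec_def mult.commute)

text \<open>If \<open>T \<phi>\<close> is nonzero at the point, the vertical direction with the
  matching sign works. Otherwise the derivative only sees horizontal components, and its own
  coefficient vector \<open>P\<close> serves as \<open>\<alpha>\<close>. In both cases the last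
  component is 1 or -1, so the chart preserves volume.\<close>

lemma transversal_direction:
  assumes d: "defining_on \<Omega> U \<phi>" and p: "p \<in> U"
  obtains \<alpha> \<delta> where "\<delta> * \<delta> = 1" "0 < Ds [heis_point \<alpha> \<delta>] \<phi> p"
proof -
  have l: "linear (\<lambda>v. Ds [v] \<phi> p)" by (rule defining_onD(6)[OF d p])
  define P where "P = (\<chi> i. Ds [hfield i 0] \<phi> p)"
  define \<tau> where "\<tau> = Ds [tvec] \<phi> p"
  have eq: "Ds [heis_point z t] \<phi> p = P \<bullet> z + t * \<tau>" for z t
    unfolding P_def \<tau>_def by (rule linear_heis_point_eq[OF l])
  show ?thesis
  proof (cases "\<tau> = 0")
    case False
    have "sgn \<tau> * sgn \<tau> = 1" using False by (auto simp: sgn_if)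
    moreover have "0 < Ds [heis_point 0 (sgn \<tau>)] \<phi> p" unfolding eq using False by (auto simp: sgn_if)
    ultimately show ?thesis by (rule that)
  next
    case True
    obtain e where "0 < Ds [e] \<phi> p" by (rule defining_on_gradient[OF d p])
    then have "0 < P \<bullet> horizontal_part e" using eq[of "horizontal_part e" "snd (snd e)"] True unfolding heis_point_horizontal_part by simp
    then have "P \<noteq> 0" by auto
    then have "0 < Ds [heis_point P 1] \<phi> p" unfolding eq using True by simp
    then show ?thesis using that[of 1 P] by simp
  qed
qed

text \<open>An implicit function theorem adapted to the chart. \<open>G\<close> increases strictly
  in the last coordinate, so the map \<open>(z, x)\<close> to \<open>(z, G (z, x))\<close> is
  injective on a compact cylinder and has a continuous inverse; \<open>h\<close> is that inverse at
  level zero, and its derivative comes from inverting the triangular derivative.\<close>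

lemma graph_chart:
  fixes \<Omega> :: "'n::finite heis set"
  assumes d: "defining_on \<Omega> U \<phi>" and O: "open \<Omega>" and p: "p \<in> frontier \<Omega>" "p \<in> U"
  obtains \<alpha> \<delta> Z c d h where "\<delta> * \<delta> = 1" "open Z"
    "p \<in> chart \<alpha> \<delta> ` (Z \<times> {c<..<d})" "chart \<alpha> \<delta> ` (Z \<times> {c<..<d}) \<subseteq> U"
    "\<And>z. z \<in> Z \<Longrightarrow> h z \<in> {c<..<d}"
    "\<And>z x. z \<in> Z \<Longrightarrow> x \<in> {c<..<d} \<Longrightarrow> chart \<alpha> \<delta> (z, x) \<in> \<Omega> \<longleftrightarrow> x < h z"
    "\<And>z x. z \<in> Z \<Longrightarrow> x \<in> {c<..<d} \<Longrightarrow> chart \<alpha> \<delta> (z, x) \<in> frontier \<Omega> \<longleftrightarrow> x = h z"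
    "\<And>z. z \<in> Z \<Longrightarrow> 0 < Ds [chart \<alpha> \<delta> (0, 1)] \<phi> (chart \<alpha> \<delta> (z, h z))"
    "\<And>z. z \<in> Z \<Longrightarrow> (h has_derivative (\<lambda>w. - Ds [chart \<alpha> \<delta> (w, 0)] \<phi> (chart \<alpha> \<delta> (z, h z)) /
        Ds [chart \<alpha> \<delta> (0, 1)] \<phi> (chart \<alpha> \<delta> (z, h z)))) (at z)"
proof -
  obtain \<alpha> \<delta> where \<delta>: "\<delta> * \<delta> = 1" and trans: "0 < Ds [heis_point \<alpha> \<delta>] \<phi> p"
    by (rule transversal_direction[OF d p(2)])
  define L where "L = (chart \<alpha> \<delta> :: _ \<Rightarrow> 'n heis)"
  define a where "a = L (0, 1)"
  have a: "a = heis_point \<alpha> \<delta>" by (simp add: a_def L_def chart_def)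
  have lL: "linear L" and blL: "bounded_linear L" and cL: "continuous_on A L" for A
    unfolding L_def by (rule linear_chart bounded_linear_chart continuous_on_chart)+
  note U = defining_onD(1)[OF d]
  define q0 where "q0 = chart_inv \<alpha> \<delta> p"
  obtain z0 x0 where q0: "q0 = (z0, x0)" by (cases q0)
  have Lq0: "L (z0, x0) = p" using chart_inverse(2)[OF \<delta>] by (simp add: q0[symmetric] q0_def L_def)
  define G where "G q = \<phi> (L q)" for q
  define E where "E q = Ds [a] \<phi> (L q)" for q
  define V where "V = L -` U"
  have oV: "open V" unfolding V_def by (rule open_vimage[OF U cL])
  have dG: "(G has_derivative (\<lambda>r. Ds [L r] \<phi> (L q))) (at q)" if "q \<in> V" for q
    unfolding G_def
    by (rule has_derivative_compose[OF bounded_linear_imp_has_derivative[OF blL] defining_onD(5)[OF d]])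
      (use that in \<open>simp add: V_def\<close>)
  have cG: "continuous_on V G" using dG has_derivative_continuous continuous_at_imp_continuous_on by blast
  have lD: "linear (\<lambda>v. Ds [v] \<phi> (L q))" if "q \<in> V" for q
    by (rule defining_onD(6)[OF d]) (use that in \<open>simp add: V_def\<close>)
  have cE: "continuous_on V E"
    unfolding E_def
    by (rule continuous_on_compose2[OF C_class_cont[OF defining_onD(2)[OF d], of "[a]"] cL]) (auto simp: V_def)
  have split: "Ds [L (w, s)] \<phi> (L q) = Ds [L (w, 0)] \<phi> (L q) + s * E q" if "q \<in> V" for w s q
  proof -
    have "L (w, s) = L ((w, 0) + s *\<^sub>R (0, 1))" by simp
    also have "\<dots> = L (w, 0) + s *\<^sub>R a" unfolding a_def by (simp only: linear_add[OF lL] linear_scale[OF lL])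
    finally show ?thesis
      unfolding E_def by (simp only: linear_add[OF lD[OF that]] linear_scale[OF lD[OF that]] real_scaleR_def)
  qed
  \<comment> \<open>The derivative in the chart direction is positive at the base point and
    continuous, hence positive on this open set.\<close>
  define W where "W = V \<inter> E -` {0<..}"
  have oW: "open W" unfolding W_def by (rule continuous_open_preimage[OF cE oV]) simp
  have "(z0, x0) \<in> W" using p(2) trans by (simp add: W_def V_def E_def Lq0 a)
  then obtain A B where AB: "open A" "open B" "(z0, x0) \<in> A \<times> B" "A \<times> B \<subseteq> W"
    by (rule open_prod_elim[OF oW])
  obtain r1 where r1: "r1 > 0" "cball z0 r1 \<subseteq> A" using AB by (meson SigmaD1 open_contains_cball)
  obtain r2 where r2: "r2 > 0" "cball x0 r2 \<subseteq> B" using AB by (meson SigmaD2 open_contains_cball)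
  define c where "c = x0 - r2"
  define d' where "d' = x0 + r2"
  define S where "S = cball z0 r1 \<times> {c..d'}"
  have SW: "S \<subseteq> W"
    using r1 r2 AB(4) cball_eq_atLeastAtMost[of x0 r2] by (auto simp: S_def c_def d'_def)
  have SV: "S \<subseteq> V" using SW by (auto simp: W_def)
  have cd: "c < x0" "x0 < d'" using r2 by (auto simp: c_def d'_def)
  have incr: "G (z, x) < G (z, y)" if z: "z \<in> cball z0 r1" and xy: "c \<le> x" "x < y" "y \<le> d'" for z x y
  proof (rule DERIV_pos_imp_increasing[OF xy(2)])
    fix t assume t: "x \<le> t" "t \<le> y"
    have tS: "(z, t) \<in> S" using z xy t by (simp add: S_def)
    have "((\<lambda>t. (z, t)) has_derivative (\<lambda>s. (0, s))) (at t)" by (auto intro!: derivative_eq_intros)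
    from has_derivative_compose[OF this dG] tS SV
    have "((\<lambda>t. G (z, t)) has_derivative (\<lambda>s. Ds [L (0, s)] \<phi> (L (z, t)))) (at t)" by blast
    moreover have "(\<lambda>s. Ds [L (0, s)] \<phi> (L (z, t))) = (*) (E (z, t))"
    proof
      fix s
      have "Ds [L (0, 0)] \<phi> (L (z, t)) = 0"
        using linear_0[OF lD[of "(z, t)"]] linear_0[OF lL] tS SV by (simp only: zero_prod_def[symmetric]) blast
      then show "Ds [L (0, s)] \<phi> (L (z, t)) = E (z, t) * s"
        using split[of "(z, t)" 0 s] tS SV by (simp add: subset_iff mult.commute del: Ds.simps)
    qed
    ultimately have "((\<lambda>t. G (z, t)) has_real_derivative E (z, t)) (at t)" by (simp add: has_field_derivative_def)
    moreover have "0 < E (z, t)" using tS SW by (auto simp: W_def)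
    ultimately show "\<exists>y. ((\<lambda>t. G (z, t)) has_real_derivative y) (at t) \<and> 0 < y" by blast
  qed
  have G0: "G (z0, x0) = 0" unfolding G_def Lq0 by (rule defining_on_frontier[OF d O p])
  \<comment> \<open>Base points whose fibre starts inside the domain and ends outside it; by strict
    monotonicity each such fibre meets the zero set exactly once.\<close>
  define Z where "Z = {z \<in> ball z0 r1. G (z, c) < 0 \<and> 0 < G (z, d')}"
  have oZ: "open Z"
  proof -
    have cGx: "continuous_on (ball z0 r1) (\<lambda>z. G (z, x))" if "x \<in> {c..d'}" for x
      by (rule continuous_on_compose2[OF cG]) (use that SV in \<open>auto intro!: continuous_intros simp: S_def\<close>)
    have "c \<in> {c..d'}" "d' \<in> {c..d'}" using cd by auto
    then have "open (ball z0 r1 \<inter> (\<lambda>z. G (z, c)) -` {..<0})" "open (ball z0 r1 \<inter> (\<lambda>z. G (z, d')) -` {0<..})"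
      using continuous_open_preimage[OF cGx, of c "{..<0}"] continuous_open_preimage[OF cGx, of d' "{0<..}"] by auto
    moreover have "Z = (ball z0 r1 \<inter> (\<lambda>z. G (z, c)) -` {..<0}) \<inter> (ball z0 r1 \<inter> (\<lambda>z. G (z, d')) -` {0<..})"
      by (auto simp: Z_def)
    ultimately show ?thesis by (simp only: open_Int)
  qed
  have z0Z: "z0 \<in> Z"
    using incr[of z0 c x0] incr[of z0 x0 d'] cd r1(1) by (simp add: Z_def G0)
  \<comment> \<open>Compactness of \<open>S\<close> is what makes the inverse of this injective map
    continuous, as differentiating the inverse requires.\<close>
  define \<Phi> where "\<Phi> q = (fst q, G q)" for q
  have inj: "inj_on \<Phi> S"
  proof (rule inj_onI)
    fix q q' assume q: "q \<in> S" "q' \<in> S" "\<Phi> q = \<Phi> q'"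
    obtain z x z' x' where qq: "q = (z, x)" "q' = (z', x')" by (cases q; cases q')
    have "z' = z" "G (z, x) = G (z, x')" using q(3) by (auto simp: \<Phi>_def qq)
    then show "q = q'" using incr[of z x x'] incr[of z x' x] q(1,2) by (cases x x' rule: linorder_cases) (auto simp: qq S_def)
  qed
  define g where "g = inv_into S \<Phi>"
  have g\<Phi>: "g (\<Phi> q) = q" if "q \<in> S" for q unfolding g_def by (rule inv_into_f_f[OF inj that])
  have c\<Phi>: "continuous_on S \<Phi>"
    unfolding \<Phi>_def by (intro continuous_intros continuous_on_subset[OF cG SV])
  have cg: "continuous_on (\<Phi> ` S) g"
    by (rule continuous_on_inv[OF c\<Phi>]) (use g\<Phi> in \<open>auto simp: S_def intro!: compact_Times\<close>)
  define h where "h z = snd (g (z, 0))" for z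
  have h: "h z \<in> {c<..<d'}" "G (z, h z) = 0" "(z, h z) \<in> S" "\<Phi> (z, h z) = (z, 0)" if z: "z \<in> Z" for z
  proof -
    have zb: "z \<in> cball z0 r1" and G: "G (z, c) < 0" "0 < G (z, d')" using z by (auto simp: Z_def)
    have "continuous_on {c..d'} (\<lambda>x. G (z, x))"
      by (rule continuous_on_compose2[OF cG]) (use zb SV in \<open>auto intro!: continuous_intros simp: S_def\<close>)
    then obtain x where x: "c \<le> x" "x \<le> d'" "G (z, x) = 0"
      using IVT'[of "\<lambda>x. G (z, x)" c 0 d'] G cd by auto
    have xS: "(z, x) \<in> S" using x zb by (simp add: S_def)
    have "\<Phi> (z, x) = (z, 0)" using x by (simp add: \<Phi>_def)
    then have hx: "h z = x" using g\<Phi>[OF xS] by (simp add: h_def)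
    have "x \<noteq> c" "x \<noteq> d'" using x(3) G by auto
    then show "h z \<in> {c<..<d'}" "G (z, h z) = 0" "(z, h z) \<in> S" "\<Phi> (z, h z) = (z, 0)"
      using x xS hx by (auto simp: \<Phi>_def)
  qed
  have sgn: "G (z, x) < 0 \<longleftrightarrow> x < h z" "G (z, x) = 0 \<longleftrightarrow> x = h z" if z: "z \<in> Z" and x: "x \<in> {c<..<d'}" for z x
  proof -
    have zb: "z \<in> cball z0 r1" using z by (auto simp: Z_def)
    show "G (z, x) < 0 \<longleftrightarrow> x < h z" "G (z, x) = 0 \<longleftrightarrow> x = h z"
      using incr[OF zb, of x "h z"] incr[OF zb, of "h z" x] h(1,2)[OF z] x
      by (cases x "h z" rule: linorder_cases; auto)+
  qed
  have LU: "L (z, x) \<in> U" if "z \<in> Z" "x \<in> {c<..<d'}" for z x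
  proof -
    have "(z, x) \<in> S" using that by (auto simp: S_def Z_def)
    then show ?thesis using SV by (auto simp: V_def)
  qed
  have inO: "L (z, x) \<in> \<Omega> \<longleftrightarrow> x < h z" if "z \<in> Z" "x \<in> {c<..<d'}" for z x
    using defining_onD(3)[OF d LU[OF that]] sgn(1)[OF that] by (simp add: G_def)
  have inF: "L (z, x) \<in> frontier \<Omega> \<longleftrightarrow> x = h z" if z: "z \<in> Z" and x: "x \<in> {c<..<d'}" for z x
  proof
    assume "L (z, x) \<in> frontier \<Omega>"
    then have "G (z, x) = 0" unfolding G_def by (rule defining_on_frontier[OF d O _ LU[OF z x]])
    then show "x = h z" using sgn(2)[OF z x] by simp
  next
    assume xh: "x = h z"
    have "L (z, x) \<notin> \<Omega>" using inO[OF z x] xh by simp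
    moreover have "L (z, x) \<in> closure \<Omega>"
    proof (rule Lim_in_closed_set[OF closed_closure])
      show "((\<lambda>y. L (z, y)) \<longlongrightarrow> L (z, x)) (at_left x)"
      proof -
        have "isCont (\<lambda>y. L (z, y)) x"
          using continuous_on_compose2[OF cL[of UNIV], of UNIV "\<lambda>y. (z, y)"]
          by (auto intro!: continuous_intros simp: continuous_on_eq_continuous_at)
        then show ?thesis unfolding isCont_def by (rule tendsto_within_subset) simp
      qed
      have "L (z, y) \<in> closure \<Omega>" if "c < y" "y < x" for y
        using inO[OF z, of y] that x xh closure_subset[of \<Omega>] by auto
      then show "\<forall>\<^sub>F y in at_left x. L (z, y) \<in> closure \<Omega>"
        using x by (auto simp: eventually_at_left[of c x])
      show "\<not> trivial_limit (at_left x)" by simp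
    qed
    ultimately show "L (z, x) \<in> frontier \<Omega>" using O by (simp add: frontier_def interior_open)
  qed
  have Epos: "0 < Ds [L (0, 1)] \<phi> (L (z, h z))" if z: "z \<in> Z" for z
    using h(3)[OF z] SW by (auto simp: W_def E_def a_def simp del: Ds.simps)
  have dh: "(h has_derivative (\<lambda>w. - Ds [L (w, 0)] \<phi> (L (z, h z)) / Ds [L (0, 1)] \<phi> (L (z, h z)))) (at z)"
    if z: "z \<in> Z" for z
  proof -
    have qS: "(z, h z) \<in> S" by (rule h(3)[OF z])
    have qV: "(z, h z) \<in> V" using qS SV by blast
    define \<Phi>' where "\<Phi>' r = (fst r, Ds [L r] \<phi> (L (z, h z)))" for r
    define e where "e = E (z, h z)"
    have e: "e > 0" using Epos[OF z] by (simp add: e_def E_def a_def del: Ds.simps)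
    define lm0 where "lm0 w = Ds [L (w, 0)] \<phi> (L (z, h z))" for w
    have l0: "linear lm0"
    proof -
      have "linear (\<lambda>w. L (w, 0))"
        using linear_compose[of "\<lambda>w. (w, 0)" L] lL by (simp add: linear_iff o_def)
      then show ?thesis using linear_compose[of "\<lambda>w. L (w, 0)" "\<lambda>v. Ds [v] \<phi> (L (z, h z))"] lD[OF qV]
        unfolding lm0_def[abs_def] o_def by blast
    qed
    \<comment> \<open>The left inverse of the triangular map \<open>(w, s)\<close> to
      \<open>(w, lm0 w + s e)\<close>.\<close>
    define g' where "g' r = (fst r, (snd r - lm0 (fst r)) / e)" for r
    have "(g has_derivative g') (at (\<Phi> (z, h z)) within \<Phi> ` S)"
    proof (rule has_derivative_inverse_within[where f'=\<Phi>'])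
      have "(\<Phi> has_derivative \<Phi>') (at (z, h z))"
        unfolding \<Phi>_def[abs_def] \<Phi>'_def[abs_def]
        by (intro has_derivative_Pair dG[OF qV] bounded_linear_imp_has_derivative[OF bounded_linear_fst])
      then show "(\<Phi> has_derivative \<Phi>') (at (z, h z) within S)" by (rule has_derivative_at_withinI)
      show "continuous (at (\<Phi> (z, h z)) within \<Phi> ` S) g"
        using cg qS unfolding continuous_on_eq_continuous_within by blast
      show "linear g'"
        unfolding g'_def[abs_def] linear_iff
        by (auto simp: linear_add[OF l0] linear_scale[OF l0] diff_divide_distrib add_divide_distrib algebra_simps)
      show "g' \<circ> \<Phi>' = id"
      proof
        fix r :: "(real^('n+'n)) \<times> real"
        obtain w s where r: "r = (w, s)" by (cases r)
        have "Ds [L (w, s)] \<phi> (L (z, h z)) = lm0 w + s * e"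
          unfolding lm0_def e_def by (rule split[OF qV])
        then show "(g' \<circ> \<Phi>') r = id r" using e by (simp add: g'_def \<Phi>'_def r del: Ds.simps)
      qed
    qed (use qS g\<Phi> in auto)
    then have 1: "(g has_derivative g') (at (z, 0) within (\<lambda>z. (z, 0)) ` Z)"
      unfolding h(4)[OF z] by (rule has_derivative_subset) (use h(3,4) in force)
    have 2: "((\<lambda>z. (z, 0)) has_derivative (\<lambda>w. (w, 0))) (at z within Z)" by (auto intro!: derivative_eq_intros)
    have "((\<lambda>z. g (z, 0)) has_derivative (\<lambda>w. g' (w, 0))) (at z within Z)"
      using diff_chain_within[OF 2 1] by (simp add: o_def)
    then have "(h has_derivative (\<lambda>w. snd (g' (w, 0)))) (at z within Z)"
      unfolding h_def[abs_def] by (rule has_derivative_snd)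
    then have "(h has_derivative (\<lambda>w. snd (g' (w, 0)))) (at z)"
      using at_within_open[OF z oZ] by simp
    then show ?thesis by (simp add: g'_def lm0_def e_def E_def a_def del: Ds.simps)
  qed
  show ?thesis
  proof (rule that[of \<delta> Z \<alpha> c d' h, OF \<delta> oZ])
    show "p \<in> chart \<alpha> \<delta> ` (Z \<times> {c<..<d'})" using z0Z cd Lq0 by (force simp: L_def image_iff)
    show "chart \<alpha> \<delta> ` (Z \<times> {c<..<d'}) \<subseteq> U" using LU by (auto simp: L_def)
  qed (use h(1) inO inF Epos dh in \<open>simp_all add: L_def del: Ds.simps\<close>)
qed

text \<open>The conclusions of \<open>graph_chart\<close> packaged as one predicate, so that a
  compact set can be said to lie in some patch.\<close>

definition graph_patch ::
  "'n::finite heis set \<Rightarrow> 'n heis set \<Rightarrow> ('n heis \<Rightarrow> real) \<Rightarrow> real ^ ('n + 'n) \<Rightarrow> real \<Rightarrow>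
   (real ^ ('n + 'n)) set \<Rightarrow> real \<Rightarrow> real \<Rightarrow> (real ^ ('n + 'n) \<Rightarrow> real) \<Rightarrow> bool" where
  "graph_patch \<Omega> U \<phi> \<alpha> \<delta> Z c d h \<longleftrightarrow> defining_on \<Omega> U \<phi> \<and> \<delta> * \<delta> = 1 \<and> open Z \<and>
    chart \<alpha> \<delta> ` (Z \<times> {c<..<d}) \<subseteq> U \<and>
    (\<forall>z\<in>Z. h z \<in> {c<..<d} \<and>
      (\<forall>x\<in>{c<..<d}. (chart \<alpha> \<delta> (z, x) \<in> \<Omega> \<longleftrightarrow> x < h z) \<and> (chart \<alpha> \<delta> (z, x) \<in> frontier \<Omega> \<longleftrightarrow> x = h z)) \<and>
      0 < Ds [chart \<alpha> \<delta> (0, 1)] \<phi> (chart \<alpha> \<delta> (z, h z)) \<and>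
      (h has_derivative (\<lambda>w. - Ds [chart \<alpha> \<delta> (w, 0)] \<phi> (chart \<alpha> \<delta> (z, h z)) /
        Ds [chart \<alpha> \<delta> (0, 1)] \<phi> (chart \<alpha> \<delta> (z, h z)))) (at z))"

lemma graph_patch_exists:
  fixes \<Omega> :: "'n::finite heis set"
  assumes d: "defining_on \<Omega> U \<phi>" and O: "open \<Omega>" and p: "p \<in> frontier \<Omega>" "p \<in> U"
  obtains \<alpha> \<delta> Z c d h where "graph_patch \<Omega> U \<phi> \<alpha> \<delta> Z c d h" "p \<in> chart \<alpha> \<delta> ` (Z \<times> {c<..<d})"
proof (rule graph_chart[OF d O p])
  fix \<alpha> \<delta> Z c d' h
  assume *: "\<delta> * \<delta> = 1" "open Z" "p \<in> chart \<alpha> \<delta> ` (Z \<times> {c<..<d'})" "chart \<alpha> \<delta> ` (Z \<times> {c<..<d'}) \<subseteq> U"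
    "\<And>z. z \<in> Z \<Longrightarrow> h z \<in> {c<..<d'}"
    "\<And>z x. z \<in> Z \<Longrightarrow> x \<in> {c<..<d'} \<Longrightarrow> chart \<alpha> \<delta> (z, x) \<in> \<Omega> \<longleftrightarrow> x < h z"
    "\<And>z x. z \<in> Z \<Longrightarrow> x \<in> {c<..<d'} \<Longrightarrow> chart \<alpha> \<delta> (z, x) \<in> frontier \<Omega> \<longleftrightarrow> x = h z"
    "\<And>z. z \<in> Z \<Longrightarrow> 0 < Ds [chart \<alpha> \<delta> (0, 1)] \<phi> (chart \<alpha> \<delta> (z, h z))"
    "\<And>z. z \<in> Z \<Longrightarrow> (h has_derivative (\<lambda>w. - Ds [chart \<alpha> \<delta> (w, 0)] \<phi> (chart \<alpha> \<delta> (z, h z)) /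
        Ds [chart \<alpha> \<delta> (0, 1)] \<phi> (chart \<alpha> \<delta> (z, h z)))) (at z)"
  have "graph_patch \<Omega> U \<phi> \<alpha> \<delta> Z c d' h"
    unfolding graph_patch_def by (intro conjI ballI d) (use * in \<open>simp_all del: Ds.simps\<close>)
  then show thesis using *(3) that by blast
qed

section \<open>The boundary in a patch: parametrization and area element\<close>

context
  fixes \<Omega> U :: "'n::finite heis set" and \<phi> \<alpha> \<delta> Z c d h
  assumes patch: "graph_patch \<Omega> U \<phi> \<alpha> \<delta> Z c d h"
begin

lemma graph_patchD:
  shows "defining_on \<Omega> U \<phi>" "\<delta> * \<delta> = 1" "open Z" "chart \<alpha> \<delta> ` (Z \<times> {c<..<d}) \<subseteq> U"
    "\<And>z. z \<in> Z \<Longrightarrow> h z \<in> {c<..<d}"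
    "\<And>z x. z \<in> Z \<Longrightarrow> x \<in> {c<..<d} \<Longrightarrow> chart \<alpha> \<delta> (z, x) \<in> \<Omega> \<longleftrightarrow> x < h z"
    "\<And>z x. z \<in> Z \<Longrightarrow> x \<in> {c<..<d} \<Longrightarrow> chart \<alpha> \<delta> (z, x) \<in> frontier \<Omega> \<longleftrightarrow> x = h z"
    "\<And>z. z \<in> Z \<Longrightarrow> 0 < Ds [chart \<alpha> \<delta> (0, 1)] \<phi> (chart \<alpha> \<delta> (z, h z))"
    "\<And>z. z \<in> Z \<Longrightarrow> (h has_derivative (\<lambda>w. - Ds [chart \<alpha> \<delta> (w, 0)] \<phi> (chart \<alpha> \<delta> (z, h z)) /
        Ds [chart \<alpha> \<delta> (0, 1)] \<phi> (chart \<alpha> \<delta> (z, h z)))) (at z)"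
  using patch unfolding graph_patch_def by blast+

definition patch_point :: "real ^ ('n + 'n) \<Rightarrow> 'n heis" where
  "patch_point z = chart \<alpha> \<delta> (z, h z)"

definition patch_slope :: "'n heis \<Rightarrow> real" where
  "patch_slope g = Ds [chart \<alpha> \<delta> (0, 1)] \<phi> g"

definition height_deriv :: "real ^ ('n + 'n) \<Rightarrow> real ^ ('n + 'n) \<Rightarrow> real" where
  "height_deriv z w = - Ds [chart \<alpha> \<delta> (w, 0)] \<phi> (patch_point z) / patch_slope (patch_point z)"

lemma height_has_derivative: "z \<in> Z \<Longrightarrow> (h has_derivative height_deriv z) (at z)"
  using graph_patchD(9) by (simp only: height_deriv_def[abs_def] patch_point_def patch_slope_def)

lemma patch_slope_pos: "z \<in> Z \<Longrightarrow> 0 < patch_slope (patch_point z)"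
  using graph_patchD(8) by (simp only: patch_point_def patch_slope_def)

lemma patch_point_in: "z \<in> Z \<Longrightarrow> patch_point z \<in> chart \<alpha> \<delta> ` (Z \<times> {c<..<d})" "z \<in> Z \<Longrightarrow> patch_point z \<in> U"
  "z \<in> Z \<Longrightarrow> patch_point z \<in> frontier \<Omega>"
  using graph_patchD(4,5,7) by (auto simp: patch_point_def)

lemma patch_point_has_derivative:
  assumes z: "z \<in> Z"
  shows "(patch_point has_derivative (\<lambda>w. chart \<alpha> \<delta> (w, height_deriv z w))) (at z)"
proof -
  have "((\<lambda>z. (z, h z)) has_derivative (\<lambda>w. (w, height_deriv z w))) (at z)"
    by (intro has_derivative_Pair height_has_derivative[OF z] has_derivative_ident)
  from has_derivative_compose[OF this bounded_linear_imp_has_derivative[OF bounded_linear_chart]]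
  show ?thesis unfolding patch_point_def[abs_def] .
qed

lemma continuous_on_height: "continuous_on Z h"
  using height_has_derivative has_derivative_continuous continuous_at_imp_continuous_on by blast

lemma continuous_on_patch_point: "continuous_on Z patch_point"
  using patch_point_has_derivative has_derivative_continuous continuous_at_imp_continuous_on by blast

lemma continuous_on_height_deriv: "continuous_on Z (\<lambda>z. height_deriv z w)"
proof -
  have c: "continuous_on Z (\<lambda>z. Ds [v] \<phi> (patch_point z))" for v
    by (rule continuous_on_compose2[OF C_class_cont[OF defining_onD(2)[OF graph_patchD(1)], of "[v]"]
       continuous_on_patch_point]) (use patch_point_in(2) in auto)
  have "patch_slope (patch_point z) \<noteq> 0" if "z \<in> Z" for z using patch_slope_pos[OF that] by simp
  then show ?thesis
    unfolding height_deriv_def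
    by (intro continuous_on_divide continuous_on_minus c) (simp_all only: patch_slope_def c ball_simps, blast)
qed

lemma patch_image: "patch_point ` Z = frontier \<Omega> \<inter> chart \<alpha> \<delta> ` (Z \<times> {c<..<d})"
proof
  show "patch_point ` Z \<subseteq> frontier \<Omega> \<inter> chart \<alpha> \<delta> ` (Z \<times> {c<..<d})" using patch_point_in by blast
  show "frontier \<Omega> \<inter> chart \<alpha> \<delta> ` (Z \<times> {c<..<d}) \<subseteq> patch_point ` Z"
    using graph_patchD(7) by (auto simp: patch_point_def)
qed

lemma open_patch: "open (chart \<alpha> \<delta> ` (Z \<times> {c<..<d}))"
  by (rule open_chart_image[OF graph_patchD(2)]) (intro open_Times graph_patchD(3) open_greaterThanLessThan)

lemma patch_parametrization: "parametrization (frontier \<Omega>) Z patch_point"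
  unfolding parametrization_def
proof (intro conjI ballI)
  show "open Z" by (rule graph_patchD(3))
  have fd: "frechet_derivative patch_point (at z) = (\<lambda>w. chart \<alpha> \<delta> (w, height_deriv z w))" if "z \<in> Z" for z
    using frechet_derivative_at[OF patch_point_has_derivative[OF that]] by simp
  show "C_class 1 Z patch_point"
    unfolding C_class_def
  proof (intro conjI allI impI ballI)
    show "Ds vs patch_point differentiable at z" if "length vs < 1" "z \<in> Z" for vs z
      using that patch_point_has_derivative by (auto simp: differentiable_def)
    show "continuous_on Z (Ds vs patch_point)" if vs: "length vs \<le> 1" for vs
    proof (cases vs)
      case Nil
      then show ?thesis using continuous_on_patch_point by simp
    next
      case (Cons v vs')
      then have "vs = [v]" using vs by simp
      moreover have "continuous_on Z (\<lambda>z. chart \<alpha> \<delta> (v, height_deriv z v))"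
        by (rule continuous_on_compose2[OF continuous_on_chart[of UNIV]]) (auto intro!: continuous_intros continuous_on_height_deriv)
      ultimately show ?thesis using fd by (simp cong: continuous_on_cong)
    qed
  qed
  show "inj (frechet_derivative patch_point (at z))" if "z \<in> Z" for z
    unfolding fd[OF that] inj_def using chart_inverse(1)[OF graph_patchD(2)] by (metis prod.inject)
  show "openin (top_of_set (frontier \<Omega>)) (patch_point ` Z)"
    unfolding patch_image using open_patch by (rule openin_open_Int)
  show "\<exists>\<theta>. homeomorphism Z (patch_point ` Z) patch_point \<theta>"
  proof (rule exI[of _ "\<lambda>g. fst (chart_inv \<alpha> \<delta> g)"], rule homeomorphismI)
    show "continuous_on Z patch_point" by (rule continuous_on_patch_point)
    show "continuous_on (patch_point ` Z) (\<lambda>g. fst (chart_inv \<alpha> \<delta> g))"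
      by (intro continuous_intros continuous_on_chart_inv)
    have "fst (chart_inv \<alpha> \<delta> (patch_point z)) = z" for z
      unfolding patch_point_def chart_inverse(1)[OF graph_patchD(2)] by simp
    then show "(\<lambda>g. fst (chart_inv \<alpha> \<delta> g)) ` (patch_point ` Z) \<subseteq> Z"
      "\<And>z. z \<in> Z \<Longrightarrow> fst (chart_inv \<alpha> \<delta> (patch_point z)) = z"
      "\<And>g. g \<in> patch_point ` Z \<Longrightarrow> patch_point (fst (chart_inv \<alpha> \<delta> g)) = g" by auto
  qed simp
qed

lemma riem_heis_point:
  "riem g (heis_point z t) (heis_point z' t') = z \<bullet> z' + (t - (\<chi> i. hcoef i g) \<bullet> z) * (t' - (\<chi> i. hcoef i g) \<bullet> z')"
proof -
  obtain x y s where g: "g = (x, y, s)" by (cases g)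
  have "hcontact g (heis_point z t) = t - (\<chi> i. hcoef i g) \<bullet> z" for z t
    by (simp add: hcontact_eq heis_point_def g inner_vec_def sum_UNIV_Plus sum_divide_distrib sum_negf
        diff_divide_distrib)
  then show ?thesis
    unfolding riem_def by (simp add: heis_point_def inner_vec_def sum_UNIV_Plus)
qed

text \<open>The area element of a graph is the length of the gradient divided by the derivative in
  the graph direction. In \<open>det_gram_graph\<close> the sum \<open>P + b \<kappa>\<close> is the
  horizontal gradient of \<open>\<phi>\<close> and \<open>b\<close> is
  \<open>T \<phi>\<close>.\<close>

lemma patch_area:
  assumes z: "z \<in> Z"
  shows "sqrt (det (riem_gram patch_point z)) = riem_grad_norm \<phi> (patch_point z) / patch_slope (patch_point z)"
proof -
  define g where "g = patch_point z"
  have gU: "g \<in> U" using patch_point_in(2)[OF z] by (simp add: g_def)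
  note dU = graph_patchD(1)
  have l: "linear (\<lambda>v. Ds [v] \<phi> g)" by (rule defining_onD(6)[OF dU gU])
  define P where "P = (\<chi> i. Ds [hfield i 0] \<phi> g)"
  define b where "b = Ds [tvec] \<phi> g"
  define \<kappa> where "\<kappa> = (\<chi> i. hcoef i g)"
  have eq: "Ds [heis_point w t] \<phi> g = P \<bullet> w + t * b" for w t
    unfolding P_def b_def by (rule linear_heis_point_eq[OF l])
  have D: "patch_slope g = P \<bullet> \<alpha> + \<delta> * b"
    unfolding patch_slope_def chart_def by (simp add: eq del: Ds.simps)
  have Dpos: "0 < patch_slope g" using patch_slope_pos[OF z] by (simp add: g_def)
  define q where "q = (- 1 / (P \<bullet> \<alpha> + \<delta> * b)) *\<^sub>R P"
  define m where "m i = axis i 1 + (q $ i) *\<^sub>R \<alpha>" for i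
  have hd: "height_deriv z (axis i 1) = q $ i" for i
    unfolding height_deriv_def g_def[symmetric] D chart_def
    by (simp add: eq q_def inner_axis del: Ds.simps)
  have fd: "frechet_derivative patch_point (at z) (axis i 1) = heis_point (m i) (\<delta> * q $ i)" for i
    unfolding frechet_derivative_at[OF patch_point_has_derivative[OF z], symmetric] hd
    by (simp add: chart_def m_def)
  have "riem_gram patch_point z = (\<chi> i j. m i \<bullet> m j + (\<delta> * q $ i - \<kappa> \<bullet> m i) * (\<delta> * q $ j - \<kappa> \<bullet> m j))"
    unfolding riem_gram_def g_def[symmetric] fd riem_heis_point \<kappa>_def ..
  also have "det \<dots> = ((norm (P + b *\<^sub>R \<kappa>))\<^sup>2 + b\<^sup>2) / (P \<bullet> \<alpha> + \<delta> * b)\<^sup>2"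
    unfolding m_def q_def by (rule det_gram_graph[OF graph_patchD(2)]) (use Dpos D in simp)
  also have "(norm (P + b *\<^sub>R \<kappa>))\<^sup>2 = (\<Sum>i\<in>UNIV. (X i \<phi> g)\<^sup>2)"
    unfolding power2_norm_eq_inner inner_vec_def
    by (intro sum.cong refl)
      (simp add: P_def b_def \<kappa>_def X_C_class_coords[OF defining_onD(2)[OF dU] _ gU] power2_eq_square mult.commute del: Ds.simps)
  finally have "det (riem_gram patch_point z) = ((\<Sum>i\<in>UNIV. (X i \<phi> g)\<^sup>2) + b\<^sup>2) / (patch_slope g)\<^sup>2"
    unfolding D .
  moreover have "b = T \<phi> g" unfolding b_def by (rule X_C_class(2)[OF defining_onD(2)[OF dU] _ gU, symmetric]) simp
  ultimately show ?thesis
    using Dpos unfolding g_def[symmetric] riem_grad_norm_def by (simp add: real_sqrt_divide)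
qed

end

section \<open>The horizontal divergence theorem\<close>

text \<open>A quadratic spline rising from 0 at s = 1 to 1 at s = 2, with the hat function
  \<open>tent\<close> of mass one as derivative. Being zero up to s = 1, it gives a cutoff supported
  at a positive distance from the boundary.\<close>

definition ramp :: "real \<Rightarrow> real" where
  "ramp s = 2 * (max 0 (s - 1) ^ 2 - 2 * max 0 (s - 3/2) ^ 2 + max 0 (s - 2) ^ 2)"

definition tent :: "real \<Rightarrow> real" where
  "tent s = 4 * (max 0 (s - 1) - 2 * max 0 (s - 3/2) + max 0 (s - 2))"

lemma ramp_has_derivative: "(ramp has_real_derivative tent s) (at s)"
proof -
  have "((\<lambda>s. max 0 (s - a) ^ 2) has_real_derivative 2 * max 0 (s - a)) (at s)" for a :: real
  proof -
    have "((\<lambda>s. s - a) has_real_derivative 1) (at s)" by (auto intro!: derivative_eq_intros)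
    from DERIV_chain2[OF max_power_has_derivative[of 0] this] show ?thesis
      by (simp add: eval_nat_numeral)
  qed
  from this[of 1] this[of "3/2"] this[of 2]
  have "((\<lambda>s. 2 * (max 0 (s - 1) ^ 2 - 2 * max 0 (s - 3/2) ^ 2 + max 0 (s - 2) ^ 2)) has_real_derivative
     2 * (2 * max 0 (s - 1) - 2 * (2 * max 0 (s - 3/2)) + 2 * max 0 (s - 2))) (at s)"
    by (intro DERIV_cmult DERIV_add DERIV_diff)
  then show ?thesis unfolding ramp_def[abs_def] tent_def by (simp add: algebra_simps)
qed

lemma ramp_simps: "s \<le> 1 \<Longrightarrow> ramp s = 0" "2 \<le> s \<Longrightarrow> ramp s = 1"
  by (simp_all add: ramp_def max_def power2_eq_square algebra_simps)

lemma tent_simps: "s \<le> 1 \<Longrightarrow> tent s = 0" "2 \<le> s \<Longrightarrow> tent s = 0" "0 \<le> tent s" "tent s \<le> 2"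
  by (simp_all add: tent_def max_def algebra_simps)

lemma continuous_on_tent: "continuous_on A tent" and continuous_on_ramp: "continuous_on A ramp"
  unfolding tent_def[abs_def] ramp_def[abs_def] by (intro continuous_intros)+

lemma ramp_bounds: "0 \<le> ramp s" "ramp s \<le> 1"
proof -
  have mono: "ramp x \<le> ramp y" if "x \<le> y" for x y
    by (rule DERIV_nonneg_imp_nondecreasing[OF that]) (use ramp_has_derivative tent_simps(3) in blast)
  show "0 \<le> ramp s" using mono[of "min s 1" s] ramp_simps(1)[of "min s 1"] by simp
  show "ramp s \<le> 1" using mono[of s "max s 2"] ramp_simps(2)[of "max s 2"] by simp
qed

lemma integral_tent: "integrable lborel tent" "(LINT s|lborel. tent s) = 1"
proof -
  have eq: "(\<lambda>s. indicator {1..2} s *\<^sub>R tent s) = tent"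
  proof
    fix s
    show "indicator {1..2} s *\<^sub>R tent s = tent s"
      using tent_simps(1,2)[of s] by (cases "s \<in> {1..2}") auto
  qed
  have "integrable lborel (\<lambda>s. indicator {1..2} s *\<^sub>R tent s)"
    by (rule borel_integrable_compact[OF compact_Icc continuous_on_tent])
  then show "integrable lborel tent" unfolding eq .
  have "(LINT s|lborel. indicator {1..2} s *\<^sub>R tent s) = ramp 2 - ramp 1"
    by (rule integral_FTC_atLeastAtMost)
      (auto intro: continuous_on_tent has_field_derivative_at_within[OF ramp_has_derivative]
        simp: has_real_derivative_iff_has_vector_derivative[symmetric])
  then show "(LINT s|lborel. tent s) = 1" unfolding eq by (simp add: ramp_simps)
qed

lemma integral_chart_Fubini:
  fixes R :: "'n::finite heis \<Rightarrow> real"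
  assumes \<delta>: "\<delta> * \<delta> = 1" and R: "integrable lborel R"
  shows "(LINT g|lborel. R g) = (LINT z|lborel. LINT x|lborel. R (chart \<alpha> \<delta> (z, x)))"
    and "integrable lborel (\<lambda>z. LINT x|lborel. R (chart \<alpha> \<delta> (z, x)))"
proof -
  have m [measurable]: "chart \<alpha> \<delta> \<in> borel_measurable borel"
    by (rule borel_measurable_continuous_onI[OF continuous_on_chart])
  have "integrable (distr lborel borel (chart \<alpha> \<delta>)) R" using R by (simp add: distr_chart[OF \<delta>])
  then have "integrable lborel (\<lambda>q. R (chart \<alpha> \<delta> q))"
    by (subst (asm) integrable_distr_eq) (use R in auto)
  then have i: "integrable (lborel \<Otimes>\<^sub>M lborel) (\<lambda>q. R (chart \<alpha> \<delta> q))" by (simp add: lborel_prod)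
  have "(LINT g|lborel. R g) = (LINT g|distr lborel borel (chart \<alpha> \<delta>). R g)" by (simp add: distr_chart[OF \<delta>])
  also have "\<dots> = (LINT q|lborel. R (chart \<alpha> \<delta> q))"
    by (rule integral_distr) (use R in auto)
  also have "\<dots> = (LINT q|(lborel \<Otimes>\<^sub>M lborel). R (chart \<alpha> \<delta> q))" by (simp add: lborel_prod)
  also have "\<dots> = (LINT z|lborel. LINT x|lborel. R (chart \<alpha> \<delta> (z, x)))"
    by (rule lborel_pair.integral_fst'[OF i, symmetric])
  finally show "(LINT g|lborel. R g) = (LINT z|lborel. LINT x|lborel. R (chart \<alpha> \<delta> (z, x)))" .
  show "integrable lborel (\<lambda>z. LINT x|lborel. R (chart \<alpha> \<delta> (z, x)))"
    by (rule lborel_pair.integrable_fst'[OF i])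
qed

section \<open>The divergence theorem in one boundary patch\<close>

context
  fixes \<Omega> U :: "'n::finite heis set" and \<phi> \<alpha> \<delta> Z c d h
  assumes patch: "graph_patch \<Omega> U \<phi> \<alpha> \<delta> Z c d h"
begin

private abbreviation (input) "C \<equiv> chart \<alpha> \<delta> ` (Z \<times> {c<..<d})"
private abbreviation (input) "\<psi> \<equiv> patch_point \<alpha> \<delta> h"
private abbreviation (input) "hder \<equiv> height_deriv \<phi> \<alpha> \<delta> h"

definition depth :: "'n heis \<Rightarrow> real" where
  "depth g = h (fst (chart_inv \<alpha> \<delta> g)) - snd (chart_inv \<alpha> \<delta> g)"

definition depth_deriv :: "('n + 'n) \<Rightarrow> 'n heis \<Rightarrow> real" where
  "depth_deriv i g = height_deriv \<phi> \<alpha> \<delta> h (fst (chart_inv \<alpha> \<delta> g)) (fst (chart_inv \<alpha> \<delta> (hfield i g)))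
     - snd (chart_inv \<alpha> \<delta> (hfield i g))"

lemma in_patch_iff: "g \<in> C \<longleftrightarrow> fst (chart_inv \<alpha> \<delta> g) \<in> Z \<and> snd (chart_inv \<alpha> \<delta> g) \<in> {c<..<d}"
proof -
  note inv = chart_inverse[OF graph_patchD(2)[OF patch], of \<alpha>]
  have "g \<in> C \<longleftrightarrow> chart_inv \<alpha> \<delta> g \<in> Z \<times> {c<..<d}"
    using inv by (metis (no_types, lifting) image_iff)
  then show ?thesis by (simp add: mem_Times_iff)
qed

lemma depth_chart: "depth (chart \<alpha> \<delta> (z, x)) = h z - x"
  by (simp add: depth_def chart_inverse[OF graph_patchD(2)[OF patch]])

lemma in_domain_iff: "g \<in> C \<Longrightarrow> g \<in> \<Omega> \<longleftrightarrow> 0 < depth g"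
  using graph_patchD(6)[OF patch] by (auto simp: depth_chart)

lemma dalong_depth:
  assumes g: "g \<in> C"
  shows "dalong (hfield i) depth (depth_deriv i g) g"
proof -
  have bl: "bounded_linear (\<lambda>g. fst (chart_inv \<alpha> \<delta> g))" "bounded_linear (\<lambda>g. snd (chart_inv \<alpha> \<delta> g))"
    using bounded_linear_compose[OF bounded_linear_fst bounded_linear_chart_inv]
      bounded_linear_compose[OF bounded_linear_snd bounded_linear_chart_inv] by auto
  have "fst (chart_inv \<alpha> \<delta> g) \<in> Z" using g in_patch_iff by blast
  from has_derivative_compose[OF bounded_linear_imp_has_derivative[OF bl(1)] height_has_derivative[OF patch this]]
  have "(depth has_derivative (\<lambda>v. hder (fst (chart_inv \<alpha> \<delta> g)) (fst (chart_inv \<alpha> \<delta> v)) - snd (chart_inv \<alpha> \<delta> v))) (at g)"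
    unfolding depth_def[abs_def] by (intro has_derivative_diff bounded_linear_imp_has_derivative[OF bl(2)])
  from has_derivative_dalong[OF this] show ?thesis unfolding depth_deriv_def .
qed

lemma continuous_on_depth: "continuous_on C depth"
  unfolding depth_def
  by (intro continuous_intros continuous_on_compose2[OF continuous_on_height[OF patch]] continuous_on_chart_inv)
    (use in_patch_iff in blast)

lemma continuous_on_depth_deriv: "continuous_on C (depth_deriv i)"
proof -
  have lin: "linear (hder z)" if "z \<in> Z" for z
    using height_has_derivative[OF patch that] has_derivative_linear by blast
  have eq: "hder z w = (\<Sum>k\<in>UNIV. w $ k * hder z (axis k 1))" if "z \<in> Z" for z w
  proof -
    have "w = (\<Sum>k\<in>UNIV. w $ k *\<^sub>R axis k 1)"
      using basis_expansion[of w] by (simp add: scalar_mult_eq_scaleR)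
    then have "hder z w = hder z (\<Sum>k\<in>UNIV. w $ k *\<^sub>R axis k 1)" by simp
    then show ?thesis by (simp only: linear_sum[OF lin[OF that]] linear_scale[OF lin[OF that]] real_scaleR_def)
  qed
  have ch: "continuous_on C (\<lambda>g. chart_inv \<alpha> \<delta> (hfield i g))"
    by (rule continuous_on_compose2[OF continuous_on_chart_inv[of UNIV] shear_field_continuous[OF shear_field_hfield]]) auto
  have c: "continuous_on C (\<lambda>g. hder (fst (chart_inv \<alpha> \<delta> g)) w)" for w
    by (rule continuous_on_compose2[OF continuous_on_height_deriv[OF patch]])
      (use in_patch_iff in \<open>auto intro!: continuous_intros continuous_on_chart_inv\<close>)
  have "continuous_on C (\<lambda>g. (\<Sum>k\<in>UNIV. fst (chart_inv \<alpha> \<delta> (hfield i g)) $ k * hder (fst (chart_inv \<alpha> \<delta> g)) (axis k 1))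
      - snd (chart_inv \<alpha> \<delta> (hfield i g)))"
    by (intro continuous_intros ch c)
  then show ?thesis
    by (rule continuous_on_eq) (use in_patch_iff eq in \<open>simp add: depth_deriv_def\<close>)
qed

text \<open>Both \<open>- depth\<close> and \<open>\<phi>\<close> vanish on the graph, and the
  former has slope one in the chart direction. Its derivatives at the boundary are thus those of
  \<open>\<phi>\<close> divided by the slope of \<open>\<phi>\<close>.\<close>

lemma depth_deriv_boundary:
  assumes z: "z \<in> Z"
  shows "- depth_deriv i (\<psi> z) = X i \<phi> (\<psi> z) / patch_slope \<phi> \<alpha> \<delta> (\<psi> z)"
proof -
  define g where "g = \<psi> z"
  have gU: "g \<in> U" using patch_point_in(2)[OF patch z] by (simp add: g_def)
  note d = graph_patchD(1)[OF patch] and \<delta> = graph_patchD(2)[OF patch]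
  have l: "linear (\<lambda>v. Ds [v] \<phi> g)" by (rule defining_onD(6)[OF d gU])
  have zg: "fst (chart_inv \<alpha> \<delta> g) = z" by (simp add: g_def patch_point_def[OF patch] chart_inverse[OF \<delta>])
  have Xg: "X i \<phi> g = Ds [hfield i g] \<phi> g" by (rule X_C_class(1)[OF defining_onD(2)[OF d] _ gU]) simp
  obtain w s where ws: "chart_inv \<alpha> \<delta> (hfield i g) = (w, s)" by (cases "chart_inv \<alpha> \<delta> (hfield i g)")
  have "hfield i g = chart \<alpha> \<delta> (w, s)" using chart_inverse(2)[OF \<delta>, of \<alpha> "hfield i g"] ws by simp
  also have "(w, s) = (w, 0) + s *\<^sub>R (0, 1)" by simp
  also have "chart \<alpha> \<delta> \<dots> = chart \<alpha> \<delta> (w, 0) + s *\<^sub>R chart \<alpha> \<delta> (0, 1)"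
    by (simp only: linear_add[OF linear_chart] linear_scale[OF linear_chart])
  finally have "X i \<phi> g = Ds [chart \<alpha> \<delta> (w, 0)] \<phi> g + s * patch_slope \<phi> \<alpha> \<delta> g"
    unfolding patch_slope_def[OF patch] Xg by (simp only: linear_add[OF l] linear_scale[OF l] real_scaleR_def)
  moreover have "depth_deriv i g = - Ds [chart \<alpha> \<delta> (w, 0)] \<phi> g / patch_slope \<phi> \<alpha> \<delta> g - s"
    unfolding depth_deriv_def zg ws height_deriv_def[OF patch] g_def[symmetric] by simp
  ultimately show ?thesis
    using patch_slope_pos[OF patch z] unfolding g_def[symmetric] by (simp add: field_simps del: Ds.simps)
qed

text \<open>
  The divergence theorem for one horizontal field in a boundary patch: multiply by a cutoff at
  depth \<open>\<epsilon>\<close>, integrate by parts with compact support, and let \<open>\<epsilon>\<close> tend to zero.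
\<close>

lemma divergence_patch:
  fixes F DF :: "'n heis \<Rightarrow> real"
  assumes O: "open \<Omega>" and K: "compact K" "K \<subseteq> C"
    and cF: "continuous_on (closure \<Omega>) F" and F0: "\<And>g. g \<in> closure \<Omega> - K \<Longrightarrow> F g = 0"
    and dF: "\<And>g. g \<in> \<Omega> \<Longrightarrow> dalong (hfield i) F (DF g) g"
    and cD: "continuous_on \<Omega> DF" and bD: "\<And>g. g \<in> \<Omega> \<Longrightarrow> \<bar>DF g\<bar> \<le> B"
  shows "set_integrable lborel \<Omega> DF"
    and "set_integrable lborel Z (\<lambda>z. F (\<psi> z) * (X i \<phi> (\<psi> z) / patch_slope \<phi> \<alpha> \<delta> (\<psi> z)))"
    and "(LINT g:\<Omega>|lborel. DF g) = (LINT z:Z|lborel. F (\<psi> z) * (X i \<phi> (\<psi> z) / patch_slope \<phi> \<alpha> \<delta> (\<psi> z)))"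
proof -
  note \<delta> = graph_patchD(2)[OF patch]
  define Y where "Y = depth_deriv i"
  define O' where "O' = \<Omega> \<inter> C"
  have oO': "open O'" using O open_patch[OF patch] by (auto simp: O'_def)
  have clO: "\<Omega> \<subseteq> closure \<Omega>" by (rule closure_subset)
  have DF0: "DF g = 0" if "g \<in> \<Omega> - K" for g
  proof -
    have "open (\<Omega> - K)" using O K(1) compact_imp_closed by blast
    then have "dalong (hfield i) F 0 g"
      by (rule dalong_cong_open[OF _ that, of "\<lambda>_. 0"]) (use F0 clO in \<open>auto simp: dalong_def\<close>)
    then show ?thesis using dF[of g] that dalong_along by (metis DiffD1)
  qed
  have Fc: "continuous_on O' F" by (rule continuous_on_subset[OF cF]) (use clO in \<open>auto simp: O'_def\<close>)
  have Yc: "continuous_on O' Y" unfolding Y_def by (rule continuous_on_subset[OF continuous_on_depth_deriv]) (auto simp: O'_def)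
  have dc: "continuous_on O' depth" by (rule continuous_on_subset[OF continuous_on_depth]) (auto simp: O'_def)
  have Dc: "continuous_on O' DF" by (rule continuous_on_subset[OF cD]) (auto simp: O'_def)
  define \<epsilon> where "\<epsilon> n = 1 / real (Suc n)" for n
  have \<epsilon>: "\<epsilon> n > 0" for n by (simp add: \<epsilon>_def)
  have \<epsilon>lim: "\<epsilon> \<longlonglongrightarrow> 0" unfolding \<epsilon>_def[abs_def] using LIMSEQ_Suc[OF lim_1_over_n] by simp
  have IBP: "set_integrable lborel O' (\<lambda>g. DF g * ramp (depth g / \<epsilon> n))"
    "set_integrable lborel O' (\<lambda>g. F g * Y g * (tent (depth g / \<epsilon> n) / \<epsilon> n))"
    "(LINT g:O'|lborel. DF g * ramp (depth g / \<epsilon> n)) =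
       - (LINT g:O'|lborel. F g * Y g * (tent (depth g / \<epsilon> n) / \<epsilon> n))" for n
  proof -
    \<comment> \<open>The part of the support with depth at least \<open>\<epsilon> n\<close>, where
      the cutoff can be nonzero. It is compact and lies inside the domain, so no boundary term
      appears in the integration by parts.\<close>
    define K' where "K' = {g \<in> K. g \<in> closure \<Omega> \<and> \<epsilon> n \<le> depth g}"
    have "K' = K \<inter> closure \<Omega> \<inter> (K \<inter> depth -` {\<epsilon> n..})" by (auto simp: K'_def)
    moreover have "closed (K \<inter> depth -` {\<epsilon> n..})"
      by (rule continuous_closed_preimage) (use continuous_on_subset[OF continuous_on_depth K(2)] K(1) compact_imp_closed in auto)
    ultimately have cK': "compact K'" using K(1) by (metis Int_assoc closed_Int closed_closure compact_Int_closed)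
    have K'O: "K' \<subseteq> O'"
    proof
      fix g assume g: "g \<in> K'"
      then have "g \<in> C" "0 < depth g" using K(2) \<epsilon>[of n] by (auto simp: K'_def)
      then show "g \<in> O'" using in_domain_iff by (simp add: O'_def)
    qed
    have off: "F g = 0 \<and> DF g = 0 \<or> depth g / \<epsilon> n \<le> 1" if "g \<in> O' - K'" for g
    proof (cases "g \<in> K")
      case True
      then have "\<not> \<epsilon> n \<le> depth g" using that clO by (auto simp: K'_def O'_def)
      then show ?thesis using \<epsilon>[of n] by (simp add: field_simps)
    next
      case False
      then show ?thesis using F0[of g] DF0[of g] that clO by (auto simp: O'_def)
    qed
    have dr: "dalong (hfield i) (\<lambda>g. ramp (depth g / \<epsilon> n)) (tent (depth g / \<epsilon> n) * (Y g / \<epsilon> n)) g" if "g \<in> O'" for g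
    proof (rule dalong_compose[OF _ ramp_has_derivative])
      have "dalong (hfield i) depth (Y g) g" unfolding Y_def by (rule dalong_depth) (use that in \<open>simp add: O'_def\<close>)
      from dalong_cmult[OF this, of "1 / \<epsilon> n"]
      show "dalong (hfield i) (\<lambda>g. depth g / \<epsilon> n) (Y g / \<epsilon> n) g" by simp
    qed
    have cr: "continuous_on O' (\<lambda>g. ramp (depth g / \<epsilon> n))" "continuous_on O' (\<lambda>g. tent (depth g / \<epsilon> n))"
      using \<epsilon>[of n] by (auto intro!: continuous_on_compose2[OF continuous_on_ramp[of UNIV]]
        continuous_on_compose2[OF continuous_on_tent[of UNIV]] continuous_intros dc)
    have off': "DF g * ramp (depth g / \<epsilon> n) = 0" "F g * Y g * (tent (depth g / \<epsilon> n) / \<epsilon> n) = 0"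
      "F g * ramp (depth g / \<epsilon> n) = 0" if "g \<in> O' - K'" for g
      using off[OF that] ramp_simps(1)[of "depth g / \<epsilon> n"] tent_simps(1)[of "depth g / \<epsilon> n"] by auto
    have \<epsilon>n: "\<epsilon> n \<noteq> 0" using \<epsilon>[of n] by simp
    have cc: "continuous_on O' (\<lambda>g. DF g * ramp (depth g / \<epsilon> n))"
      "continuous_on O' (\<lambda>g. F g * Y g * (tent (depth g / \<epsilon> n) / \<epsilon> n))"
      "continuous_on O' (\<lambda>g. F g * ramp (depth g / \<epsilon> n))"
      "continuous_on O' (\<lambda>g. DF g * ramp (depth g / \<epsilon> n) + F g * (tent (depth g / \<epsilon> n) * (Y g / \<epsilon> n)))"
      by (intro continuous_intros Dc Fc Yc cr ballI \<epsilon>n)+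
    show 1: "set_integrable lborel O' (\<lambda>g. DF g * ramp (depth g / \<epsilon> n))"
      by (rule set_integrable_mult_compact_support[OF oO' cK' K'O cc(1) off'(1)])
    show 2: "set_integrable lborel O' (\<lambda>g. F g * Y g * (tent (depth g / \<epsilon> n) / \<epsilon> n))"
      by (rule set_integrable_mult_compact_support[OF oO' cK' K'O cc(2) off'(2)])
    have dm: "dalong (hfield i) (\<lambda>g. F g * ramp (depth g / \<epsilon> n))
        (DF g * ramp (depth g / \<epsilon> n) + F g * (tent (depth g / \<epsilon> n) * (Y g / \<epsilon> n))) g" if "g \<in> O'" for g
    proof -
      have "g \<in> \<Omega>" using that by (simp add: O'_def)
      then show ?thesis by (rule dalong_mult[OF dF dr[OF that]])
    qed
    have "(LINT g:O'|lborel. DF g * ramp (depth g / \<epsilon> n) + F g * (tent (depth g / \<epsilon> n) * (Y g / \<epsilon> n))) = 0"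
      by (rule integral_along_compact_support(2)[OF shear_field_hfield oO' cK' K'O dm cc(3,4) off'(3)])
    then have "(LINT g:O'|lborel. DF g * ramp (depth g / \<epsilon> n) + F g * Y g * (tent (depth g / \<epsilon> n) / \<epsilon> n)) = 0"
      by (simp add: mult_ac)
    then show "(LINT g:O'|lborel. DF g * ramp (depth g / \<epsilon> n)) =
       - (LINT g:O'|lborel. F g * Y g * (tent (depth g / \<epsilon> n) / \<epsilon> n))"
      using 1 2 by (simp add: set_integral_add)
  qed
  have eqD: "indicator O' g *\<^sub>R DF g = indicator \<Omega> g *\<^sub>R DF g" for g
    using DF0[of g] K(2) by (auto simp: indicator_def O'_def)
  have mD: "(\<lambda>g. indicator O' g *\<^sub>R DF g) \<in> borel_measurable lborel"
    using borel_measurable_continuous_on_indicator[of O' DF] oO' Dc by simp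
  have iKB: "integrable lborel (\<lambda>g. indicator K g *\<^sub>R \<bar>B\<bar>)"
    by (rule borel_integrable_compact[OF K(1)]) (rule continuous_on_const)
  have domD: "norm (indicator O' g *\<^sub>R DF g) \<le> indicator K g *\<^sub>R \<bar>B\<bar>" for g
  proof (cases "g \<in> O' \<and> g \<in> K")
    case True
    then have "\<bar>DF g\<bar> \<le> \<bar>B\<bar>" using bD[of g] by (auto simp: O'_def)
    then show ?thesis using True by simp
  next
    case False
    then have z: "indicator O' g *\<^sub>R DF g = 0" using DF0[of g] by (cases "g \<in> O'") (simp_all add: O'_def)
    show ?thesis unfolding z by simp
  qed
  have iD: "integrable lborel (\<lambda>g. indicator O' g *\<^sub>R DF g)"
    by (rule Bochner_Integration.integrable_bound[OF iKB mD]) (use domD in \<open>intro AE_I2, smt (verit) real_norm_def\<close>)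
  then show "set_integrable lborel \<Omega> DF" unfolding set_integrable_def eqD .
  have limL: "(\<lambda>n. LINT g:O'|lborel. DF g * ramp (depth g / \<epsilon> n)) \<longlonglongrightarrow> (LINT g:\<Omega>|lborel. DF g)"
    unfolding set_lebesgue_integral_def eqD[symmetric]
  proof (rule integral_dominated_convergence[where w="\<lambda>g. indicator K g *\<^sub>R \<bar>B\<bar>"])
    show "(\<lambda>g. indicator O' g *\<^sub>R DF g) \<in> borel_measurable lborel" by (rule mD)
    show "(\<lambda>g. indicator O' g *\<^sub>R (DF g * ramp (depth g / \<epsilon> n))) \<in> borel_measurable lborel" for n
      using IBP(1)[of n] unfolding set_integrable_def by (rule borel_measurable_integrable)
    show "integrable lborel (\<lambda>g. indicator K g *\<^sub>R \<bar>B\<bar>)" by (rule iKB)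
    show "AE g in lborel. (\<lambda>n. indicator O' g *\<^sub>R (DF g * ramp (depth g / \<epsilon> n))) \<longlonglongrightarrow> indicator O' g *\<^sub>R DF g"
    proof (rule AE_I2)
      fix g
      show "(\<lambda>n. indicator O' g *\<^sub>R (DF g * ramp (depth g / \<epsilon> n))) \<longlonglongrightarrow> indicator O' g *\<^sub>R DF g"
      proof (cases "g \<in> O'")
        case True
        then have "g \<in> C" "g \<in> \<Omega>" unfolding O'_def by blast+
        then have dp: "0 < depth g" using in_domain_iff by blast
        have "\<forall>\<^sub>F n in sequentially. \<epsilon> n < depth g / 2" using order_tendstoD(2)[OF \<epsilon>lim, of "depth g / 2"] dp by simp
        then have "\<forall>\<^sub>F n in sequentially. indicator O' g *\<^sub>R (DF g * ramp (depth g / \<epsilon> n)) = indicator O' g *\<^sub>R DF g"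
        proof eventually_elim
          case (elim n)
          then have "2 \<le> depth g / \<epsilon> n" using \<epsilon>[of n] by (simp add: field_simps)
          then show ?case by (simp add: ramp_simps)
        qed
        then show ?thesis by (rule tendsto_eventually)
      qed simp
    qed
    show "AE g in lborel. norm (indicator O' g *\<^sub>R (DF g * ramp (depth g / \<epsilon> n))) \<le> indicator K g *\<^sub>R \<bar>B\<bar>" for n
    proof (rule AE_I2)
      fix g
      have "norm (indicator O' g *\<^sub>R (DF g * ramp (depth g / \<epsilon> n))) = norm (indicator O' g *\<^sub>R DF g) * ramp (depth g / \<epsilon> n)"
        using ramp_bounds(1)[of "depth g / \<epsilon> n"] by (simp add: abs_mult)
      also have "\<dots> \<le> norm (indicator O' g *\<^sub>R DF g) * 1" by (rule mult_left_mono[OF ramp_bounds(2)]) simp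
      finally show "norm (indicator O' g *\<^sub>R (DF g * ramp (depth g / \<epsilon> n))) \<le> indicator K g *\<^sub>R \<bar>B\<bar>"
        using domD[of g] by simp
    qed
  qed
  define Q where "Q g = indicator O' g *\<^sub>R (F g * Y g)" for g
  have Qm [measurable]: "Q \<in> borel_measurable borel"
    unfolding Q_def using oO' by (intro borel_measurable_continuous_on_indicator continuous_intros Fc Yc) simp
  have "compact (K \<inter> closure \<Omega>)" using K(1) by (simp add: compact_Int_closed)
  moreover have cFY: "continuous_on (K \<inter> closure \<Omega>) (\<lambda>g. F g * Y g)"
    unfolding Y_def
    by (intro continuous_intros continuous_on_subset[OF cF] continuous_on_subset[OF continuous_on_depth_deriv]) (use K in auto)
  ultimately have "bounded ((\<lambda>g. F g * Y g) ` (K \<inter> closure \<Omega>))"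
    by (intro compact_imp_bounded compact_continuous_image)
  then obtain M where M: "M > 0" "\<And>g. g \<in> K \<inter> closure \<Omega> \<Longrightarrow> \<bar>F g * Y g\<bar> \<le> M"
    unfolding bounded_pos by auto
  have QM: "\<bar>Q g\<bar> \<le> M * indicator K g" for g
  proof (cases "g \<in> O' \<and> g \<in> K")
    case True
    then have "g \<in> K \<inter> closure \<Omega>" using clO unfolding O'_def by blast
    from M(2)[OF this] show ?thesis using True by (simp add: Q_def)
  next
    case False
    then have "Q g = 0" using F0[of g] clO unfolding Q_def O'_def by (cases "g \<in> O'") (auto simp: O'_def)
    then show ?thesis using M(1) by simp
  qed
  have QM': "\<bar>Q g\<bar> \<le> M" for g
    using QM[of g] M(1) by (cases "g \<in> K") auto
  define KZ where "KZ = (\<lambda>g. fst (chart_inv \<alpha> \<delta> g)) ` K"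
  have cKZ: "compact KZ"
    unfolding KZ_def by (intro compact_continuous_image K continuous_intros continuous_on_chart_inv)
  have inKZ: "z \<in> KZ" if "chart \<alpha> \<delta> (z, x) \<in> K" for z x
    unfolding KZ_def using that by (rule rev_image_eqI) (simp add: chart_inverse[OF \<delta>])
  \<comment> \<open>The fibre integral after the substitution
    \<open>x = h z - \<epsilon> n * s\<close>, which turns
    \<open>tent (depth / \<epsilon> n) / \<epsilon> n\<close> into the fixed weight
    \<open>tent s\<close>. \<open>Q\<close> is the product \<open>F Y\<close> extended by zero, so
    the formula makes sense for every \<open>s\<close>.\<close>
  define A where "A n z = (if z \<in> Z then LINT s|lborel. Q (chart \<alpha> \<delta> (z, h z - \<epsilon> n * s)) * tent s else 0)" for n z
  have Rn: "(LINT g:O'|lborel. F g * Y g * (tent (depth g / \<epsilon> n) / \<epsilon> n)) = (LINT z|lborel. A n z)"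
     "A n \<in> borel_measurable lborel" for n
  proof -
    define R where "R g = indicator O' g *\<^sub>R (F g * Y g * (tent (depth g / \<epsilon> n) / \<epsilon> n))" for g
    have iR: "integrable lborel R" using IBP(2)[of n] by (simp add: R_def[abs_def] set_integrable_def)
    have eq: "(LINT x|lborel. R (chart \<alpha> \<delta> (z, x))) = A n z" for z
    proof (cases "z \<in> Z")
      case True
      have Rz: "R (chart \<alpha> \<delta> (z, x)) = Q (chart \<alpha> \<delta> (z, x)) * (tent ((h z - x) / \<epsilon> n) / \<epsilon> n)" for x
        by (simp add: R_def Q_def depth_chart)
      have "(LINT x|lborel. R (chart \<alpha> \<delta> (z, x))) =
          \<bar>- \<epsilon> n\<bar> *\<^sub>R (LINT s|lborel. R (chart \<alpha> \<delta> (z, h z + (- \<epsilon> n) * s)))"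
        by (rule lborel_integral_real_affine) (use \<epsilon>[of n] in simp)
      also have "\<dots> = (LINT s|lborel. \<epsilon> n * R (chart \<alpha> \<delta> (z, h z + (- \<epsilon> n) * s)))"
        using \<epsilon>[of n] by simp
      also have "\<dots> = (LINT s|lborel. Q (chart \<alpha> \<delta> (z, h z - \<epsilon> n * s)) * tent s)"
        by (intro Bochner_Integration.integral_cong refl) (use \<epsilon>[of n] in \<open>simp add: Rz less_imp_neq[symmetric]\<close>)
      finally show ?thesis using True by (simp add: A_def)
    next
      case False
      then have "chart \<alpha> \<delta> (z, x) \<notin> C" for x by (simp add: in_patch_iff chart_inverse[OF \<delta>])
      then have "R (chart \<alpha> \<delta> (z, x)) = 0" for x by (simp add: R_def O'_def)
      then show ?thesis using False by (simp add: A_def)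
    qed
    show "(LINT g:O'|lborel. F g * Y g * (tent (depth g / \<epsilon> n) / \<epsilon> n)) = (LINT z|lborel. A n z)"
      using integral_chart_Fubini(1)[OF \<delta> iR, of \<alpha>] unfolding eq by (simp add: R_def set_lebesgue_integral_def)
    show "A n \<in> borel_measurable lborel"
      using integral_chart_Fubini(2)[OF \<delta> iR, of \<alpha>] unfolding eq by (rule borel_measurable_integrable)
  qed
  have hFY: "continuous_on (closure \<Omega> \<inter> C) (\<lambda>g. F g * Y g)"
    unfolding Y_def
    by (intro continuous_intros continuous_on_subset[OF cF] continuous_on_subset[OF continuous_on_depth_deriv]) auto
  \<comment> \<open>For fixed \<open>s > 1\<close> the points \<open>h z - \<epsilon> n * s\<close>
    approach the graph from inside, where \<open>F Y\<close> is continuous up to the boundary; for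
    smaller \<open>s\<close> the weight vanishes. Mass one of \<open>tent\<close> leaves the
    boundary value.\<close>
  have Alim: "(\<lambda>n. A n z) \<longlonglongrightarrow> indicator Z z *\<^sub>R (F (\<psi> z) * Y (\<psi> z))" for z
  proof (cases "z \<in> Z")
    case True
    note horizontal_part = graph_patchD(5)[OF patch True]
    have sm [measurable]: "(\<lambda>s. Q (chart \<alpha> \<delta> (z, h z - r * s)) * tent s) \<in> borel_measurable lborel" for r
    proof -
      have "(\<lambda>s. chart \<alpha> \<delta> (z, h z - r * s)) \<in> borel_measurable borel"
        by (intro borel_measurable_continuous_onI continuous_on_compose2[OF continuous_on_chart[of UNIV]] continuous_intros) auto
      from measurable_compose[OF this Qm] have 1: "(\<lambda>s. Q (chart \<alpha> \<delta> (z, h z - r * s))) \<in> borel_measurable borel" .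
      have 2: "tent \<in> borel_measurable borel" by (rule borel_measurable_continuous_onI[OF continuous_on_tent])
      show ?thesis using borel_measurable_times[OF 1 2] by simp
    qed
    have "(\<lambda>n. LINT s|lborel. Q (chart \<alpha> \<delta> (z, h z - \<epsilon> n * s)) * tent s) \<longlonglongrightarrow>
        (LINT s|lborel. F (\<psi> z) * Y (\<psi> z) * tent s)"
    proof (rule integral_dominated_convergence[where w="\<lambda>s. M * tent s"])
      show "(\<lambda>s. F (\<psi> z) * Y (\<psi> z) * tent s) \<in> borel_measurable lborel" "integrable lborel (\<lambda>s. M * tent s)"
        using integral_tent(1) by auto
      show "AE s in lborel. (\<lambda>n. Q (chart \<alpha> \<delta> (z, h z - \<epsilon> n * s)) * tent s) \<longlonglongrightarrow> F (\<psi> z) * Y (\<psi> z) * tent s"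
      proof (rule AE_I2)
        fix s :: real
        show "(\<lambda>n. Q (chart \<alpha> \<delta> (z, h z - \<epsilon> n * s)) * tent s) \<longlonglongrightarrow> F (\<psi> z) * Y (\<psi> z) * tent s"
        proof (cases "s \<le> 1")
          case False
          have l1: "(\<lambda>n. h z - \<epsilon> n * s) \<longlonglongrightarrow> h z - 0 * s" by (intro tendsto_intros \<epsilon>lim)
          then have l1': "(\<lambda>n. h z - \<epsilon> n * s) \<longlonglongrightarrow> h z" by simp
          have pos: "h z - \<epsilon> n * s < h z" for n using False \<epsilon>[of n] by simp
          have ev: "\<forall>\<^sub>F n in sequentially. c < h z - \<epsilon> n * s"
            using order_tendstoD(1)[OF l1', of c] horizontal_part by simp
          then have inO: "\<forall>\<^sub>F n in sequentially. chart \<alpha> \<delta> (z, h z - \<epsilon> n * s) \<in> O'"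
          proof eventually_elim
            case (elim n)
            then have x: "h z - \<epsilon> n * s \<in> {c<..<d}" using pos[of n] horizontal_part by simp
            then have "chart \<alpha> \<delta> (z, h z - \<epsilon> n * s) \<in> \<Omega>" using graph_patchD(6)[OF patch True x] pos[of n] by simp
            then show ?case using x True by (auto simp: O'_def)
          qed
          have "(\<lambda>n. chart \<alpha> \<delta> (z, h z - \<epsilon> n * s)) \<longlonglongrightarrow> chart \<alpha> \<delta> (z, h z)"
            by (rule bounded_linear.tendsto[OF bounded_linear_chart]) (intro tendsto_intros l1')
          then have l2: "(\<lambda>n. chart \<alpha> \<delta> (z, h z - \<epsilon> n * s)) \<longlonglongrightarrow> \<psi> z" by (simp add: patch_point_def[OF patch])
          have "\<psi> z \<in> closure \<Omega> \<inter> C" using patch_point_in(1,3)[OF patch True] by (simp add: frontier_def)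
          then have "(\<lambda>n. F (chart \<alpha> \<delta> (z, h z - \<epsilon> n * s)) * Y (chart \<alpha> \<delta> (z, h z - \<epsilon> n * s))) \<longlonglongrightarrow> F (\<psi> z) * Y (\<psi> z)"
            by (rule continuous_on_tendsto_compose[OF hFY l2])
              (use inO in eventually_elim, use clO in \<open>auto simp: O'_def\<close>)
          then have "(\<lambda>n. Q (chart \<alpha> \<delta> (z, h z - \<epsilon> n * s))) \<longlonglongrightarrow> F (\<psi> z) * Y (\<psi> z)"
            by (rule Lim_transform_eventually) (use inO in eventually_elim, simp add: Q_def)
          then show ?thesis by (intro tendsto_intros)
        qed (simp add: tent_simps)
      qed
      show "AE s in lborel. norm (Q (chart \<alpha> \<delta> (z, h z - \<epsilon> n * s)) * tent s) \<le> M * tent s" for n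
      proof (rule AE_I2)
        fix s
        have "\<bar>Q (chart \<alpha> \<delta> (z, h z - \<epsilon> n * s))\<bar> \<le> M"
          by (rule QM')
        then show "norm (Q (chart \<alpha> \<delta> (z, h z - \<epsilon> n * s)) * tent s) \<le> M * tent s"
          using tent_simps(3)[of s] by (simp add: abs_mult mult_right_mono)
      qed
    qed (rule sm)
    then show ?thesis using True integral_tent by (simp add: A_def)
  qed (simp add: A_def)
  have domA: "norm (A n z) \<le> indicator KZ z *\<^sub>R M" for n z
  proof (cases "z \<in> Z \<and> z \<in> KZ")
    case True
    have "norm (LINT s|lborel. Q (chart \<alpha> \<delta> (z, h z - \<epsilon> n * s)) * tent s)
        \<le> (LINT s|lborel. norm (Q (chart \<alpha> \<delta> (z, h z - \<epsilon> n * s)) * tent s))"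
      by (rule integral_norm_bound)
    also have "\<dots> \<le> (LINT s|lborel. M * tent s)"
    proof (rule integral_mono')
      show "integrable lborel (\<lambda>s. M * tent s)" using integral_tent(1) by simp
      show "0 \<le> M * tent s" for s using M(1) tent_simps(3)[of s] by simp
      show "norm (Q (chart \<alpha> \<delta> (z, h z - \<epsilon> n * s)) * tent s) \<le> M * tent s" for s
      proof -
        have "\<bar>Q (chart \<alpha> \<delta> (z, h z - \<epsilon> n * s))\<bar> \<le> M"
          by (rule QM')
        then show ?thesis using tent_simps(3)[of s] by (simp add: abs_mult mult_right_mono)
      qed
    qed
    finally have "norm (LINT s|lborel. Q (chart \<alpha> \<delta> (z, h z - \<epsilon> n * s)) * tent s) \<le> (LINT s|lborel. M * tent s)" .
    then show ?thesis using True integral_tent by (simp add: A_def)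
  next
    case False
    have "A n z = 0"
    proof (cases "z \<in> Z")
      case True
      then have "z \<notin> KZ" using False by simp
      then have "chart \<alpha> \<delta> (z, x) \<notin> K" for x using inKZ by blast
      then have "Q (chart \<alpha> \<delta> (z, x)) = 0" for x using QM[of "chart \<alpha> \<delta> (z, x)"] by simp
      then show ?thesis by (simp add: A_def)
    qed (simp add: A_def)
    then show ?thesis using M(1) by simp
  qed
  define L where "L z = indicator Z z *\<^sub>R (F (\<psi> z) * Y (\<psi> z))" for z
  have iKM: "integrable lborel (\<lambda>z. indicator KZ z *\<^sub>R M)"
    by (rule borel_integrable_compact[OF cKZ]) (rule continuous_on_const)
  have Lm: "L \<in> borel_measurable lborel"
    by (rule borel_measurable_LIMSEQ_real[OF _ Rn(2)]) (use Alim in \<open>simp add: L_def\<close>)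
  have Llim: "AE z in lborel. (\<lambda>n. A n z) \<longlonglongrightarrow> L z" using Alim by (simp add: L_def)
  have domA': "AE z in lborel. norm (A n z) \<le> indicator KZ z *\<^sub>R M" for n using domA by simp
  have iL: "integrable lborel L"
    by (rule integrable_dominated_convergence[OF Lm Rn(2) iKM Llim domA'])
  have limR: "(\<lambda>n. LINT z|lborel. A n z) \<longlonglongrightarrow> (LINT z|lborel. L z)"
    by (rule integral_dominated_convergence[OF Lm Rn(2) iKM Llim domA'])
  \<comment> \<open>The minus sign from the integration by parts cancels against the one in
    \<open>depth_deriv_boundary\<close>.\<close>
  have eqL: "indicator Z z *\<^sub>R (F (\<psi> z) * (X i \<phi> (\<psi> z) / patch_slope \<phi> \<alpha> \<delta> (\<psi> z))) = - L z" for z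
  proof (cases "z \<in> Z")
    case True
    show ?thesis
      unfolding depth_deriv_boundary[OF True, symmetric] L_def Y_def using True by simp
  qed (simp add: L_def)
  show "set_integrable lborel Z (\<lambda>z. F (\<psi> z) * (X i \<phi> (\<psi> z) / patch_slope \<phi> \<alpha> \<delta> (\<psi> z)))"
    unfolding set_integrable_def eqL using iL by simp
  have "(\<lambda>n. LINT g:O'|lborel. DF g * ramp (depth g / \<epsilon> n)) \<longlonglongrightarrow> - (LINT z|lborel. L z)"
    unfolding IBP(3) Rn(1) by (rule tendsto_minus[OF limR])
  then have "(LINT g:\<Omega>|lborel. DF g) = - (LINT z|lborel. L z)" using limL LIMSEQ_unique by blast
  then show "(LINT g:\<Omega>|lborel. DF g) = (LINT z:Z|lborel. F (\<psi> z) * (X i \<phi> (\<psi> z) / patch_slope \<phi> \<alpha> \<delta> (\<psi> z)))"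
    unfolding set_lebesgue_integral_def eqL by simp
qed

end

section \<open>From patches to the whole boundary\<close>

lemma C2_boundaryE:
  assumes "C2_boundary \<Omega>" "p \<in> frontier \<Omega>"
  obtains \<phi> U where "defining_on \<Omega> U \<phi>" "p \<in> U"
  using assms unfolding C2_boundary_def defining_function_iff by blast

text \<open>The boundary of a bounded set is compact, so finitely many graph patches cover it and
  the definite description in \<open>surface_measure\<close> denotes the unique measure.\<close>

lemma is_surface_measure_frontier:
  fixes \<Omega> :: "'n::finite heis set"
  assumes O: "open \<Omega>" and b: "bounded \<Omega>" and C2: "C2_boundary \<Omega>"
  shows "is_surface_measure (frontier \<Omega>) (surface_measure (frontier \<Omega>))"
proof -
  have "\<exists>V \<psi> C. parametrization (frontier \<Omega>) V \<psi> \<and> open C \<and> p \<in> C \<and> \<psi> ` V = frontier \<Omega> \<inter> C"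
    if p: "p \<in> frontier \<Omega>" for p
  proof -
    obtain \<phi> U where d: "defining_on \<Omega> U \<phi>" "p \<in> U" by (rule C2_boundaryE[OF C2 p])
    obtain \<alpha> \<delta> Z c d' h where *: "graph_patch \<Omega> U \<phi> \<alpha> \<delta> Z c d' h" "p \<in> chart \<alpha> \<delta> ` (Z \<times> {c<..<d'})"
      by (rule graph_patch_exists[OF d(1) O p d(2)])
    show ?thesis
      using patch_parametrization[OF *(1)] open_patch[OF *(1)] *(2) patch_image[OF *(1)] by blast
  qed
  then obtain V \<psi> C where *: "\<And>p. p \<in> frontier \<Omega> \<Longrightarrow> parametrization (frontier \<Omega>) (V p) (\<psi> p) \<and> open (C p) \<and>
      p \<in> C p \<and> \<psi> p ` V p = frontier \<Omega> \<inter> C p" by metis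
  have cF: "compact (frontier \<Omega>)" by (rule compact_frontier_bounded[OF b])
  obtain D where D: "D \<subseteq> frontier \<Omega>" "finite D" "frontier \<Omega> \<subseteq> (\<Union>p\<in>D. C p)"
    by (rule compactE_image[OF cF, of "frontier \<Omega>" C]) (use * in blast)+
  obtain e where e: "bij_betw e {0..<card D} D" using ex_bij_betw_nat_finite[OF D(2)] by blast
  have eD: "e i \<in> D" if "i < card D" for i using bij_betwE[OF e] that by auto
  have "\<exists>!\<sigma>. is_surface_measure (frontier \<Omega>) \<sigma>"
  proof (rule ex1_surface_measure[where N="card D" and V="\<lambda>i. V (e i)" and \<psi>="\<lambda>i. \<psi> (e i)"])
    show "closed (frontier \<Omega>)" by simp
    show "parametrization (frontier \<Omega>) (V (e i)) (\<psi> (e i))" if "i < card D" for i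
      using *[of "e i"] eD[OF that] D(1) by blast
    have eq: "\<psi> p ` V p = frontier \<Omega> \<inter> C p" if "p \<in> D" for p using * that D(1) by blast
    have "frontier \<Omega> = (\<Union>p\<in>D. \<psi> p ` V p)" using D(3) eq by auto
    also have "D = e ` {..<card D}" using bij_betw_imp_surj_on[OF e] by (simp add: lessThan_atLeast0)
    finally show "frontier \<Omega> = (\<Union>i<card D. \<psi> (e i) ` V (e i))" by simp
  qed
  then show ?thesis unfolding surface_measure_def by (rule theI')
qed

lemma continuous_on_X_T:
  fixes \<phi> :: "'n::finite heis \<Rightarrow> real"
  assumes C: "C_class 2 U \<phi>"
  shows "continuous_on U (X i \<phi>)" "continuous_on U (T \<phi>)"
proof -
  have "continuous_on U (\<lambda>x. Ds [hfield i 0] \<phi> x + hcoef i x * Ds [tvec] \<phi> x)"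
    by (intro continuous_on_add continuous_on_mult C_class_cont[OF C] linear_continuous_on[OF bounded_linear_hcoef]) simp_all
  then show "continuous_on U (X i \<phi>)"
    by (rule continuous_on_eq) (simp add: X_C_class_coords[OF C])
  have "continuous_on U (Ds [tvec] \<phi>)" by (rule C_class_cont[OF C]) simp
  then show "continuous_on U (T \<phi>)"
    by (rule continuous_on_eq) (simp add: X_C_class(2)[OF C])
qed

lemma continuous_on_locally:
  fixes g :: "'a::t2_space \<Rightarrow> 'b::t2_space"
  assumes "\<And>p. p \<in> S \<Longrightarrow> \<exists>U f. open U \<and> p \<in> U \<and> continuous_on (S \<inter> U) f \<and> (\<forall>q\<in>S \<inter> U. g q = f q)"
  shows "continuous_on S g"
  unfolding continuous_on_eq_continuous_within
proof
  fix p assume p: "p \<in> S"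
  then obtain U f where U: "open U" "p \<in> U" "continuous_on (S \<inter> U) f" "\<forall>q\<in>S \<inter> U. g q = f q"
    using assms by blast
  then have "continuous_on (S \<inter> U) g" using continuous_on_cong by (metis (no_types, lifting))
  then have "continuous (at p within (S \<inter> U)) g"
    using p U(2) continuous_on_eq_continuous_within by blast
  moreover have "at p within (S \<inter> U) = at p within S" by (rule at_within_nhd[OF U(2,1)]) auto
  ultimately show "continuous (at p within S) g" by (simp add: continuous_within)
qed

lemma continuous_on_riem_grad_norm:
  fixes \<phi> :: "'n::finite heis \<Rightarrow> real"
  assumes C: "C_class 2 U \<phi>"
  shows "continuous_on U (riem_grad_norm \<phi>)"
  unfolding riem_grad_norm_def by (intro continuous_intros continuous_on_X_T[OF C])

lemma defining_on_riem_grad_norm: "defining_on \<Omega> U \<phi> \<Longrightarrow> p \<in> U \<Longrightarrow> 0 < riem_grad_norm \<phi> p"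
  by (rule riem_grad_norm_pos) (simp add: defining_on_def)

text \<open>Although the normal is built from a pointwise choice, near each point it agrees with the
  continuous quotient formed from a single defining function.\<close>

lemma continuous_on_normal:
  fixes \<Omega> :: "'n::finite heis set"
  assumes O: "open \<Omega>" and C2: "C2_boundary \<Omega>"
  shows "continuous_on (frontier \<Omega>) (\<lambda>g. riem g (outer_normal \<Omega> g) (hfield i g))"
proof (rule continuous_on_locally)
  fix p assume p: "p \<in> frontier \<Omega>"
  obtain \<phi> U where d: "defining_on \<Omega> U \<phi>" "p \<in> U" by (rule C2_boundaryE[OF C2 p])
  have "continuous_on U (\<lambda>g. X i \<phi> g / riem_grad_norm \<phi> g)"
    using defining_on_riem_grad_norm[OF d(1)]
    by (intro continuous_on_divide continuous_on_X_T continuous_on_riem_grad_norm defining_onD(2)[OF d(1)])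
      (metis less_irrefl)
  then have "continuous_on (frontier \<Omega> \<inter> U) (\<lambda>g. X i \<phi> g / riem_grad_norm \<phi> g)"
    by (rule continuous_on_subset) blast
  then show "\<exists>U f. open U \<and> p \<in> U \<and> continuous_on (frontier \<Omega> \<inter> U) f \<and>
      (\<forall>q\<in>frontier \<Omega> \<inter> U. riem q (outer_normal \<Omega> q) (hfield i q) = f q)"
    using defining_onD(1)[OF d(1)] d(2) boundary_geometry(1)[OF d(1) O] by blast
qed

text \<open>The square of a positive part has a continuous first derivative, which is what a
  partition of unity for the divergence theorem needs.\<close>

definition bump :: "'n::finite heis \<Rightarrow> real \<Rightarrow> 'n heis \<Rightarrow> real" where
  "bump p r g = max 0 (r\<^sup>2 - (g - p) \<bullet> (g - p)) ^ 2"

definition bump_deriv :: "'n::finite heis \<Rightarrow> real \<Rightarrow> 'n heis \<Rightarrow> 'n heis \<Rightarrow> real" where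
  "bump_deriv p r v g = 2 * max 0 (r\<^sup>2 - (g - p) \<bullet> (g - p)) * (- 2 * ((g - p) \<bullet> v))"

lemma dalong_bump: "dalong V (bump p r) (bump_deriv p r (V g) g) g"
proof -
  have "((\<lambda>g. r\<^sup>2 - (g - p) \<bullet> (g - p)) has_derivative (\<lambda>y. - 2 * ((g - p) \<bullet> y))) (at g)"
    by (auto intro!: derivative_eq_intros simp: inner_commute)
  from dalong_compose[OF has_derivative_dalong[OF this, of V] max_power_has_derivative[of 0]]
  show ?thesis unfolding bump_def[abs_def] bump_deriv_def by (simp add: eval_nat_numeral)
qed

lemma continuous_on_bump: "continuous_on A (bump p r)"
  and continuous_on_bump_deriv: "continuous_on A V \<Longrightarrow> continuous_on A (\<lambda>g. bump_deriv p r (V g) g)"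
  unfolding bump_def[abs_def] bump_deriv_def by (intro continuous_intros | assumption)+

lemma bump_zero: "g \<notin> cball p r \<Longrightarrow> 0 < r \<Longrightarrow> bump p r g = 0"
  and bump_pos: "g \<in> ball p r \<Longrightarrow> 0 < bump p r g"
  and bump_nonneg: "0 \<le> bump p r g"
proof -
  have n: "(g - p) \<bullet> (g - p) = (dist p g)\<^sup>2"
    by (simp add: dist_norm norm_minus_commute power2_norm_eq_inner)
  show "bump p r g = 0" if "g \<notin> cball p r" "0 < r"
  proof -
    have "r\<^sup>2 \<le> (dist p g)\<^sup>2" using that by (intro power_mono) auto
    then show ?thesis unfolding bump_def n by simp
  qed
  show "0 < bump p r g" if "g \<in> ball p r"
  proof -
    have "(dist p g)\<^sup>2 < r\<^sup>2" using that by (intro power_strict_mono) auto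
    then show ?thesis unfolding bump_def n by simp
  qed
  show "0 \<le> bump p r g" by (simp add: bump_def)
qed

text \<open>For support inside the domain both sides are zero. In a patch the area element times the
  normal component is \<open>X i \<phi>\<close> over the slope, because the gradient length cancels;
  this is the integrand that the patch computation produced.\<close>

lemma divergence_chart:
  fixes \<Omega> :: "'n::finite heis set" and F DF :: "'n heis \<Rightarrow> real"
  assumes O: "open \<Omega>" and b: "bounded \<Omega>" and C2: "C2_boundary \<Omega>"
    and K: "compact K" "K \<subseteq> \<Omega> \<or> (\<exists>U \<phi> \<alpha> \<delta> Z c d h. graph_patch \<Omega> U \<phi> \<alpha> \<delta> Z c d h \<and> K \<subseteq> chart \<alpha> \<delta> ` (Z \<times> {c<..<d}))"
    and cF: "continuous_on (closure \<Omega>) F" and F0: "\<And>g. g \<in> closure \<Omega> - K \<Longrightarrow> F g = 0"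
    and dF: "\<And>g. g \<in> \<Omega> \<Longrightarrow> dalong (hfield i) F (DF g) g"
    and cD: "continuous_on \<Omega> DF" and bD: "\<And>g. g \<in> \<Omega> \<Longrightarrow> \<bar>DF g\<bar> \<le> B"
  defines "\<nu> \<equiv> \<lambda>g. riem g (outer_normal \<Omega> g) (hfield i g)"
  shows "set_integrable lborel \<Omega> DF"
    and "integrable (surface_measure (frontier \<Omega>)) (\<lambda>g. F g * \<nu> g)"
    and "(LINT g:\<Omega>|lborel. DF g) = (LINT g|surface_measure (frontier \<Omega>). F g * \<nu> g)"
proof -
  note \<sigma> = is_surface_measure_frontier[OF O b C2]
  have sp: "space (surface_measure (frontier \<Omega>)) = frontier \<Omega>"
    using sets_eq_imp_space_eq[of "surface_measure (frontier \<Omega>)" "restrict_space borel (frontier \<Omega>)"] \<sigma>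
    by (simp add: is_surface_measure_def space_restrict_space)
  have Fcl: "frontier \<Omega> \<subseteq> closure \<Omega>" by (auto simp: frontier_def)
  have "set_integrable lborel \<Omega> DF \<and> integrable (surface_measure (frontier \<Omega>)) (\<lambda>g. F g * \<nu> g) \<and>
     (LINT g:\<Omega>|lborel. DF g) = (LINT g|surface_measure (frontier \<Omega>). F g * \<nu> g)"
    using K(2)
  proof
    assume KO: "K \<subseteq> \<Omega>"
    have "F g * \<nu> g = 0" if "g \<in> frontier \<Omega>" for g
      using F0[of g] that KO O Fcl by (auto simp: frontier_def interior_open)
    then have z: "F g * \<nu> g = 0" if "g \<in> space (surface_measure (frontier \<Omega>))" for g using that sp by simp
    have "integrable (surface_measure (frontier \<Omega>)) (\<lambda>g. F g * \<nu> g)"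
      using Bochner_Integration.integrable_cong[OF refl z] by simp
    moreover have "(LINT g|surface_measure (frontier \<Omega>). F g * \<nu> g) = 0"
      using Bochner_Integration.integral_cong[OF refl z] by simp
    moreover have "F g = 0" if "g \<in> \<Omega> - K" for g using F0 closure_subset that by blast
    note integral_along_compact_support[OF shear_field_hfield O K(1) KO dF continuous_on_subset[OF cF closure_subset] cD this]
    ultimately show ?thesis by (simp only: simp_thms)
  next
    assume "\<exists>U \<phi> \<alpha> \<delta> Z c d h. graph_patch \<Omega> U \<phi> \<alpha> \<delta> Z c d h \<and> K \<subseteq> chart \<alpha> \<delta> ` (Z \<times> {c<..<d})"
    then obtain U \<phi> \<alpha> \<delta> Z c d h where patch: "graph_patch \<Omega> U \<phi> \<alpha> \<delta> Z c d h" and KC: "K \<subseteq> chart \<alpha> \<delta> ` (Z \<times> {c<..<d})"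
      by blast
    define \<psi> where "\<psi> = patch_point \<alpha> \<delta> h"
    note dp = divergence_patch[OF patch O K(1) KC cF F0 dF cD bD, folded \<psi>_def]
    note def = graph_patchD(1)[OF patch]
    note par = patch_parametrization[OF patch, folded \<psi>_def]
    have psi: "\<psi> z \<in> frontier \<Omega>" "\<psi> z \<in> U" if "z \<in> Z" for z
      using patch_point_in[OF patch that] by (simp_all add: \<psi>_def)
    have J: "sqrt (det (riem_gram \<psi> z)) = riem_grad_norm \<phi> (\<psi> z) / patch_slope \<phi> \<alpha> \<delta> (\<psi> z)" if "z \<in> Z" for z
      unfolding \<psi>_def by (rule patch_area[OF patch that])
    have Rp: "0 < riem_grad_norm \<phi> (\<psi> z)" if "z \<in> Z" for z by (rule defining_on_riem_grad_norm[OF def psi(2)[OF that]])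
    have sl: "0 < patch_slope \<phi> \<alpha> \<delta> (\<psi> z)" if "z \<in> Z" for z
      unfolding \<psi>_def by (rule patch_slope_pos[OF patch that])
    have eq: "sqrt (det (riem_gram \<psi> z)) * (F (\<psi> z) * \<nu> (\<psi> z)) = F (\<psi> z) * (X i \<phi> (\<psi> z) / patch_slope \<phi> \<alpha> \<delta> (\<psi> z))"
      if z: "z \<in> Z" for z
      unfolding J[OF z] \<nu>_def boundary_geometry(1)[OF def O psi[OF z]] using Rp[OF z] sl[OF z] by simp
    have Fn: "continuous_on (frontier \<Omega>) (\<lambda>g. F g * \<nu> g)"
      unfolding \<nu>_def by (intro continuous_on_mult continuous_on_subset[OF cF Fcl] continuous_on_normal[OF O C2])
    have si: "set_integrable lborel Z (\<lambda>z. sqrt (det (riem_gram \<psi> z)) * (F (\<psi> z) * \<nu> (\<psi> z)))"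
      using dp(2) by (rule set_integrable_cong[THEN iffD1, rotated 3]) (simp_all add: eq)
    have off: "F g * \<nu> g = 0" if "g \<in> frontier \<Omega> - \<psi> ` Z" for g
    proof -
      have "g \<notin> K" using that KC patch_image[OF patch] unfolding \<psi>_def by blast
      then show ?thesis using F0[of g] that Fcl by auto
    qed
    have J0: "0 \<le> sqrt (det (riem_gram \<psi> z))" if "z \<in> Z" for z
      unfolding J[OF that] using Rp[OF that] sl[OF that] by simp
    note sc = integral_surface_chart[OF frontier_closed \<sigma> par J0 borel_measurable_continuous_on_restrict[OF Fn] off si]
    have "(LINT g|surface_measure (frontier \<Omega>). F g * \<nu> g) =
       (LINT z:Z|lborel. F (\<psi> z) * (X i \<phi> (\<psi> z) / patch_slope \<phi> \<alpha> \<delta> (\<psi> z)))"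
    proof -
      have "(LINT g|surface_measure (frontier \<Omega>). F g * \<nu> g) =
         (LINT z:Z|lborel. sqrt (det (riem_gram \<psi> z)) * (F (\<psi> z) * \<nu> (\<psi> z)))" by (rule sc(2))
      also have "\<dots> = (LINT z:Z|lborel. F (\<psi> z) * (X i \<phi> (\<psi> z) / patch_slope \<phi> \<alpha> \<delta> (\<psi> z)))"
        by (rule set_lebesgue_integral_cong) (use graph_patchD(3)[OF patch] eq in simp_all)
      finally show ?thesis .
    qed
    then show ?thesis using dp(1,3) sc(1) by simp
  qed
  then show "set_integrable lborel \<Omega> DF" "integrable (surface_measure (frontier \<Omega>)) (\<lambda>g. F g * \<nu> g)"
    "(LINT g:\<Omega>|lborel. DF g) = (LINT g|surface_measure (frontier \<Omega>). F g * \<nu> g)" by blast+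
qed

text \<open>Compactness of the closure gives a finite cover by balls that lie in the domain or in a
  patch. The normalized bumps split \<open>F\<close> into pieces to which the local version applies,
  and the derivatives of the weights cancel in the sum.\<close>

theorem horizontal_divergence_theorem:
  fixes \<Omega> :: "'n::finite heis set" and F DF :: "'n heis \<Rightarrow> real"
  assumes O: "open \<Omega>" and b: "bounded \<Omega>" and C2: "C2_boundary \<Omega>"
    and cF: "continuous_on (closure \<Omega>) F"
    and dF: "\<And>g. g \<in> \<Omega> \<Longrightarrow> dalong (hfield i) F (DF g) g"
    and cD: "continuous_on \<Omega> DF" and bD: "\<And>g. g \<in> \<Omega> \<Longrightarrow> \<bar>DF g\<bar> \<le> B"
  defines "\<nu> \<equiv> \<lambda>g. riem g (outer_normal \<Omega> g) (hfield i g)"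
  shows "set_integrable lborel \<Omega> DF"
    and "integrable (surface_measure (frontier \<Omega>)) (\<lambda>g. F g * \<nu> g)"
    and "(LINT g:\<Omega>|lborel. DF g) = (LINT g|surface_measure (frontier \<Omega>). F g * \<nu> g)"
proof -
  have cc: "compact (closure \<Omega>)" using b by (simp add: compact_closure)
  have clO: "\<Omega> \<subseteq> closure \<Omega>" by (rule closure_subset)
  define good where "good K \<longleftrightarrow> K \<subseteq> \<Omega> \<or> (\<exists>U \<phi> \<alpha> \<delta> Z c d h. graph_patch \<Omega> U \<phi> \<alpha> \<delta> Z c d h \<and> K \<subseteq> chart \<alpha> \<delta> ` (Z \<times> {c<..<d}))" for K
  have "\<exists>r>0. good (cball p r)" if p: "p \<in> closure \<Omega>" for p
  proof (cases "p \<in> \<Omega>")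
    case True
    then obtain r where "r > 0" "cball p r \<subseteq> \<Omega>" using O unfolding open_contains_cball by blast
    then show ?thesis unfolding good_def by blast
  next
    case False
    then have p: "p \<in> frontier \<Omega>" using p O by (simp add: frontier_def interior_open)
    obtain \<phi> U where d: "defining_on \<Omega> U \<phi>" "p \<in> U" by (rule C2_boundaryE[OF C2 p])
    obtain \<alpha> \<delta> Z c d' h where *: "graph_patch \<Omega> U \<phi> \<alpha> \<delta> Z c d' h" "p \<in> chart \<alpha> \<delta> ` (Z \<times> {c<..<d'})"
      by (rule graph_patch_exists[OF d(1) O p d(2)])
    from open_patch[OF *(1)] *(2) obtain r where r: "r > 0" "cball p r \<subseteq> chart \<alpha> \<delta> ` (Z \<times> {c<..<d'})"
      unfolding open_contains_cball by blast
    have "good (cball p r)"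
      unfolding good_def by (rule disjI2, intro exI conjI, rule *(1), rule r(2))
    then show ?thesis using r(1) by blast
  qed
  then have "\<forall>p\<in>closure \<Omega>. \<exists>r. r > 0 \<and> good (cball p r)" by (rule ballI)
  from bchoice[OF this] obtain r where r': "\<forall>p\<in>closure \<Omega>. r p > 0 \<and> good (cball p (r p))" ..
  then have r: "\<And>p. p \<in> closure \<Omega> \<Longrightarrow> r p > 0" "\<And>p. p \<in> closure \<Omega> \<Longrightarrow> good (cball p (r p))" by blast+
  have "closure \<Omega> \<subseteq> (\<Union>p\<in>closure \<Omega>. ball p (r p))"
    by (rule subsetI, rule UN_I, assumption) (simp add: r(1))
  then obtain P where P: "P \<subseteq> closure \<Omega>" "finite P" "closure \<Omega> \<subseteq> (\<Union>p\<in>P. ball p (r p))"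
    by (rule compactE_image[OF cc, of "closure \<Omega>" "\<lambda>p. ball p (r p)", OF open_ball])
  define S where "S g = (\<Sum>p\<in>P. bump p (r p) g)" for g
  have S: "0 < S g" if g: "g \<in> closure \<Omega>" for g
  proof -
    obtain p where p: "p \<in> P" "g \<in> ball p (r p)" using P(3) g by blast
    show ?thesis unfolding S_def
      by (rule sum_pos2[where f="\<lambda>p. bump p (r p) g", OF P(2) p(1) bump_pos[OF p(2)] bump_nonneg])
  qed
  define DS where "DS g = (\<Sum>p\<in>P. bump_deriv p (r p) (hfield i g) g)" for g
  define \<eta> where "\<eta> p g = bump p (r p) g * inverse (S g)" for p g
  define D\<eta> where "D\<eta> p g = bump_deriv p (r p) (hfield i g) g * inverse (S g) + bump p (r p) g * (- (inverse (S g) ^ 2) * DS g)" for p g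
  have d\<eta>: "dalong (hfield i) (\<eta> p) (D\<eta> p g) g" if "g \<in> closure \<Omega>" for p g
  proof -
    have "dalong (hfield i) S (DS g) g" unfolding S_def[abs_def] DS_def by (intro dalong_sum dalong_bump)
    moreover have "(inverse has_real_derivative - (inverse (S g) ^ 2)) (at (S g))"
      using DERIV_inverse[of "S g" UNIV] S[OF that] by (simp add: power2_eq_square)
    ultimately have "dalong (hfield i) (\<lambda>g. inverse (S g)) (- (inverse (S g) ^ 2) * DS g) g" by (rule dalong_compose)
    then show ?thesis unfolding \<eta>_def[abs_def] D\<eta>_def by (rule dalong_mult[OF dalong_bump])
  qed
  have ch: "continuous_on A (hfield i)" for A by (rule shear_field_continuous[OF shear_field_hfield])
  have cS: "continuous_on A S" "continuous_on A DS" for A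
    unfolding S_def DS_def by (intro continuous_on_sum continuous_on_bump continuous_on_bump_deriv ch)+
  have cI: "continuous_on (closure \<Omega>) (\<lambda>g. inverse (S g))"
    using S by (intro continuous_on_inverse cS) (metis less_irrefl)
  have c\<eta>: "continuous_on (closure \<Omega>) (\<eta> p)" "continuous_on (closure \<Omega>) (D\<eta> p)" for p
    unfolding \<eta>_def D\<eta>_def
    by (intro continuous_on_add continuous_on_mult continuous_on_minus continuous_on_power continuous_on_bump continuous_on_bump_deriv ch cI cS)+
  have bnd: "\<exists>M. \<forall>g\<in>closure \<Omega>. \<bar>f g\<bar> \<le> M" if "continuous_on (closure \<Omega>) f" for f :: "'n heis \<Rightarrow> real"
    using compact_imp_bounded[OF compact_continuous_image[OF that cc]] by (auto simp: bounded_iff)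
  have part: "set_integrable lborel \<Omega> (\<lambda>g. DF g * \<eta> p g + F g * D\<eta> p g)"
    "integrable (surface_measure (frontier \<Omega>)) (\<lambda>g. F g * \<eta> p g * \<nu> g)"
    "(LINT g:\<Omega>|lborel. DF g * \<eta> p g + F g * D\<eta> p g) = (LINT g|surface_measure (frontier \<Omega>). F g * \<eta> p g * \<nu> g)"
    if p: "p \<in> P" for p
  proof -
    obtain M1 where M1: "\<And>g. g \<in> closure \<Omega> \<Longrightarrow> \<bar>\<eta> p g\<bar> \<le> M1" using bnd[OF c\<eta>(1)] by blast
    obtain M2 where M2: "\<And>g. g \<in> closure \<Omega> \<Longrightarrow> \<bar>F g * D\<eta> p g\<bar> \<le> M2"
      using bnd[OF continuous_on_mult[OF cF c\<eta>(2)]] by blast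
    have pc: "p \<in> closure \<Omega>" using p P(1) by blast
    have 1: "compact (cball p (r p))" by simp
    have 2: "continuous_on (closure \<Omega>) (\<lambda>g. F g * \<eta> p g)" by (intro continuous_on_mult cF c\<eta>)
    have 3: "F g * \<eta> p g = 0" if "g \<in> closure \<Omega> - cball p (r p)" for g
      using bump_zero[of g p "r p"] r(1)[OF pc] that by (simp add: \<eta>_def)
    have 4: "dalong (hfield i) (\<lambda>g. F g * \<eta> p g) (DF g * \<eta> p g + F g * D\<eta> p g) g" if "g \<in> \<Omega>" for g
      using dalong_mult[OF dF[OF that] d\<eta>] that clO by blast
    have 5: "continuous_on \<Omega> (\<lambda>g. DF g * \<eta> p g + F g * D\<eta> p g)"
      by (intro continuous_on_add continuous_on_mult cD continuous_on_subset[OF cF clO] continuous_on_subset[OF c\<eta>(1) clO]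
          continuous_on_subset[OF c\<eta>(2) clO])
    have 6: "\<bar>DF g * \<eta> p g + F g * D\<eta> p g\<bar> \<le> B * M1 + M2" if g: "g \<in> \<Omega>" for g
    proof -
      have gc: "g \<in> closure \<Omega>" using g clO by blast
      have "\<bar>DF g * \<eta> p g\<bar> \<le> B * M1"
        unfolding abs_mult using bD[OF g] M1[OF gc] by (intro mult_mono) auto
      then show ?thesis using M2[OF gc] by linarith
    qed
    have 7: "cball p (r p) \<subseteq> \<Omega> \<or> (\<exists>U \<phi> \<alpha> \<delta> Z c d h. graph_patch \<Omega> U \<phi> \<alpha> \<delta> Z c d h \<and>
        cball p (r p) \<subseteq> chart \<alpha> \<delta> ` (Z \<times> {c<..<d}))"
      using r(2)[OF pc] unfolding good_def .
    show "set_integrable lborel \<Omega> (\<lambda>g. DF g * \<eta> p g + F g * D\<eta> p g)"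
      by (rule divergence_chart(1)[OF O b C2 1 7 2 3 4 5 6])
    show "integrable (surface_measure (frontier \<Omega>)) (\<lambda>g. F g * \<eta> p g * \<nu> g)"
      unfolding \<nu>_def by (rule divergence_chart(2)[OF O b C2 1 7 2 3 4 5 6])
    show "(LINT g:\<Omega>|lborel. DF g * \<eta> p g + F g * D\<eta> p g) = (LINT g|surface_measure (frontier \<Omega>). F g * \<eta> p g * \<nu> g)"
      unfolding \<nu>_def by (rule divergence_chart(3)[OF O b C2 1 7 2 3 4 5 6])
  qed
  have one: "(\<Sum>p\<in>P. \<eta> p g) = 1" if "g \<in> closure \<Omega>" for g
    using S[OF that] unfolding \<eta>_def sum_distrib_right[symmetric] S_def[symmetric] by simp
  \<comment> \<open>The weights add up to one on the open set \<open>\<Omega>\<close>, so their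
    derivatives add up to zero there.\<close>
  have sumD: "(\<Sum>p\<in>P. DF g * \<eta> p g + F g * D\<eta> p g) = DF g" if g: "g \<in> \<Omega>" for g
  proof -
    have gc: "g \<in> closure \<Omega>" using g clO by blast
    have "dalong (hfield i) (\<lambda>g. \<Sum>p\<in>P. \<eta> p g) (\<Sum>p\<in>P. D\<eta> p g) g" by (intro dalong_sum d\<eta>[OF gc])
    moreover have "dalong (hfield i) (\<lambda>g. \<Sum>p\<in>P. \<eta> p g) 0 g"
      by (rule dalong_cong_open[OF O g, of "\<lambda>_. 1"]) (use one clO in \<open>auto simp: dalong_def\<close>)
    ultimately have "(\<Sum>p\<in>P. D\<eta> p g) = 0" using dalong_along by metis
    then show ?thesis
      unfolding sum.distrib sum_distrib_left[symmetric] one[OF gc] by simp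
  qed
  have sumF: "(\<Sum>p\<in>P. F g * \<eta> p g * \<nu> g) = F g * \<nu> g" if "g \<in> frontier \<Omega>" for g
  proof -
    have "(\<Sum>p\<in>P. F g * \<eta> p g * \<nu> g) = F g * (\<Sum>p\<in>P. \<eta> p g) * \<nu> g"
      by (simp only: sum_distrib_left sum_distrib_right)
    then show ?thesis using one[of g] that by (simp add: frontier_def)
  qed
  note \<sigma> = is_surface_measure_frontier[OF O b C2]
  have sp: "space (surface_measure (frontier \<Omega>)) = frontier \<Omega>"
    using sets_eq_imp_space_eq[of "surface_measure (frontier \<Omega>)" "restrict_space borel (frontier \<Omega>)"] \<sigma>
    by (simp add: is_surface_measure_def space_restrict_space)
  have sumF': "(\<Sum>p\<in>P. F g * \<eta> p g * \<nu> g) = F g * \<nu> g" if "g \<in> space (surface_measure (frontier \<Omega>))" for g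
    by (rule sumF) (use that sp in simp)
  have OB: "\<Omega> \<in> sets lborel" using O by simp
  have s1: "set_integrable lborel \<Omega> (\<lambda>g. \<Sum>p\<in>P. DF g * \<eta> p g + F g * D\<eta> p g)"
    using part(1) unfolding set_integrable_def scaleR_sum_right by (rule Bochner_Integration.integrable_sum)
  show si: "set_integrable lborel \<Omega> DF"
    by (rule iffD1[OF set_integrable_cong[OF refl refl sumD] s1])
  have i1: "integrable (surface_measure (frontier \<Omega>)) (\<lambda>g. \<Sum>p\<in>P. F g * \<eta> p g * \<nu> g)"
    by (rule Bochner_Integration.integrable_sum[OF part(2)])
  then show "integrable (surface_measure (frontier \<Omega>)) (\<lambda>g. F g * \<nu> g)"
    by (rule iffD1[OF Bochner_Integration.integrable_cong[OF refl sumF'], rotated])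
  have "(LINT g:\<Omega>|lborel. DF g) = (LINT g:\<Omega>|lborel. \<Sum>p\<in>P. DF g * \<eta> p g + F g * D\<eta> p g)"
    by (rule set_lebesgue_integral_cong[OF OB]) (simp add: sumD)
  also have "\<dots> = (\<Sum>p\<in>P. LINT g:\<Omega>|lborel. DF g * \<eta> p g + F g * D\<eta> p g)"
    using part(1) unfolding set_lebesgue_integral_def set_integrable_def scaleR_sum_right
    by (rule Bochner_Integration.integral_sum)
  also have "\<dots> = (\<Sum>p\<in>P. LINT g|surface_measure (frontier \<Omega>). F g * \<eta> p g * \<nu> g)"
    by (rule sum.cong[OF refl part(3)])
  also have "\<dots> = (LINT g|surface_measure (frontier \<Omega>). (\<Sum>p\<in>P. F g * \<eta> p g * \<nu> g))"
    by (rule Bochner_Integration.integral_sum[OF part(2), symmetric])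
  also have "\<dots> = (LINT g|surface_measure (frontier \<Omega>). F g * \<nu> g)"
    by (rule Bochner_Integration.integral_cong[OF refl]) (simp add: sumF sp)
  finally show "(LINT g:\<Omega>|lborel. DF g) = (LINT g|surface_measure (frontier \<Omega>). F g * \<nu> g)" .
qed

section \<open>Measurability of the mean curvature\<close>

lemma Ds_2_hfield:
  fixes f :: "'n::finite heis \<Rightarrow> real"
  assumes C: "C_class 2 U f" and U: "open U" "x \<in> U"
  shows "Ds [hfield i x, hfield j x] f x = Ds [hfield i 0, hfield j 0] f x + hcoef j x * Ds [hfield i 0, tvec] f x
    + hcoef i x * (Ds [tvec, hfield j 0] f x + hcoef j x * Ds [tvec, tvec] f x)"
proof -
  have l1: "linear (\<lambda>v. Ds [v, w] f x)" for w by (rule Ds_linear[OF C _ U(2)]) simp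
  have l2: "linear (\<lambda>w. Ds [v, w] f x)" for v by (rule Ds_2_linear_right[OF C U])
  show ?thesis
    unfolding hfield_eq[of i x] hfield_eq[of j x]
    by (simp only: linear_add[OF l1] linear_scale[OF l1] linear_add[OF l2] linear_scale[OF l2] real_scaleR_def)
      (simp add: algebra_simps del: Ds.simps)
qed

lemma continuous_on_Ds_2_hfield:
  fixes f :: "'n::finite heis \<Rightarrow> real"
  assumes C: "C_class 2 U f" and U: "open U"
  shows "continuous_on U (\<lambda>x. Ds [hfield i x, hfield j x] f x)"
proof -
  have "continuous_on U (\<lambda>x. Ds [hfield i 0, hfield j 0] f x + hcoef j x * Ds [hfield i 0, tvec] f x
    + hcoef i x * (Ds [tvec, hfield j 0] f x + hcoef j x * Ds [tvec, tvec] f x))"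
    by (intro continuous_on_add continuous_on_mult C_class_cont[OF C] linear_continuous_on[OF bounded_linear_hcoef]) simp_all
  then show ?thesis by (rule continuous_on_eq) (simp only: Ds_2_hfield[OF C U])
qed

lemma continuous_on_hcurv_expr:
  fixes \<Omega> :: "'n::finite heis set"
  assumes d: "defining_on \<Omega> U \<phi>"
  shows "continuous_on {g \<in> U. hgrad_norm \<phi> g \<noteq> 0} (hcurv_expr \<phi>)"
proof -
  note C = defining_onD(2)[OF d] and U = defining_onD(1)[OF d]
  have 1: "continuous_on U (hgrad_norm \<phi>)"
    unfolding hgrad_norm_def by (intro continuous_intros continuous_on_X_T[OF C])
  have "continuous_on U (\<lambda>p. \<Sum>i\<in>UNIV. Ds [hfield i p, hfield i p] \<phi> p)"
    by (intro continuous_on_sum continuous_on_Ds_2_hfield[OF C U])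
  then have 2: "continuous_on U (hlaplace \<phi>)"
    by (rule continuous_on_eq) (simp only: defining_on_hessian[OF d])
  have "continuous_on U (\<lambda>p. \<Sum>i\<in>UNIV. \<Sum>j\<in>UNIV. X i \<phi> p * X j \<phi> p * Ds [hfield i p, hfield j p] \<phi> p)"
    by (intro continuous_on_sum continuous_on_mult continuous_on_X_T[OF C] continuous_on_Ds_2_hfield[OF C U])
  then have 3: "continuous_on U (hinflaplace \<phi>)"
    by (rule continuous_on_eq) (simp only: defining_on_hessian[OF d])
  have s: "{g \<in> U. hgrad_norm \<phi> g \<noteq> 0} \<subseteq> U" by blast
  note 1 = continuous_on_subset[OF 1 s] and 2 = continuous_on_subset[OF 2 s] and 3 = continuous_on_subset[OF 3 s]
  show ?thesis unfolding hcurv_expr_def by (intro continuous_intros 1 2 3) simp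
qed

lemma continuous_on_angle_fun:
  fixes \<Omega> :: "'n::finite heis set"
  assumes O: "open \<Omega>" and C2: "C2_boundary \<Omega>"
  shows "continuous_on (frontier \<Omega>) (angle_fun \<Omega>)"
  unfolding angle_fun_def by (intro continuous_intros continuous_on_normal[OF O C2])

lemma closed_char_set:
  assumes O: "open \<Omega>" and C2: "C2_boundary \<Omega>"
  shows "closed (char_set \<Omega>)"
proof -
  have "char_set \<Omega> = frontier \<Omega> \<inter> angle_fun \<Omega> -` {0}" by (auto simp: char_set_def)
  then show ?thesis
    using continuous_closed_preimage[OF continuous_on_angle_fun[OF O C2] frontier_closed, of "{0}"] by simp
qed

lemma continuous_on_curvature:
  fixes \<Omega> :: "'n::finite heis set"
  assumes O: "open \<Omega>" and C2: "C2_boundary \<Omega>"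
  shows "continuous_on (frontier \<Omega> - char_set \<Omega>) (\<lambda>g. hcurv_expr (local_defining \<Omega> g) g)"
proof (rule continuous_on_locally)
  fix p assume "p \<in> frontier \<Omega> - char_set \<Omega>"
  then have p: "p \<in> frontier \<Omega>" by simp
  obtain \<phi> U where d: "defining_on \<Omega> U \<phi>" "p \<in> U" by (rule C2_boundaryE[OF C2 p])
  have "(frontier \<Omega> - char_set \<Omega>) \<inter> U \<subseteq> {g \<in> U. hgrad_norm \<phi> g \<noteq> 0}"
    using char_set_iff[OF d(1) O] by blast
  then have "continuous_on ((frontier \<Omega> - char_set \<Omega>) \<inter> U) (hcurv_expr \<phi>)"
    by (rule continuous_on_subset[OF continuous_on_hcurv_expr[OF d(1)]])
  moreover have "\<forall>q\<in>(frontier \<Omega> - char_set \<Omega>) \<inter> U. hcurv_expr (local_defining \<Omega> q) q = hcurv_expr \<phi> q"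
    using boundary_geometry(3)[OF d(1) O] by blast
  ultimately show "\<exists>V f. open V \<and> p \<in> V \<and> continuous_on ((frontier \<Omega> - char_set \<Omega>) \<inter> V) f \<and>
     (\<forall>q\<in>(frontier \<Omega> - char_set \<Omega>) \<inter> V. hcurv_expr (local_defining \<Omega> q) q = f q)"
    using defining_onD(1)[OF d(1)] d(2) by blast
qed

section \<open>Borel measurability through upper and lower limits\<close>

text \<open>
  The upper limit at points outside \<open>Y\<close> is Borel because the supremum over a ball around \<open>x\<close> is
  lower semicontinuous in \<open>x\<close>, whatever the function.
\<close>

lemma Limsup_within_nat:
  fixes f :: "'a::metric_space \<Rightarrow> ereal"
  assumes "x \<notin> Y"
  shows "Limsup (at x within Y) f = (INF n. SUP y\<in>Y \<inter> ball x (1 / real (Suc n)). f y)"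
proof -
  have eq: "Y \<inter> ball x e - {x} = Y \<inter> ball x e" for e using assms by auto
  show ?thesis unfolding Limsup_within eq
  proof (rule antisym)
    show "(INF e\<in>{0<..}. SUP y\<in>Y \<inter> ball x e. f y) \<le> (INF n. SUP y\<in>Y \<inter> ball x (1 / real (Suc n)). f y)"
      by (intro INF_mono bexI[where A="{0<..}"]) auto
    show "(INF n. SUP y\<in>Y \<inter> ball x (1 / real (Suc n)). f y) \<le> (INF e\<in>{0<..}. SUP y\<in>Y \<inter> ball x e. f y)"
    proof (rule INF_mono)
      fix e :: real assume "e \<in> {0<..}"
      then obtain n where "1 / real (Suc n) < e" using nat_approx_posE[of e] by (metis greaterThan_iff of_nat_Suc)
      then have "Y \<inter> ball x (1 / real (Suc n)) \<subseteq> Y \<inter> ball x e" by auto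
      then show "\<exists>n\<in>UNIV. (SUP y\<in>Y \<inter> ball x (1 / real (Suc n)). f y) \<le> (SUP y\<in>Y \<inter> ball x e. f y)"
        using SUP_subset_mono[of _ _ f f] by blast
    qed
  qed
qed

lemma borel_measurable_upper_envelope:
  fixes f :: "'a::metric_space \<Rightarrow> ereal"
  shows "(\<lambda>x. INF n. SUP y\<in>Y \<inter> ball x (1 / real (Suc n)). f y) \<in> borel_measurable borel"
proof (rule borel_measurable_INF)
  fix n :: nat
  show "(\<lambda>x. SUP y\<in>Y \<inter> ball x (1 / real (Suc n)). f y) \<in> borel_measurable borel"
  proof (rule borel_measurableI_greater)
    fix a :: ereal
    have eq: "{x \<in> space borel. a < (SUP y\<in>Y \<inter> ball x (1 / real (Suc n)). f y)} =
       (\<Union>y\<in>{y\<in>Y. a < f y}. ball y (1 / real (Suc n)))"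
      by (auto simp: less_SUP_iff dist_commute)
    show "{x \<in> space borel. a < (SUP y\<in>Y \<inter> ball x (1 / real (Suc n)). f y)} \<in> sets borel"
      unfolding eq by (rule borel_open) blast
  qed
qed simp

text \<open>Existence of a limit becomes equality of upper and lower limits, which can be treated as
  measurable functions. Infinite common limits match the default value because
  \<open>real_of_ereal\<close> maps them to 0.\<close>

lemma Lim_eq_Limsup:
  fixes h :: "'a \<Rightarrow> real"
  shows "(if \<exists>!L. (h \<longlongrightarrow> L) F then Lim F h else 0) =
     (if Limsup F (\<lambda>y. ereal (h y)) = Liminf F (\<lambda>y. ereal (h y))
      then real_of_ereal (Limsup F (\<lambda>y. ereal (h y))) else 0)"
\<comment> \<open>Along the trivial filter every number is a limit, so uniqueness fails; on the
  other side the upper limit is minus infinity and the lower one plus infinity, and both sides are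
  0.\<close>
proof (cases "F = bot")
  case True
  have "\<not> (\<exists>!L. (h \<longlongrightarrow> L) F)"
  proof
    assume "\<exists>!L. (h \<longlongrightarrow> L) F"
    moreover have "(h \<longlongrightarrow> 0) F" "(h \<longlongrightarrow> 1) F" unfolding True by simp_all
    ultimately have "(0::real) = 1" by blast
    then show False by simp
  qed
  then show ?thesis unfolding True by (simp add: top_ereal_def)
next
  case False
  note nt = False
  show ?thesis
  proof (cases "\<exists>L. (h \<longlongrightarrow> L) F")
    case True
    then obtain L where L: "(h \<longlongrightarrow> L) F" ..
    then have u: "\<exists>!L. (h \<longlongrightarrow> L) F" using tendsto_unique[OF nt] by blast
    have e: "((\<lambda>y. ereal (h y)) \<longlongrightarrow> ereal L) F" using L by simp
    have "Limsup F (\<lambda>y. ereal (h y)) = ereal L" "Liminf F (\<lambda>y. ereal (h y)) = ereal L"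
      using lim_imp_Limsup[OF nt e] lim_imp_Liminf[OF nt e] by auto
    then show ?thesis using u tendsto_Lim[OF nt L] by simp
  next
    case no: False
    have "real_of_ereal l = 0" if l: "Limsup F (\<lambda>y. ereal (h y)) = l" "Liminf F (\<lambda>y. ereal (h y)) = l" for l
    proof -
      have "((\<lambda>y. ereal (h y)) \<longlongrightarrow> l) F" using Liminf_eq_Limsup[OF nt l(2,1)] .
      then have "l \<noteq> ereal r" for r using no by auto
      then show ?thesis by (cases l) auto
    qed
    then show ?thesis using no by auto
  qed
qed

text \<open>Off the characteristic set the curvature is continuous. On that set, which is closed, it
  equals an expression in upper and lower limits taken from outside the set, and these are
  Borel.\<close>

lemma borel_measurable_hmean_curv:
  fixes \<Omega> :: "'n::finite heis set"
  assumes O: "open \<Omega>" and C2: "C2_boundary \<Omega>"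
  shows "hmean_curv \<Omega> \<in> borel_measurable (restrict_space borel (frontier \<Omega>))"
proof -
  define Y where "Y = frontier \<Omega> - char_set \<Omega>"
  define h where "h g = hcurv_expr (local_defining \<Omega> g) g" for g
  define ls where "ls x = (INF n. SUP y\<in>Y \<inter> ball x (1 / real (Suc n)). ereal (h y))" for x
  define li where "li x = - (INF n. SUP y\<in>Y \<inter> ball x (1 / real (Suc n)). - ereal (h y))" for x
  have [measurable]: "ls \<in> borel_measurable borel" unfolding ls_def by (rule borel_measurable_upper_envelope)
  have [measurable]: "li \<in> borel_measurable borel"
    unfolding li_def by (intro borel_measurable_uminus_ereal borel_measurable_upper_envelope)
  define q where "q x = (if ls x = li x then real_of_ereal (ls x) else 0)" for x
  have [measurable]: "q \<in> borel_measurable borel" unfolding q_def by measurable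
  have cs: "char_set \<Omega> \<in> sets borel" using closed_char_set[OF O C2] by simp
  have Ym: "Y \<in> sets borel" unfolding Y_def using cs by simp
  have 1: "(\<lambda>g. indicator Y g *\<^sub>R h g) \<in> borel_measurable borel"
    unfolding h_def Y_def by (rule borel_measurable_continuous_on_indicator[OF _ continuous_on_curvature[OF O C2]])
      (use cs in simp)
  have 2: "(\<lambda>g. indicator (char_set \<Omega>) g *\<^sub>R q g) \<in> borel_measurable borel" using cs by measurable
  have eq: "hmean_curv \<Omega> g = indicator Y g *\<^sub>R h g + indicator (char_set \<Omega>) g *\<^sub>R q g" if g: "g \<in> frontier \<Omega>" for g
  proof (cases "g \<in> char_set \<Omega>")
    case True
    then have gY: "g \<notin> Y" by (simp add: Y_def)
    have s: "Limsup (at g within Y) (\<lambda>y. ereal (h y)) = ls g"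
      unfolding ls_def by (rule Limsup_within_nat[OF gY])
    have i: "Liminf (at g within Y) (\<lambda>y. ereal (h y)) = li g"
      unfolding li_def Limsup_within_nat[OF gY, symmetric] ereal_Limsup_uminus by simp
    have "hmean_curv \<Omega> g = (if \<exists>!L. (h \<longlongrightarrow> L) (at g within Y) then Lim (at g within Y) h else 0)"
      using True unfolding hmean_curv_def Let_def h_def[abs_def] Y_def by simp
    also have "\<dots> = q g" unfolding Lim_eq_Limsup s i q_def ..
    finally show ?thesis using True gY by simp
  next
    case False
    then show ?thesis using g by (simp add: hmean_curv_def Let_def h_def Y_def)
  qed
  have "(\<lambda>g. indicator Y g *\<^sub>R h g + indicator (char_set \<Omega>) g *\<^sub>R q g) \<in> borel_measurable (restrict_space borel (frontier \<Omega>))"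
    by (rule measurable_restrict_space1) (intro borel_measurable_add 1 2)
  then show ?thesis
    by (rule measurable_cong[THEN iffD2, rotated]) (simp add: eq space_restrict_space)
qed

section \<open>The boundary flux\<close>

text \<open>\<open>extends_continuously\<close> only asserts that some extension exists, while the
  boundary term of the identity is written with \<open>Lim\<close>. This is the canonical extension
  that links the two.\<close>

definition boundary_value :: "'a::topological_space set \<Rightarrow> ('a \<Rightarrow> real) \<Rightarrow> 'a \<Rightarrow> real" where
  "boundary_value \<Omega> f p = (if p \<in> \<Omega> then f p else Lim (at p within \<Omega>) f)"

lemma boundary_value_inside [simp]: "p \<in> \<Omega> \<Longrightarrow> boundary_value \<Omega> f p = f p"
  by (simp add: boundary_value_def)

lemma boundary_value_eqI:
  fixes \<Omega> :: "'a::real_normed_vector set"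
  assumes O: "open \<Omega>" and p: "p \<in> frontier \<Omega>" and l: "(f \<longlongrightarrow> l) (at p within \<Omega>)"
  shows "boundary_value \<Omega> f p = l"
proof -
  have "p \<notin> \<Omega>" using O p by (simp add: frontier_def interior_open)
  then show ?thesis using tendsto_Lim[OF at_frontier_nontrivial[OF O p] l] by (simp add: boundary_value_def)
qed

lemma continuous_on_boundary_value:
  fixes \<Omega> :: "'a::real_normed_vector set"
  assumes O: "open \<Omega>" and e: "extends_continuously \<Omega> f"
  shows "continuous_on (closure \<Omega>) (boundary_value \<Omega> f)"
proof -
  obtain F where F: "continuous_on (closure \<Omega>) F" "\<And>g. g \<in> \<Omega> \<Longrightarrow> F g = f g"
    using e by (auto simp: extends_continuously_def)
  have "F p = boundary_value \<Omega> f p" if p: "p \<in> closure \<Omega>" for p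
  proof (cases "p \<in> \<Omega>")
    case True then show ?thesis using F by simp
  next
    case False
    then have fr: "p \<in> frontier \<Omega>" using p O by (simp add: frontier_def interior_open)
    have "(F \<longlongrightarrow> F p) (at p within closure \<Omega>)" using F(1) p by (simp add: continuous_on_def)
    then have "(F \<longlongrightarrow> F p) (at p within \<Omega>)" by (rule tendsto_within_subset) (rule closure_subset)
    then have "(f \<longlongrightarrow> F p) (at p within \<Omega>)"
      by (rule Lim_transform_eventually) (use F(2) in \<open>auto simp: eventually_at_filter\<close>)
    then show ?thesis using boundary_value_eqI[OF O fr] by simp
  qed
  then show ?thesis by (rule continuous_on_eq[OF F(1)])
qed

lemma boundary_value_tendsto:
  fixes \<Omega> :: "'a::real_normed_vector set"
  assumes O: "open \<Omega>" and e: "extends_continuously \<Omega> f" and p: "p \<in> frontier \<Omega>"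
  shows "(f \<longlongrightarrow> boundary_value \<Omega> f p) (at p within \<Omega>)"
proof -
  have "p \<in> closure \<Omega>" using p by (simp add: frontier_def)
  then have "(boundary_value \<Omega> f \<longlongrightarrow> boundary_value \<Omega> f p) (at p within closure \<Omega>)"
    using continuous_on_boundary_value[OF O e] by (simp add: continuous_on_def)
  then have "(boundary_value \<Omega> f \<longlongrightarrow> boundary_value \<Omega> f p) (at p within \<Omega>)"
    by (rule tendsto_within_subset) (rule closure_subset)
  then show ?thesis
    by (rule Lim_transform_eventually) (auto simp: eventually_at_filter)
qed

lemma extends_continuously_intros:
  shows "continuous_on (closure \<Omega>) f \<Longrightarrow> extends_continuously \<Omega> f"
    and "extends_continuously \<Omega> f \<Longrightarrow> extends_continuously \<Omega> h \<Longrightarrow> extends_continuously \<Omega> (\<lambda>x. f x + h x)"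
    and "extends_continuously \<Omega> f \<Longrightarrow> extends_continuously \<Omega> h \<Longrightarrow> extends_continuously \<Omega> (\<lambda>x. f x - h x)"
    and "extends_continuously \<Omega> f \<Longrightarrow> extends_continuously \<Omega> h \<Longrightarrow> extends_continuously \<Omega> (\<lambda>x. f x * h x)"
proof -
  show "continuous_on (closure \<Omega>) f \<Longrightarrow> extends_continuously \<Omega> f" unfolding extends_continuously_def by blast
  assume "extends_continuously \<Omega> f" "extends_continuously \<Omega> h"
  then obtain F H where *: "continuous_on (closure \<Omega>) F" "\<forall>g\<in>\<Omega>. F g = f g"
     "continuous_on (closure \<Omega>) H" "\<forall>g\<in>\<Omega>. H g = h g" unfolding extends_continuously_def by blast
  show "extends_continuously \<Omega> (\<lambda>x. f x + h x)" "extends_continuously \<Omega> (\<lambda>x. f x - h x)" "extends_continuously \<Omega> (\<lambda>x. f x * h x)"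
    unfolding extends_continuously_def using *(2,4)
    by (intro exI[of _ "\<lambda>x. F x + H x"] exI[of _ "\<lambda>x. F x - H x"] exI[of _ "\<lambda>x. F x * H x"] conjI
      continuous_on_add[OF *(1,3)] continuous_on_diff[OF *(1,3)] continuous_on_mult[OF *(1,3)]; simp)+
qed

lemma extends_continuously_sum:
  assumes "\<And>i. i \<in> I \<Longrightarrow> extends_continuously \<Omega> (f i)"
  shows "extends_continuously \<Omega> (\<lambda>x. \<Sum>i\<in>I. f i x)"
  using assms
proof (induction I rule: infinite_finite_induct)
  case (insert i I)
  then show ?case by (simp add: extends_continuously_intros(2))
qed (auto intro: extends_continuously_intros(1))

lemma extends_continuously_cong:
  "extends_continuously \<Omega> f \<Longrightarrow> (\<And>g. g \<in> \<Omega> \<Longrightarrow> f g = h g) \<Longrightarrow> extends_continuously \<Omega> h"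
  unfolding extends_continuously_def by (metis)

lemma extends_continuously_bounded:
  fixes \<Omega> :: "'a::euclidean_space set"
  assumes b: "bounded \<Omega>" and e: "extends_continuously \<Omega> f"
  obtains B where "\<And>g. g \<in> \<Omega> \<Longrightarrow> \<bar>f g\<bar> \<le> B"
proof -
  obtain F where F: "continuous_on (closure \<Omega>) F" "\<forall>g\<in>\<Omega>. F g = f g" using e unfolding extends_continuously_def by blast
  have "compact (F ` closure \<Omega>)"
    by (rule compact_continuous_image[OF F(1)]) (use b in \<open>simp add: compact_closure\<close>)
  then obtain B where "\<And>y. y \<in> F ` closure \<Omega> \<Longrightarrow> norm y \<le> B" using compact_imp_bounded bounded_iff by metis
  then have "\<And>g. g \<in> \<Omega> \<Longrightarrow> \<bar>F g\<bar> \<le> B" using closure_subset[of \<Omega>] by auto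
  then show ?thesis using that F(2) by auto
qed

lemma extends_continuously_continuous:
  "extends_continuously \<Omega> f \<Longrightarrow> continuous_on \<Omega> f"
  unfolding extends_continuously_def using closure_subset[of \<Omega>] continuous_on_subset continuous_on_eq by metis

lemma extends_continuously_integrable:
  fixes \<Omega> :: "'a::euclidean_space set"
  assumes O: "open \<Omega>" and b: "bounded \<Omega>" and e: "extends_continuously \<Omega> f"
  shows "set_integrable lborel \<Omega> f"
proof -
  obtain F where F: "continuous_on (closure \<Omega>) F" "\<forall>g\<in>\<Omega>. F g = f g" using e unfolding extends_continuously_def by blast
  have "set_integrable lborel (closure \<Omega>) F"
    unfolding set_integrable_def
    by (rule borel_integrable_compact[OF _ F(1)]) (use b in \<open>simp add: compact_closure\<close>)
  then have "set_integrable lborel \<Omega> F"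
    by (rule set_integrable_subset) (use O closure_subset in auto)
  then show ?thesis
    by (rule set_integrable_cong[THEN iffD1, rotated 3]) (use F(2) in auto)
qed

section \<open>The determinant for n = 1 and the integrated divergence\<close>

lemma det_UNIV_pair:
  fixes A :: "real ^ 'm::finite ^ 'm"
  assumes UNIV: "(UNIV :: 'm set) = {a, b}" "a \<noteq> b"
  shows "det A = A $ a $ a * A $ b $ b - A $ a $ b * A $ b $ a"
proof -
  have "{p. p permutes (UNIV :: 'm set)} = {id, Transposition.transpose a b}"
    unfolding UNIV(1) permutes_doubleton_iff by blast
  moreover have "id \<noteq> Transposition.transpose a b" using UNIV(2) by (metis id_apply transpose_apply_first)
  ultimately show ?thesis unfolding det_def using UNIV(2)
    by (simp add: UNIV(1) sign_id sign_swap_id)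
qed

text \<open>For a symmetric 2x2 matrix with entries a, b, b, d one has (a + d)^2 - a^2 - 2 b^2 - d^2
  = 2 (a d - b^2).\<close>

lemma det_hhess:
  fixes u :: "'n::finite heis \<Rightarrow> real"
  assumes "CARD('n) = 1"
  shows "(hlaplace u g)\<^sup>2 - hhess_normsq u g = 2 * det (hhess u g)"
proof -
  obtain c :: 'n where c: "UNIV = {c}" using assms by (rule card_1_singletonE)
  have U: "(UNIV :: ('n + 'n) set) = {Inl c, Inr c}" unfolding UNIV_sum c by blast
  have s: "hhess u g $ Inr c $ Inl c = hhess u g $ Inl c $ Inr c" by (simp add: hhess_def)
  have "hlaplace u g = hhess u g $ Inl c $ Inl c + hhess u g $ Inr c $ Inr c"
    unfolding hlaplace_def U by (simp add: hhess_def)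
  then show ?thesis
    unfolding hhess_normsq_def U
    by (simp add: det_UNIV_pair[OF U] s power2_eq_square algebra_simps)
qed

lemma integrands_integrable:
  assumes O: "open \<Omega>" and b: "bounded \<Omega>"
    and X: "\<And>i j. extends_continuously \<Omega> (X i (X j u))" and T: "extends_continuously \<Omega> (T u)"
  shows "set_integrable lborel \<Omega> (\<lambda>g. (hlaplace u g)\<^sup>2)" "set_integrable lborel \<Omega> (hhess_normsq u)"
    "set_integrable lborel \<Omega> (\<lambda>g. (T u g)\<^sup>2)"
proof -
  have h: "extends_continuously \<Omega> (\<lambda>g. hhess u g $ i $ j)" for i j
  proof -
    have "extends_continuously \<Omega> (\<lambda>g. 1 / 2 * (X i (X j u) g + X j (X i u) g))"
      by (intro extends_continuously_intros(2,4) X extends_continuously_intros(1)[OF continuous_on_const])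
    then show ?thesis by (simp add: hhess_def)
  qed
  show "set_integrable lborel \<Omega> (\<lambda>g. (hlaplace u g)\<^sup>2)" "set_integrable lborel \<Omega> (hhess_normsq u)"
    "set_integrable lborel \<Omega> (\<lambda>g. (T u g)\<^sup>2)"
    unfolding hlaplace_def hhess_normsq_def[abs_def] power2_eq_square
    by (intro extends_continuously_integrable[OF O b] extends_continuously_intros(4) extends_continuously_sum X T h)+
qed

lemma sum_integral_bochner_deriv:
  fixes u :: "'n::finite heis \<Rightarrow> real"
  assumes O: "open \<Omega>" and b: "bounded \<Omega>" and G: "Gamma_class 3 \<Omega> u" and C: "C_class 2 \<Omega> u"
    and X: "\<And>i j. extends_continuously \<Omega> (X i (X j u))" and T: "extends_continuously \<Omega> (T u)"
    and B: "\<And>j. set_integrable lborel \<Omega> (bochner_deriv u j)"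
  shows "(\<Sum>j\<in>UNIV. LINT g:\<Omega>|lborel. bochner_deriv u j g) =
    (LINT g:\<Omega>|lborel. (hlaplace u g)\<^sup>2) - (LINT g:\<Omega>|lborel. hhess_normsq u g)
      + 3 / 2 * real CARD('n) * (LINT g:\<Omega>|lborel. (T u g)\<^sup>2)"
proof -
  have "(\<Sum>j\<in>UNIV. LINT g:\<Omega>|lborel. bochner_deriv u j g) = (LINT g:\<Omega>|lborel. (\<Sum>j\<in>UNIV. bochner_deriv u j g))"
    using B unfolding set_lebesgue_integral_def set_integrable_def scaleR_sum_right
    by (subst Bochner_Integration.integral_sum) auto
  also have "\<dots> = (LINT g:\<Omega>|lborel. (hlaplace u g)\<^sup>2 - hhess_normsq u g + 3 / 2 * real CARD('n) * (T u g)\<^sup>2)"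
    by (rule set_lebesgue_integral_cong) (use O bochner_divergence[OF G C O] in auto)
  also have "\<dots> = (LINT g:\<Omega>|lborel. (hlaplace u g)\<^sup>2) - (LINT g:\<Omega>|lborel. hhess_normsq u g)
            + 3 / 2 * real CARD('n) * (LINT g:\<Omega>|lborel. (T u g)\<^sup>2)"
    using integrands_integrable[OF O b X T] by (simp add: set_integral_diff)
  finally show ?thesis .
qed

section \<open>The identity for functions vanishing on the boundary\<close>

context
  fixes \<Omega> :: "'n::finite heis set" and u :: "'n heis \<Rightarrow> real"
  assumes O: "open \<Omega>" and b: "bounded \<Omega>" and C2: "C2_boundary \<Omega>"
    and G: "Gamma_class_closure 3 \<Omega> u" and C: "C_class_closure 2 \<Omega> u" and z: "\<forall>g\<in>frontier \<Omega>. u g = 0"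
begin

lemma extends_Ds: "length vs \<le> 2 \<Longrightarrow> extends_continuously \<Omega> (Ds vs u)"
  using C by (simp add: C_class_closure_def)

lemma C_class_u: "C_class 2 \<Omega> u" and Gamma_class_u: "Gamma_class 3 \<Omega> u"
  using C G by (simp_all add: C_class_closure_def Gamma_class_closure_def)

lemma extends_X:
  "extends_continuously \<Omega> (X i u)" "extends_continuously \<Omega> (X i (X j u))"
  "extends_continuously \<Omega> (X i (X j (X k u)))" "extends_continuously \<Omega> (T u)" "extends_continuously \<Omega> (X i (T u))"
proof -
  have *: "length is \<le> 3 \<Longrightarrow> extends_continuously \<Omega> (Xs is u)" for "is"
    using G by (simp add: Gamma_class_closure_def)
  show "extends_continuously \<Omega> (X i u)" "extends_continuously \<Omega> (X i (X j u))"
    "extends_continuously \<Omega> (X i (X j (X k u)))"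
    using *[of "[i]"] *[of "[i, j]"] *[of "[i, j, k]"] by simp_all
  show "extends_continuously \<Omega> (T u)"
    by (rule extends_continuously_cong[OF extends_Ds[of "[tvec]"]]) (simp_all add: X_C_class(2)[OF C_class_u])
  have "Ds [hfield i x, tvec] u x = Ds [hfield i 0, tvec] u x + hcoef i x * Ds [tvec, tvec] u x" if x: "x \<in> \<Omega>" for x
  proof -
    have l: "linear (\<lambda>v. Ds [v, tvec] u x)" by (rule Ds_linear[OF C_class_u _ x]) simp
    show ?thesis unfolding hfield_eq[of i x] by (simp only: linear_add[OF l] linear_scale[OF l] real_scaleR_def)
  qed
  moreover have "extends_continuously \<Omega> (\<lambda>x. Ds [hfield i 0, tvec] u x + hcoef i x * Ds [tvec, tvec] u x)"
    by (intro extends_continuously_intros(2,4) extends_Ds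
      extends_continuously_intros(1)[OF linear_continuous_on[OF bounded_linear_hcoef]]) simp_all
  ultimately show "extends_continuously \<Omega> (X i (T u))"
    by (elim extends_continuously_cong) (simp add: X_T_C_class[OF C_class_u O] del: Ds.simps)
qed

lemma extends_bochner: "extends_continuously \<Omega> (bochner u j)" "extends_continuously \<Omega> (bochner_deriv u j)"
  unfolding bochner_def[abs_def] bochner_deriv_def[abs_def]
  by (intro extends_continuously_intros(2-4) extends_continuously_sum extends_X
      extends_continuously_intros(1)[OF continuous_on_const])+

private abbreviation (input) "ext_Ds vs \<equiv> boundary_value \<Omega> (Ds vs u)"

lemma C2_vanishing_u: "C2_vanishing \<Omega> UNIV u ext_Ds"
  unfolding C2_vanishing_def
proof (intro conjI allI impI ballI)
  show "C_class 2 (\<Omega> \<inter> UNIV) u" using C_class_u by simp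
  fix vs :: "'n heis list" assume "length vs \<le> 2"
  then show "continuous_on (closure \<Omega> \<inter> UNIV) (ext_Ds vs)"
    using continuous_on_boundary_value[OF O extends_Ds] by simp
next
  fix vs g assume "g \<in> \<Omega> \<inter> (UNIV :: 'n heis set)" then show "ext_Ds vs g = Ds vs u g" by simp
next
  fix q assume q: "q \<in> frontier \<Omega> \<inter> UNIV"
  have "continuous_on (closure \<Omega>) u" using C by (simp add: C_class_closure_def)
  then have "(u \<longlongrightarrow> u q) (at q within closure \<Omega>)" using q by (simp add: continuous_on_def frontier_def)
  then have "(u \<longlongrightarrow> u q) (at q within \<Omega>)" by (rule tendsto_within_subset) (rule closure_subset)
  then have "boundary_value \<Omega> u q = u q" using boundary_value_eqI[OF O] q by blast
  then show "ext_Ds [] q = 0" using z q by simp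
qed

lemma hcoef_tendsto: "(hcoef i \<longlongrightarrow> hcoef i p) (at p within S)"
  by (rule tendsto_within_subset[OF _ subset_UNIV])
    (use linear_continuous_at[OF bounded_linear_hcoef, of p i] in \<open>simp add: isCont_def\<close>)

text \<open>The direction \<open>hfield i g\<close> moves with \<open>g\<close>, so the limit is
  taken after expanding into fixed directions with continuous coefficients; linearity of the limit
  derivatives reassembles the frame vectors at \<open>p\<close>.\<close>

lemma boundary_value_X:
  assumes p: "p \<in> frontier \<Omega>"
  shows "boundary_value \<Omega> (X i u) p = ext_Ds [hfield i p] p"
    and "boundary_value \<Omega> (X i (X j u)) p = ext_Ds [hfield i p, hfield j p] p + structure_const i j / 2 * ext_Ds [tvec] p"
    and "boundary_value \<Omega> (T u) p = ext_Ds [tvec] p"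
proof -
  note lin = C2_vanishing_linear[OF C2_vanishing_u O open_UNIV p UNIV_I]
  have t: "length vs \<le> 2 \<Longrightarrow> (Ds vs u \<longlongrightarrow> ext_Ds vs p) (at p within \<Omega>)" for vs
    by (rule boundary_value_tendsto[OF O extends_Ds p])
  have ev: "\<forall>\<^sub>F g in at p within \<Omega>. P g" if "\<And>g. g \<in> \<Omega> \<Longrightarrow> P g" for P
    using that by (auto simp: eventually_at_filter)
  have tT: "(T u \<longlongrightarrow> ext_Ds [tvec] p) (at p within \<Omega>)"
    by (rule Lim_transform_eventually[OF t ev]) (simp_all add: X_C_class(2)[OF C_class_u])
  then show "boundary_value \<Omega> (T u) p = ext_Ds [tvec] p" by (rule boundary_value_eqI[OF O p])
  have "((\<lambda>g. Ds [hfield i 0] u g + hcoef i g * Ds [tvec] u g) \<longlongrightarrow> ext_Ds [hfield i 0] p + hcoef i p * ext_Ds [tvec] p) (at p within \<Omega>)"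
    by (intro tendsto_add tendsto_mult hcoef_tendsto t) simp_all
  also have "ext_Ds [hfield i 0] p + hcoef i p * ext_Ds [tvec] p = ext_Ds [hfield i p] p"
    unfolding hfield_eq[of i p] by (simp only: linear_add[OF lin(1)] linear_scale[OF lin(1)] real_scaleR_def)
  finally have "(X i u \<longlongrightarrow> ext_Ds [hfield i p] p) (at p within \<Omega>)"
    by (rule Lim_transform_eventually) (rule ev, simp add: X_C_class_coords[OF C_class_u] del: Ds.simps)
  then show "boundary_value \<Omega> (X i u) p = ext_Ds [hfield i p] p" by (rule boundary_value_eqI[OF O p])
  have "((\<lambda>x. Ds [hfield i 0, hfield j 0] u x + hcoef j x * Ds [hfield i 0, tvec] u x
    + hcoef i x * (Ds [tvec, hfield j 0] u x + hcoef j x * Ds [tvec, tvec] u x) + structure_const i j / 2 * T u x) \<longlongrightarrow>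
    ext_Ds [hfield i 0, hfield j 0] p + hcoef j p * ext_Ds [hfield i 0, tvec] p
    + hcoef i p * (ext_Ds [tvec, hfield j 0] p + hcoef j p * ext_Ds [tvec, tvec] p) + structure_const i j / 2 * ext_Ds [tvec] p) (at p within \<Omega>)"
    by (intro tendsto_add tendsto_mult tendsto_const hcoef_tendsto t tT) simp_all
  also have "ext_Ds [hfield i 0, hfield j 0] p + hcoef j p * ext_Ds [hfield i 0, tvec] p
    + hcoef i p * (ext_Ds [tvec, hfield j 0] p + hcoef j p * ext_Ds [tvec, tvec] p) = ext_Ds [hfield i p, hfield j p] p"
    unfolding hfield_eq[of i p] hfield_eq[of j p]
    by (simp only: linear_add[OF lin(2)] linear_scale[OF lin(2)] linear_add[OF lin(3)] linear_scale[OF lin(3)] real_scaleR_def)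
     (simp add: algebra_simps del: Ds.simps)
  finally have "(X i (X j u) \<longlongrightarrow> ext_Ds [hfield i p, hfield j p] p + structure_const i j / 2 * ext_Ds [tvec] p) (at p within \<Omega>)"
    by (rule Lim_transform_eventually) (rule ev, simp only: X_X_C_class[OF C_class_u O] Ds_2_hfield[OF C_class_u O])
  then show "boundary_value \<Omega> (X i (X j u)) p = ext_Ds [hfield i p, hfield j p] p + structure_const i j / 2 * ext_Ds [tvec] p"
    by (rule boundary_value_eqI[OF O p])
qed

lemma boundary_value_bochner:
  assumes p: "p \<in> frontier \<Omega>"
  shows "boundary_value \<Omega> (bochner u j) p =
    boundary_value \<Omega> (X j u) p * (\<Sum>i\<in>UNIV. boundary_value \<Omega> (X i (X i u)) p)
    - (\<Sum>i\<in>UNIV. boundary_value \<Omega> (X i u) p * boundary_value \<Omega> (X i (X j u)) p)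
    - boundary_value \<Omega> (T u) p * (\<Sum>i\<in>UNIV. structure_const i j * boundary_value \<Omega> (X i u) p)"
  by (rule boundary_value_eqI[OF O p], unfold bochner_def[abs_def])
    (intro tendsto_intros boundary_value_tendsto[OF O _ p] extends_X)

lemma hgrad_normsq_bdry_eq:
  assumes p: "p \<in> frontier \<Omega>"
  shows "hgrad_normsq_bdry \<Omega> u p = (\<Sum>i\<in>UNIV. (boundary_value \<Omega> (X i u) p)\<^sup>2)"
proof -
  have "p \<notin> \<Omega>" using O p by (auto simp: frontier_def interior_open)
  then show ?thesis by (simp add: hgrad_normsq_bdry_def boundary_value_def)
qed

text \<open>On the boundary \<open>X i u\<close> is \<open>a\<close> times
  \<open>X i \<phi>\<close>, so the flux is \<open>a / R\<close> times the curvature form of the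
  second derivatives of \<open>u\<close>, which brings in another factor \<open>a\<close>. The
  result \<open>a\<^sup>2 / R\<close> times the curvature numerator is regrouped as angle, curvature
  and squared gradient.\<close>

lemma boundary_flux:
  assumes p: "p \<in> frontier \<Omega>"
  shows "(\<Sum>j\<in>UNIV. boundary_value \<Omega> (bochner u j) p * riem p (outer_normal \<Omega> p) (hfield j p)) =
    angle_fun \<Omega> p * (hmean_curv \<Omega> p * hgrad_normsq_bdry \<Omega> u p)"
proof -
  obtain \<phi> U where d: "defining_on \<Omega> U \<phi>" "p \<in> U" by (rule C2_boundaryE[OF C2 p])
  define R where "R = riem_grad_norm \<phi> p"
  define N where "N i = X i \<phi> p" for i
  define Q where "Q i j = ext_Ds [hfield i p, hfield j p] p" for i j
  define t where "t = ext_Ds [tvec] p"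
  define g where "g = hgrad_norm \<phi> p"
  have g2: "g\<^sup>2 = (\<Sum>i\<in>UNIV. (N i)\<^sup>2)" by (simp add: g_def N_def hgrad_norm_squared)
  have \<nu>: "riem p (outer_normal \<Omega> p) (hfield j p) = N j / R" for j
    by (simp add: boundary_geometry(1)[OF d(1) O p d(2)] N_def R_def)
  have W: "angle_fun \<Omega> p = g / R" by (simp add: boundary_geometry(2)[OF d(1) O p d(2)] g_def R_def)
  show ?thesis
  proof (cases "g = 0")
    case True
    then have "N i = 0" for i using g2 by (simp add: sum_nonneg_eq_0_iff)
    then show ?thesis using True by (simp add: \<nu> W)
  next
    case False
    have v: "C2_vanishing \<Omega> U u ext_Ds"
      using C2_vanishing_u C_class_subset[OF C_class_u] unfolding C2_vanishing_def
      by (auto intro: continuous_on_subset)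
    obtain a where a: "\<And>v. ext_Ds [v] p = a * Ds [v] \<phi> p"
      and Qa: "g\<^sup>2 * (\<Sum>i\<in>UNIV. Q i i) - (\<Sum>i\<in>UNIV. \<Sum>j\<in>UNIV. N i * N j * Q i j)
       = a * (g\<^sup>2 * hlaplace \<phi> p - hinflaplace \<phi> p)"
      unfolding g_def Q_def N_def
      by (rule C2_vanishing_curvature[OF d(1) v O p d(2)]) blast
    have x: "boundary_value \<Omega> (X i u) p = a * N i" for i
      unfolding boundary_value_X[OF p] a N_def
      by (simp add: X_C_class(1)[OF defining_onD(2)[OF d(1)] _ d(2)] del: Ds.simps)
    have s0: "structure_const i i = 0" for i :: "'n + 'n" using structure_const_commute[of i i] by simp
    \<comment> \<open>This removes from the flux both the term with \<open>T u\<close> and the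
      antisymmetric part of \<open>X i (X j u)\<close>, as each meets the symmetric product
      \<open>N i N j\<close>.\<close>
    have anti: "(\<Sum>j\<in>UNIV. \<Sum>i\<in>UNIV. structure_const i j * (N i * N j)) = 0"
    proof -
      have "(\<Sum>j\<in>UNIV. \<Sum>i\<in>UNIV. structure_const i j * (N i * N j)) = (\<Sum>i\<in>UNIV. \<Sum>j\<in>UNIV. structure_const i j * (N i * N j))"
        by (rule sum.swap)
      also have "\<dots> = (\<Sum>i\<in>UNIV. \<Sum>j\<in>UNIV. - (structure_const j i * (N j * N i)))"
        by (intro sum.cong refl) (subst structure_const_commute, simp only: mult_minus_left mult.commute)
      finally show ?thesis by (simp add: sum_negf)
    qed
    \<comment> \<open>The coefficient 3/2 combines 1 from the explicit \<open>T u\<close> term of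
      the field and 1/2 from the antisymmetric part of \<open>X i (X j u)\<close>.\<close>
    have B: "boundary_value \<Omega> (bochner u j) p * (N j / R) =
        a / R * ((N j)\<^sup>2 * (\<Sum>i\<in>UNIV. Q i i)) - a / R * (\<Sum>i\<in>UNIV. N i * N j * Q i j)
        - (3 / 2 * t * a / R) * (\<Sum>i\<in>UNIV. structure_const i j * (N i * N j))" for j
    proof -
      have e1: "(\<Sum>i\<in>UNIV. a * N i * (Q i j + structure_const i j / 2 * t)) * N j =
          a * (\<Sum>i\<in>UNIV. N i * N j * Q i j) + t / 2 * a * (\<Sum>i\<in>UNIV. structure_const i j * (N i * N j))"
        unfolding sum_distrib_left sum_distrib_right sum.distrib[symmetric]
        by (intro sum.cong refl) (simp add: algebra_simps)
      have e2: "t * (\<Sum>i\<in>UNIV. structure_const i j * (a * N i)) * N j = t * a * (\<Sum>i\<in>UNIV. structure_const i j * (N i * N j))"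
        unfolding sum_distrib_left sum_distrib_right
        by (intro sum.cong refl) (simp add: algebra_simps)
      have e3: "boundary_value \<Omega> (bochner u j) p =
        a * N j * (\<Sum>i\<in>UNIV. Q i i) - (\<Sum>i\<in>UNIV. a * N i * (Q i j + structure_const i j / 2 * t))
        - t * (\<Sum>i\<in>UNIV. structure_const i j * (a * N i))"
        unfolding boundary_value_bochner[OF p] x boundary_value_X(2,3)[OF p] Q_def[symmetric] t_def[symmetric]
        by (simp add: s0)
      have "boundary_value \<Omega> (bochner u j) p * N j = a * ((N j)\<^sup>2 * (\<Sum>i\<in>UNIV. Q i i))
        - a * (\<Sum>i\<in>UNIV. N i * N j * Q i j) - 3 / 2 * t * a * (\<Sum>i\<in>UNIV. structure_const i j * (N i * N j))"
        unfolding e3 left_diff_distrib e1 e2 by (simp add: power2_eq_square algebra_simps)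
      then show ?thesis by (simp add: diff_divide_distrib)
    qed
    have "(\<Sum>j\<in>UNIV. boundary_value \<Omega> (bochner u j) p * (N j / R)) =
       a / R * (g\<^sup>2 * (\<Sum>i\<in>UNIV. Q i i)) - a / R * (\<Sum>j\<in>UNIV. \<Sum>i\<in>UNIV. N i * N j * Q i j)
       - (3 / 2 * t * a / R) * (\<Sum>j\<in>UNIV. \<Sum>i\<in>UNIV. structure_const i j * (N i * N j))"
      unfolding B sum_subtractf sum_distrib_left[symmetric] sum_distrib_right[symmetric] g2 by simp
    also have "(\<Sum>j\<in>UNIV. \<Sum>i\<in>UNIV. N i * N j * Q i j) = (\<Sum>i\<in>UNIV. \<Sum>j\<in>UNIV. N i * N j * Q i j)"
      by (rule sum.swap)
    also have "a / R * (g\<^sup>2 * (\<Sum>i\<in>UNIV. Q i i)) - a / R * (\<Sum>i\<in>UNIV. \<Sum>j\<in>UNIV. N i * N j * Q i j)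
       - (3 / 2 * t * a / R) * (\<Sum>j\<in>UNIV. \<Sum>i\<in>UNIV. structure_const i j * (N i * N j)) =
       a / R * (a * (g\<^sup>2 * hlaplace \<phi> p - hinflaplace \<phi> p))"
      unfolding anti Qa[symmetric] by (simp add: right_diff_distrib)
    finally have L: "(\<Sum>j\<in>UNIV. boundary_value \<Omega> (bochner u j) p * (N j / R)) =
       a / R * (a * (g\<^sup>2 * hlaplace \<phi> p - hinflaplace \<phi> p))" .
    have n: "p \<notin> char_set \<Omega>" using False char_set_iff[OF d(1) O p d(2)] by (simp add: g_def)
    have m: "hmean_curv \<Omega> p = (g\<^sup>2 * hlaplace \<phi> p - hinflaplace \<phi> p) / g ^ 3"
      unfolding hmean_curv_noncharacteristic[OF d(1) O p d(2) n] hcurv_expr_def g_def ..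
    have q: "hgrad_normsq_bdry \<Omega> u p = a\<^sup>2 * g\<^sup>2"
      unfolding hgrad_normsq_bdry_eq[OF p] x g2 by (simp add: power_mult_distrib sum_distrib_left)
    have "g / R * (Y / g ^ 3 * (a\<^sup>2 * g\<^sup>2)) = a / R * (a * Y)" for Y
      using False by (simp add: power2_eq_square power3_eq_cube)
    from this[symmetric] show ?thesis unfolding \<nu> L W m q .
  qed
qed

text \<open>The curvature may blow up at characteristic points, so integrability against the
  perimeter measure is drawn from the flux, whose summands are integrable by the divergence theorem.
  The sign claim holds because the other two factors of the integrand, angle and squared gradient,
  are nonnegative.\<close>

lemma integral_identity:
  defines "K \<equiv> \<lambda>g. hmean_curv \<Omega> g * hgrad_normsq_bdry \<Omega> u g"
  shows "integrable (hperimeter \<Omega>) K"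
    and "(LINT g:\<Omega>|lborel. (hlaplace u g)\<^sup>2) - (LINT g:\<Omega>|lborel. hhess_normsq u g)
            + 3 / 2 * real CARD('n) * (LINT g:\<Omega>|lborel. (T u g)\<^sup>2) = (LINT g|hperimeter \<Omega>. K g)"
    and "(\<forall>g\<in>frontier \<Omega>. 0 \<le> hmean_curv \<Omega> g) \<Longrightarrow> 0 \<le> (LINT g|hperimeter \<Omega>. K g)"
proof -
  define \<sigma> where "\<sigma> = surface_measure (frontier \<Omega>)"
  define \<nu> where "\<nu> j g = riem g (outer_normal \<Omega> g) (hfield j g)" for j g
  define B where "B j = boundary_value \<Omega> (bochner u j)" for j
  have sets: "sets \<sigma> = sets (restrict_space borel (frontier \<Omega>))"
    using is_surface_measure_frontier[OF O b C2] by (simp add: is_surface_measure_def \<sigma>_def)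
  have space: "space \<sigma> = frontier \<Omega>" using sets_eq_imp_space_eq[OF sets] by (simp add: space_restrict_space)
  have meas: "f \<in> borel_measurable \<sigma> \<longleftrightarrow> f \<in> borel_measurable (restrict_space borel (frontier \<Omega>))" for f :: "'n heis \<Rightarrow> real"
    by (rule arg_cong[OF measurable_cong_sets[OF sets refl]])
  have div: "set_integrable lborel \<Omega> (bochner_deriv u j) \<and> integrable \<sigma> (\<lambda>g. B j g * \<nu> j g) \<and>
     (LINT g:\<Omega>|lborel. bochner_deriv u j g) = (LINT g|\<sigma>. B j g * \<nu> j g)" for j
  proof -
    obtain M where M: "\<And>g. g \<in> \<Omega> \<Longrightarrow> \<bar>bochner_deriv u j g\<bar> \<le> M"
      using extends_continuously_bounded[OF b extends_bochner(2)] by blast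
    have "dalong (hfield j) (B j) (bochner_deriv u j g) g" if g: "g \<in> \<Omega>" for g
      by (rule dalong_cong_open[OF O g _ dalong_bochner[OF Gamma_class_u C_class_u O g]]) (simp add: B_def)
    note * = horizontal_divergence_theorem[OF O b C2 continuous_on_boundary_value[OF O extends_bochner(1)] this[unfolded B_def]
        extends_continuously_continuous[OF extends_bochner(2)] M]
    show ?thesis using * unfolding B_def \<nu>_def \<sigma>_def by blast
  qed
  have flux: "(\<Sum>j\<in>UNIV. B j g * \<nu> j g) = angle_fun \<Omega> g *\<^sub>R K g" if "g \<in> frontier \<Omega>" for g
    using boundary_flux[OF that] by (simp add: B_def \<nu>_def K_def)
  have i1: "integrable \<sigma> (\<lambda>g. \<Sum>j\<in>UNIV. B j g * \<nu> j g)" using div by (intro Bochner_Integration.integrable_sum) blast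
  then have i2: "integrable \<sigma> (\<lambda>g. angle_fun \<Omega> g *\<^sub>R K g)"
    by (rule Bochner_Integration.integrable_cong[THEN iffD1, rotated 2]) (simp_all add: space flux)
  have a: "angle_fun \<Omega> \<in> borel_measurable \<sigma>"
    unfolding meas by (rule borel_measurable_continuous_on_restrict[OF continuous_on_angle_fun[OF O C2]])
  have "continuous_on (frontier \<Omega>) (\<lambda>g. \<Sum>i\<in>UNIV. (boundary_value \<Omega> (X i u) g)\<^sup>2)"
    by (intro continuous_intros continuous_on_subset[OF continuous_on_boundary_value[OF O extends_X(1)]])
      (simp add: frontier_def)
  then have "continuous_on (frontier \<Omega>) (hgrad_normsq_bdry \<Omega> u)"
    by (rule continuous_on_eq) (simp add: hgrad_normsq_bdry_eq)
  then have K: "K \<in> borel_measurable \<sigma>"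
    unfolding K_def meas
    by (intro borel_measurable_times borel_measurable_hmean_curv[OF O C2] borel_measurable_continuous_on_restrict)
  have nn: "0 \<le> angle_fun \<Omega> g" for g by (simp add: angle_fun_def sum_nonneg)
  show "integrable (hperimeter \<Omega>) K"
    unfolding hperimeter_def \<sigma>_def[symmetric] using i2 by (subst integrable_density[OF K a]) (simp_all add: nn)
  have eq: "(LINT g|hperimeter \<Omega>. K g) = (LINT g|\<sigma>. angle_fun \<Omega> g *\<^sub>R K g)"
    unfolding hperimeter_def \<sigma>_def[symmetric] by (rule integral_density[OF K a]) (simp add: nn)
  have "(LINT g|\<sigma>. angle_fun \<Omega> g *\<^sub>R K g) = (LINT g|\<sigma>. (\<Sum>j\<in>UNIV. B j g * \<nu> j g))"
    by (rule Bochner_Integration.integral_cong) (simp_all add: space flux)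
  also have "\<dots> = (\<Sum>j\<in>UNIV. LINT g|\<sigma>. B j g * \<nu> j g)" using div by (intro Bochner_Integration.integral_sum) blast
  also have "\<dots> = (\<Sum>j\<in>UNIV. LINT g:\<Omega>|lborel. bochner_deriv u j g)" using div by simp
  also have "\<dots> = (LINT g:\<Omega>|lborel. (hlaplace u g)\<^sup>2) - (LINT g:\<Omega>|lborel. hhess_normsq u g)
            + 3 / 2 * real CARD('n) * (LINT g:\<Omega>|lborel. (T u g)\<^sup>2)"
    using sum_integral_bochner_deriv[OF O b Gamma_class_u C_class_u extends_X(2,4)] div by blast
  finally show "(LINT g:\<Omega>|lborel. (hlaplace u g)\<^sup>2) - (LINT g:\<Omega>|lborel. hhess_normsq u g)
            + 3 / 2 * real CARD('n) * (LINT g:\<Omega>|lborel. (T u g)\<^sup>2) = (LINT g|hperimeter \<Omega>. K g)"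
    unfolding eq ..
  assume "\<forall>g\<in>frontier \<Omega>. 0 \<le> hmean_curv \<Omega> g"
  then show "0 \<le> (LINT g|hperimeter \<Omega>. K g)"
    unfolding eq by (intro Bochner_Integration.integral_nonneg_AE AE_I2)
      (simp add: space K_def nn hgrad_normsq_bdry_eq sum_nonneg)
qed

lemma integral_det:
  assumes "CARD('n) = 1"
  shows "(LINT g:\<Omega>|lborel. (hlaplace u g)\<^sup>2) - (LINT g:\<Omega>|lborel. hhess_normsq u g) = 2 * (LINT g:\<Omega>|lborel. det (hhess u g))"
proof -
  note i = integrands_integrable[OF O b extends_X(2,4)]
  have "(LINT g:\<Omega>|lborel. (hlaplace u g)\<^sup>2) - (LINT g:\<Omega>|lborel. hhess_normsq u g) =
     (LINT g:\<Omega>|lborel. (hlaplace u g)\<^sup>2 - hhess_normsq u g)"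
    using i by (simp add: set_integral_diff)
  also have "\<dots> = (LINT g:\<Omega>|lborel. 2 * det (hhess u g))"
    by (simp add: det_hhess[OF assms])
  finally show ?thesis by simp
qed

end

section \<open>Test functions\<close>

lemma Ds_append: "Ds (vs @ ws) f = Ds vs (Ds ws f)"
  by (induction vs) simp_all

lemma Ds_cong_open:
  assumes U: "open U" and eq: "\<And>x. x \<in> U \<Longrightarrow> f x = g x" and x: "x \<in> U"
  shows "Ds vs f x = Ds vs g x"
  using x
proof (induction vs arbitrary: x)
  case (Cons v vs)
  have "(Ds vs f has_derivative D) (at x) \<longleftrightarrow> (Ds vs g has_derivative D) (at x)" for D
    using has_derivative_transform_within_open[OF _ U Cons.prems, of "Ds vs f" D UNIV "Ds vs g"]
      has_derivative_transform_within_open[OF _ U Cons.prems, of "Ds vs g" D UNIV "Ds vs f"]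
    by (auto simp: Cons.IH)
  then show ?case by (simp add: frechet_derivative_def)
qed (use eq in simp)

lemma C_class_cong_open:
  assumes U: "open U" and eq: "\<And>x. x \<in> U \<Longrightarrow> f x = g x" and C: "C_class k U f"
  shows "C_class k U g"
proof -
  note D = Ds_cong_open[OF U eq]
  have "Ds vs g differentiable (at x)" if "x \<in> U" "length vs < k" for vs x
  proof -
    have "(Ds vs g has_derivative (\<lambda>v. Ds (v # vs) f x)) (at x)"
      by (rule has_derivative_transform_within_open[OF C_classD[OF C that(2,1)] U that(1)]) (rule D)
    then show ?thesis by (rule differentiableI)
  qed
  moreover have "continuous_on U (Ds vs g)" if "length vs \<le> k" for vs
    by (rule continuous_on_eq[OF C_class_cont[OF C that]]) (rule D)
  ultimately show ?thesis by (simp add: C_class_def)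
qed

text \<open>\<open>Ds\<close> applies the head of its list last. Splitting off the last element, the
  direction differentiated first, reduces the order by one and is the form in which sums and
  products are handled by induction.\<close>

lemma C_class_Suc:
  "C_class (Suc k) U f \<longleftrightarrow> continuous_on U f \<and> (\<forall>x\<in>U. f differentiable (at x)) \<and> (\<forall>v. C_class k U (Ds [v] f))"
proof -
  have s: "Ds (ws @ [v]) f = Ds ws (Ds [v] f)" for ws v by (rule Ds_append)
  have all: "(\<forall>vs. P vs) \<longleftrightarrow> P [] \<and> (\<forall>ws v. P (ws @ [v]))" for P :: "'a list \<Rightarrow> bool"
    by (metis rev_exhaust)
  show ?thesis
    unfolding C_class_def by (subst (1 2) all) (auto simp: s simp del: Ds.simps(2))
qed

lemma C_class_0: "C_class 0 U f \<longleftrightarrow> continuous_on U f"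
  by (auto simp: C_class_def)

lemma C_class_mono: "C_class k U f \<Longrightarrow> j \<le> k \<Longrightarrow> C_class j U f"
  by (simp add: C_class_def)

lemma C_class_const: "C_class k U (\<lambda>x. c)"
proof (induction k arbitrary: c)
  case (Suc k)
  have "Ds [v] (\<lambda>x::'a. c) = (\<lambda>x. 0)" for v by simp
  with Suc show ?case by (simp add: C_class_Suc del: Ds.simps)
qed (simp add: C_class_0)

lemma C_class_linear:
  assumes "bounded_linear l" shows "C_class k U l"
proof (cases k)
  case 0
  then show ?thesis using linear_continuous_on[OF assms] by (simp add: C_class_0)
next
  case (Suc j)
  have "Ds [v] l = (\<lambda>x. l v)" for v
    using frechet_derivative_at[OF bounded_linear_imp_has_derivative[OF assms]] by (simp add: fun_eq_iff)
  then have "C_class j U (Ds [v] l)" for v by (simp only: C_class_const)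
  then show ?thesis
    unfolding Suc C_class_Suc
    using linear_continuous_on[OF assms] bounded_linear_imp_differentiable[OF assms] by blast
qed

lemma C_class_add:
  assumes U: "open U" and C: "C_class k U f" "C_class k U g"
  shows "C_class k U (\<lambda>x. f x + g x)"
  using C
proof (induction k arbitrary: f g)
  case 0
  then show ?case by (simp add: C_class_0 continuous_on_add)
next
  case (Suc k)
  have "C_class k U (Ds [v] (\<lambda>x. f x + g x))" for v
  proof (rule C_class_cong_open[OF U])
    show "C_class k U (\<lambda>x. Ds [v] f x + Ds [v] g x)"
      by (rule Suc.IH) (use Suc.prems in \<open>simp_all add: C_class_Suc del: Ds.simps\<close>)
    fix x assume x: "x \<in> U"
    show "Ds [v] f x + Ds [v] g x = Ds [v] (\<lambda>x. f x + g x) x"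
      using frechet_derivative_at[OF has_derivative_add[OF C_class_1D[OF Suc.prems(1) _ x] C_class_1D[OF Suc.prems(2) _ x]]]
      by (simp add: fun_eq_iff)
  qed
  with Suc.prems show ?case
    by (simp add: C_class_Suc continuous_on_add del: Ds.simps)
qed

lemma C_class_mult:
  fixes f g :: "'a::real_normed_vector \<Rightarrow> real"
  assumes U: "open U" and C: "C_class k U f" "C_class k U g"
  shows "C_class k U (\<lambda>x. f x * g x)"
  using C
proof (induction k arbitrary: f g)
  case 0
  then show ?case by (simp add: C_class_0 continuous_on_mult)
next
  case (Suc k)
  have "C_class k U (Ds [v] (\<lambda>x. f x * g x))" for v
  proof (rule C_class_cong_open[OF U])
    show "C_class k U (\<lambda>x. f x * Ds [v] g x + Ds [v] f x * g x)"
      by (intro C_class_add[OF U] Suc.IH C_class_mono[OF Suc.prems(1)] C_class_mono[OF Suc.prems(2)])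
        (use Suc.prems in \<open>simp_all add: C_class_Suc del: Ds.simps\<close>)
    fix x assume x: "x \<in> U"
    show "f x * Ds [v] g x + Ds [v] f x * g x = Ds [v] (\<lambda>x. f x * g x) x"
      using frechet_derivative_at[OF has_derivative_mult[OF C_class_1D[OF Suc.prems(1) _ x] C_class_1D[OF Suc.prems(2) _ x]]]
      by (simp add: fun_eq_iff)
  qed
  with Suc.prems show ?case
    by (simp add: C_class_Suc continuous_on_mult del: Ds.simps)
qed

lemma C_class_Ds: "C_class (Suc k) U f \<Longrightarrow> C_class k U (Ds [v] f)"
  unfolding C_class_Suc by blast

lemma C_class_X:
  assumes U: "open U" and C: "C_class (Suc k) U f"
  shows "C_class k U (X i f)"
proof (rule C_class_cong_open[OF U])
  show "C_class k U (\<lambda>x. Ds [hfield i 0] f x + hcoef i x * Ds [tvec] f x)"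
    by (intro C_class_add[OF U] C_class_mult[OF U] C_class_linear[OF bounded_linear_hcoef] C_class_Ds[OF C])
qed (simp add: X_C_class_coords[OF C] del: Ds.simps)

lemma C_class_T:
  assumes U: "open U" and C: "C_class (Suc k) U f"
  shows "C_class k U (T f)"
  by (rule C_class_cong_open[OF U _ C_class_Ds[OF C, of tvec]]) (simp add: X_C_class(2)[OF C] del: Ds.simps)

lemma C_class_Xs:
  assumes U: "open U" and C: "C_class (length is + k) U f"
  shows "C_class k U (Xs is f)"
  using C by (induction "is" arbitrary: k) (simp_all add: C_class_X[OF U])

lemma Gamma_class_C_class:
  assumes U: "open U" and C: "C_class k U f"
  shows "Gamma_class k U f"
  unfolding Gamma_class_def
proof (intro conjI allI impI ballI)
  fix "is" :: "('a + 'a) list"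
  assume l: "length is \<le> k"
  have "C_class 0 U (Xs is f)" by (rule C_class_Xs[OF U]) (use C l in \<open>simp add: C_class_mono\<close>)
  then show "continuous_on U (Xs is f)" by (simp add: C_class_0)
next
  fix "is" :: "('a + 'a) list" and g i
  assume l: "length is < k" and g: "g \<in> U"
  have "C_class 1 U (Xs is f)" by (rule C_class_Xs[OF U]) (use C l in \<open>simp add: C_class_mono\<close>)
  from has_derivative_dalong[OF C_class_1D[OF this _ g], of "hfield i"]
  show "(\<lambda>s. Xs is f (g + s *\<^sub>R hfield i g)) field_differentiable (at 0)"
    unfolding dalong_def field_differentiable_def by auto
qed

section \<open>Compactly supported functions and the combined statement\<close>

lemma along_eq_0:
  assumes "open W" "g \<in> W" "\<And>p. p \<in> W \<Longrightarrow> f p = 0"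
  shows "along V f g = 0"
proof -
  have "along V f g = along V (\<lambda>_. 0) g" by (rule along_cong_open(1)[OF assms(1,2)]) (rule assms(3))
  then show ?thesis by (simp add: along_def)
qed

lemma extends_continuously_by_zero:
  fixes \<Omega> :: "'a::real_normed_vector set"
  assumes O: "open \<Omega>" and K: "compact K" "K \<subseteq> \<Omega>" and f: "continuous_on \<Omega> f" and f0: "\<And>g. g \<in> \<Omega> - K \<Longrightarrow> f g = 0"
  shows "extends_continuously \<Omega> f"
proof -
  define F where "F g = (if g \<in> \<Omega> then f g else 0)" for g
  have "continuous_on \<Omega> F" by (rule continuous_on_eq[OF f]) (simp add: F_def)
  moreover have "continuous_on (- K) F"
    by (rule continuous_on_eq[OF continuous_on_const[of _ 0]]) (use f0 in \<open>auto simp: F_def\<close>)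
  moreover have "open (- K)" using K(1) by (simp add: compact_imp_closed open_Compl)
  ultimately have "continuous_on (\<Omega> \<union> - K) F" using O by (intro continuous_on_open_Un)
  moreover have "\<Omega> \<union> - K = UNIV" using K(2) by blast
  ultimately have "continuous_on (closure \<Omega>) F" using continuous_on_subset[of UNIV F] by simp
  then show ?thesis unfolding extends_continuously_def by (intro exI[of _ F]) (simp add: F_def)
qed

text \<open>The field itself has compact support, so every component of its divergence integrates to
  zero by the flow argument, without any boundary term.\<close>

lemma test_function_identity:
  fixes \<Omega> :: "'n::finite heis set"
  assumes O: "open \<Omega>" and b: "bounded \<Omega>" and u: "test_function \<Omega> u"
  shows "(LINT g:\<Omega>|lborel. (hlaplace u g)\<^sup>2) - (LINT g:\<Omega>|lborel. hhess_normsq u g)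
      + 3 / 2 * real CARD('n) * (LINT g:\<Omega>|lborel. (T u g)\<^sup>2) = 0"
proof -
  have C: "C_class k \<Omega> u" for k using u by (simp add: test_function_def)
  obtain K where K: "compact K" "K \<subseteq> \<Omega>" and u0: "\<And>g. g \<in> \<Omega> - K \<Longrightarrow> u g = 0"
    using u by (auto simp: test_function_def)
  have oW: "open (\<Omega> - K)" using O K(1) by (simp add: compact_imp_closed open_Diff)
  have X1: "X i u g = 0" if g: "g \<in> \<Omega> - K" for i g
    unfolding X_def by (rule along_eq_0[OF oW g u0])
  have X2: "X i (X j u) g = 0" if g: "g \<in> \<Omega> - K" for i j g
    unfolding X_def[of i] by (rule along_eq_0[OF oW g X1])
  have T1: "T u g = 0" if g: "g \<in> \<Omega> - K" for g
    unfolding T_def by (rule along_eq_0[OF oW g u0])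
  have CX: "C_class k \<Omega> (Xs is u)" for k "is" by (rule C_class_Xs[OF O C])
  have CT: "C_class k \<Omega> (T u)" for k by (rule C_class_T[OF O C])
  have G: "Gamma_class 3 \<Omega> u" by (rule Gamma_class_C_class[OF O C])
  have cX: "continuous_on \<Omega> (X i u)" "continuous_on \<Omega> (X i (X j u))" "continuous_on \<Omega> (X i (X j (X k u)))" for i j k
    using CX[of 0 "[i]"] CX[of 0 "[i, j]"] CX[of 0 "[i, j, k]"] by (simp_all add: C_class_0)
  have cT: "continuous_on \<Omega> (T u)" "continuous_on \<Omega> (X i (T u))" for i
    using CT[of 0] C_class_X[OF O CT, of 0 i] by (simp_all add: C_class_0)
  \<comment> \<open>\<open>test_function\<close> prescribes nothing outside the open set, so the
    continuous extensions to the closure are obtained by zero rather than from values of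
    \<open>u\<close>.\<close>
  have eX: "extends_continuously \<Omega> (X i (X j u))" for i j
    by (rule extends_continuously_by_zero[OF O K cX(2) X2])
  have eT: "extends_continuously \<Omega> (T u)"
    by (rule extends_continuously_by_zero[OF O K cT(1) T1])
  have cB: "continuous_on \<Omega> (bochner u j)" "continuous_on \<Omega> (bochner_deriv u j)" for j
    unfolding bochner_def[abs_def] bochner_deriv_def[abs_def]
    by (intro continuous_on_add continuous_on_diff continuous_on_mult continuous_on_sum continuous_on_const cX cT)+
  have B0: "bochner u j g = 0" if "g \<in> \<Omega> - K" for j g by (simp add: bochner_def X1[OF that] T1[OF that])
  have int: "set_integrable lborel \<Omega> (bochner_deriv u j)" "(LINT g:\<Omega>|lborel. bochner_deriv u j g) = 0" for j
    by (rule integral_along_compact_support[OF shear_field_hfield O K]; fact dalong_bochner[OF G C O] cB B0)+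
  show ?thesis using sum_integral_bochner_deriv[OF O b G C eX eT int(1)] int(2) by simp
qed

theorem corollary1p2:
  fixes \<Omega> :: "'n::finite heis set" and u :: "'n heis \<Rightarrow> real"
  assumes "open \<Omega>" and "bounded \<Omega>" and "C2_boundary \<Omega>"
  shows
    "(Gamma_class_closure 3 \<Omega> u \<and> C_class_closure 2 \<Omega> u \<and>
      (\<forall>g\<in>\<Omega>. u g \<le> 0) \<and> (\<forall>g\<in>frontier \<Omega>. u g = 0) \<longrightarrow>
        integrable (hperimeter \<Omega>) (\<lambda>g. hmean_curv \<Omega> g * hgrad_normsq_bdry \<Omega> u g) \<and>
        (LINT g:\<Omega>|lborel. (hlaplace u g)\<^sup>2) - (LINT g:\<Omega>|lborel. hhess_normsq u g)
            + 3 / 2 * real CARD('n) * (LINT g:\<Omega>|lborel. (T u g)\<^sup>2)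
          = (LINT g|hperimeter \<Omega>. hmean_curv \<Omega> g * hgrad_normsq_bdry \<Omega> u g) \<and>
        ((\<forall>g\<in>frontier \<Omega>. hmean_curv \<Omega> g \<ge> 0) \<longrightarrow>
          (LINT g:\<Omega>|lborel. hhess_normsq u g)
            \<le> (LINT g:\<Omega>|lborel. (hlaplace u g)\<^sup>2)
               + 3 / 2 * real CARD('n) * (LINT g:\<Omega>|lborel. (T u g)\<^sup>2)) \<and>
        (CARD('n) = 1 \<longrightarrow>
          (LINT g:\<Omega>|lborel. det (hhess u g)) + 3 / 4 * (LINT g:\<Omega>|lborel. (T u g)\<^sup>2)
            = 1 / 2 * (LINT g|hperimeter \<Omega>. hmean_curv \<Omega> g * hgrad_normsq_bdry \<Omega> u g))) \<and>
     (test_function \<Omega> u \<longrightarrow>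
        (LINT g:\<Omega>|lborel. hhess_normsq u g)
          = (LINT g:\<Omega>|lborel. (hlaplace u g)\<^sup>2)
             + 3 / 2 * real CARD('n) * (LINT g:\<Omega>|lborel. (T u g)\<^sup>2))"
proof (intro conjI impI; (elim conjE)?)
  assume u: "Gamma_class_closure 3 \<Omega> u" "C_class_closure 2 \<Omega> u" "\<forall>g\<in>frontier \<Omega>. u g = 0"
  note id = integral_identity[OF assms u]
  show "integrable (hperimeter \<Omega>) (\<lambda>g. hmean_curv \<Omega> g * hgrad_normsq_bdry \<Omega> u g)" by (rule id(1))
  show "(LINT g:\<Omega>|lborel. (hlaplace u g)\<^sup>2) - (LINT g:\<Omega>|lborel. hhess_normsq u g)
            + 3 / 2 * real CARD('n) * (LINT g:\<Omega>|lborel. (T u g)\<^sup>2)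
          = (LINT g|hperimeter \<Omega>. hmean_curv \<Omega> g * hgrad_normsq_bdry \<Omega> u g)" by (rule id(2))
  show "(LINT g:\<Omega>|lborel. hhess_normsq u g) \<le> (LINT g:\<Omega>|lborel. (hlaplace u g)\<^sup>2)
      + 3 / 2 * real CARD('n) * (LINT g:\<Omega>|lborel. (T u g)\<^sup>2)" if "\<forall>g\<in>frontier \<Omega>. hmean_curv \<Omega> g \<ge> 0"
    using id(2) id(3)[OF that] by linarith
  show "(LINT g:\<Omega>|lborel. det (hhess u g)) + 3 / 4 * (LINT g:\<Omega>|lborel. (T u g)\<^sup>2)
      = 1 / 2 * (LINT g|hperimeter \<Omega>. hmean_curv \<Omega> g * hgrad_normsq_bdry \<Omega> u g)" if n: "CARD('n) = 1"
    \<comment> \<open>The general identity at n = 1 divided by two, whence 3/4 and 1/2.\<close>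
    using id(2) integral_det[OF assms u n] unfolding n by simp
next
  assume "test_function \<Omega> u"
  from test_function_identity[OF assms(1,2) this]
  show "(LINT g:\<Omega>|lborel. hhess_normsq u g) = (LINT g:\<Omega>|lborel. (hlaplace u g)\<^sup>2)
      + 3 / 2 * real CARD('n) * (LINT g:\<Omega>|lborel. (T u g)\<^sup>2)" by linarith
qed

end
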